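(* Let the regularity assumption given in the context hold with regularity exponent $0<s\le1$. Let $R>0$ and let $B=\{v\in H^s(\Omega):\|v\|_{H^s(\Omega)}\le R\}$. There exist a linear, bounded, self-adjoint, positive definite operator $Q_S:L^2(\Omega)\to L^2(\Omega)$ and a constant $C>0$ independent of $\varepsilon$ such that for every $\varepsilon>0$, with $\delta_0=C\varepsilon$, there is $L_0=O(\log(1/\varepsilon))$ such that for any $0<\delta<\delta_0$ and any $L\ge L_0$ there exists an iUzawa-Net $\mathcal T(y_d,f;\theta_{\mathcal T})$ with $L$ layers that is weight tying and is algorithm tracking with respect to $B\times B$ and $\delta$ (with this $Q_S$). Moreover, for any $(y_d,f)^\top\in B\times B$, the layer outputs $\{(u^k,p^k)^\top\}_{k=1}^L$ of $\mathcal T(y_d,f;\theta_{\mathcal T})$ satisfy $$\|T(y_d,f)-u^k\|_{L^2(\Omega)}<\varepsilon\qquad\text{for all } L_0\le k\le L .$$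
   Context: **Problem.** $\Omega\subset\mathbb R^d$ ($d\ge1$) is a bounded Lipschitz domain with $\overline\Omega\subset(0,2\pi)^d$, identified with a subset of $\mathbb T^d=\mathbb R^d/(2\pi\mathbb Z)^d$. $U=Y=L^2(\Omega)$ (real). $N:U\to U$ is linear, bounded, self-adjoint with $\langle u,Nu\rangle_U\ge c_0\|u\|_U^2$, $c_0>0$. $S:U\to Y$ is bounded linear (the solution operator of a well-posed linear PDE) with adjoint $S^*$. $\theta:U\to\mathbb R\cup\{+\infty\}$ is convex, lower semicontinuous, proper. For $(y_d,f)\in Y\times U$, $T(y_d,f)=u^*$ is the unique minimizer over $u\in U$ of $\frac12\|S(u+f)-y_d\|_Y^2+\frac12\langle u,Nu\rangle_U+\theta(u)$. **Regularity assumption (exponent $0<s\le1$).** (i) $S=\iota^*\circ\tilde S\circ\iota$ with $\tilde S:H^{-s}(\Omega)\to H^s(\Omega)$ bounded linear, $\iota:L^2(\Omega)\hookrightarrow H^{-s}(\Omega)$ the canonical embedding and $\iota^*:H^s(\Omega)\hookrightarrow L^2(\Omega)$ its adjoint, also a canonical embedding ($H^{-s}(\Omega)$ is the dual of $H^s(\Omega)$). (ii) $(Nu)(x)=\lambda(x)u(x)$ a.e., with $\lambda\ge c_0>0$ a.e.; there are an integer $m\ge1$, a closed set $E\subset\mathbb R^m$ and functions $\psi_\xi:\mathbb R\to\mathbb R\cup\{+\infty\}$, $\xi\in E$, each convex, lower semicontinuous and proper, such that $\theta(u)=\int_\Omega\psi_{\mu(x)}(u(x))\,dx$ with $\mu(x)\in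 E$ a.e. (the integral is $+\infty$ if the integrand is $+\infty$ on a set of positive measure); and $\lambda$ and (the components of) $\mu$ belong to $H^s(\Omega)\cap L^\infty(\Omega)$. (iii) The set-valued map $\xi\mapsto\mathrm{gph}\,\partial\psi_\xi\subset\mathbb R^2$ is sub-Lipschitz on $E$: for any $\rho>0$ there is $\kappa_\rho>0$ such that for all $\xi_1,\xi_2\in E$, $\max_{|z|\le\rho}|d(z,\mathrm{gph}\,\partial\psi_{\xi_1})-d(z,\mathrm{gph}\,\partial\psi_{\xi_2})|\le\kappa_\rho\|\xi_1-\xi_2\|$, where $d(z,C)=\inf_{c\in C}\|z-c\|$. **Network modules.** "Extension operator" means a bounded linear $\mathcal E:L^2(\Omega)\to L^2(\mathbb T^d)$ with $\mathcal E(u)|_\Omega=u$. $\mathcal F$ is the Fourier transform on $\mathbb T^d$ and $\mathcal F_{k_{\max}}$ its truncation to modes $k\in(\mathbb Z\cap[-k_{\max},k_{\max}])^d$. *FNO module:* $u\mapsto(\mathcal Q\circ\mathcal K\circ\mathcal P)(\mathcal E u)|_\Omega$, where $(\mathcal Pv)(x)=Pv(x)$ with $P:\mathbb R\to\mathbb R^{m_p}$ linear, $(\mathcal Qv)(x)=Qv(x)$ with $Q:\mathbb R^{m_p}\to\mathbb R$ linear, and $\mathcal K(v)=v^{(L')}$ with $v^{(0)}=v$, $v^{(\ell+1)}=\sigma\big(W_\ell v^{(\ell)}+b_\ell+\mathcal F^{-1}(\mathcal R_\ell\cdot\mathcal F_{k_{\max}}v^{(\ell)})\big)$. Here $W_\ell\in\mathbb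 R^{m_p\times m_p}$, $b_\ell:\mathbb T^d\to\mathbb R^{m_p}$ is a smooth bias function, $\mathcal R_\ell(k)\in\mathbb C^{m_p\times m_p}$ with $\mathcal R_\ell(-k)=\overline{\mathcal R_\ell(k)}$, and $\sigma$ is a fixed smooth, non-polynomial, globally Lipschitz activation (e.g. GELU) applied componentwise. The sizes $m_p,L',k_{\max}$, the weights and $\mathcal E$ are free. *$\mathcal Q_S$ module:* $\mathcal Q_S(u)=\big(P^\top\mathcal K(P\,\mathcal Eu)\big)|_\Omega+\gamma u$, $\mathcal K(v)=V^\top Vv+\mathcal F^{-1}(\Phi^*\Phi\,\mathcal F v)$, with $P\in\mathbb R^{m_p}$, $V\in\mathbb R^{m_p\times m_p}$, $\Phi:\mathbb Z^d\to\mathbb C^{m_p\times m_p}$ square-summable with $\Phi(-k)=\overline{\Phi(k)}$ ($\Phi(k)^*$ is the Hermitian transpose); the hyperparameter $\gamma>0$ is chosen as part of the network. *$\mathcal Q_A$ module:* $(\mathcal Q_Au)(x)=\mathcal N(u(x),\mu(x),\lambda(x))$ a.e., where $\mathcal N:\mathbb R^{m+2}\to\mathbb R$ is a ReLU network with $M\ge1$ layers: $v^{(0)}=W_0(r,r,\xi,\eta)^\top$, $v^{(l)}=\mathrm{ReLU}\big(W_l(v^{(l-1)},r,\xi,\eta)^\top+b_l\big)$ for $1\le l\le M-1$, $\mathcal N(r,\xi,\eta)=W_M(v^{(M-1)},r,\xi,\eta)^\top+b_M$. **iUzawa-Net with $L$ layers.** Fix $\tau\ge0$. For $k=0,\dots,L-1$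 let $\mathcal S^k:U\to Y$, $\mathcal A^k:Y\to U$ be FNO modules, $\mathcal Q_S^k$ a $\mathcal Q_S$ module and $\mathcal Q_A^k$ a $\mathcal Q_A$ module. The layer outputs are $$u^{k+1}=\mathcal Q_A^k(\tau u^k-\mathcal A^kp^k),\qquad p^{k+1}=p^k+\mathcal Q_S^k\big(\mathcal S^k(u^{k+1}+f)-p^k-y_d\big),$$ with default initialization $u^0=0$, $p^0=0$, and $\mathcal T(y_d,f;\theta_{\mathcal T})=u^L$. The network is *weight tying* if all layers share identical modules: $\mathcal S^k=\mathcal S$, $\mathcal A^k=\mathcal A$, $\mathcal Q_A^k=\mathcal Q_A$, $\mathcal Q_S^k=\mathcal Q_S$ for all $k=0,\dots,L-1$. **Algorithm tracking.** Let $Q_A=N+\tau I$ and let $Q_S:Y\to Y$ be a fixed linear, bounded, self-adjoint, positive definite operator. For $K\subset Y\times U$, $\delta>0$, an $L$-layer iUzawa-Net is algorithm tracking with respect to $K$ and $\delta$ if for any input $(y_d,f)^\top\in K$ and any initialization $(p^0,u^0)^\top\in K\cup\{0\}$ its layer outputs satisfy, for $k=0,\dots,L-1$, $\|u^{k+1}-\bar u^{k+1}\|_U\le\delta$ and $\|p^{k+1}-\bar p^{k+1}\|_Y\le\delta$, where $$\bar u^{k+1}=(Q_A+\partial\theta)^{-1}(\tau u^k-S^*p^k),\qquad \bar p^{k+1}=p^k+Q_S^{-1}(S\bar u^{k+1}-p^k+Sf-y_d).$$ $L_0=O(\log(1/\varepsilon))$ is understood as $\varepsilon\to0$, with constant independent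 of $\varepsilon$ and $\delta$ (it may depend on $R$ and the problem data). *)

theory Defs
  imports
    "HOL-Analysis.Analysis"
    "HOL-Library.Landau_Symbols"
    "HOL-Computational_Algebra.Polynomial"
begin

section \<open>Real \<open>L\<^sup>2\<close> spaces\<close>

text \<open>Elements of \<open>L\<^sup>2(X)\<close> are represented by functions on the whole ambient space of which only
  the restriction to \<open>X\<close> matters, up to equality almost everywhere on \<open>X\<close>; thus \<open>u|\<^sub>X\<close> is
  represented by \<open>u\<close> itself. Identities between elements of \<open>L\<^sup>2(X)\<close> are stated with \<open>ae_eq\<close>.\<close>

definition L2 :: "'a::euclidean_space set \<Rightarrow> ('a \<Rightarrow> real) set" where
  "L2 X = {u. u \<in> borel_measurable (lebesgue_on X) \<and> integrable (lebesgue_on X) (\<lambda>x. (u x)\<^sup>2)}"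

definition ae_eq :: "'a::euclidean_space set \<Rightarrow> ('a \<Rightarrow> real) \<Rightarrow> ('a \<Rightarrow> real) \<Rightarrow> bool" where
  "ae_eq X u v \<longleftrightarrow> (AE x in lebesgue_on X. u x = v x)"

definition l2_inner :: "'a::euclidean_space set \<Rightarrow> ('a \<Rightarrow> real) \<Rightarrow> ('a \<Rightarrow> real) \<Rightarrow> real" where
  "l2_inner X u v = (\<integral>x. u x * v x \<partial>lebesgue_on X)"

definition l2_norm :: "'a::euclidean_space set \<Rightarrow> ('a \<Rightarrow> real) \<Rightarrow> real" where
  "l2_norm X u = sqrt (l2_inner X u u)"

definition Linf :: "'a::euclidean_space set \<Rightarrow> ('a \<Rightarrow> real) set" where
  "Linf X = {u. u \<in> borel_measurable (lebesgue_on X) \<and> (\<exists>C. AE x in lebesgue_on X. \<bar>u x\<bar> \<le> C)}"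

text \<open>Additivity together with the norm bound makes the operator respect \<open>ae_eq\<close>.\<close>

definition l2_bounded_linear ::
  "'a::euclidean_space set \<Rightarrow> 'b::euclidean_space set \<Rightarrow> (('a \<Rightarrow> real) \<Rightarrow> ('b \<Rightarrow> real)) \<Rightarrow> bool" where
  "l2_bounded_linear X Y A \<longleftrightarrow>
     (\<forall>u\<in>L2 X. A u \<in> L2 Y) \<and>
     (\<forall>u\<in>L2 X. \<forall>v\<in>L2 X. ae_eq Y (A (\<lambda>x. u x + v x)) (\<lambda>x. A u x + A v x)) \<and>
     (\<forall>c. \<forall>u\<in>L2 X. ae_eq Y (A (\<lambda>x. c * u x)) (\<lambda>x. c * A u x)) \<and>
     (\<exists>C. \<forall>u\<in>L2 X. l2_norm Y (A u) \<le> C * l2_norm X u)"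

definition l2_self_adjoint :: "'a::euclidean_space set \<Rightarrow> (('a \<Rightarrow> real) \<Rightarrow> ('a \<Rightarrow> real)) \<Rightarrow> bool" where
  "l2_self_adjoint X A \<longleftrightarrow> (\<forall>u\<in>L2 X. \<forall>v\<in>L2 X. l2_inner X (A u) v = l2_inner X u (A v))"

definition l2_coercive ::
  "'a::euclidean_space set \<Rightarrow> real \<Rightarrow> (('a \<Rightarrow> real) \<Rightarrow> ('a \<Rightarrow> real)) \<Rightarrow> bool" where
  "l2_coercive X c A \<longleftrightarrow> (\<forall>u\<in>L2 X. l2_inner X u (A u) \<ge> c * (l2_norm X u)\<^sup>2)"

text \<open>Positive definiteness is meant in the uniform sense, which is what makes the inverse an
  everywhere defined bounded operator.\<close>

definition l2_positive_definite ::
  "'a::euclidean_space set \<Rightarrow> (('a \<Rightarrow> real) \<Rightarrow> ('a \<Rightarrow> real)) \<Rightarrow> bool" where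
  "l2_positive_definite X A \<longleftrightarrow> (\<exists>c>0. l2_coercive X c A)"

text \<open>The objects below are unique up to \<open>ae_eq\<close>, so \<open>SOME\<close> picks a representative.\<close>

definition l2_adjoint ::
  "'a::euclidean_space set \<Rightarrow> (('a \<Rightarrow> real) \<Rightarrow> ('a \<Rightarrow> real)) \<Rightarrow> ('a \<Rightarrow> real) \<Rightarrow> ('a \<Rightarrow> real)" where
  "l2_adjoint X A y = (SOME z. z \<in> L2 X \<and> (\<forall>u\<in>L2 X. l2_inner X (A u) y = l2_inner X u z))"

definition l2_inverse ::
  "'a::euclidean_space set \<Rightarrow> (('a \<Rightarrow> real) \<Rightarrow> ('a \<Rightarrow> real)) \<Rightarrow> ('a \<Rightarrow> real) \<Rightarrow> ('a \<Rightarrow> real)" where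
  "l2_inverse X A y = (SOME z. z \<in> L2 X \<and> ae_eq X (A z) y)"

section \<open>Lipschitz domains, smooth functions and Sobolev spaces\<close>

text \<open>Near each boundary point the domain is, after a rotation, the strict epigraph of a Lipschitz
  function: \<open>e\<close> is the vertical direction and \<open>g\<close> is only evaluated on the hyperplane
  orthogonal to \<open>e\<close>.\<close>

definition bounded_lipschitz_domain :: "'a::euclidean_space set \<Rightarrow> bool" where
  "bounded_lipschitz_domain X \<longleftrightarrow>
     open X \<and> connected X \<and> X \<noteq> {} \<and> bounded X \<and>
     (\<forall>p\<in>frontier X. \<exists>e r g C. norm e = 1 \<and> r > 0 \<and> C-lipschitz_on UNIV (g :: 'a \<Rightarrow> real) \<and>
        X \<inter> ball p r = {x \<in> ball p r. x \<bullet> e > g (x - (x \<bullet> e) *\<^sub>R e)})"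

primrec C_k :: "nat \<Rightarrow> ('a::euclidean_space \<Rightarrow> real) \<Rightarrow> bool" where
  "C_k 0 f \<longleftrightarrow> continuous_on UNIV f"
| "C_k (Suc n) f \<longleftrightarrow>
     (\<forall>x. f differentiable (at x)) \<and>
     (\<forall>b\<in>Basis. C_k n (\<lambda>x. frechet_derivative f (at x) b))"

definition smooth :: "('a::euclidean_space \<Rightarrow> real) \<Rightarrow> bool" where
  "smooth f \<longleftrightarrow> (\<forall>n. C_k n f)"

definition test_function :: "'a::euclidean_space set \<Rightarrow> ('a \<Rightarrow> real) \<Rightarrow> bool" where
  "test_function X \<phi> \<longleftrightarrow>
     smooth \<phi> \<and> compact (closure {x. \<phi> x \<noteq> 0}) \<and> closure {x. \<phi> x \<noteq> 0} \<subseteq> X"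

definition weak_gradient :: "'a::euclidean_space set \<Rightarrow> ('a \<Rightarrow> real) \<Rightarrow> ('a \<Rightarrow> 'a) \<Rightarrow> bool" where
  "weak_gradient X u g \<longleftrightarrow>
     (\<forall>b\<in>Basis. (\<lambda>x. g x \<bullet> b) \<in> L2 X \<and>
        (\<forall>\<phi>. test_function X \<phi> \<longrightarrow>
           l2_inner X u (\<lambda>x. frechet_derivative \<phi> (at x) b) = - l2_inner X (\<lambda>x. g x \<bullet> b) \<phi>))"

definition gagliardo :: "'a::euclidean_space set \<Rightarrow> real \<Rightarrow> ('a \<Rightarrow> real) \<Rightarrow> ennreal" where
  "gagliardo X s u =
     (\<integral>\<^sup>+x. (\<integral>\<^sup>+y. ennreal ((u x - u y)\<^sup>2 / dist x y powr (real DIM('a) + 2 * s))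
        \<partial>lebesgue_on X) \<partial>lebesgue_on X)"

text \<open>\<open>H\<^sup>s(X)\<close> for \<open>0 < s \<le> 1\<close>: Sobolev--Slobodeckij space for \<open>s < 1\<close>, \<open>W\<^sup>1\<^sup>,\<^sup>2(X)\<close> for \<open>s = 1\<close>.\<close>

definition Hs :: "'a::euclidean_space set \<Rightarrow> real \<Rightarrow> ('a \<Rightarrow> real) set" where
  "Hs X s = {u \<in> L2 X. if s = 1 then \<exists>g. weak_gradient X u g else gagliardo X s u < \<infinity>}"

definition hs_norm :: "'a::euclidean_space set \<Rightarrow> real \<Rightarrow> ('a \<Rightarrow> real) \<Rightarrow> real" where
  "hs_norm X s u = sqrt ((l2_norm X u)\<^sup>2 +
     (if s = 1 then \<Sum>b\<in>Basis. (l2_norm X (\<lambda>x. (SOME g. weak_gradient X u g) x \<bullet> b))\<^sup>2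
      else enn2real (gagliardo X s u)))"

text \<open>\<open>H\<^sup>-\<^sup>s(X)\<close>, the dual of \<open>H\<^sup>s(X)\<close>; two functionals agreeing on \<open>Hs X s\<close> represent the same
  element.\<close>

definition Hs_dual :: "'a::euclidean_space set \<Rightarrow> real \<Rightarrow> (('a \<Rightarrow> real) \<Rightarrow> real) set" where
  "Hs_dual X s = {l.
     (\<forall>u\<in>Hs X s. \<forall>v\<in>Hs X s. l (\<lambda>x. u x + v x) = l u + l v) \<and>
     (\<forall>c. \<forall>u\<in>Hs X s. l (\<lambda>x. c * u x) = c * l u) \<and>
     (\<exists>C. \<forall>u\<in>Hs X s. \<bar>l u\<bar> \<le> C * hs_norm X s u)}"

definition hs_dual_norm ::
  "'a::euclidean_space set \<Rightarrow> real \<Rightarrow> (('a \<Rightarrow> real) \<Rightarrow> real) \<Rightarrow> real" where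
  "hs_dual_norm X s l = (SUP u\<in>{u \<in> Hs X s. hs_norm X s u \<le> 1}. \<bar>l u\<bar>)"

definition dual_to_hs_bounded_linear ::
  "'a::euclidean_space set \<Rightarrow> real \<Rightarrow> ((('a \<Rightarrow> real) \<Rightarrow> real) \<Rightarrow> ('a \<Rightarrow> real)) \<Rightarrow> bool" where
  "dual_to_hs_bounded_linear X s A \<longleftrightarrow>
     (\<forall>l\<in>Hs_dual X s. A l \<in> Hs X s) \<and>
     (\<forall>l\<in>Hs_dual X s. \<forall>l'\<in>Hs_dual X s. ae_eq X (A (\<lambda>v. l v + l' v)) (\<lambda>x. A l x + A l' x)) \<and>
     (\<forall>c. \<forall>l\<in>Hs_dual X s. ae_eq X (A (\<lambda>v. c * l v)) (\<lambda>x. c * A l x)) \<and>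
     (\<exists>C. \<forall>l\<in>Hs_dual X s. hs_norm X s (A l) \<le> C * hs_dual_norm X s l)"

text \<open>\<open>S = \<iota>\<^sup>* \<circ> A \<circ> \<iota>\<close>, where \<open>\<iota> u = \<langle>u, \<cdot>\<rangle>\<close> and \<open>\<iota>\<^sup>*\<close> is the inclusion \<open>H\<^sup>s(X) \<subseteq> L\<^sup>2(X)\<close>.\<close>

definition factors_through_hs ::
  "'a::euclidean_space set \<Rightarrow> real \<Rightarrow> (('a \<Rightarrow> real) \<Rightarrow> ('a \<Rightarrow> real)) \<Rightarrow> bool" where
  "factors_through_hs X s S \<longleftrightarrow>
     (\<exists>A. dual_to_hs_bounded_linear X s A \<and> (\<forall>u\<in>L2 X. ae_eq X (S u) (A (\<lambda>v. l2_inner X u v))))"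

section \<open>Convex functions with values in \<open>(-\<infinity>, \<infinity>]\<close>\<close>

definition proper_convex_lsc :: "(real \<Rightarrow> ereal) \<Rightarrow> bool" where
  "proper_convex_lsc \<psi> \<longleftrightarrow>
     (\<forall>r. \<psi> r \<noteq> -\<infinity>) \<and> (\<exists>r. \<psi> r \<noteq> \<infinity>) \<and>
     (\<forall>q r t. 0 < t \<and> t < 1 \<longrightarrow>
        \<psi> ((1 - t) * q + t * r) \<le> ereal (1 - t) * \<psi> q + ereal t * \<psi> r) \<and>
     (\<forall>r a. a < \<psi> r \<longrightarrow> (\<forall>\<^sub>F q in at r. a < \<psi> q))"

definition l2_proper_convex_lsc ::
  "'a::euclidean_space set \<Rightarrow> (('a \<Rightarrow> real) \<Rightarrow> ereal) \<Rightarrow> bool" where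
  "l2_proper_convex_lsc X \<theta> \<longleftrightarrow>
     (\<forall>u\<in>L2 X. \<theta> u \<noteq> -\<infinity>) \<and> (\<exists>u\<in>L2 X. \<theta> u \<noteq> \<infinity>) \<and>
     (\<forall>u\<in>L2 X. \<forall>v\<in>L2 X. \<forall>t. 0 < t \<and> t < 1 \<longrightarrow>
        \<theta> (\<lambda>x. (1 - t) * u x + t * v x) \<le> ereal (1 - t) * \<theta> u + ereal t * \<theta> v) \<and>
     (\<forall>u\<in>L2 X. \<forall>a. a < \<theta> u \<longrightarrow>
        (\<exists>e>0. \<forall>v\<in>L2 X. l2_norm X (\<lambda>x. v x - u x) < e \<longrightarrow> a < \<theta> v))"

definition subdiff_graph :: "(real \<Rightarrow> ereal) \<Rightarrow> (real \<times> real) set" where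
  "subdiff_graph \<psi> = {(r, p). \<forall>q. \<psi> q \<ge> \<psi> r + ereal (p * (q - r))}"

definition l2_subdiff ::
  "'a::euclidean_space set \<Rightarrow> (('a \<Rightarrow> real) \<Rightarrow> ereal) \<Rightarrow> ('a \<Rightarrow> real) \<Rightarrow> ('a \<Rightarrow> real) set" where
  "l2_subdiff X \<theta> u =
     {w \<in> L2 X. \<forall>v\<in>L2 X. \<theta> v \<ge> \<theta> u + ereal (l2_inner X w (\<lambda>x. v x - u x))}"

text \<open>\<open>infdist\<close> on \<open>real \<times> real\<close> is the Euclidean distance to a set in the plane.\<close>

definition sub_lipschitz_graphs ::
  "'b::real_normed_vector set \<Rightarrow> ('b \<Rightarrow> real \<Rightarrow> ereal) \<Rightarrow> bool" where
  "sub_lipschitz_graphs E \<psi> \<longleftrightarrow>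
     (\<forall>\<rho>>0. \<exists>\<kappa>>0. \<forall>\<xi>1\<in>E. \<forall>\<xi>2\<in>E. \<forall>z. norm z \<le> \<rho> \<longrightarrow>
        \<bar>infdist z (subdiff_graph (\<psi> \<xi>1)) - infdist z (subdiff_graph (\<psi> \<xi>2))\<bar>
          \<le> \<kappa> * norm (\<xi>1 - \<xi>2))"

text \<open>Integral of an extended real function as positive minus negative part. Since
  \<open>\<infinity> - \<infinity> = \<infinity>\<close> in \<open>ereal\<close>, it is \<open>\<infinity>\<close> whenever the integral of the positive part is.\<close>

definition ereal_integral :: "'a measure \<Rightarrow> ('a \<Rightarrow> ereal) \<Rightarrow> ereal" where
  "ereal_integral M h =
     enn2ereal (\<integral>\<^sup>+x. e2ennreal (h x) \<partial>M) - enn2ereal (\<integral>\<^sup>+x. e2ennreal (- h x) \<partial>M)"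

definition is_integral_functional ::
  "'a::euclidean_space set \<Rightarrow> ('b \<Rightarrow> real \<Rightarrow> ereal) \<Rightarrow> ('a \<Rightarrow> 'b) \<Rightarrow> (('a \<Rightarrow> real) \<Rightarrow> ereal) \<Rightarrow> bool"
  where
  "is_integral_functional X \<psi> \<mu> \<theta> \<longleftrightarrow>
     (\<forall>u\<in>L2 X. (\<lambda>x. \<psi> (\<mu> x) (u x)) \<in> borel_measurable (lebesgue_on X) \<and>
        \<theta> u = ereal_integral (lebesgue_on X) (\<lambda>x. \<psi> (\<mu> x) (u x)))"

section \<open>The optimal control problem\<close>

definition cost ::
  "'a::euclidean_space set \<Rightarrow> (('a \<Rightarrow> real) \<Rightarrow> ('a \<Rightarrow> real)) \<Rightarrow> (('a \<Rightarrow> real) \<Rightarrow> ('a \<Rightarrow> real)) \<Rightarrow>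
   (('a \<Rightarrow> real) \<Rightarrow> ereal) \<Rightarrow> ('a \<Rightarrow> real) \<Rightarrow> ('a \<Rightarrow> real) \<Rightarrow> ('a \<Rightarrow> real) \<Rightarrow> ereal" where
  "cost X S N \<theta> yd f u =
     ereal ((l2_norm X (\<lambda>x. S (\<lambda>z. u z + f z) x - yd x))\<^sup>2 / 2 + l2_inner X u (N u) / 2) + \<theta> u"

definition solution_operator ::
  "'a::euclidean_space set \<Rightarrow> (('a \<Rightarrow> real) \<Rightarrow> ('a \<Rightarrow> real)) \<Rightarrow> (('a \<Rightarrow> real) \<Rightarrow> ('a \<Rightarrow> real)) \<Rightarrow>
   (('a \<Rightarrow> real) \<Rightarrow> ereal) \<Rightarrow> ('a \<Rightarrow> real) \<Rightarrow> ('a \<Rightarrow> real) \<Rightarrow> ('a \<Rightarrow> real)" where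
  "solution_operator X S N \<theta> yd f =
     (SOME u. u \<in> L2 X \<and> (\<forall>v\<in>L2 X. cost X S N \<theta> yd f u \<le> cost X S N \<theta> yd f v) \<and>
        (\<forall>v\<in>L2 X. cost X S N \<theta> yd f v \<le> cost X S N \<theta> yd f u \<longrightarrow> ae_eq X v u))"

text \<open>\<open>(N + \<tau> I + \<partial>\<theta>)\<^sup>-\<^sup>1 w\<close>\<close>

definition resolvent ::
  "'a::euclidean_space set \<Rightarrow> (('a \<Rightarrow> real) \<Rightarrow> ('a \<Rightarrow> real)) \<Rightarrow> real \<Rightarrow> (('a \<Rightarrow> real) \<Rightarrow> ereal) \<Rightarrow>
   ('a \<Rightarrow> real) \<Rightarrow> ('a \<Rightarrow> real)" where
  "resolvent X N \<tau> \<theta> w =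
     (SOME u. u \<in> L2 X \<and> (\<lambda>x. w x - (N u x + \<tau> * u x)) \<in> l2_subdiff X \<theta> u)"

section \<open>The torus and its Fourier transform\<close>

text \<open>\<open>L\<^sup>2\<close> of the torus is \<open>L\<^sup>2\<close> of the fundamental cell \<open>(0, 2\<pi>)\<^sup>d\<close>.\<close>

definition torus_cell :: "(real ^ 'd) set" where
  "torus_cell = box 0 (\<chi> i. 2 * pi)"

definition character :: "int ^ 'd \<Rightarrow> real ^ 'd \<Rightarrow> complex" where
  "character k x = exp (\<i> * of_real (\<Sum>i\<in>UNIV. of_int (k $ i) * x $ i))"

definition fourier_coeff :: "(real ^ 'd \<Rightarrow> real) \<Rightarrow> int ^ 'd \<Rightarrow> complex" where
  "fourier_coeff v k =
     (\<integral>x. of_real (v x) * character (- k) x \<partial>lebesgue_on torus_cell) / of_real ((2 * pi) ^ CARD('d))"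

definition modes :: "nat \<Rightarrow> (int ^ 'd) set" where
  "modes kmax = {k. \<forall>i. \<bar>k $ i\<bar> \<le> int kmax}"

definition smooth_on_torus :: "(real ^ 'd \<Rightarrow> real) \<Rightarrow> bool" where
  "smooth_on_torus b \<longleftrightarrow> smooth b \<and> (\<forall>x i. b (x + axis i (2 * pi)) = b x)"

definition extension_operator ::
  "(real ^ 'd) set \<Rightarrow> ((real ^ 'd \<Rightarrow> real) \<Rightarrow> (real ^ 'd \<Rightarrow> real)) \<Rightarrow> bool" where
  "extension_operator X Ext \<longleftrightarrow>
     l2_bounded_linear X torus_cell Ext \<and> (\<forall>u\<in>L2 X. ae_eq X (Ext u) u)"

section \<open>Network modules\<close>

text \<open>Vectors in \<open>\<real>\<^sup>n\<close> with \<open>n\<close> a hyperparameter of the network are functions on \<open>nat\<close> of which only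
  the entries below \<open>n\<close> are used; matrices likewise.\<close>

record ('d::finite) fno =
  fno_E :: "(real ^ 'd \<Rightarrow> real) \<Rightarrow> (real ^ 'd \<Rightarrow> real)"
  fno_width :: nat
  fno_depth :: nat
  fno_kmax :: nat
  fno_P :: "nat \<Rightarrow> real"
  fno_Q :: "nat \<Rightarrow> real"
  fno_W :: "nat \<Rightarrow> nat \<Rightarrow> nat \<Rightarrow> real"
  fno_b :: "nat \<Rightarrow> nat \<Rightarrow> real ^ 'd \<Rightarrow> real"
  fno_R :: "nat \<Rightarrow> int ^ 'd \<Rightarrow> nat \<Rightarrow> nat \<Rightarrow> complex"

definition fno_module :: "(real ^ 'd) set \<Rightarrow> 'd fno \<Rightarrow> bool" where
  "fno_module X F \<longleftrightarrow>
     extension_operator X (fno_E F) \<and> fno_width F \<ge> 1 \<and> fno_depth F \<ge> 1 \<and>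
     (\<forall>l<fno_depth F. \<forall>i<fno_width F. smooth_on_torus (fno_b F l i)) \<and>
     (\<forall>l<fno_depth F. \<forall>k. \<forall>i<fno_width F. \<forall>j<fno_width F.
        fno_R F l (- k) i j = cnj (fno_R F l k i j))"

text \<open>The symmetry of \<open>fno_R\<close> makes the truncated Fourier sum real; \<open>Re\<close> is only a type conversion.\<close>

primrec fno_state ::
  "(real \<Rightarrow> real) \<Rightarrow> 'd::finite fno \<Rightarrow> (real ^ 'd \<Rightarrow> real) \<Rightarrow> nat \<Rightarrow> nat \<Rightarrow> real ^ 'd \<Rightarrow> real" where
  "fno_state \<sigma> F v 0 = (\<lambda>i x. fno_P F i * v x)"
| "fno_state \<sigma> F v (Suc l) = (\<lambda>i x. \<sigma> (
     (\<Sum>j<fno_width F. fno_W F l i j * fno_state \<sigma> F v l j x) + fno_b F l i x +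
     Re (\<Sum>k\<in>modes (fno_kmax F). (\<Sum>j<fno_width F.
           fno_R F l k i j * fourier_coeff (fno_state \<sigma> F v l j) k) * character k x)))"

definition fno_apply ::
  "(real \<Rightarrow> real) \<Rightarrow> 'd::finite fno \<Rightarrow> (real ^ 'd \<Rightarrow> real) \<Rightarrow> (real ^ 'd \<Rightarrow> real)" where
  "fno_apply \<sigma> F u =
     (\<lambda>x. \<Sum>i<fno_width F. fno_Q F i * fno_state \<sigma> F (fno_E F u) (fno_depth F) i x)"

record ('d::finite) qs =
  qs_E :: "(real ^ 'd \<Rightarrow> real) \<Rightarrow> (real ^ 'd \<Rightarrow> real)"
  qs_width :: nat
  qs_P :: "nat \<Rightarrow> real"
  qs_V :: "nat \<Rightarrow> nat \<Rightarrow> real"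
  qs_Phi :: "int ^ 'd \<Rightarrow> nat \<Rightarrow> nat \<Rightarrow> complex"
  qs_gamma :: real

definition qs_module :: "(real ^ 'd) set \<Rightarrow> 'd qs \<Rightarrow> bool" where
  "qs_module X G \<longleftrightarrow>
     extension_operator X (qs_E G) \<and> qs_width G \<ge> 1 \<and> qs_gamma G > 0 \<and>
     (\<lambda>k. \<Sum>i<qs_width G. \<Sum>j<qs_width G. (cmod (qs_Phi G k i j))\<^sup>2) summable_on UNIV \<and>
     (\<forall>k. \<forall>i<qs_width G. \<forall>j<qs_width G. qs_Phi G (- k) i j = cnj (qs_Phi G k i j))"

definition qs_kernel ::
  "'d::finite qs \<Rightarrow> (nat \<Rightarrow> real ^ 'd \<Rightarrow> real) \<Rightarrow> nat \<Rightarrow> real ^ 'd \<Rightarrow> real" where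
  "qs_kernel G v = (\<lambda>i x.
     (\<Sum>j<qs_width G. (\<Sum>h<qs_width G. qs_V G h i * qs_V G h j) * v j x) +
     Re (\<Sum>\<^sub>\<infinity>k. (\<Sum>j<qs_width G. (\<Sum>h<qs_width G. cnj (qs_Phi G k h i) * qs_Phi G k h j)
           * fourier_coeff (v j) k) * character k x))"

definition qs_apply :: "'d::finite qs \<Rightarrow> (real ^ 'd \<Rightarrow> real) \<Rightarrow> (real ^ 'd \<Rightarrow> real)" where
  "qs_apply G u = (\<lambda>x.
     (\<Sum>i<qs_width G. qs_P G i * qs_kernel G (\<lambda>j z. qs_P G j * qs_E G u z) i x) + qs_gamma G * u x)"

text \<open>The matrix \<open>W\<^sub>l\<close> of the ReLU network, acting on \<open>(v\<^sup>(\<^sup>l\<^sup>-\<^sup>1\<^sup>), r, \<xi>, \<eta>)\<close>, is stored as four blocks of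
  columns. For \<open>l = 0\<close> the first block has the single column \<open>0\<close>, acting on the first copy of \<open>r\<close>.\<close>

record ('m::finite) qa =
  qa_depth :: nat
  qa_width :: "nat \<Rightarrow> nat"
  qa_Wv :: "nat \<Rightarrow> nat \<Rightarrow> nat \<Rightarrow> real"
  qa_Wr :: "nat \<Rightarrow> nat \<Rightarrow> real"
  qa_Wxi :: "nat \<Rightarrow> nat \<Rightarrow> real ^ 'm"
  qa_Weta :: "nat \<Rightarrow> nat \<Rightarrow> real"
  qa_b :: "nat \<Rightarrow> nat \<Rightarrow> real"

definition qa_module :: "'m::finite qa \<Rightarrow> bool" where
  "qa_module H \<longleftrightarrow> qa_depth H \<ge> 1 \<and> (\<forall>l<qa_depth H. qa_width H l \<ge> 1)"

primrec qa_hidden ::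
  "'m::finite qa \<Rightarrow> real \<Rightarrow> real ^ 'm \<Rightarrow> real \<Rightarrow> nat \<Rightarrow> nat \<Rightarrow> real" where
  "qa_hidden H r \<xi> \<eta> 0 = (\<lambda>i.
     qa_Wv H 0 i 0 * r + qa_Wr H 0 i * r + qa_Wxi H 0 i \<bullet> \<xi> + qa_Weta H 0 i * \<eta>)"
| "qa_hidden H r \<xi> \<eta> (Suc l) = (\<lambda>i. max 0 (
     (\<Sum>j<qa_width H l. qa_Wv H (Suc l) i j * qa_hidden H r \<xi> \<eta> l j) + qa_Wr H (Suc l) i * r +
     qa_Wxi H (Suc l) i \<bullet> \<xi> + qa_Weta H (Suc l) i * \<eta> + qa_b H (Suc l) i))"

definition qa_net :: "'m::finite qa \<Rightarrow> real \<Rightarrow> real ^ 'm \<Rightarrow> real \<Rightarrow> real" where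
  "qa_net H r \<xi> \<eta> = (let M = qa_depth H in
     (\<Sum>j<qa_width H (M - 1). qa_Wv H M 0 j * qa_hidden H r \<xi> \<eta> (M - 1) j) + qa_Wr H M 0 * r +
     qa_Wxi H M 0 \<bullet> \<xi> + qa_Weta H M 0 * \<eta> + qa_b H M 0)"

definition qa_apply ::
  "'m::finite qa \<Rightarrow> ('a \<Rightarrow> real ^ 'm) \<Rightarrow> ('a \<Rightarrow> real) \<Rightarrow> ('a \<Rightarrow> real) \<Rightarrow> ('a \<Rightarrow> real)" where
  "qa_apply H \<mu> lam u = (\<lambda>x. qa_net H (u x) (\<mu> x) (lam x))"

section \<open>The iUzawa-Net\<close>

record ('d::finite, 'm::finite) iuzawa_layer =
  lay_S :: "'d fno"
  lay_A :: "'d fno"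
  lay_QS :: "'d qs"
  lay_QA :: "'m qa"

text \<open>A network with \<open>L\<close> layers is a sequence of layers of which only the first \<open>L\<close> are used.\<close>

definition iuzawa_net :: "(real ^ 'd) set \<Rightarrow> nat \<Rightarrow> (nat \<Rightarrow> ('d, 'm::finite) iuzawa_layer) \<Rightarrow> bool"
  where
  "iuzawa_net X L net \<longleftrightarrow>
     (\<forall>k<L. fno_module X (lay_S (net k)) \<and> fno_module X (lay_A (net k)) \<and>
        qs_module X (lay_QS (net k)) \<and> qa_module (lay_QA (net k)))"

definition weight_tying :: "nat \<Rightarrow> (nat \<Rightarrow> ('d::finite, 'm::finite) iuzawa_layer) \<Rightarrow> bool" where
  "weight_tying L net \<longleftrightarrow> (\<exists>lay. \<forall>k<L. net k = lay)"

text \<open>The pair \<open>(u\<^sup>k, p\<^sup>k)\<close> produced from the initialization \<open>(u0, p0)\<close>.\<close>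

primrec layer_output ::
  "(real \<Rightarrow> real) \<Rightarrow> real \<Rightarrow> (real ^ 'd \<Rightarrow> real ^ 'm) \<Rightarrow> (real ^ 'd \<Rightarrow> real) \<Rightarrow>
   (nat \<Rightarrow> ('d::finite, 'm::finite) iuzawa_layer) \<Rightarrow>
   (real ^ 'd \<Rightarrow> real) \<Rightarrow> (real ^ 'd \<Rightarrow> real) \<Rightarrow> (real ^ 'd \<Rightarrow> real) \<Rightarrow> (real ^ 'd \<Rightarrow> real) \<Rightarrow>
   nat \<Rightarrow> (real ^ 'd \<Rightarrow> real) \<times> (real ^ 'd \<Rightarrow> real)" where
  "layer_output \<sigma> \<tau> \<mu> lam net yd f u0 p0 0 = (u0, p0)"
| "layer_output \<sigma> \<tau> \<mu> lam net yd f u0 p0 (Suc k) =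
     (let u = fst (layer_output \<sigma> \<tau> \<mu> lam net yd f u0 p0 k);
          p = snd (layer_output \<sigma> \<tau> \<mu> lam net yd f u0 p0 k);
          u' = qa_apply (lay_QA (net k)) \<mu> lam (\<lambda>x. \<tau> * u x - fno_apply \<sigma> (lay_A (net k)) p x);
          p' = (\<lambda>x. p x + qs_apply (lay_QS (net k))
                 (\<lambda>z. fno_apply \<sigma> (lay_S (net k)) (\<lambda>w. u' w + f w) z - p z - yd z) x)
      in (u', p'))"

definition algorithm_tracking ::
  "(real ^ 'd) set \<Rightarrow> ((real ^ 'd \<Rightarrow> real) \<Rightarrow> (real ^ 'd \<Rightarrow> real)) \<Rightarrow>
   ((real ^ 'd \<Rightarrow> real) \<Rightarrow> (real ^ 'd \<Rightarrow> real)) \<Rightarrow> ((real ^ 'd \<Rightarrow> real) \<Rightarrow> ereal) \<Rightarrow>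
   ((real ^ 'd \<Rightarrow> real) \<Rightarrow> (real ^ 'd \<Rightarrow> real)) \<Rightarrow>
   (real \<Rightarrow> real) \<Rightarrow> real \<Rightarrow> (real ^ 'd \<Rightarrow> real ^ 'm) \<Rightarrow> (real ^ 'd \<Rightarrow> real) \<Rightarrow>
   ((real ^ 'd \<Rightarrow> real) \<times> (real ^ 'd \<Rightarrow> real)) set \<Rightarrow> real \<Rightarrow>
   nat \<Rightarrow> (nat \<Rightarrow> ('d::finite, 'm::finite) iuzawa_layer) \<Rightarrow> bool" where
  "algorithm_tracking X S N \<theta> QS \<sigma> \<tau> \<mu> lam K \<delta> L net \<longleftrightarrow>
     (\<forall>(yd, f)\<in>K. \<forall>(p0, u0)\<in>K \<union> {(\<lambda>x. 0, \<lambda>x. 0)}. \<forall>k<L.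
        let (u, p) = layer_output \<sigma> \<tau> \<mu> lam net yd f u0 p0 k;
            (u', p') = layer_output \<sigma> \<tau> \<mu> lam net yd f u0 p0 (Suc k);
            ubar = resolvent X N \<tau> \<theta> (\<lambda>x. \<tau> * u x - l2_adjoint X S p x);
            pbar = (\<lambda>x. p x + l2_inverse X QS (\<lambda>z. S ubar z - p z + S f z - yd z) x)
        in l2_norm X (\<lambda>x. u' x - ubar x) \<le> \<delta> \<and> l2_norm X (\<lambda>x. p' x - pbar x) \<le> \<delta>)"

end

theory Submission
  imports Defs
begin

text \<open>With \<open>Q\<^sub>S = \<beta> I\<close> and \<open>\<beta>\<close> large, one exact iteration contracts the energy
  \<open>(c\<^sub>0 + \<tau>) \<parallel>u\<parallel>\<^sup>2 + \<beta> \<parallel>p\<parallel>\<^sup>2\<close>, and the fixed point encodes the optimality system of the control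
  problem. A network whose layers track the exact step up to \<open>\<delta>\<close> therefore ends up within
  \<open>O(\<delta>)\<close> of the solution after \<open>O(log(1/\<epsilon>))\<close> layers, and all its iterates stay in a fixed ball.

  The operator \<open>Q\<^sub>S\<^sup>-\<^sup>1\<close> is realised exactly by the skip connection of the module. The operators \<open>S\<close> and
  \<open>S\<^sup>*\<close> are limits of finite-rank operators because \<open>H\<^sup>s(\<Omega>)\<close> embeds compactly into \<open>L\<^sup>2(\<Omega>)\<close>. A
  finite-rank operator is realised by one Fourier layer: since the extension operator is arbitrary
  off \<open>\<Omega>\<close>, the low Fourier coefficients of the extension can be made arbitrary bounded functionals
  of \<open>u\<close>, and \<open>\<sigma>\<close> is linearised at a point where its derivative does not vanish. The resolvent acts
  pointwise, as a proximal map that is Lipschitz in its argument and in the coefficients by the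
  sub-Lipschitz assumption, so a ReLU network approximates it on compact sets. Uniformity over all
  layers comes from the pointwise invariant \<open>|u\<^sup>k| \<le> |u\<^sup>0| + D\<close> together with the compactness of
  the Sobolev ball containing \<open>u\<^sup>0\<close>, which makes the tails of \<open>u\<^sup>0\<close> uniformly small in \<open>L\<^sup>2\<close>.\<close>

section \<open>The Hilbert space \<open>L\<^sup>2(X)\<close>\<close>

text \<open>One layer must serve every depth and every input of the ball, so its accuracy has to be
  arranged on a set, fixed in advance, that no iterate leaves. For \<open>S\<close> and its adjoint
  an L^2 ball suffices, because these operators are compact. The resolvent is the obstacle: it acts
  pointwise, a ReLU network imitates it only for arguments in some [-M, M], and an L^2 bound says
  nothing about pointwise values. Two facts help. The network for the adjoint returns functions
  bounded by a constant on L^2 balls, and the resolvent divides by \<open>c0 + \<tau>\<close> while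
  its argument carries only \<open>\<tau> * u\<close>, so that a bound |u0| + D reproduces itself.
  In the energy, the coupling through \<open>S\<close> appears once with each sign and cancels; a
  large \<open>\<beta>\<close> absorbs the quadratic remainder. The admissible \<delta> is
  proportional to \<epsilon> because the tracking errors form a geometric series: half of \<epsilon>
  pays for its sum, the other half for the decay of the initial error, and this decay sets the
  logarithmic depth.\<close>

lemma L2_measurable: "u \<in> L2 X \<Longrightarrow> u \<in> borel_measurable (lebesgue_on X)"
  by (simp add: L2_def)

lemma L2_integrable_sq: "u \<in> L2 X \<Longrightarrow> integrable (lebesgue_on X) (\<lambda>x. (u x)\<^sup>2)"
  by (simp add: L2_def)

lemma L2_mult_integrable:
  assumes "u \<in> L2 X" "v \<in> L2 X"
  shows "integrable (lebesgue_on X) (\<lambda>x. u x * v x)"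
proof (rule Bochner_Integration.integrable_bound)
  show "integrable (lebesgue_on X) (\<lambda>x. (u x)\<^sup>2 + (v x)\<^sup>2)"
    using assms by (intro Bochner_Integration.integrable_add L2_integrable_sq)
  show "(\<lambda>x. u x * v x) \<in> borel_measurable (lebesgue_on X)"
    using assms by (intro borel_measurable_times L2_measurable)
  have "\<bar>a * b\<bar> \<le> a\<^sup>2 + b\<^sup>2" for a b :: real
    using sum_squares_bound[of "\<bar>a\<bar>" "\<bar>b\<bar>"] mult_nonneg_nonneg[OF abs_ge_zero[of a] abs_ge_zero[of b]]
    unfolding abs_mult power2_abs by linarith
  then show "AE x in lebesgue_on X. norm (u x * v x) \<le> norm ((u x)\<^sup>2 + (v x)\<^sup>2)"
    by simp
qed

lemma L2_add [intro]:
  assumes "u \<in> L2 X" "v \<in> L2 X" shows "(\<lambda>x. u x + v x) \<in> L2 X"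
proof -
  have "integrable (lebesgue_on X) (\<lambda>x. (u x)\<^sup>2 + (v x)\<^sup>2 + 2 * (u x * v x))"
    using assms by (intro Bochner_Integration.integrable_add L2_integrable_sq integrable_mult_right L2_mult_integrable)
  then show ?thesis
    using assms by (auto simp: L2_def power2_sum algebra_simps)
qed

lemma L2_scale [intro]:
  assumes "u \<in> L2 X" shows "(\<lambda>x. c * u x) \<in> L2 X"
  using assms by (auto simp: L2_def power_mult_distrib)

lemma L2_diff [intro]:
  assumes "u \<in> L2 X" "v \<in> L2 X" shows "(\<lambda>x. u x - v x) \<in> L2 X"
  using L2_add[OF assms(1) L2_scale[OF assms(2), of "-1"]] by simp

lemma L2_zero [simp]: "(\<lambda>x. 0) \<in> L2 X"
  by (simp add: L2_def)

lemma L2_uminus [intro]: "u \<in> L2 X \<Longrightarrow> (\<lambda>x. - u x) \<in> L2 X"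
  using L2_scale[of u X "-1"] by simp

lemma L2_divide [intro]: "u \<in> L2 X \<Longrightarrow> (\<lambda>x. u x / c) \<in> L2 X"
  using L2_scale[of u X "inverse c"] by (simp add: field_simps)

lemma L2_sum [intro]:
  "(\<And>i. i \<in> I \<Longrightarrow> u i \<in> L2 X) \<Longrightarrow> (\<lambda>x. \<Sum>i\<in>I. u i x) \<in> L2 X"
  by (induction I rule: infinite_finite_induct) auto

lemma L2_dominated:
  assumes "v \<in> L2 X" "u \<in> borel_measurable (lebesgue_on X)"
    "AE x in lebesgue_on X. \<bar>u x\<bar> \<le> \<bar>v x\<bar>"
  shows "u \<in> L2 X"
proof -
  have "integrable (lebesgue_on X) (\<lambda>x. (u x)\<^sup>2)"
  proof (rule Bochner_Integration.integrable_bound[OF L2_integrable_sq[OF assms(1)]])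
    show "(\<lambda>x. (u x)\<^sup>2) \<in> borel_measurable (lebesgue_on X)"
      using assms(2) by measurable
    show "AE x in lebesgue_on X. norm ((u x)\<^sup>2) \<le> norm ((v x)\<^sup>2)"
      using assms(3) by eventually_elim (simp add: abs_le_square_iff)
  qed
  then show ?thesis using assms(2) by (simp add: L2_def)
qed

lemma L2_abs [intro]: "u \<in> L2 X \<Longrightarrow> (\<lambda>x. \<bar>u x\<bar>) \<in> L2 X"
  by (rule L2_dominated[of u]) (auto simp: L2_def)

lemma L2_ae_cong:
  assumes "v \<in> L2 X" "u \<in> borel_measurable (lebesgue_on X)" "ae_eq X u v"
  shows "u \<in> L2 X"
proof (rule L2_dominated[OF assms(1,2)])
  show "AE x in lebesgue_on X. \<bar>u x\<bar> \<le> \<bar>v x\<bar>"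
    using assms(3) unfolding ae_eq_def by eventually_elim simp
qed

lemma ae_eq_refl [simp]: "ae_eq X u u"
  by (simp add: ae_eq_def)

lemma ae_eq_sym: "ae_eq X u v \<Longrightarrow> ae_eq X v u"
  unfolding ae_eq_def by (erule eventually_mono) simp

lemma ae_eq_trans [trans]: "ae_eq X u v \<Longrightarrow> ae_eq X v w \<Longrightarrow> ae_eq X u w"
  unfolding ae_eq_def by (erule (1) eventually_elim2) simp

lemma l2_inner_commute: "l2_inner X u v = l2_inner X v u"
  by (simp add: l2_inner_def mult.commute)

lemma l2_inner_add_left:
  "u \<in> L2 X \<Longrightarrow> v \<in> L2 X \<Longrightarrow> w \<in> L2 X \<Longrightarrow>
    l2_inner X (\<lambda>x. u x + v x) w = l2_inner X u w + l2_inner X v w"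
  by (simp add: l2_inner_def distrib_right L2_mult_integrable)

lemma l2_inner_diff_left:
  "u \<in> L2 X \<Longrightarrow> v \<in> L2 X \<Longrightarrow> w \<in> L2 X \<Longrightarrow>
    l2_inner X (\<lambda>x. u x - v x) w = l2_inner X u w - l2_inner X v w"
  by (simp add: l2_inner_def left_diff_distrib L2_mult_integrable)

lemma l2_inner_scale_left: "l2_inner X (\<lambda>x. c * u x) w = c * l2_inner X u w"
  by (simp add: l2_inner_def mult.assoc)

lemma l2_inner_uminus_left: "l2_inner X (\<lambda>x. - u x) w = - l2_inner X u w"
  using l2_inner_scale_left[of X "-1" u w] by simp

lemma l2_inner_add_right:
  "u \<in> L2 X \<Longrightarrow> v \<in> L2 X \<Longrightarrow> w \<in> L2 X \<Longrightarrow>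
    l2_inner X w (\<lambda>x. u x + v x) = l2_inner X w u + l2_inner X w v"
  using l2_inner_add_left[of u X v w] by (simp add: l2_inner_commute)

lemma l2_inner_diff_right:
  "u \<in> L2 X \<Longrightarrow> v \<in> L2 X \<Longrightarrow> w \<in> L2 X \<Longrightarrow>
    l2_inner X w (\<lambda>x. u x - v x) = l2_inner X w u - l2_inner X w v"
  using l2_inner_diff_left[of u X v w] by (simp add: l2_inner_commute)

lemma l2_inner_scale_right: "l2_inner X w (\<lambda>x. c * u x) = c * l2_inner X w u"
  using l2_inner_scale_left[of X c u w] by (simp add: l2_inner_commute)

lemma l2_inner_zero [simp]: "l2_inner X (\<lambda>x. 0) u = 0" "l2_inner X u (\<lambda>x. 0) = 0"
  by (simp_all add: l2_inner_def)

lemma l2_inner_sum_left: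
  assumes "\<And>i. i \<in> I \<Longrightarrow> u i \<in> L2 X" "w \<in> L2 X"
  shows "l2_inner X (\<lambda>x. \<Sum>i\<in>I. u i x) w = (\<Sum>i\<in>I. l2_inner X (u i) w)"
  using assms
  by (induction I rule: infinite_finite_induct) (simp_all add: l2_inner_add_left L2_sum)

lemma l2_inner_cong:
  assumes "u \<in> borel_measurable (lebesgue_on X)" "u' \<in> borel_measurable (lebesgue_on X)"
    "v \<in> borel_measurable (lebesgue_on X)" "v' \<in> borel_measurable (lebesgue_on X)"
    "ae_eq X u u'" "ae_eq X v v'"
  shows "l2_inner X u v = l2_inner X u' v'"
  unfolding l2_inner_def
proof (rule integral_cong_AE)
  show "AE x in lebesgue_on X. u x * v x = u' x * v' x"
    using assms(5,6) unfolding ae_eq_def by eventually_elim simp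
qed (use assms in measurable)

lemma l2_norm_nonneg [simp]: "0 \<le> l2_norm X u"
  by (simp add: l2_norm_def l2_inner_def)

lemma l2_norm_sq: "(l2_norm X u)\<^sup>2 = l2_inner X u u"
  by (simp add: l2_norm_def l2_inner_def)

lemma l2_norm_sq_integral: "(l2_norm X u)\<^sup>2 = (\<integral>x. (u x)\<^sup>2 \<partial>lebesgue_on X)"
  unfolding l2_norm_sq by (simp add: l2_inner_def power2_eq_square)

lemma l2_norm_zero [simp]: "l2_norm X (\<lambda>x. 0) = 0"
  by (simp add: l2_norm_def)

lemma l2_norm_scale: "l2_norm X (\<lambda>x. c * u x) = \<bar>c\<bar> * l2_norm X u"
  unfolding l2_norm_def l2_inner_scale_left l2_inner_scale_right
  by (simp add: real_sqrt_mult flip: mult.assoc)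

lemma l2_norm_uminus [simp]: "l2_norm X (\<lambda>x. - u x) = l2_norm X u"
  using l2_norm_scale[of X "-1" u] by simp

lemma l2_norm_minus_commute: "l2_norm X (\<lambda>x. u x - v x) = l2_norm X (\<lambda>x. v x - u x)"
  using l2_norm_uminus[of X "\<lambda>x. u x - v x"] by simp

lemma l2_norm_cong:
  assumes "u \<in> borel_measurable (lebesgue_on X)" "v \<in> borel_measurable (lebesgue_on X)" "ae_eq X u v"
  shows "l2_norm X u = l2_norm X v"
  using assms l2_inner_cong unfolding l2_norm_def by metis

lemma l2_norm_zero_ae:
  assumes "u \<in> L2 X" "l2_norm X u = 0" shows "ae_eq X u (\<lambda>x. 0)"
proof -
  have "(\<integral>x. (u x)\<^sup>2 \<partial>lebesgue_on X) = 0"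
    using assms(2) l2_norm_sq_integral[of X u] by simp
  then have "AE x in lebesgue_on X. (u x)\<^sup>2 = 0"
    by (subst (asm) integral_nonneg_eq_0_iff_AE) (use L2_integrable_sq[OF assms(1)] in auto)
  then show ?thesis by (simp add: ae_eq_def)
qed

lemma l2_norm_mono:
  assumes "v \<in> L2 X" "u \<in> borel_measurable (lebesgue_on X)"
    "AE x in lebesgue_on X. \<bar>u x\<bar> \<le> \<bar>v x\<bar>"
  shows "l2_norm X u \<le> l2_norm X v"
proof -
  have "(\<integral>x. (u x)\<^sup>2 \<partial>lebesgue_on X) \<le> (\<integral>x. (v x)\<^sup>2 \<partial>lebesgue_on X)"
    using assms L2_dominated[OF assms]
    by (intro integral_mono_AE L2_integrable_sq) (auto simp: abs_le_square_iff)
  then show ?thesis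
    by (metis l2_norm_nonneg l2_norm_sq_integral power2_le_imp_le)
qed

lemma l2_cauchy_schwarz:
  assumes u: "u \<in> L2 X" and v: "v \<in> L2 X"
  shows "\<bar>l2_inner X u v\<bar> \<le> l2_norm X u * l2_norm X v"
proof (cases "l2_norm X v = 0")
  case True
  then have "ae_eq X v (\<lambda>x. 0)" using v l2_norm_zero_ae by auto
  then have "l2_inner X u v = l2_inner X u (\<lambda>x. 0)"
    using u v by (intro l2_inner_cong) (auto simp: L2_def)
  then show ?thesis using True by simp
next
  case False
  define t where "t = l2_inner X u v / l2_inner X v v"
  have vv: "l2_inner X v v > 0"
    using False l2_norm_sq[of X v] by (metis l2_norm_nonneg zero_less_power2 )
  have "0 \<le> l2_inner X (\<lambda>x. u x - t * v x) (\<lambda>x. u x - t * v x)"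
    using l2_norm_sq by (metis zero_le_power2)
  also have "\<dots> = l2_inner X u u - 2 * t * l2_inner X u v + t * t * l2_inner X v v"
    using u v by (simp add: l2_inner_diff_left l2_inner_diff_right l2_inner_scale_left
        l2_inner_scale_right L2_diff L2_scale l2_inner_commute[of X v u] algebra_simps)
  also have "\<dots> = l2_inner X u u - (l2_inner X u v)\<^sup>2 / l2_inner X v v"
    using vv by (simp add: t_def field_simps power2_eq_square)
  finally have "(l2_inner X u v)\<^sup>2 \<le> l2_inner X u u * l2_inner X v v"
    using vv by (simp add: field_simps)
  then have "\<bar>l2_inner X u v\<bar>\<^sup>2 \<le> (l2_norm X u * l2_norm X v)\<^sup>2"
    by (simp add: power_mult_distrib l2_norm_sq)
  then show ?thesis
    by (rule power2_le_imp_le) simp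
qed

lemma l2_norm_add_sq:
  assumes "u \<in> L2 X" "v \<in> L2 X"
  shows "(l2_norm X (\<lambda>x. u x + v x))\<^sup>2 = (l2_norm X u)\<^sup>2 + 2 * l2_inner X u v + (l2_norm X v)\<^sup>2"
  using assms unfolding l2_norm_sq
  by (simp add: l2_inner_add_left l2_inner_add_right L2_add l2_inner_commute[of X v u])

lemma l2_norm_diff_sq:
  assumes "u \<in> L2 X" "v \<in> L2 X"
  shows "(l2_norm X (\<lambda>x. u x - v x))\<^sup>2 = (l2_norm X u)\<^sup>2 - 2 * l2_inner X u v + (l2_norm X v)\<^sup>2"
  using assms unfolding l2_norm_sq
  by (simp add: l2_inner_diff_left l2_inner_diff_right L2_diff l2_inner_commute[of X v u])

lemma l2_norm_triangle:
  assumes u: "u \<in> L2 X" and v: "v \<in> L2 X"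
  shows "l2_norm X (\<lambda>x. u x + v x) \<le> l2_norm X u + l2_norm X v"
proof (rule power2_le_imp_le)
  show "(l2_norm X (\<lambda>x. u x + v x))\<^sup>2 \<le> (l2_norm X u + l2_norm X v)\<^sup>2"
    using l2_cauchy_schwarz[OF u v] unfolding l2_norm_add_sq[OF u v] power2_sum by linarith
qed simp

lemma l2_norm_triangle_diff:
  assumes "u \<in> L2 X" "v \<in> L2 X"
  shows "l2_norm X (\<lambda>x. u x - v x) \<le> l2_norm X u + l2_norm X v"
  using l2_norm_triangle[OF assms(1) L2_uminus[OF assms(2)]] by simp

lemma l2_dist_triangle:
  assumes "u \<in> L2 X" "v \<in> L2 X" "w \<in> L2 X"
  shows "l2_norm X (\<lambda>x. u x - w x) \<le> l2_norm X (\<lambda>x. u x - v x) + l2_norm X (\<lambda>x. v x - w x)"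
  using l2_norm_triangle[of "\<lambda>x. u x - v x" X "\<lambda>x. v x - w x"] assms by (simp add: L2_diff)

lemma l2_norm_le_dist:
  assumes "u \<in> L2 X" "v \<in> L2 X"
  shows "l2_norm X u \<le> l2_norm X (\<lambda>x. u x - v x) + l2_norm X v"
  using l2_norm_triangle[of "\<lambda>x. u x - v x" X v] assms by (simp add: L2_diff)

lemma L2_const [simp]:
  assumes "X \<in> lmeasurable" shows "(\<lambda>x. c) \<in> L2 X"
proof -
  interpret finite_measure "lebesgue_on X"
    using assms by (rule finite_measure_lebesgue_on)
  show ?thesis by (simp add: L2_def)
qed

lemma l2_norm_const:
  assumes "X \<in> lmeasurable"
  shows "l2_norm X (\<lambda>x. c) = \<bar>c\<bar> * sqrt (measure lebesgue X)"
proof -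
  have "l2_norm X (\<lambda>x. c * 1) = \<bar>c\<bar> * l2_norm X (\<lambda>x. 1)" by (rule l2_norm_scale)
  moreover have "l2_norm X (\<lambda>x. 1) = sqrt (measure lebesgue X)"
    using assms unfolding l2_norm_def l2_inner_def
    by (simp add: measure_restrict_space fmeasurableD)
  ultimately show ?thesis by simp
qed

text \<open>The weights \<open>r\<^sup>-\<^sup>2\<^sup>n\<close> (where \<open>r\<^sup>4 = q\<^sup>2\<close>) keep the sum of the squared increments
  integrable and bound all increments by one \<open>L\<^sup>2\<close> function times \<open>r\<^sup>n\<close>.\<close>

lemma l2_complete_geometric:
  assumes u: "\<And>n. u n \<in> L2 X"
    and step: "\<And>n. l2_norm X (\<lambda>x. u (Suc n) x - u n x) \<le> C * q ^ n"
    and q: "0 < q" "q < 1"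
  shows "\<exists>v\<in>L2 X. (\<lambda>n. l2_norm X (\<lambda>x. u n x - v x)) \<longlonglongrightarrow> 0"
proof -
  define r where "r = sqrt q"
  have r: "0 < r" "r < 1" "r\<^sup>2 = q" using q by (auto simp: r_def)
  define d where "d n x = (u (Suc n) x - u n x)\<^sup>2 / q ^ n" for n x
  have d_int: "integrable (lebesgue_on X) (d n)" for n
    unfolding d_def using L2_integrable_sq[OF L2_diff[OF u u]] by auto
  have d_nonneg: "d n x \<ge> 0" for n x
    using q by (simp add: d_def)
  have C: "C \<ge> 0"
    using step[of 0] order_trans[OF l2_norm_nonneg step[of 0]] by simp
  have d_le: "(\<integral>x. d n x \<partial>lebesgue_on X) \<le> C\<^sup>2 * q ^ n" for n
  proof -
    have "(\<integral>x. d n x \<partial>lebesgue_on X) = (l2_norm X (\<lambda>x. u (Suc n) x - u n x))\<^sup>2 / q ^ n"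
      unfolding d_def l2_norm_sq_integral by simp
    also have "\<dots> \<le> (C * q ^ n)\<^sup>2 / q ^ n"
      using q step[of n] by (intro divide_right_mono power_mono) auto
    also have "\<dots> = C\<^sup>2 * q ^ n"
      using q by (simp add: power2_eq_square)
    finally show ?thesis .
  qed
  have sum_int: "summable (\<lambda>n. \<integral>x. norm (d n x) \<partial>lebesgue_on X)"
  proof (rule summable_comparison_test')
    show "summable (\<lambda>n. C\<^sup>2 * q ^ n)"
      using q by (intro summable_mult summable_geometric) auto
    show "norm (\<integral>x. norm (d n x) \<partial>lebesgue_on X) \<le> C\<^sup>2 * q ^ n" for n
      using d_le[of n] d_nonneg by (simp add: Bochner_Integration.integral_nonneg)
  qed
  have AE_sum: "AE x in lebesgue_on X. summable (\<lambda>n. norm (d n x))"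
  proof -
    have meas: "(\<lambda>x. ennreal (d n x)) \<in> borel_measurable (lebesgue_on X)" for n
      using d_int by auto
    have "(\<integral>\<^sup>+x. (\<Sum>n. ennreal (d n x)) \<partial>lebesgue_on X) = (\<Sum>n. \<integral>\<^sup>+x. ennreal (d n x) \<partial>lebesgue_on X)"
      using meas by (intro nn_integral_suminf) auto
    also have "\<dots> = (\<Sum>n. ennreal (\<integral>x. d n x \<partial>lebesgue_on X))"
      using d_int d_nonneg by (simp add: nn_integral_eq_integral)
    also have "\<dots> = ennreal (\<Sum>n. \<integral>x. d n x \<partial>lebesgue_on X)"
      using sum_int d_nonneg by (intro suminf_ennreal2) (auto simp: Bochner_Integration.integral_nonneg)
    also have "\<dots> < \<infinity>" by simp
    finally have "(\<integral>\<^sup>+x. (\<Sum>n. ennreal (d n x)) \<partial>lebesgue_on X) \<noteq> \<infinity>" by simp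
    then have "AE x in lebesgue_on X. (\<Sum>n. ennreal (d n x)) \<noteq> \<infinity>"
      using meas by (intro nn_integral_PInf_AE borel_measurable_suminf_order) auto
    then show ?thesis
    proof eventually_elim
      case (elim x)
      then have "summable (\<lambda>n. d n x)"
        using d_nonneg by (intro summable_suminf_not_top) auto
      then show ?case using d_nonneg by simp
    qed
  qed
  define h where "h x = (\<Sum>n. d n x)" for x
  have h_int: "integrable (lebesgue_on X) h"
    unfolding h_def by (rule integrable_suminf[OF d_int AE_sum sum_int])
  have pw: "\<bar>u (Suc n) x - u n x\<bar> \<le> sqrt (h x) * r ^ n" and h0: "h x \<ge> 0"
    if "summable (\<lambda>n. norm (d n x))" for n x
  proof -
    have "summable (\<lambda>n. d n x)" using that d_nonneg by simp
    then have "d n x \<le> h x"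
      unfolding h_def using sum_le_suminf[of "\<lambda>n. d n x" "{n}"] d_nonneg by auto
    then have "(u (Suc n) x - u n x)\<^sup>2 \<le> h x * q ^ n"
      using q by (simp add: d_def field_simps)
    then have "\<bar>u (Suc n) x - u n x\<bar> \<le> sqrt (h x * q ^ n)"
      by (metis real_sqrt_abs real_sqrt_le_iff)
    then show "\<bar>u (Suc n) x - u n x\<bar> \<le> sqrt (h x) * r ^ n"
      by (simp add: real_sqrt_mult r_def real_sqrt_power)
    show "h x \<ge> 0" using \<open>d n x \<le> h x\<close> d_nonneg[of n x] by linarith
  qed
  \<comment> \<open>A total definition through \<open>suminf\<close>, so \<open>v\<close> is
    measurable as it stands; the almost everywhere summability enters only the pointwise
    estimates.\<close>
  define v where "v x = u 0 x + (\<Sum>n. u (Suc n) x - u n x)" for x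
  have tail: "\<bar>u n x - v x\<bar> \<le> sqrt (h x) * r ^ n / (1 - r)" and lim: "(\<lambda>n. u n x) \<longlonglongrightarrow> v x"
    if "summable (\<lambda>n. norm (d n x))" for n x
  proof -
    have geo: "summable (\<lambda>k. sqrt (h x) * r ^ k)"
      using r by (intro summable_mult summable_geometric) auto
    have abs_sum: "summable (\<lambda>k. \<bar>u (Suc k) x - u k x\<bar>)"
      by (rule summable_comparison_test'[OF geo]) (use pw[OF that] in auto)
    then have sm: "summable (\<lambda>k. u (Suc k) x - u k x)"
      by (rule summable_rabs_cancel)
    have part: "u m x = u 0 x + (\<Sum>k<m. u (Suc k) x - u k x)" for m
      by (induction m) auto
    have "v x - u n x = (\<Sum>k. u (Suc k) x - u k x) - (\<Sum>k<n. u (Suc k) x - u k x)"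
      unfolding v_def using part[of n] by linarith
    also have "\<dots> = (\<Sum>k. u (Suc (k + n)) x - u (k + n) x)"
      using suminf_minus_initial_segment[OF sm, of n] by simp
    also have "\<bar>\<dots>\<bar> \<le> (\<Sum>k. \<bar>u (Suc (k + n)) x - u (k + n) x\<bar>)"
      using abs_sum by (intro summable_rabs) (simp add: summable_iff_shift[of "\<lambda>k. \<bar>u (Suc k) x - u k x\<bar>"])
    also have "\<dots> \<le> (\<Sum>k. sqrt (h x) * r ^ n * r ^ k)"
    proof (rule suminf_le)
      show "\<bar>u (Suc (k + n)) x - u (k + n) x\<bar> \<le> sqrt (h x) * r ^ n * r ^ k" for k
        using pw[OF that, of "k + n"] by (simp add: power_add mult_ac)
      show "summable (\<lambda>k. \<bar>u (Suc (k + n)) x - u (k + n) x\<bar>)"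
        using abs_sum by (simp add: summable_iff_shift[of "\<lambda>k. \<bar>u (Suc k) x - u k x\<bar>"])
      show "summable (\<lambda>k. sqrt (h x) * r ^ n * r ^ k)"
        using r by (intro summable_mult summable_geometric) auto
    qed
    also have "\<dots> = sqrt (h x) * r ^ n / (1 - r)"
      using r by (simp add: suminf_mult suminf_geometric divide_inverse)
    finally show "\<bar>u n x - v x\<bar> \<le> sqrt (h x) * r ^ n / (1 - r)" by simp
    have "(\<lambda>m. u 0 x + (\<Sum>k<m. u (Suc k) x - u k x)) \<longlonglongrightarrow> u 0 x + (\<Sum>k. u (Suc k) x - u k x)"
      using summable_LIMSEQ[OF sm] by (intro tendsto_add tendsto_const)
    then show "(\<lambda>n. u n x) \<longlonglongrightarrow> v x" by (simp add: v_def flip: part)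
  qed
  have v_meas: "v \<in> borel_measurable (lebesgue_on X)"
    unfolding v_def using L2_measurable[OF u] by measurable
  \<comment> \<open>\<open>h\<close> is known to be non-negative only where the series converges.
    With the absolute value, the square of this function is |h| everywhere, which is
    integrable.\<close>
  have sqrt_h: "(\<lambda>x. sqrt (\<bar>h x\<bar>)) \<in> L2 X"
    using h_int by (auto simp: L2_def)
  have bound: "AE x in lebesgue_on X. \<bar>u n x - v x\<bar> \<le> \<bar>(r ^ n / (1 - r)) * sqrt \<bar>h x\<bar>\<bar>" for n
    using AE_sum
  proof eventually_elim
    case (elim x)
    show ?case using tail[OF elim, of n] h0[OF elim] r by (simp add: abs_mult mult.commute)
  qed
  have uv: "(\<lambda>x. u n x - v x) \<in> L2 X" for n
    by (rule L2_dominated[OF L2_scale[OF sqrt_h] _ bound[of n]])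
      (use v_meas L2_measurable[OF u] in measurable)
  have "v \<in> L2 X"
    using L2_diff[OF u[of 0] uv[of 0]] by simp
  moreover have "(\<lambda>n. l2_norm X (\<lambda>x. u n x - v x)) \<longlonglongrightarrow> 0"
  proof (rule tendsto_sandwich[where f = "\<lambda>_. 0"])
    show "\<forall>\<^sub>F n in sequentially. l2_norm X (\<lambda>x. u n x - v x) \<le> (r ^ n / (1 - r)) * l2_norm X (\<lambda>x. sqrt \<bar>h x\<bar>)"
    proof (intro always_eventually allI)
      fix n
      have "l2_norm X (\<lambda>x. u n x - v x) \<le> l2_norm X (\<lambda>x. (r ^ n / (1 - r)) * sqrt \<bar>h x\<bar>)"
        using bound[of n] L2_measurable[OF uv] by (intro l2_norm_mono L2_scale sqrt_h) auto
      then show "l2_norm X (\<lambda>x. u n x - v x) \<le> (r ^ n / (1 - r)) * l2_norm X (\<lambda>x. sqrt \<bar>h x\<bar>)"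
        using r unfolding l2_norm_scale by simp
    qed
    have "(\<lambda>n. (r ^ n / (1 - r)) * l2_norm X (\<lambda>x. sqrt \<bar>h x\<bar>)) \<longlonglongrightarrow> (0 / (1 - r)) * l2_norm X (\<lambda>x. sqrt \<bar>h x\<bar>)"
      using r by (intro tendsto_intros LIMSEQ_power_zero) auto
    then show "(\<lambda>n. (r ^ n / (1 - r)) * l2_norm X (\<lambda>x. sqrt \<bar>h x\<bar>)) \<longlonglongrightarrow> 0" by simp
  qed auto
  ultimately show ?thesis by blast
qed

text \<open>The representer minimises \<open>\<parallel>z\<parallel>\<^sup>2/2 - \<phi>(z)\<close>; by the parallelogram law a minimising sequence
  with defect \<open>4\<^sup>-\<^sup>n\<close> converges geometrically.\<close>

lemma l2_riesz:
  assumes add: "\<And>u v. u \<in> L2 X \<Longrightarrow> v \<in> L2 X \<Longrightarrow> \<phi> (\<lambda>x. u x + v x) = \<phi> u + \<phi> v"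
    and scale: "\<And>c u. u \<in> L2 X \<Longrightarrow> \<phi> (\<lambda>x. c * u x) = c * \<phi> u"
    and bound: "\<And>u. u \<in> L2 X \<Longrightarrow> \<bar>\<phi> u\<bar> \<le> C * l2_norm X u"
  shows "\<exists>z\<in>L2 X. \<forall>u\<in>L2 X. \<phi> u = l2_inner X u z"
proof -
  define J where "J z = (l2_norm X z)\<^sup>2 / 2 - \<phi> z" for z
  have diff: "\<phi> (\<lambda>x. u x - v x) = \<phi> u - \<phi> v" if "u \<in> L2 X" "v \<in> L2 X" for u v
    using add[OF that(1) L2_scale[OF that(2), of "-1"]] scale[OF that(2), of "-1"] by simp
  have J_lower: "J z \<ge> - C\<^sup>2 / 2" if "z \<in> L2 X" for z
  proof -
    have "0 \<le> (l2_norm X z - C)\<^sup>2" by simp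
    then have "C * l2_norm X z \<le> (l2_norm X z)\<^sup>2 / 2 + C\<^sup>2 / 2"
      by (simp add: power2_diff field_simps)
    then show ?thesis using bound[OF that] by (simp add: J_def)
  qed
  define I where "I = Inf (J ` L2 X)"
  have bdd: "bdd_below (J ` L2 X)"
    using J_lower by (intro bdd_belowI2) auto
  have I_le: "I \<le> J z" if "z \<in> L2 X" for z
    unfolding I_def using bdd that by (intro cInf_lower) auto
  have "\<exists>z\<in>L2 X. J z < I + (1/4) ^ n" for n
  proof -
    have "I < I + (1/4) ^ n" by simp
    then obtain y where "y \<in> J ` L2 X" "y < I + (1/4) ^ n"
      unfolding I_def using cInf_lessD[of "J ` L2 X"] L2_zero by blast
    then show ?thesis by auto
  qed
  then obtain z where z: "\<And>n. z n \<in> L2 X" "\<And>n. J (z n) < I + (1/4) ^ n" by metis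
  have mid: "(l2_norm X (\<lambda>x. a x - b x))\<^sup>2 \<le> 4 * (J a - I) + 4 * (J b - I)"
    if "a \<in> L2 X" "b \<in> L2 X" for a b
  proof -
    have m: "(\<lambda>x. (1/2) * (a x + b x)) \<in> L2 X" using that by (intro L2_scale L2_add)
    have "\<phi> (\<lambda>x. (1/2) * (a x + b x)) = (\<phi> a + \<phi> b) / 2"
      using scale[OF L2_add[OF that], of "1/2"] add[OF that] by simp
    moreover have "(l2_norm X (\<lambda>x. (1/2) * (a x + b x)))\<^sup>2 =
        ((l2_norm X a)\<^sup>2 + 2 * l2_inner X a b + (l2_norm X b)\<^sup>2) / 4"
      unfolding l2_norm_scale power_mult_distrib l2_norm_add_sq[OF that] by (simp add: power2_eq_square)
    ultimately show ?thesis
      using I_le[OF m] l2_norm_diff_sq[OF that] unfolding J_def by (simp add: field_simps)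
  qed
  have "l2_norm X (\<lambda>x. z (Suc n) x - z n x) \<le> 3 * (1/2) ^ n" for n
  proof (rule power2_le_imp_le)
    \<comment> \<open>The two defects add up to 5 times 4^-n; rounding 5 up to 9 makes the bound the
      square of 3 times 2^-n.\<close>
    have "(l2_norm X (\<lambda>x. z (Suc n) x - z n x))\<^sup>2 \<le> 4 * (1/4) ^ Suc n + 4 * (1/4) ^ n"
      using mid[OF z(1) z(1), of "Suc n" n] z(2)[of n] z(2)[of "Suc n"] by simp
    also have "\<dots> \<le> 9 * (1/4) ^ n" by simp
    also have "\<dots> = (3 * (1/2) ^ n)\<^sup>2"
    proof -
      have "((1 / 2 :: real) ^ n)\<^sup>2 = (1 / 4) ^ n"
        by (simp add: power2_eq_square flip: power_mult_distrib)
      then show ?thesis by (simp add: power_mult_distrib)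
    qed
    finally show "(l2_norm X (\<lambda>x. z (Suc n) x - z n x))\<^sup>2 \<le> (3 * (1/2) ^ n)\<^sup>2" .
  qed simp
  from l2_complete_geometric[OF z(1) this] obtain w where
    w: "w \<in> L2 X" and wlim: "(\<lambda>n. l2_norm X (\<lambda>x. z n x - w x)) \<longlonglongrightarrow> 0" by auto
  have Jw: "J w \<le> I"
  proof -
    define e where "e n = l2_norm X (\<lambda>x. z n x - w x)" for n
    have "J w \<le> I + (1/4) ^ n + (\<bar>C\<bar> + l2_norm X w) * e n" for n
    proof -
      have "J w = J (z n) - (l2_norm X (\<lambda>x. z n x - w x))\<^sup>2 / 2 - l2_inner X w (\<lambda>x. z n x - w x) + \<phi> (\<lambda>x. z n x - w x)"
        using l2_norm_add_sq[OF w L2_diff[OF z(1)[of n] w]] diff[OF z(1)[of n] w] by (simp add: J_def field_simps)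
      moreover have "\<bar>l2_inner X w (\<lambda>x. z n x - w x)\<bar> \<le> l2_norm X w * e n"
        unfolding e_def using w z(1) by (intro l2_cauchy_schwarz L2_diff)
      moreover have "\<bar>\<phi> (\<lambda>x. z n x - w x)\<bar> \<le> \<bar>C\<bar> * e n"
        using bound[OF L2_diff[OF z(1)[of n] w]] mult_right_mono[OF abs_ge_self[of C], of "e n"]
        unfolding e_def by fastforce
      ultimately show ?thesis
        using z(2)[of n] zero_le_power2[of "l2_norm X (\<lambda>x. z n x - w x)"]
        unfolding distrib_right by linarith
    qed
    moreover have "(\<lambda>n. I + (1/4) ^ n + (\<bar>C\<bar> + l2_norm X w) * e n) \<longlonglongrightarrow> I + 0 + (\<bar>C\<bar> + l2_norm X w) * 0"
      unfolding e_def using wlim by (intro tendsto_intros LIMSEQ_power_zero) auto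
    ultimately show ?thesis by (intro LIMSEQ_le_const[of _ I "J w"]) auto
  qed
  have "\<phi> u = l2_inner X u w" if u: "u \<in> L2 X" for u
  proof -
    \<comment> \<open>\<open>b\<close> is the derivative of \<open>J\<close> at \<open>w\<close> in
      direction \<open>u\<close>. Minimality makes t b + t^2 |u|^2 / 2 non-negative for t of both
      signs, which forces b = 0.\<close>
    define b where "b = l2_inner X w u - \<phi> u"
    have ineq: "0 \<le> t * b + t\<^sup>2 * (l2_norm X u)\<^sup>2 / 2" for t
    proof -
      have "J w \<le> J (\<lambda>x. w x + t * u x)"
        using Jw I_le[OF L2_add[OF w L2_scale[OF u]]] by (meson order_trans)
      then show ?thesis
        using l2_norm_add_sq[OF w L2_scale[OF u, of t]] add[OF w L2_scale[OF u, of t]] scale[OF u, of t]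
        by (simp add: J_def b_def l2_inner_scale_right l2_norm_scale power_mult_distrib algebra_simps add_divide_distrib)
    qed
    have "b = 0"
    proof (rule ccontr)
      assume "b \<noteq> 0"
      \<comment> \<open>The quadratic is tested at t = -b / m, close to its minimiser; the added 1
        keeps \<open>m\<close> positive when \<open>u\<close> vanishes.\<close>
      define m where "m = (l2_norm X u)\<^sup>2 + 1"
      have m: "m > 0" "(l2_norm X u)\<^sup>2 \<le> m" by (auto simp: m_def add_nonneg_pos)
      have "t\<^sup>2 * (l2_norm X u)\<^sup>2 / 2 \<le> t\<^sup>2 * m / 2" for t using m by (intro divide_right_mono mult_left_mono) auto
      then have "0 \<le> (- b / m) * b + (- b / m)\<^sup>2 * m / 2" using ineq[of "- b / m"] by (meson add_left_mono order_trans)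
      also have "\<dots> = - (b\<^sup>2 / m) / 2" using m(1) by (simp add: field_simps power2_eq_square)
      finally show False using \<open>b \<noteq> 0\<close> m(1) by (simp add: field_simps)
    qed
    then show ?thesis by (simp add: b_def l2_inner_commute)
  qed
  then show ?thesis using w by blast
qed

section \<open>Bounded operators on \<open>L\<^sup>2(X)\<close>\<close>

lemma l2_bounded_linear_in: "l2_bounded_linear X Y A \<Longrightarrow> u \<in> L2 X \<Longrightarrow> A u \<in> L2 Y"
  by (simp add: l2_bounded_linear_def)

lemma l2_bounded_linear_add:
  "l2_bounded_linear X Y A \<Longrightarrow> u \<in> L2 X \<Longrightarrow> v \<in> L2 X \<Longrightarrow>
    ae_eq Y (A (\<lambda>x. u x + v x)) (\<lambda>x. A u x + A v x)"
  by (simp add: l2_bounded_linear_def)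

lemma l2_bounded_linear_scale:
  "l2_bounded_linear X Y A \<Longrightarrow> u \<in> L2 X \<Longrightarrow> ae_eq Y (A (\<lambda>x. c * u x)) (\<lambda>x. c * A u x)"
  by (simp add: l2_bounded_linear_def)

lemma l2_bounded_linear_diff:
  assumes A: "l2_bounded_linear X Y A" and u: "u \<in> L2 X" and v: "v \<in> L2 X"
  shows "ae_eq Y (A (\<lambda>x. u x - v x)) (\<lambda>x. A u x - A v x)"
  using l2_bounded_linear_add[OF A u L2_scale[OF v, of "-1"]] l2_bounded_linear_scale[OF A v, of "-1"]
  unfolding ae_eq_def by eventually_elim simp

lemma l2_bounded_linear_bound:
  assumes "l2_bounded_linear X Y A"
  obtains K where "K > 0" "\<And>u. u \<in> L2 X \<Longrightarrow> l2_norm Y (A u) \<le> K * l2_norm X u"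
proof -
  obtain C where C: "\<forall>u\<in>L2 X. l2_norm Y (A u) \<le> C * l2_norm X u"
    using assms by (auto simp: l2_bounded_linear_def)
  have "l2_norm Y (A u) \<le> max C 1 * l2_norm X u" if "u \<in> L2 X" for u
    using C that mult_right_mono[of C "max C 1" "l2_norm X u"] by force
  then show thesis by (intro that[of "max C 1"]) auto
qed

text \<open>The functional u -> <A u, y> is bounded, so \<open>l2_riesz\<close> supplies the object
  that \<open>SOME\<close> selects in \<open>l2_adjoint\<close>.\<close>

lemma l2_adjoint_props:
  assumes A: "l2_bounded_linear X X A" and y: "y \<in> L2 X"
  shows "l2_adjoint X A y \<in> L2 X" "u \<in> L2 X \<Longrightarrow> l2_inner X (A u) y = l2_inner X u (l2_adjoint X A y)"
proof -
  obtain K where K: "K > 0" "\<And>u. u \<in> L2 X \<Longrightarrow> l2_norm X (A u) \<le> K * l2_norm X u"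
    using l2_bounded_linear_bound[OF A] by metis
  have in_L2: "A u \<in> L2 X" if "u \<in> L2 X" for u using l2_bounded_linear_in[OF A that] .
  have "\<exists>z\<in>L2 X. \<forall>u\<in>L2 X. l2_inner X (A u) y = l2_inner X u z"
  proof (rule l2_riesz[where C = "K * l2_norm X y"])
    fix u v assume u: "u \<in> L2 X" and v: "v \<in> L2 X"
    have "l2_inner X (A (\<lambda>x. u x + v x)) y = l2_inner X (\<lambda>x. A u x + A v x) y"
      using l2_bounded_linear_add[OF A u v] in_L2 u v y by (intro l2_inner_cong L2_measurable L2_add) auto
    then show "l2_inner X (A (\<lambda>x. u x + v x)) y = l2_inner X (A u) y + l2_inner X (A v) y"
      using in_L2 u v y by (simp add: l2_inner_add_left)
  next
    fix c u assume u: "u \<in> L2 X"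
    have "l2_inner X (A (\<lambda>x. c * u x)) y = l2_inner X (\<lambda>x. c * A u x) y"
      using l2_bounded_linear_scale[OF A u] in_L2 u y by (intro l2_inner_cong L2_measurable L2_scale) auto
    then show "l2_inner X (A (\<lambda>x. c * u x)) y = c * l2_inner X (A u) y"
      by (simp add: l2_inner_scale_left)
  next
    fix u assume u: "u \<in> L2 X"
    show "\<bar>l2_inner X (A u) y\<bar> \<le> K * l2_norm X y * l2_norm X u"
      using l2_cauchy_schwarz[OF in_L2[OF u] y] mult_right_mono[OF K(2)[OF u], of "l2_norm X y"]
      by (simp add: mult_ac)
  qed
  then have "\<exists>z. z \<in> L2 X \<and> (\<forall>u\<in>L2 X. l2_inner X (A u) y = l2_inner X u z)" by auto
  from someI_ex[OF this]
  show "l2_adjoint X A y \<in> L2 X" "u \<in> L2 X \<Longrightarrow> l2_inner X (A u) y = l2_inner X u (l2_adjoint X A y)"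
    unfolding l2_adjoint_def by auto
qed

lemma l2_norm_le_of_inner:
  assumes "z \<in> L2 X" "l2_inner X z z \<le> M * l2_norm X z" "M \<ge> 0"
  shows "l2_norm X z \<le> M"
proof (cases "l2_norm X z = 0")
  case False
  then have "l2_norm X z > 0" using l2_norm_nonneg[of X z] by linarith
  then show ?thesis using assms(2) unfolding l2_norm_sq[symmetric] power2_eq_square by simp
qed (use assms in simp)

section \<open>Density in \<open>L\<^sup>2\<close>\<close>

lemma l2_tendsto_dominated:
  assumes w: "w \<in> L2 X" and u: "\<And>n. u n \<in> borel_measurable (lebesgue_on X)"
    and v: "v \<in> borel_measurable (lebesgue_on X)"
    and bound: "\<And>n. AE x in lebesgue_on X. \<bar>u n x - v x\<bar> \<le> w x"
    and lim: "AE x in lebesgue_on X. (\<lambda>n. u n x) \<longlonglongrightarrow> v x"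
  shows "(\<lambda>n. l2_norm X (\<lambda>x. u n x - v x)) \<longlonglongrightarrow> 0"
proof -
  have "(\<lambda>n. \<integral>x. (u n x - v x)\<^sup>2 \<partial>lebesgue_on X) \<longlonglongrightarrow> (\<integral>x. 0 \<partial>lebesgue_on X)"
  proof (rule integral_dominated_convergence)
    show "integrable (lebesgue_on X) (\<lambda>x. (w x)\<^sup>2)" by (rule L2_integrable_sq[OF w])
    show "AE x in lebesgue_on X. (\<lambda>n. (u n x - v x)\<^sup>2) \<longlonglongrightarrow> 0"
      using lim
    proof eventually_elim
      case (elim x)
      have "(\<lambda>n. (u n x - v x)\<^sup>2) \<longlonglongrightarrow> (v x - v x)\<^sup>2"
        using elim by (intro tendsto_intros)
      then show ?case by simp
    qed
    show "AE x in lebesgue_on X. norm ((u n x - v x)\<^sup>2) \<le> (w x)\<^sup>2" for n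
      using bound[of n]
    proof eventually_elim
      case (elim x)
      then show ?case using power_mono[OF elim abs_ge_zero, of 2] by simp
    qed
  qed (use u v in measurable)
  then have "(\<lambda>n. sqrt (\<integral>x. (u n x - v x)\<^sup>2 \<partial>lebesgue_on X)) \<longlonglongrightarrow> sqrt (\<integral>x. 0 \<partial>lebesgue_on X)"
    by (rule tendsto_real_sqrt)
  then show ?thesis
    by (simp only: l2_norm_sq_integral[symmetric] real_sqrt_abs abs_of_nonneg[OF l2_norm_nonneg]) simp
qed

lemma tendsto_zero_imp_ex_less:
  assumes "f \<longlonglongrightarrow> (0 :: real)" "e > 0" shows "\<exists>n. f n < e"
  using order_tendstoD(2)[OF assms] by (rule eventually_happens'[OF sequentially_bot])

lemma continuous_imp_lebesgue_on_measurable: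
  assumes "continuous_on UNIV (g :: 'a::euclidean_space \<Rightarrow> real)"
  shows "g \<in> borel_measurable (lebesgue_on X)"
proof -
  have "g \<in> borel_measurable borel"
    using assms by (rule borel_measurable_continuous_onI)
  then have "g \<in> borel_measurable lebesgue"
    by (intro measurable_completion) simp
  then show ?thesis by (rule measurable_restrict_space1)
qed

lemma compact_continuous_abs_bound:
  fixes f :: "'a::topological_space \<Rightarrow> real"
  assumes "compact K" "continuous_on K f" shows "\<exists>C. \<forall>x\<in>K. \<bar>f x\<bar> \<le> C"
  using compact_imp_bounded[OF compact_continuous_image[OF assms(2,1)]] by (auto simp: bounded_iff)

lemma L2_bounded:
  assumes "X \<in> lmeasurable" "u \<in> borel_measurable (lebesgue_on X)" "\<And>x. x \<in> X \<Longrightarrow> \<bar>u x\<bar> \<le> C"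
  shows "u \<in> L2 X"
proof (rule L2_dominated[OF L2_const[OF assms(1), of C] assms(2)])
  show "AE x in lebesgue_on X. \<bar>u x\<bar> \<le> \<bar>C\<bar>"
    by (rule AE_I2) (use assms(3) in force)
qed

text \<open>Two truncations are at work. Clipping \<open>f\<close> to [-n, n] costs little in norm;
  the bounded result is an almost everywhere limit of continuous functions, and clipping those as
  well leaves the limit unchanged while providing the constant 2n as a dominating function.\<close>

lemma L2_continuous_dense:
  assumes X: "X \<in> lmeasurable" and f: "f \<in> L2 X" and "\<eta> > 0"
  obtains g where "continuous_on UNIV g" "g \<in> L2 X" "l2_norm X (\<lambda>x. f x - g x) < \<eta>"
proof -
  define clip where "clip n t = max (- real n) (min (real n) t)" for n t
  have clip_abs: "\<bar>clip n t\<bar> \<le> real n" for n t by (auto simp: clip_def)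
  have "(\<lambda>n. l2_norm X (\<lambda>x. clip n (f x) - f x)) \<longlonglongrightarrow> 0"
  proof (rule l2_tendsto_dominated[OF L2_abs[OF f]])
    show "(\<lambda>x. clip n (f x)) \<in> borel_measurable (lebesgue_on X)" for n
      using L2_measurable[OF f] unfolding clip_def by measurable
    show "AE x in lebesgue_on X. \<bar>clip n (f x) - f x\<bar> \<le> \<bar>f x\<bar>" for n
      by (rule AE_I2) (auto simp: clip_def)
    have "(\<lambda>n. clip n t) \<longlonglongrightarrow> t" for t
    proof (rule tendsto_eventually)
      show "\<forall>\<^sub>F n in sequentially. clip n t = t"
        using eventually_ge_at_top[of "nat \<lceil>\<bar>t\<bar>\<rceil>"]
        by eventually_elim (auto simp: clip_def abs_le_iff ceiling_le_iff nat_le_iff)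
    qed
    then show "AE x in lebesgue_on X. (\<lambda>n. clip n (f x)) \<longlonglongrightarrow> f x" by simp
  qed (use L2_measurable[OF f] in auto)
  then obtain n where n: "l2_norm X (\<lambda>x. clip n (f x) - f x) < \<eta> / 2"
    using \<open>\<eta> > 0\<close> tendsto_zero_imp_ex_less[of _ "\<eta> / 2"] by auto
  define F where "F x = clip n (f x)" for x
  have F_meas: "F \<in> borel_measurable (lebesgue_on X)"
    using L2_measurable[OF f] unfolding F_def clip_def by measurable
  have F_L2: "F \<in> L2 X" by (rule L2_bounded[OF X F_meas, of "real n"]) (auto simp: F_def clip_abs)
  have "F measurable_on X"
    using X F_meas by (subst measurable_on_iff_borel_measurable) (auto dest: fmeasurableD)
  then obtain Z g where Z: "negligible Z" and g: "\<And>k. continuous_on UNIV (g k)"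
    and lim: "\<And>x. x \<notin> Z \<Longrightarrow> (\<lambda>k. g k x) \<longlonglongrightarrow> (if x \<in> X then F x else 0)"
    unfolding measurable_on_def by (metis (no_types))
  define G where "G k x = clip n (g k x)" for k x
  have G_cont: "continuous_on UNIV (G k)" for k
    unfolding G_def clip_def by (intro continuous_intros g)
  have G_meas: "G k \<in> borel_measurable (lebesgue_on X)" for k
    by (rule continuous_imp_lebesgue_on_measurable[OF G_cont])
  have G_L2: "G k \<in> L2 X" for k
    by (rule L2_bounded[OF X G_meas, of _ "real n"]) (auto simp: G_def clip_abs)
  have "(\<lambda>k. l2_norm X (\<lambda>x. G k x - F x)) \<longlonglongrightarrow> 0"
  proof (rule l2_tendsto_dominated[OF L2_const[OF X, of "2 * real n"] G_meas F_meas])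
    show "AE x in lebesgue_on X. \<bar>G k x - F x\<bar> \<le> 2 * real n" for k
    proof (rule AE_I2)
      fix x show "\<bar>G k x - F x\<bar> \<le> 2 * real n"
        using clip_abs[of n "g k x"] clip_abs[of n "f x"] unfolding G_def F_def by linarith
    qed
    have "AE x in lebesgue. x \<notin> Z" using Z by (simp add: negligible_iff_null_sets AE_not_in)
    then have "AE x in lebesgue_on X. x \<notin> Z"
      using X by (subst AE_restrict_space_iff) (auto dest: fmeasurableD)
    moreover have "AE x in lebesgue_on X. x \<in> X" using AE_space[of "lebesgue_on X"] by simp
    ultimately show "AE x in lebesgue_on X. (\<lambda>k. G k x) \<longlonglongrightarrow> F x"
    proof eventually_elim
      case (elim x)
      then have "(\<lambda>k. g k x) \<longlonglongrightarrow> F x" using lim by fastforce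
      then have "(\<lambda>k. clip n (g k x)) \<longlonglongrightarrow> clip n (F x)"
        unfolding clip_def by (intro tendsto_intros)
      moreover have "clip n (F x) = F x" by (auto simp: F_def clip_def)
      ultimately show ?case by (simp add: G_def)
    qed
  qed
  then obtain k where k: "l2_norm X (\<lambda>x. G k x - F x) < \<eta> / 2"
    using \<open>\<eta> > 0\<close> tendsto_zero_imp_ex_less[of _ "\<eta> / 2"] by auto
  have "l2_norm X (\<lambda>x. f x - G k x) \<le> l2_norm X (\<lambda>x. f x - F x) + l2_norm X (\<lambda>x. F x - G k x)"
    by (rule l2_dist_triangle[OF f F_L2 G_L2])
  also have "\<dots> < \<eta>"
    using n k l2_norm_minus_commute[of X f F] l2_norm_minus_commute[of X F "G k"] by (simp add: F_def)
  finally show thesis using that G_cont G_L2 by blast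
qed

section \<open>Smooth functions\<close>

text \<open>\<open>frechet_derivative\<close> is a choice term. This rule lets any exhibited
  derivative stand in for it, which drives the closure proofs below.\<close>

lemma C_k_SucI:
  assumes "\<And>x. (f has_derivative D x) (at x)" "\<And>b. b \<in> Basis \<Longrightarrow> C_k n (\<lambda>x. D x b)"
  shows "C_k (Suc n) f"
proof -
  have "frechet_derivative f (at x) = D x" for x
    using frechet_derivative_at[OF assms(1)[of x]] by simp
  then show ?thesis
    using assms by (auto simp: differentiable_def)
qed

lemma C_k_Suc_has_derivative:
  "C_k (Suc n) f \<Longrightarrow> (f has_derivative frechet_derivative f (at x)) (at x)"
  by (simp add: frechet_derivative_works[symmetric])

lemma C_k_Suc_imp: "C_k (Suc n) f \<Longrightarrow> C_k n f"
proof (induction n arbitrary: f)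
  case 0
  then show ?case
    by (auto simp: continuous_on_eq_continuous_at intro: differentiable_imp_continuous_within)
next
  case (Suc n)
  then show ?case by simp
qed

lemma C_k_const: "C_k n (\<lambda>x. c)"
proof (induction n arbitrary: c)
  case (Suc n)
  show ?case by (rule C_k_SucI[where D = "\<lambda>x h. 0"]) (auto intro: Suc)
qed simp

lemma C_k_add: "C_k n f \<Longrightarrow> C_k n g \<Longrightarrow> C_k n (\<lambda>x. f x + g x)"
proof (induction n arbitrary: f g)
  case 0
  then show ?case by (auto intro: continuous_intros)
next
  case (Suc n)
  show ?case
  proof (rule C_k_SucI)
    show "((\<lambda>x. f x + g x) has_derivative
        (\<lambda>h. frechet_derivative f (at x) h + frechet_derivative g (at x) h)) (at x)" for x
      using Suc.prems by (intro has_derivative_add C_k_Suc_has_derivative)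
    show "C_k n (\<lambda>x. frechet_derivative f (at x) b + frechet_derivative g (at x) b)" if "b \<in> Basis" for b
      using Suc.prems that by (intro Suc.IH) auto
  qed
qed

lemma C_k_mult: "C_k n f \<Longrightarrow> C_k n g \<Longrightarrow> C_k n (\<lambda>x. f x * g x)"
proof (induction n arbitrary: f g)
  case 0
  then show ?case by (auto intro: continuous_intros)
next
  case (Suc n)
  show ?case
  proof (rule C_k_SucI)
    show "((\<lambda>x. f x * g x) has_derivative
        (\<lambda>h. f x * frechet_derivative g (at x) h + frechet_derivative f (at x) h * g x)) (at x)" for x
      using Suc.prems by (intro has_derivative_mult C_k_Suc_has_derivative)
    show "C_k n (\<lambda>x. f x * frechet_derivative g (at x) b + frechet_derivative f (at x) b * g x)"
      if "b \<in> Basis" for b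
      using Suc.prems that by (intro C_k_add Suc.IH C_k_Suc_imp[OF Suc.prems(1)] C_k_Suc_imp[OF Suc.prems(2)]) auto
  qed
qed

lemma C_k_shift: "C_k n f \<Longrightarrow> C_k n (\<lambda>x. f (x + c))"
proof (induction n arbitrary: f)
  case 0
  then show ?case by (auto intro!: continuous_on_compose2[of UNIV f] continuous_intros)
next
  case (Suc n)
  show ?case
  proof (rule C_k_SucI)
    show "((\<lambda>x. f (x + c)) has_derivative frechet_derivative f (at (x + c))) (at x)" for x
    proof -
      have "((\<lambda>x. x + c) has_derivative (\<lambda>h. h)) (at x)"
        by (auto intro!: derivative_eq_intros)
      from has_derivative_compose[OF this C_k_Suc_has_derivative[OF Suc.prems]]
      show ?thesis .
    qed
    show "C_k n (\<lambda>x. frechet_derivative f (at (x + c)) b)" if "b \<in> Basis" for b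
      using Suc.IH[of "\<lambda>x. frechet_derivative f (at x) b"] Suc.prems that by simp
  qed
qed

text \<open>Differentiating moves from \<open>F j\<close> to \<open>F (Suc j)\<close> and leaves
  only the constant factor b \<bullet> a, so the induction closes once \<open>j\<close> is
  arbitrary. Both sine and cosine and the bump functions below arise as such families.\<close>

lemma C_k_ridge:
  assumes F: "\<And>j t. (F j has_real_derivative F (Suc j) t) (at t)"
  shows "C_k n (\<lambda>x. F j (x \<bullet> a + c))"
proof (induction n arbitrary: j)
  case 0
  have "continuous_on UNIV (F j)"
    using F by (auto simp: continuous_on_eq_continuous_at intro: DERIV_isCont)
  then show ?case by (auto intro!: continuous_on_compose2[of UNIV "F j"] continuous_intros)
next
  case (Suc n)
  show ?case
  proof (rule C_k_SucI)
    show "((\<lambda>x. F j (x \<bullet> a + c)) has_derivative (\<lambda>h. F (Suc j) (x \<bullet> a + c) * (h \<bullet> a))) (at x)" for x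
    proof -
      have "((\<lambda>x. x \<bullet> a + c) has_derivative (\<lambda>h. h \<bullet> a)) (at x)"
        by (auto intro!: derivative_eq_intros)
      from has_derivative_compose[OF this F[of j "x \<bullet> a + c", unfolded has_field_derivative_def]]
      show ?thesis by simp
    qed
    show "C_k n (\<lambda>x. F (Suc j) (x \<bullet> a + c) * (b \<bullet> a))" for b
      by (intro C_k_mult Suc C_k_const)
  qed
qed

lemma smooth_const [intro]: "smooth (\<lambda>x. c)"
  by (simp add: smooth_def C_k_const)

lemma smooth_add [intro]: "smooth f \<Longrightarrow> smooth g \<Longrightarrow> smooth (\<lambda>x. f x + g x)"
  by (simp add: smooth_def C_k_add)

lemma smooth_mult [intro]: "smooth f \<Longrightarrow> smooth g \<Longrightarrow> smooth (\<lambda>x. f x * g x)"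
  by (simp add: smooth_def C_k_mult)

lemma smooth_shift [intro]: "smooth f \<Longrightarrow> smooth (\<lambda>x. f (x + c))"
  by (simp add: smooth_def C_k_shift)

lemma smooth_diff [intro]: "smooth f \<Longrightarrow> smooth g \<Longrightarrow> smooth (\<lambda>x. f x - g x)"
  using smooth_add[of f "\<lambda>x. (- 1) * g x"] smooth_mult[OF smooth_const[of "-1"], of g] by simp

lemma smooth_prod [intro]: "(\<And>i. i \<in> I \<Longrightarrow> smooth (f i)) \<Longrightarrow> smooth (\<lambda>x. \<Prod>i\<in>I. f i x)"
  by (induction I rule: infinite_finite_induct) auto

lemma smooth_power [intro]: "smooth f \<Longrightarrow> smooth (\<lambda>x. f x ^ n)"
  by (induction n) auto

lemma smooth_ridge:
  assumes "\<And>j t. (F j has_real_derivative F (Suc j) t) (at t)"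
  shows "smooth (\<lambda>x. F j (x \<bullet> a + c))"
  unfolding smooth_def using C_k_ridge[of F, OF assms] by blast

lemma smooth_has_derivative: "smooth f \<Longrightarrow> (f has_derivative frechet_derivative f (at x)) (at x)"
  unfolding smooth_def using C_k_Suc_has_derivative by blast

lemma smooth_continuous: "smooth f \<Longrightarrow> continuous_on UNIV f"
  unfolding smooth_def by (metis C_k.simps(1))

lemma smooth_continuous_derivative:
  "smooth f \<Longrightarrow> b \<in> Basis \<Longrightarrow> continuous_on UNIV (\<lambda>x. frechet_derivative f (at x) b)"
  unfolding smooth_def by (metis C_k.simps)

lemma smooth_sin_cos:
  "smooth (\<lambda>x :: 'a::euclidean_space. sin (x \<bullet> a))" "smooth (\<lambda>x :: 'a. cos (x \<bullet> a))"
proof -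
  \<comment> \<open>Sine advanced by j quarter periods: differentiation then raises j by one, and j
    = 1 is the cosine.\<close>
  define F where "F j t = sin (t + real j * (pi / 2))" for j t
  have F: "(F j has_real_derivative F (Suc j) t) (at t)" for j t
  proof -
    have "sin (A + pi / 2) = cos A" for A :: real by (simp add: sin_add)
    moreover have "t + real (Suc j) * (pi / 2) = (t + real j * (pi / 2)) + pi / 2"
      by (simp add: field_simps)
    ultimately have "F (Suc j) t = cos (t + real j * (pi / 2))"
      unfolding F_def by metis
    then show ?thesis unfolding F_def by (auto intro!: derivative_eq_intros)
  qed
  have "smooth (\<lambda>x :: 'a. F 0 (x \<bullet> a + 0))" "smooth (\<lambda>x :: 'a. F 1 (x \<bullet> a + 0))"
    using F by (rule smooth_ridge)+
  moreover have "F 1 t = cos t" "F 0 t = sin t" for t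
    by (simp_all add: F_def sin_add)
  ultimately show "smooth (\<lambda>x :: 'a. sin (x \<bullet> a))" "smooth (\<lambda>x :: 'a. cos (x \<bullet> a))" by simp_all
qed

text \<open>The functions \<open>p(1/t) exp(-1/t)\<close>, extended by \<open>0\<close> to \<open>t \<le> 0\<close>, are closed under
  differentiation.\<close>

primrec bump_poly :: "nat \<Rightarrow> real poly" where
  "bump_poly 0 = 1"
| "bump_poly (Suc j) = (bump_poly j - pderiv (bump_poly j)) * [:0, 0, 1:]"

definition bump1 :: "nat \<Rightarrow> real \<Rightarrow> real" where
  "bump1 j t = (if t > 0 then poly (bump_poly j) (1 / t) * exp (- 1 / t) else 0)"

text \<open>Induction on the coefficients of q. The exponent k has to be arbitrary because splitting
  off the constant term leaves a factor y that is absorbed into y^k.\<close>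

lemma poly_exp_tendsto_0: "((\<lambda>y :: real. y ^ k * poly q y * exp (- y)) \<longlongrightarrow> 0) at_top"
proof (induction q arbitrary: k)
  case (pCons a q)
  have "((\<lambda>y :: real. a * (y ^ k / exp y) + y ^ Suc k * poly q y * exp (- y)) \<longlongrightarrow> a * 0 + 0) at_top"
    by (intro tendsto_intros tendsto_power_div_exp_0 pCons.IH)
  then show ?case by (simp add: exp_minus field_simps)
qed simp

lemma bump1_has_derivative: "(bump1 j has_real_derivative bump1 (Suc j) t) (at t)"
proof (cases "t = 0")
  case False
  show ?thesis
  proof (cases "t > 0")
    case True
    have "((\<lambda>t. poly (bump_poly j) (1 / t) * exp (- 1 / t)) has_real_derivative bump1 (Suc j) t) (at t)"
      using True by (auto intro!: derivative_eq_intros poly_DERIV[THEN DERIV_chain2]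
          simp: bump1_def field_simps power2_eq_square)
    moreover have "eventually (\<lambda>t. poly (bump_poly j) (1 / t) * exp (- 1 / t) = bump1 j t) (nhds t)"
      using eventually_nhds_in_open[of "{0<..}" t] True
      by (auto simp: bump1_def elim!: eventually_mono)
    ultimately show ?thesis by (subst (asm) DERIV_cong_ev[OF refl _ refl])
  next
    case neg: False
    then have "t < 0" using False by simp
    then have "eventually (\<lambda>t. 0 = bump1 j t) (nhds t)"
      using eventually_nhds_in_open[of "{..<0}" t]
      by (auto simp: bump1_def elim!: eventually_mono)
    moreover have "((\<lambda>t. 0) has_real_derivative bump1 (Suc j) t) (at t)"
      using neg by (simp add: bump1_def)
    ultimately show ?thesis by (subst (asm) DERIV_cong_ev[OF refl _ refl])
  qed
next
  case True
  have "((\<lambda>h. bump1 j h / h) \<longlongrightarrow> 0) (at 0)"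
  proof (rule filterlim_split_at)
    show "((\<lambda>h. bump1 j h / h) \<longlongrightarrow> 0) (at_left 0)"
      by (rule tendsto_eventually) (auto simp: bump1_def eventually_at_filter)
    \<comment> \<open>With y = 1/h the difference quotient at 0 is y p(y) exp(-y), which tends to 0
      as y tends to infinity; this is where flatness at the origin comes from.\<close>
    have "((\<lambda>h :: real. inverse h ^ 1 * poly (bump_poly j) (inverse h) * exp (- inverse h)) \<longlongrightarrow> 0) (at_right 0)"
      by (rule filterlim_compose[OF poly_exp_tendsto_0 filterlim_inverse_at_top_right])
    then show "((\<lambda>h. bump1 j h / h) \<longlongrightarrow> 0) (at_right 0)"
      by (rule Lim_transform_eventually)
        (auto simp: bump1_def eventually_at_filter field_simps inverse_eq_divide)
  qed
  then show ?thesis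
    using True by (simp add: has_field_derivative_iff bump1_def)
qed

section \<open>Smooth cutoffs exhausting an open set\<close>

definition bump_box :: "'a::euclidean_space \<Rightarrow> 'a \<Rightarrow> 'a \<Rightarrow> real" where
  "bump_box a b x = (\<Prod>i\<in>Basis. bump1 0 (x \<bullet> i - a \<bullet> i) * bump1 0 (b \<bullet> i - x \<bullet> i))"

lemma bump1_range: "0 \<le> bump1 0 t" "bump1 0 t \<le> 1" "bump1 0 t > 0 \<longleftrightarrow> t > 0" "bump1 0 t = 0 \<longleftrightarrow> t \<le> 0"
  by (auto simp: bump1_def)

lemma smooth_bump_box: "smooth (bump_box a b)"
  unfolding bump_box_def
proof (intro smooth_prod smooth_mult)
  fix i :: 'a
  have "smooth (\<lambda>x. bump1 0 (x \<bullet> i + (- (a \<bullet> i))))" "smooth (\<lambda>x. bump1 0 (x \<bullet> (- i) + b \<bullet> i))"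
    using bump1_has_derivative by (rule smooth_ridge)+
  then show "smooth (\<lambda>x. bump1 0 (x \<bullet> i - a \<bullet> i))" "smooth (\<lambda>x. bump1 0 (b \<bullet> i - x \<bullet> i))"
    by (simp_all add: algebra_simps)
qed

lemma bump_box_range: "0 \<le> bump_box a b x" "bump_box a b x \<le> 1"
  unfolding bump_box_def by (auto intro!: prod_nonneg prod_le_1 mult_nonneg_nonneg mult_le_one simp: bump1_range)

lemma bump_box_pos: "x \<in> box a b \<Longrightarrow> bump_box a b x > 0"
  unfolding bump_box_def by (auto intro!: prod_pos mult_pos_pos simp: bump1_range box_def)

lemma bump_box_outside: "x \<notin> box a b \<Longrightarrow> bump_box a b x = 0"
  unfolding bump_box_def by (auto simp: bump1_range box_def prod_zero_iff not_less)

text \<open>V is a countable union of open boxes whose closures lie in V. In \<kappa> n only the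
  first n boxes enter, so the support stays in finitely many closed boxes; the exponent n drives 1 -
  bump to 0 at every point of a box that has entered. The two uses of n together give pointwise
  convergence to 1 with compact supports.\<close>

lemma test_function_cutoff:
  assumes "open V"
  obtains \<kappa> :: "nat \<Rightarrow> 'a::euclidean_space \<Rightarrow> real" where "\<And>n. test_function V (\<kappa> n)"
    "\<And>n x. 0 \<le> \<kappa> n x" "\<And>n x. \<kappa> n x \<le> 1" "\<And>x. x \<in> V \<Longrightarrow> (\<lambda>n. \<kappa> n x) \<longlonglongrightarrow> 1"
proof (cases "V = {}")
  case True
  show ?thesis
    by (rule that[of "\<lambda>n x. 0"]) (auto simp: True test_function_def)
next
  case False
  define \<B> where "\<B> = {box a b | a b :: 'a. cbox a b \<subseteq> V}"
  have cover: "\<Union>\<B> = V"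
  proof
    show "\<Union>\<B> \<subseteq> V" using box_subset_cbox unfolding \<B>_def by blast
    show "V \<subseteq> \<Union>\<B>"
    proof
      fix x assume "x \<in> V"
      then obtain a b where "cbox a b \<subseteq> V" "x \<in> box a b"
        using open_contains_cbox[OF assms] by metis
      then show "x \<in> \<Union>\<B>" unfolding \<B>_def by blast
    qed
  qed
  obtain \<B>' where \<B>': "\<B>' \<subseteq> \<B>" "countable \<B>'" "\<Union>\<B>' = \<Union>\<B>"
    by (rule Lindelof[of \<B>]) (auto simp: \<B>_def)
  have ne: "\<B>' \<noteq> {}" using False cover \<B>'(3) by auto
  have "\<exists>a b. from_nat_into \<B>' n = box a b \<and> cbox a b \<subseteq> V" for n
    using from_nat_into[OF ne, of n] \<B>'(1) unfolding \<B>_def by blast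
  then obtain a b where ab: "\<And>n. from_nat_into \<B>' n = box (a n) (b n)" "\<And>n. cbox (a n) (b n) \<subseteq> V" by metis
  define \<kappa> where "\<kappa> n x = 1 - (\<Prod>j<n. (1 - bump_box (a j) (b j) x) ^ n)" for n x
  have factor: "0 \<le> (1 - bump_box (a j) (b j) x) ^ n" "(1 - bump_box (a j) (b j) x) ^ n \<le> 1" for j x n
    using bump_box_range[of "a j" "b j" x] by (auto intro!: power_le_one)
  show ?thesis
  proof
    fix n
    define C where "C = (\<Union>j<n. cbox (a j) (b j))"
    have "{x. \<kappa> n x \<noteq> 0} \<subseteq> C"
    proof
      fix x assume x: "x \<in> {x. \<kappa> n x \<noteq> 0}"
      obtain j where j: "j < n" "bump_box (a j) (b j) x \<noteq> 0"
      proof -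
        have "\<not> (\<forall>j<n. bump_box (a j) (b j) x = 0)"
        proof
          assume "\<forall>j<n. bump_box (a j) (b j) x = 0"
          then have "\<kappa> n x = 0" unfolding \<kappa>_def by simp
          then show False using x by simp
        qed
        then show thesis using that by blast
      qed
      then have "x \<in> box (a j) (b j)" using bump_box_outside by metis
      then show "x \<in> C" unfolding C_def using j(1) box_subset_cbox[of "a j" "b j"] by blast
    qed
    moreover have "compact C" unfolding C_def by (intro compact_UN) auto
    ultimately have "closure {x. \<kappa> n x \<noteq> 0} \<subseteq> C"
      by (intro closure_minimal) (auto intro: compact_imp_closed)
    moreover have "C \<subseteq> V" unfolding C_def using ab(2) by blast
    moreover have "smooth (\<kappa> n)" unfolding \<kappa>_def
      using smooth_bump_box by (intro smooth_diff smooth_prod smooth_power smooth_const)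
    ultimately show "test_function V (\<kappa> n)"
      unfolding test_function_def using \<open>compact C\<close>
      by (meson bounded_subset closed_closure compact_eq_bounded_closed order_trans)
    fix x
    have "0 \<le> (\<Prod>j<n. (1 - bump_box (a j) (b j) x) ^ n)" "(\<Prod>j<n. (1 - bump_box (a j) (b j) x) ^ n) \<le> 1"
      using factor by (auto intro!: prod_nonneg prod_le_1)
    then show "0 \<le> \<kappa> n x" "\<kappa> n x \<le> 1" by (auto simp: \<kappa>_def)
  next
    fix x assume "x \<in> V"
    then obtain B where "B \<in> \<B>'" "x \<in> B" using cover \<B>'(3) by blast
    then obtain j where "x \<in> box (a j) (b j)"
      using ab(1) \<B>'(2) by (metis from_nat_into_surj)
    define t where "t = 1 - bump_box (a j) (b j) x"
    have t: "0 \<le> t" "t < 1"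
      using bump_box_pos[OF \<open>x \<in> box (a j) (b j)\<close>] bump_box_range[of "a j" "b j" x] by (auto simp: t_def)
    have "(\<lambda>n. \<Prod>j<n. (1 - bump_box (a j) (b j) x) ^ n) \<longlonglongrightarrow> 0"
    proof (rule tendsto_sandwich[where f = "\<lambda>_. 0"])
      show "(\<lambda>n. t ^ n) \<longlonglongrightarrow> 0" using t by (intro LIMSEQ_power_zero) auto
      show "\<forall>\<^sub>F n in sequentially. (\<Prod>j<n. (1 - bump_box (a j) (b j) x) ^ n) \<le> t ^ n"
        using eventually_gt_at_top[of j]
      proof eventually_elim
        case (elim n)
        have "(\<Prod>j<n. (1 - bump_box (a j) (b j) x) ^ n) = t ^ n * (\<Prod>i\<in>{..<n} - {j}. (1 - bump_box (a i) (b i) x) ^ n)"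
          unfolding t_def using elim by (subst prod.remove[of _ j]) auto
        also have "\<dots> \<le> t ^ n * 1"
          using factor t by (intro mult_left_mono prod_le_1) auto
        finally show ?case by simp
      qed
    qed (use factor in \<open>auto intro!: always_eventually prod_nonneg\<close>)
    then have "(\<lambda>n. 1 - (\<Prod>j<n. (1 - bump_box (a j) (b j) x) ^ n)) \<longlonglongrightarrow> 1 - 0"
      by (intro tendsto_intros)
    then show "(\<lambda>n. \<kappa> n x) \<longlonglongrightarrow> 1" by (simp add: \<kappa>_def)
  qed
qed

section \<open>Trigonometric polynomials\<close>

inductive ctrig :: "(real ^ 'd \<Rightarrow> complex) \<Rightarrow> bool" where
  ctrig_char: "ctrig (\<lambda>x. c * character k x)"
| ctrig_add: "ctrig f \<Longrightarrow> ctrig g \<Longrightarrow> ctrig (\<lambda>x. f x + g x)"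

lemma character_add: "character (k + l) x = character k x * character l x"
  by (simp add: character_def exp_add[symmetric] sum.distrib algebra_simps)

lemma character_0 [simp]: "character 0 x = 1"
  by (simp add: character_def)

lemma character_uminus: "character (- k) x = cnj (character k x)"
  by (simp add: character_def exp_cnj sum_negf)

lemma cmod_character [simp]: "cmod (character k x) = 1"
  by (simp add: character_def norm_exp_imaginary)

lemma character_shift: "character k (x + y) = character k x * character k y"
  by (simp add: character_def exp_add[symmetric] sum.distrib algebra_simps)

lemma continuous_on_character [continuous_intros]:
  "continuous_on S f \<Longrightarrow> continuous_on S (\<lambda>x. character k (f x))"
  unfolding character_def by (intro continuous_intros)

lemma ctrig_mult_char: "ctrig g \<Longrightarrow> ctrig (\<lambda>x. (c * character k x) * g x)"
proof (induction rule: ctrig.induct)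
  case (ctrig_char c' k')
  have "(\<lambda>x. c * character k x * (c' * character k' x)) = (\<lambda>x. (c * c') * character (k + k') x)"
    by (simp add: character_add mult_ac)
  then show ?case by (simp add: ctrig.ctrig_char)
next
  case (ctrig_add f g)
  then show ?case by (simp add: distrib_left ctrig.ctrig_add)
qed

lemma ctrig_mult: "ctrig f \<Longrightarrow> ctrig g \<Longrightarrow> ctrig (\<lambda>x. f x * g x)"
proof (induction rule: ctrig.induct)
  case (ctrig_char c k)
  then show ?case by (rule ctrig_mult_char)
next
  case (ctrig_add f g)
  then show ?case by (simp add: distrib_right ctrig.ctrig_add)
qed

text \<open>Generated as an algebra from constants and the coordinate sines and cosines, since this
  is the form to which Stone-Weierstrass applies; \<open>rtrig_imp_ctrig\<close> translates into
  frequencies.\<close>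

inductive rtrig :: "(real ^ 'd \<Rightarrow> real) \<Rightarrow> bool" where
  rtrig_const: "rtrig (\<lambda>x. c)"
| rtrig_cos: "rtrig (\<lambda>x. cos (x $ i))"
| rtrig_sin: "rtrig (\<lambda>x. sin (x $ i))"
| rtrig_add: "rtrig f \<Longrightarrow> rtrig g \<Longrightarrow> rtrig (\<lambda>x. f x + g x)"
| rtrig_mult: "rtrig f \<Longrightarrow> rtrig g \<Longrightarrow> rtrig (\<lambda>x. f x * g x)"

lemma character_axis: "character (axis i 1) x = cis (x $ i)"
proof -
  have "(\<Sum>j\<in>UNIV. of_int (axis i 1 $ j) * x $ j) = (\<Sum>j\<in>UNIV. if j = i then x $ i else 0)"
    by (intro sum.cong) (auto simp: axis_def)
  then show ?thesis by (simp add: character_def cis_conv_exp)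
qed

lemma rtrig_imp_ctrig: "rtrig f \<Longrightarrow> ctrig (\<lambda>x. complex_of_real (f x))"
proof (induction rule: rtrig.induct)
  case (rtrig_const c)
  show ?case using ctrig_char[of "of_real c" 0] by simp
next
  case (rtrig_cos i)
  have "(\<lambda>x :: real ^ 'a. complex_of_real (cos (x $ i))) =
      (\<lambda>x. (1/2) * character (axis i 1) x + (1/2) * character (- axis i 1) x)"
    by (rule ext) (simp add: character_uminus character_axis complex_eq_iff)
  then show ?case by (simp only: ctrig.intros)
next
  case (rtrig_sin i)
  have "(\<lambda>x :: real ^ 'a. complex_of_real (sin (x $ i))) =
      (\<lambda>x. (-\<i>/2) * character (axis i 1) x + (\<i>/2) * character (- axis i 1) x)"
    by (rule ext) (simp add: character_uminus character_axis complex_eq_iff)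
  then show ?case by (simp only: ctrig.intros)
next
  case (rtrig_add f g)
  then show ?case by (simp add: ctrig_add)
next
  case (rtrig_mult f g)
  then show ?case by (simp add: ctrig_mult)
qed

lemma finite_modes [simp]: "finite (modes K :: (int ^ 'd) set)"
proof (rule finite_subset)
  show "modes K \<subseteq> vec_lambda ` (UNIV \<rightarrow>\<^sub>E {- int K..int K} :: ('d \<Rightarrow> int) set)"
  proof
    fix k :: "int ^ 'd" assume "k \<in> modes K"
    then have "vec_nth k \<in> UNIV \<rightarrow>\<^sub>E {- int K..int K}"
      by (auto simp: modes_def abs_le_iff minus_le_iff)
    then show "k \<in> vec_lambda ` (UNIV \<rightarrow>\<^sub>E {- int K..int K})"
      by (metis image_eqI vec_nth_inverse)
  qed
  show "finite (vec_lambda ` (UNIV \<rightarrow>\<^sub>E {- int K..int K} :: ('d \<Rightarrow> int) set))"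
    by (intro finite_imageI finite_PiE) auto
qed

lemma modes_uminus: "- k \<in> modes K \<longleftrightarrow> k \<in> modes K"
  by (simp add: modes_def)

text \<open>A representation is claimed for all large K, not for one K, so that two polynomials can
  be brought to a common mode set before they are added.\<close>

lemma ctrig_modes:
  "ctrig f \<Longrightarrow> \<exists>K0. \<forall>K\<ge>K0. \<exists>c. f = (\<lambda>x. \<Sum>k\<in>modes K. c k * character k x)"
proof (induction rule: ctrig.induct)
  case (ctrig_char c k)
  define K0 where "K0 = nat (Max (range (\<lambda>i. \<bar>k $ i\<bar>)))"
  have "\<exists>c'. (\<lambda>x. c * character k x) = (\<lambda>x. \<Sum>l\<in>modes K. c' l * character l x)" if "K \<ge> K0" for K
  proof (intro exI ext)
    fix x
    have "k \<in> modes K"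
      unfolding modes_def
    proof (intro CollectI allI)
      fix i
      have "\<bar>k $ i\<bar> \<le> Max (range (\<lambda>i. \<bar>k $ i\<bar>))" by (rule Max_ge) auto
      then show "\<bar>k $ i\<bar> \<le> int K" using that unfolding K0_def by linarith
    qed
    then have "(\<Sum>l\<in>modes K. (if l = k then c else 0) * character l x) = c * character k x"
      by (simp add: if_distrib[of "\<lambda>z. z * _"] cong: if_cong)
    then show "c * character k x = (\<Sum>l\<in>modes K. (if l = k then c else 0) * character l x)" by simp
  qed
  then show ?case by blast
next
  case (ctrig_add f g)
  then obtain K1 K2 where
    K1: "\<And>K. K \<ge> K1 \<Longrightarrow> \<exists>c. f = (\<lambda>x. \<Sum>k\<in>modes K. c k * character k x)" and
    K2: "\<And>K. K \<ge> K2 \<Longrightarrow> \<exists>c. g = (\<lambda>x. \<Sum>k\<in>modes K. c k * character k x)" by blast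
  have "\<exists>c. (\<lambda>x. f x + g x) = (\<lambda>x. \<Sum>k\<in>modes K. c k * character k x)" if "K \<ge> max K1 K2" for K
  proof -
    obtain c1 c2 where "f = (\<lambda>x. \<Sum>k\<in>modes K. c1 k * character k x)"
      "g = (\<lambda>x. \<Sum>k\<in>modes K. c2 k * character k x)" using K1[of K] K2[of K] \<open>K \<ge> max K1 K2\<close> by auto
    then have "(\<lambda>x. f x + g x) = (\<lambda>x. \<Sum>k\<in>modes K. (c1 k + c2 k) * character k x)"
      by (simp add: distrib_right sum.distrib)
    then show ?thesis by (intro exI[of _ "\<lambda>k. c1 k + c2 k"])
  qed
  then show ?case by blast
qed

lemma rtrig_smooth: "rtrig f \<Longrightarrow> smooth f"
proof (induction rule: rtrig.induct)
  case (rtrig_cos i)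
  show ?case using smooth_sin_cos(2)[of "axis i (1 :: real)"] by (simp add: inner_axis inner_real_def)
next
  case (rtrig_sin i)
  show ?case using smooth_sin_cos(1)[of "axis i (1 :: real)"] by (simp add: inner_axis inner_real_def)
qed auto

section \<open>Density of trigonometric polynomials and of test functions\<close>

lemma torus_cell_iff: "x \<in> torus_cell \<longleftrightarrow> (\<forall>i. 0 < x $ i \<and> x $ i < 2 * pi)"
  by (simp add: torus_cell_def mem_box_cart)

text \<open>Stone-Weierstrass needs separation of points. Equal sines and cosines mean that
  coordinates agree modulo 2 pi, and inside the open cell they differ by less than 2 pi.\<close>

lemma rtrig_dense_continuous:
  fixes K :: "(real ^ 'd) set"
  assumes "compact K" "K \<subseteq> torus_cell" "continuous_on K f" "e > 0"
  shows "\<exists>g. rtrig g \<and> (\<forall>x\<in>K. \<bar>f x - g x\<bar> < e)"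
proof (rule Stone_Weierstrass_HOL[where P = rtrig, OF assms(1)])
  fix x y :: "real ^ 'd" assume xy: "x \<in> K \<and> y \<in> K \<and> x \<noteq> y"
  then obtain i where i: "x $ i \<noteq> y $ i" by (auto simp: vec_eq_iff)
  have range: "0 < x $ i" "x $ i < 2 * pi" "0 < y $ i" "y $ i < 2 * pi"
    using xy assms(2) by (auto simp: torus_cell_iff subset_iff)
  have "cos (x $ i) \<noteq> cos (y $ i) \<or> sin (x $ i) \<noteq> sin (y $ i)"
  proof (rule ccontr)
    assume "\<not> ?thesis"
    then obtain n :: int where n: "x $ i = y $ i + 2 * pi * n"
      using sin_cos_eq_iff[of "x $ i" "y $ i"] by auto
    then have "\<bar>2 * pi * n\<bar> < 2 * pi" using range by linarith
    then have "\<bar>real_of_int n\<bar> < 1" by (simp add: abs_mult)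
    then have "n = 0" by linarith
    then show False using n i by simp
  qed
  then show "\<exists>f. rtrig f \<and> f x \<noteq> f y"
    using rtrig_cos[of i] rtrig_sin[of i] by metis
qed (use assms in \<open>auto intro: rtrig.intros dest: rtrig_smooth smooth_continuous continuous_on_subset\<close>)

lemma rtrig_in_L2:
  assumes "V \<in> lmeasurable" "closure V \<subseteq> torus_cell" "rtrig q"
  shows "q \<in> L2 V"
proof -
  have cont: "continuous_on UNIV q" using assms by (simp add: rtrig_smooth smooth_continuous)
  have "bounded (closure V)"
    using bounded_subset[OF _ assms(2)] by (simp add: torus_cell_def bounded_box)
  then obtain C where C: "\<forall>x\<in>closure V. \<bar>q x\<bar> \<le> C"
    using compact_continuous_abs_bound[of "closure V" q] continuous_on_subset[OF cont]
    by (auto simp: compact_eq_bounded_closed)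
  then show ?thesis
    using closure_subset by (intro L2_bounded[OF assms(1) continuous_imp_lebesgue_on_measurable[OF cont], of C]) blast
qed

lemma rtrig_dense_L2:
  assumes V: "V \<in> lmeasurable" "closure V \<subseteq> torus_cell" and w: "w \<in> L2 V" and "\<eta> > 0"
  shows "\<exists>q. rtrig q \<and> l2_norm V (\<lambda>x. w x - q x) < \<eta>"
proof -
  obtain g where g: "continuous_on UNIV g" "g \<in> L2 V" "l2_norm V (\<lambda>x. w x - g x) < \<eta> / 2"
    using L2_continuous_dense[OF V(1) w, of "\<eta> / 2"] \<open>\<eta> > 0\<close> by auto
  have cpt: "compact (closure V)"
    using bounded_subset[OF _ V(2)] by (simp add: torus_cell_def bounded_box compact_eq_bounded_closed)
  define m where "m = sqrt (measure lebesgue V)"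
  have m: "m \<ge> 0" by (simp add: m_def)
  define e where "e = \<eta> / 2 / (m + 1)"
  have e: "e > 0" using \<open>\<eta> > 0\<close> m by (simp add: e_def)
  obtain q where q: "rtrig q" "\<And>x. x \<in> closure V \<Longrightarrow> \<bar>g x - q x\<bar> < e"
    using rtrig_dense_continuous[OF cpt V(2) continuous_on_subset[OF g(1)] e] by auto
  have qL: "q \<in> L2 V" by (rule rtrig_in_L2[OF V q(1)])
  have "l2_norm V (\<lambda>x. g x - q x) \<le> l2_norm V (\<lambda>x. e)"
  proof (rule l2_norm_mono[OF L2_const[OF V(1)] L2_measurable[OF L2_diff[OF g(2) qL]]])
    show "AE x in lebesgue_on V. \<bar>g x - q x\<bar> \<le> \<bar>e\<bar>"
    proof (rule AE_I2)
      fix x assume "x \<in> space (lebesgue_on V)"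
      then have "x \<in> closure V" using closure_subset by auto
      then show "\<bar>g x - q x\<bar> \<le> \<bar>e\<bar>" using q(2)[of x] by simp
    qed
  qed
  also have "\<dots> = e * m" using e by (simp add: l2_norm_const[OF V(1)] m_def)
  also have "\<dots> \<le> \<eta> / 2" using m \<open>\<eta> > 0\<close> by (simp add: e_def field_simps)
  finally have "l2_norm V (\<lambda>x. w x - q x) < \<eta>"
    using l2_dist_triangle[OF w g(2) qL] g(3) by linarith
  then show ?thesis using q(1) by blast
qed

lemma test_function_bounded:
  assumes "test_function V \<phi>" obtains C where "\<And>x. \<bar>\<phi> x\<bar> \<le> C"
proof -
  have "compact (closure {x. \<phi> x \<noteq> 0})" "continuous_on UNIV \<phi>"
    using assms smooth_continuous by (auto simp: test_function_def)
  then obtain C where C: "\<forall>x\<in>closure {x. \<phi> x \<noteq> 0}. \<bar>\<phi> x\<bar> \<le> C"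
    using compact_continuous_abs_bound[OF _ continuous_on_subset] by (metis subset_UNIV)
  have "\<bar>\<phi> x\<bar> \<le> max C 0" for x
  proof (cases "\<phi> x = 0")
    case False
    then have "x \<in> closure {x. \<phi> x \<noteq> 0}" by (intro subsetD[OF closure_subset]) simp
    then have "\<bar>\<phi> x\<bar> \<le> C" using C by metis
    then show ?thesis by simp
  qed simp
  then show thesis by (rule that)
qed

lemma test_function_L2:
  assumes "X \<in> lmeasurable" "test_function V \<phi>" shows "\<phi> \<in> L2 X"
proof -
  obtain C where "\<And>x. \<bar>\<phi> x\<bar> \<le> C" using test_function_bounded[OF assms(2)] by metis
  then show ?thesis
    using assms by (intro L2_bounded[OF assms(1), of _ C] continuous_imp_lebesgue_on_measurable smooth_continuous)
      (auto simp: test_function_def)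
qed

text \<open>A trigonometric polynomial q close to w is smooth but lacks compact support. Multiplying
  by the cutoffs repairs this, and since they tend to 1 on V, dominated convergence with dominator
  |q| makes the loss small.\<close>

lemma test_function_dense:
  fixes V :: "(real ^ 'd) set"
  assumes V: "open V" "closure V \<subseteq> torus_cell" and w: "w \<in> L2 V" and "\<eta> > 0"
  shows "\<exists>\<phi>. test_function V \<phi> \<and> l2_norm V (\<lambda>x. w x - \<phi> x) < \<eta>"
proof -
  have "bounded V" using bounded_subset[of torus_cell V] V(2) closure_subset
    by (auto simp: torus_cell_def bounded_box)
  then have Vm: "V \<in> lmeasurable" using V(1) by (simp add: lmeasurable_open)
  obtain q where q: "rtrig q" "l2_norm V (\<lambda>x. w x - q x) < \<eta> / 2"
    using rtrig_dense_L2[OF Vm V(2) w, of "\<eta> / 2"] \<open>\<eta> > 0\<close> by auto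
  have qL: "q \<in> L2 V" by (rule rtrig_in_L2[OF Vm V(2) q(1)])
  obtain \<kappa> :: "nat \<Rightarrow> real ^ 'd \<Rightarrow> real" where \<kappa>: "\<And>n. test_function V (\<kappa> n)" "\<And>n x. 0 \<le> \<kappa> n x"
    "\<And>n x. \<kappa> n x \<le> 1" "\<And>x. x \<in> V \<Longrightarrow> (\<lambda>n. \<kappa> n x) \<longlonglongrightarrow> 1"
    using test_function_cutoff[OF V(1)] by metis
  have test: "test_function V (\<lambda>x. \<kappa> n x * q x)" for n
  proof -
    have "closure {x. \<kappa> n x * q x \<noteq> 0} \<subseteq> closure {x. \<kappa> n x \<noteq> 0}"
      by (intro closure_mono) auto
    moreover have "smooth (\<lambda>x. \<kappa> n x * q x)"
      using \<kappa>(1)[of n] rtrig_smooth[OF q(1)] by (auto simp: test_function_def)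
    ultimately show ?thesis
      using \<kappa>(1)[of n] unfolding test_function_def
      by (meson bounded_subset closed_closure compact_eq_bounded_closed order_trans)
  qed
  have "(\<lambda>n. l2_norm V (\<lambda>x. \<kappa> n x * q x - q x)) \<longlonglongrightarrow> 0"
  proof (rule l2_tendsto_dominated[OF L2_abs[OF qL] _ L2_measurable[OF qL]])
    show "(\<lambda>x. \<kappa> n x * q x) \<in> borel_measurable (lebesgue_on V)" for n
      by (rule L2_measurable[OF test_function_L2[OF Vm test]])
    show "AE x in lebesgue_on V. \<bar>\<kappa> n x * q x - q x\<bar> \<le> \<bar>q x\<bar>" for n
    proof (rule AE_I2)
      fix x
      have "\<bar>\<kappa> n x * q x - q x\<bar> = (1 - \<kappa> n x) * \<bar>q x\<bar>"
      proof -
        have "\<kappa> n x * q x - q x = - ((1 - \<kappa> n x) * q x)" by (simp add: algebra_simps)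
        then show ?thesis using \<kappa>(3)[of n x] by (simp only: abs_minus_cancel abs_mult)
      qed
      also have "\<dots> \<le> 1 * \<bar>q x\<bar>" using \<kappa>(2)[of n x] by (intro mult_right_mono) auto
      finally show "\<bar>\<kappa> n x * q x - q x\<bar> \<le> \<bar>q x\<bar>" by simp
    qed
    show "AE x in lebesgue_on V. (\<lambda>n. \<kappa> n x * q x) \<longlonglongrightarrow> q x"
    proof (rule AE_I2)
      fix x assume "x \<in> space (lebesgue_on V)"
      then have "(\<lambda>n. \<kappa> n x * q x) \<longlonglongrightarrow> 1 * q x"
        by (intro tendsto_intros \<kappa>(4)) auto
      then show "(\<lambda>n. \<kappa> n x * q x) \<longlonglongrightarrow> q x" by simp
    qed
  qed
  then obtain n where n: "l2_norm V (\<lambda>x. \<kappa> n x * q x - q x) < \<eta> / 2"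
    using \<open>\<eta> > 0\<close> tendsto_zero_imp_ex_less[of _ "\<eta> / 2"] by auto
  have "l2_norm V (\<lambda>x. w x - \<kappa> n x * q x) < \<eta>"
    using l2_dist_triangle[OF w qL test_function_L2[OF Vm test[of n]]] q(2) n
      l2_norm_minus_commute[of V q "\<lambda>x. \<kappa> n x * q x"] by linarith
  then show ?thesis using test by blast
qed

text \<open>By density a test function can replace one copy of w in <w, w>. This is how norms are
  recovered from information that is available only on test functions, as for weak
  gradients.\<close>

lemma l2_norm_le_of_test_functions:
  fixes V :: "(real ^ 'd) set"
  assumes V: "open V" "closure V \<subseteq> torus_cell" and w: "w \<in> L2 V" and M: "M \<ge> 0"
    and test: "\<And>\<phi>. test_function V \<phi> \<Longrightarrow> \<bar>l2_inner V w \<phi>\<bar> \<le> M * l2_norm V \<phi>"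
  shows "l2_norm V w \<le> M"
proof (rule l2_norm_le_of_inner[OF w _ M])
  have "bounded V" using bounded_subset[of torus_cell V] V(2) closure_subset
    by (auto simp: torus_cell_def bounded_box)
  then have Vm: "V \<in> lmeasurable" using V(1) by (simp add: lmeasurable_open)
  show "l2_inner V w w \<le> M * l2_norm V w"
  proof (rule field_le_epsilon)
    fix e :: real assume "e > 0"
    define \<eta> where "\<eta> = e / (l2_norm V w + M + 1)"
    have pos: "l2_norm V w + M + 1 > 0" using M l2_norm_nonneg[of V w] by linarith
    have \<eta>: "\<eta> > 0" using \<open>e > 0\<close> pos by (simp add: \<eta>_def)
    obtain \<phi> where \<phi>: "test_function V \<phi>" "l2_norm V (\<lambda>x. w x - \<phi> x) < \<eta>"
      using test_function_dense[OF V w \<eta>] by blast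
    have \<phi>L: "\<phi> \<in> L2 V" by (rule test_function_L2[OF Vm \<phi>(1)])
    have "l2_inner V w w = l2_inner V w (\<lambda>x. w x - \<phi> x) + l2_inner V w \<phi>"
      using w \<phi>L by (simp add: l2_inner_diff_right)
    also have "\<dots> \<le> l2_norm V w * \<eta> + M * (l2_norm V w + \<eta>)"
    proof (rule add_mono)
      have "l2_inner V w (\<lambda>x. w x - \<phi> x) \<le> l2_norm V w * l2_norm V (\<lambda>x. w x - \<phi> x)"
        using l2_cauchy_schwarz[OF w L2_diff[OF w \<phi>L]] by linarith
      also have "\<dots> \<le> l2_norm V w * \<eta>" using \<phi>(2) by (intro mult_left_mono) auto
      finally show "l2_inner V w (\<lambda>x. w x - \<phi> x) \<le> l2_norm V w * \<eta>" .
      have "l2_norm V \<phi> \<le> l2_norm V w + \<eta>"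
        using l2_norm_le_dist[OF \<phi>L w] \<phi>(2) l2_norm_minus_commute[of V w \<phi>] by linarith
      then have "M * l2_norm V \<phi> \<le> M * (l2_norm V w + \<eta>)" using M by (intro mult_left_mono) auto
      then show "l2_inner V w \<phi> \<le> M * (l2_norm V w + \<eta>)" using test[OF \<phi>(1)] by linarith
    qed
    also have "\<dots> = M * l2_norm V w + (l2_norm V w + M) * \<eta>" by (simp add: algebra_simps)
    also have "\<dots> \<le> M * l2_norm V w + e"
      using \<open>e > 0\<close> pos by (simp add: \<eta>_def field_simps)
    finally show "l2_inner V w w \<le> M * l2_norm V w + e" .
  qed
qed

section \<open>Finite-rank operators\<close>

text \<open>The class of range functions is a parameter because it changes along the way:
  \<open>bounded_L2 X\<close> for local averages, \<open>L2 X\<close> once adjoints are taken,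
  trigonometric polynomials in front of a Fourier layer, and \<open>L2 torus_cell\<close> for
  extensions.\<close>

inductive fin_rank ::
  "'a::euclidean_space set \<Rightarrow> ('a \<Rightarrow> real) set \<Rightarrow> (('a \<Rightarrow> real) \<Rightarrow> ('a \<Rightarrow> real)) \<Rightarrow> bool"
  for X \<Phi> where
  fin_rank_zero: "fin_rank X \<Phi> (\<lambda>u x. 0)"
| fin_rank_step: "fin_rank X \<Phi> T \<Longrightarrow> a \<in> L2 X \<Longrightarrow> \<phi> \<in> \<Phi> \<Longrightarrow>
    fin_rank X \<Phi> (\<lambda>u x. T u x + l2_inner X a u * \<phi> x)"

lemma fin_rank_add:
  assumes "fin_rank X \<Phi> T1" "fin_rank X \<Phi> T2"
  shows "fin_rank X \<Phi> (\<lambda>u x. T1 u x + T2 u x)"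
  using assms(2)
proof (induction rule: fin_rank.induct)
  case fin_rank_zero
  then show ?case using assms(1) by simp
next
  case (fin_rank_step T a \<phi>)
  from fin_rank.fin_rank_step[OF this(4) this(2,3)] show ?case by (simp add: add.assoc)
qed

lemma fin_rank_indicator:
  assumes "fin_rank X \<Phi> T" "\<And>\<phi>. \<phi> \<in> \<Phi> \<Longrightarrow> (\<lambda>x. indicator W x * \<phi> x) \<in> \<Phi>"
  shows "fin_rank X \<Phi> (\<lambda>u x. indicator W x * T u x)"
  using assms(1)
proof (induction rule: fin_rank.induct)
  case fin_rank_zero
  then show ?case by (simp add: fin_rank.fin_rank_zero)
next
  case (fin_rank_step T a \<phi>)
  from fin_rank.fin_rank_step[OF this(4) this(2) assms(2)[OF this(3)]]
  show ?case by (simp add: distrib_left mult_ac)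
qed

lemma fin_rank_sum:
  assumes "finite I" "\<And>i. i \<in> I \<Longrightarrow> a i \<in> L2 X" "\<And>i. i \<in> I \<Longrightarrow> \<phi> i \<in> \<Phi>"
  shows "fin_rank X \<Phi> (\<lambda>u x. \<Sum>i\<in>I. l2_inner X (a i) u * \<phi> i x)"
  using assms
proof (induction rule: finite_induct)
  case empty
  then show ?case by (simp add: fin_rank_zero)
next
  case (insert i I)
  then have "fin_rank X \<Phi> (\<lambda>u x. (\<Sum>i\<in>I. l2_inner X (a i) u * \<phi> i x) + l2_inner X (a i) u * \<phi> i x)"
    by (intro fin_rank_step) auto
  then show ?case using insert by (simp add: add.commute)
qed

lemma fin_rank_L2:
  assumes "fin_rank X \<Phi> T" "\<Phi> \<subseteq> L2 X" shows "T u \<in> L2 X"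
  using assms(1) by (induction rule: fin_rank.induct) (use assms(2) in \<open>auto intro!: L2_add L2_scale\<close>)

definition bounded_L2 :: "'a::euclidean_space set \<Rightarrow> ('a \<Rightarrow> real) set" where
  "bounded_L2 X = {\<phi> \<in> L2 X. \<exists>C. \<forall>x. \<bar>\<phi> x\<bar> \<le> C}"

lemma bounded_L2_subset: "bounded_L2 X \<subseteq> L2 X"
  by (auto simp: bounded_L2_def)

text \<open>Cauchy-Schwarz bounds the coefficients and the range functions are bounded at every
  point. The image of an L^2 ball is thus uniformly bounded, which later gives both the range on
  which an activation is linearised and the range of the pointwise network.\<close>

lemma fin_rank_sup_bound:
  assumes "fin_rank X (bounded_L2 X) T"
  shows "\<exists>C\<ge>0. \<forall>u\<in>L2 X. \<forall>x. \<bar>T u x\<bar> \<le> C * l2_norm X u"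
  using assms
proof (induction rule: fin_rank.induct)
  case fin_rank_zero
  show ?case by (rule exI[of _ 0]) auto
next
  case (fin_rank_step T a \<phi>)
  then obtain C where C: "C \<ge> 0" "\<forall>u\<in>L2 X. \<forall>x. \<bar>T u x\<bar> \<le> C * l2_norm X u" by blast
  obtain C' where C': "\<And>x. \<bar>\<phi> x\<bar> \<le> C'" using fin_rank_step by (auto simp: bounded_L2_def)
  have C'0: "C' \<ge> 0" using C'[of undefined] by linarith
  have "\<bar>T u x + l2_inner X a u * \<phi> x\<bar> \<le> (C + l2_norm X a * C') * l2_norm X u" if "u \<in> L2 X" for u x
  proof -
    have "\<bar>l2_inner X a u * \<phi> x\<bar> \<le> (l2_norm X a * l2_norm X u) * C'"
      unfolding abs_mult using C'[of x] C'0 l2_cauchy_schwarz[OF fin_rank_step(2) that] by (intro mult_mono) auto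
    moreover have "\<bar>T u x\<bar> \<le> C * l2_norm X u" using C(2) that by blast
    moreover have "(C + l2_norm X a * C') * l2_norm X u = C * l2_norm X u + l2_norm X a * l2_norm X u * C'"
      by (simp add: algebra_simps)
    ultimately show ?thesis by linarith
  qed
  then show ?case using C(1) C'0 by (intro exI[of _ "C + l2_norm X a * C'"]) auto
qed

section \<open>Integrals over subdomains\<close>

lemma L2_subset:
  assumes "u \<in> L2 X" "Y \<subseteq> X" "X \<in> sets lebesgue" "Y \<in> sets lebesgue"
  shows "u \<in> L2 Y"
proof -
  have "integrable lebesgue (\<lambda>x. indicator X x *\<^sub>R (u x)\<^sup>2)"
    using L2_integrable_sq[OF assms(1)] assms(3) by (simp add: integrable_restrict_space)
  then have "integrable lebesgue (\<lambda>x. indicator Y x *\<^sub>R (indicator X x *\<^sub>R (u x)\<^sup>2))"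
    by (rule integrable_mult_indicator[OF assms(4)])
  also have "(\<lambda>x. indicator Y x *\<^sub>R (indicator X x *\<^sub>R (u x)\<^sup>2)) = (\<lambda>x. indicator Y x *\<^sub>R (u x)\<^sup>2)"
    by (rule ext) (use assms(2) in \<open>auto simp: indicator_def\<close>)
  finally have "integrable (lebesgue_on Y) (\<lambda>x. (u x)\<^sup>2)"
    using assms(4) by (simp add: integrable_restrict_space)
  moreover have "u \<in> borel_measurable (lebesgue_on Y)"
    using L2_measurable[OF assms(1)] assms(2) by (rule measurable_restrict_mono)
  ultimately show ?thesis by (simp add: L2_def)
qed

lemma ennreal_l2_norm_sq:
  "u \<in> L2 X \<Longrightarrow> ennreal ((l2_norm X u)\<^sup>2) = (\<integral>\<^sup>+x. ennreal ((u x)\<^sup>2) \<partial>lebesgue_on X)"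
  unfolding l2_norm_sq_integral
  by (rule nn_integral_eq_integral[symmetric]) (auto dest: L2_integrable_sq)

lemma nn_integral_lebesgue_on:
  assumes "X \<in> sets lebesgue"
  shows "(\<integral>\<^sup>+x. f x \<partial>lebesgue_on X) = (\<integral>\<^sup>+x. f x * indicator X x \<partial>lborel)"
  using assms by (simp add: nn_integral_restrict_space nn_integral_completion)

lemma borel_imp_lebesgue_on:
  "u \<in> borel_measurable borel \<Longrightarrow> (u :: 'a::euclidean_space \<Rightarrow> real) \<in> borel_measurable (lebesgue_on X)"
  by (intro measurable_restrict_space1 measurable_completion) simp

lemma AE_lebesgue_on_iff:
  "X \<in> sets lebesgue \<Longrightarrow> (AE x in lebesgue_on X. P x) \<longleftrightarrow> (AE x in lebesgue. x \<in> X \<longrightarrow> P x)"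
  by (simp add: AE_restrict_space_iff)

text \<open>The estimates below use Fubini and translations on \<open>lborel\<close>, where Borel
  measurability is required; a Lebesgue measurable function has a Borel version that vanishes off
  X.\<close>

lemma borel_representative:
  fixes u :: "'a::euclidean_space \<Rightarrow> real"
  assumes X: "X \<in> sets borel" and u: "u \<in> borel_measurable (lebesgue_on X)"
  obtains u' where "u' \<in> borel_measurable borel" "\<And>x. x \<notin> X \<Longrightarrow> u' x = 0" "ae_eq X u u'"
proof -
  have XL: "X \<in> sets lebesgue" using X by simp
  have "(\<lambda>x. if x \<in> X then u x else 0) \<in> borel_measurable lebesgue"
    using u XL by (simp add: borel_measurable_if)
  then obtain g where g: "g \<in> borel_measurable lborel" "AE x in lborel. (if x \<in> X then u x else 0) = g x"
    using completion_ex_borel_measurable_real by blast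
  define u' where "u' x = (if x \<in> X then g x else 0)" for x
  have "u' \<in> borel_measurable borel"
    unfolding u'_def using g(1) X by measurable
  moreover have "AE x in lebesgue. (if x \<in> X then u x else 0) = g x"
    using g(2) by (rule AE_completion)
  then have "ae_eq X u u'"
    unfolding ae_eq_def AE_lebesgue_on_iff[OF XL] by eventually_elim (auto simp: u'_def)
  ultimately show thesis by (intro that[of u']) (auto simp: u'_def)
qed

section \<open>Averaging over displaced balls\<close>

text \<open>The squared increments of u are averaged over a ball displaced from x by h e, not
  centred at x, so that near the boundary the ball can be kept inside the domain. Indicators over
  \<open>lborel\<close> prepare the exchange of integrals.\<close>

definition modulus_integral ::
  "'a::euclidean_space set \<Rightarrow> 'a \<Rightarrow> real \<Rightarrow> real \<Rightarrow> ('a \<Rightarrow> real) \<Rightarrow> ennreal" where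
  "modulus_integral V e c h u =
     (\<integral>\<^sup>+x. (\<integral>\<^sup>+y. ennreal ((u x - u y)\<^sup>2) * indicator (ball (x + h *\<^sub>R e) (c * h)) y \<partial>lborel) * indicator V x \<partial>lborel)"

text \<open>The deviation t - mean(u) is the mean of t - u, so Cauchy-Schwarz against the constant
  function 1 gives the bound.\<close>

lemma average_deviation:
  fixes u :: "'a::euclidean_space \<Rightarrow> real"
  assumes u: "u \<in> L2 B" and B: "B \<in> lmeasurable" "measure lebesgue B = b" "b > 0"
  shows "ennreal ((t - (\<integral>y. u y \<partial>lebesgue_on B) / b)\<^sup>2)
    \<le> (\<integral>\<^sup>+y. ennreal ((t - u y)\<^sup>2) \<partial>lebesgue_on B) / ennreal b"
proof -
  define v where "v y = t - u y" for y
  have v: "v \<in> L2 B" unfolding v_def using B(1) u by (intro L2_diff) auto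
  have one: "(\<lambda>y. 1) \<in> L2 B" using B(1) by simp
  have norm1: "(l2_norm B (\<lambda>y. 1))\<^sup>2 = b"
    using B by (simp add: l2_norm_const)
  have "integrable (lebesgue_on B) u"
    using L2_mult_integrable[OF u one] by simp
  then have "l2_inner B v (\<lambda>y. 1) = b * t - (\<integral>y. u y \<partial>lebesgue_on B)"
    using L2_mult_integrable[OF L2_const[OF B(1), of t] one] B
    unfolding l2_inner_def v_def by (simp add: measure_restrict_space fmeasurableD)
  then have "b * (t - (\<integral>y. u y \<partial>lebesgue_on B) / b) = l2_inner B v (\<lambda>y. 1)"
    using B(3) by (simp add: right_diff_distrib)
  then have "(b * (t - (\<integral>y. u y \<partial>lebesgue_on B) / b))\<^sup>2 \<le> (l2_norm B v * l2_norm B (\<lambda>y. 1))\<^sup>2"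
    using power_mono[OF l2_cauchy_schwarz[OF v one], of 2] by simp
  then have "b * (b * (t - (\<integral>y. u y \<partial>lebesgue_on B) / b)\<^sup>2) \<le> b * (l2_norm B v)\<^sup>2"
    by (simp add: power_mult_distrib norm1 power2_eq_square[of b] mult_ac)
  then have "(t - (\<integral>y. u y \<partial>lebesgue_on B) / b)\<^sup>2 \<le> (l2_norm B v)\<^sup>2 / b"
    using B(3) by (simp add: field_simps)
  then have "ennreal ((t - (\<integral>y. u y \<partial>lebesgue_on B) / b)\<^sup>2) \<le> ennreal ((l2_norm B v)\<^sup>2 / b)"
    by (rule ennreal_leI)
  also have "\<dots> = ennreal ((l2_norm B v)\<^sup>2) / ennreal b"
    using B(3) by (simp add: divide_ennreal)
  also have "ennreal ((l2_norm B v)\<^sup>2) = (\<integral>\<^sup>+y. ennreal ((t - u y)\<^sup>2) \<partial>lebesgue_on B)"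
    unfolding ennreal_l2_norm_sq[OF v] by (simp add: v_def)
  finally show ?thesis .
qed

text \<open>The centres lie in V itself, although compactness is that of the closure, because the
  cone condition will be used at the centres. Removing the earlier balls makes the cells
  disjoint.\<close>

lemma finite_ball_cells:
  fixes V :: "'a::euclidean_space set"
  assumes "bounded V" "d > 0" "V \<in> sets borel"
  shows "\<exists>(n :: nat) x C. (\<forall>i<n. x i \<in> V \<and> C i \<in> sets borel \<and> C i \<subseteq> V \<inter> ball (x i) d) \<and>
    (\<forall>y\<in>V. \<exists>i<n. y \<in> C i) \<and> (\<forall>i j. i < j \<longrightarrow> C i \<inter> C j = {})"
proof -
  have "compact (closure V)" using assms(1) by simp
  moreover have "closure V \<subseteq> (\<Union>x\<in>V. ball x d)"
  proof
    fix y assume "y \<in> closure V"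
    then obtain x where "x \<in> V" "dist x y < d" using assms(2) by (meson closure_approachable)
    then show "y \<in> (\<Union>x\<in>V. ball x d)" by auto
  qed
  ultimately obtain D where D: "D \<subseteq> V" "finite D" "closure V \<subseteq> (\<Union>x\<in>D. ball x d)"
    by (elim compactE_image[where C = V and f = "\<lambda>x. ball x d"]) auto
  obtain x where x: "bij_betw x {..<card D} D"
    using ex_bij_betw_nat_finite[OF D(2)] by (metis atLeast0LessThan)
  define C where "C i = V \<inter> ball (x i) d - (\<Union>j<i. ball (x j) d)" for i
  have "x i \<in> V" if "i < card D" for i
      using x D(1) that by (auto simp: bij_betw_def)
  moreover have "C i \<in> sets borel" for i
      unfolding C_def using assms(3) by auto
  moreover have "C i \<subseteq> V \<inter> ball (x i) d" for i by (auto simp: C_def)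
  moreover have "C i \<inter> C j = {}" if "i < j" for i j using that by (auto simp: C_def)
  moreover have "\<exists>i<card D. y \<in> C i" if "y \<in> V" for y
    proof -
      have "y \<in> closure V" using that closure_subset by blast
      then obtain z where "z \<in> D" "y \<in> ball z d" using D(3) by blast
      then have ex: "\<exists>i. i < card D \<and> y \<in> ball (x i) d" using x by (metis bij_betw_iff_bijections lessThan_iff)
      define i where "i = (LEAST i. i < card D \<and> y \<in> ball (x i) d)"
      have "i < card D" "y \<in> ball (x i) d" using LeastI_ex[OF ex] by (auto simp: i_def)
      moreover have "y \<notin> ball (x j) d" if "j < i" for j
        using not_less_Least[of j "\<lambda>i. i < card D \<and> y \<in> ball (x i) d"] that \<open>i < card D\<close>
        by (auto simp: i_def)
      ultimately show ?thesis using that by (auto simp: C_def)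
    qed
  ultimately show ?thesis by (intro exI[of _ "card D"] exI[of _ x] exI[of _ C]) auto
qed

text \<open>On each cell \<open>T u\<close> is constant, namely the mean of u over the ball of
  radius c h / 2 displaced by h e from the centre of the cell. A point y of the cell is within c h /
  2 of that centre, so the averaging ball is contained in the ball of radius c h around y + h e that
  occurs in the modulus.\<close>

lemma patch_average:
  fixes X V :: "'a::euclidean_space set"
  assumes X: "X \<in> lmeasurable" and V: "V \<in> sets borel" "V \<subseteq> X" "bounded V" and h: "h > 0" and c: "c > 0"
    and cone: "\<And>x. x \<in> V \<Longrightarrow> ball (x + h *\<^sub>R e) (c * h) \<subseteq> X"
  shows "\<exists>T. fin_rank X (bounded_L2 X) T \<and> (\<forall>u\<in>L2 X. u \<in> borel_measurable borel \<longrightarrow>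
      ennreal ((l2_norm V (\<lambda>x. u x - T u x))\<^sup>2)
        \<le> modulus_integral V e c h u / ennreal (unit_ball_vol (real DIM('a)) * (c * h / 2) ^ DIM('a)))"
proof -
  have XL: "X \<in> sets lebesgue" and VL: "V \<in> sets lebesgue" using X V by (auto dest: fmeasurableD)
  define b where "b = unit_ball_vol (real DIM('a)) * (c * h / 2) ^ DIM('a)"
  have b: "b > 0" unfolding b_def using c h by (intro mult_pos_pos) auto
  have d: "c * h / 2 > 0" using c h by simp
  obtain n :: nat and x C where
    "\<forall>i<n. x i \<in> V \<and> C i \<in> sets borel \<and> C i \<subseteq> V \<inter> ball (x i) (c * h / 2)"
    "\<forall>y\<in>V. \<exists>i<n. y \<in> C i" "\<forall>i j. i < j \<longrightarrow> C i \<inter> C j = {}"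
    using finite_ball_cells[OF V(3) d V(1)] by (elim exE conjE) metis
  then have xC: "\<And>i. i < n \<Longrightarrow> x i \<in> V" "\<And>i. i < n \<Longrightarrow> C i \<in> sets borel"
    "\<And>i. i < n \<Longrightarrow> C i \<subseteq> V \<inter> ball (x i) (c * h / 2)" "\<And>y. y \<in> V \<Longrightarrow> \<exists>i<n. y \<in> C i"
    "\<And>i j. i < j \<Longrightarrow> C i \<inter> C j = {}" by simp_all
  define B where "B i = ball (x i + h *\<^sub>R e) (c * h / 2)" for i
  have BX: "B i \<subseteq> X" if "i < n" for i
    unfolding B_def using c h by (intro order_trans[OF subset_ball cone[OF xC(1)[OF that]]]) simp
  have Bm: "B i \<in> lmeasurable" "measure lebesgue (B i) = b" for i
    using c h by (auto simp: B_def b_def content_ball)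
  have Bsets: "B i \<in> sets lebesgue" for i by (simp add: B_def)
  define a where "a i = (\<lambda>y. indicator (B i) y / b)" for i
  have "(\<lambda>y. indicator (B i) y :: real) \<in> borel_measurable (lebesgue_on X)" for i
    by (intro borel_imp_lebesgue_on borel_measurable_indicator) (simp add: B_def)
  then have aL: "a i \<in> L2 X" for i
    unfolding a_def by (intro L2_divide L2_bounded[OF X, of _ 1]) (auto simp: indicator_def)
  define \<phi> where "\<phi> i = (\<lambda>y. indicator (C i) y :: real)" for i
  have "\<phi> i \<in> borel_measurable (lebesgue_on X)" if "i < n" for i
    unfolding \<phi>_def using xC(2)[OF that] by (intro borel_imp_lebesgue_on) simp
  then have \<phi>: "\<phi> i \<in> bounded_L2 X" if "i < n" for i
    using that unfolding bounded_L2_def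
    by (auto intro!: L2_bounded[OF X, of _ 1] exI[of _ 1] simp: \<phi>_def indicator_def)
  define T where "T u x = (\<Sum>i<n. l2_inner X (a i) u * \<phi> i x)" for u x
  have T: "fin_rank X (bounded_L2 X) T"
    unfolding T_def using aL \<phi> by (intro fin_rank_sum) auto
  show ?thesis
  proof (intro exI[of _ T] conjI T ballI impI)
    fix u assume u: "u \<in> L2 X" "u \<in> borel_measurable borel"
    have TuL: "T u \<in> L2 X" using fin_rank_L2[OF T bounded_L2_subset] .
    have pw: "ennreal ((u y - T u y)\<^sup>2) \<le>
       (\<integral>\<^sup>+z. ennreal ((u y - u z)\<^sup>2) * indicator (ball (y + h *\<^sub>R e) (c * h)) z \<partial>lborel) / ennreal b"
      if "y \<in> V" for y
    proof -
      obtain i where i: "i < n" "y \<in> C i" using xC(4)[OF \<open>y \<in> V\<close>] by blast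
      have other: "y \<notin> C j" if "j \<noteq> i" for j
        using xC(5)[of i j] xC(5)[of j i] i(2) that by (cases "i < j") auto
      have "T u y = (\<Sum>j\<in>{..<n}. if j = i then l2_inner X (a i) u else 0)"
        unfolding T_def using other i by (intro sum.cong) (auto simp: \<phi>_def)
      then have "T u y = l2_inner X (a i) u" using i(1) by simp
      also have "\<dots> = (\<integral>z. indicator (B i) z *\<^sub>R u z \<partial>lebesgue_on X) / b"
        unfolding l2_inner_def a_def by (simp flip: integral_divide_zero)
      also have "(\<integral>z. indicator (B i) z *\<^sub>R u z \<partial>lebesgue_on X) = (\<integral>z. u z \<partial>lebesgue_on (B i))"
      proof -
        have "(\<integral>z. indicator (B i) z *\<^sub>R u z \<partial>lebesgue_on X) = (\<integral>z. indicator X z *\<^sub>R (indicator (B i) z *\<^sub>R u z) \<partial>lebesgue)"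
          using XL by (simp add: integral_restrict_space)
        also have "(\<lambda>z. indicator X z *\<^sub>R (indicator (B i) z *\<^sub>R u z)) = (\<lambda>z. indicator (B i) z *\<^sub>R u z)"
          by (rule ext) (use BX[OF i(1)] in \<open>auto simp: indicator_def\<close>)
        also have "(\<integral>z. indicator (B i) z *\<^sub>R u z \<partial>lebesgue) = (\<integral>z. u z \<partial>lebesgue_on (B i))"
          using Bsets by (simp add: integral_restrict_space)
        finally show ?thesis .
      qed
      finally have Tu: "T u y = (\<integral>z. u z \<partial>lebesgue_on (B i)) / b" .
      have "ennreal ((u y - T u y)\<^sup>2) \<le> (\<integral>\<^sup>+z. ennreal ((u y - u z)\<^sup>2) \<partial>lebesgue_on (B i)) / ennreal b"
        unfolding Tu by (rule average_deviation[OF L2_subset[OF u(1) BX[OF i(1)] XL Bsets] Bm b])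
      also have "\<dots> \<le> (\<integral>\<^sup>+z. ennreal ((u y - u z)\<^sup>2) * indicator (ball (y + h *\<^sub>R e) (c * h)) z \<partial>lborel) / ennreal b"
      proof (rule divide_right_mono_ennreal)
        have "B i \<subseteq> ball (y + h *\<^sub>R e) (c * h)"
        proof
          fix z assume "z \<in> B i"
          then have "dist (x i + h *\<^sub>R e) z < c * h / 2" by (simp add: B_def)
          moreover have "dist (x i) y < c * h / 2" using xC(3)[OF i(1)] i(2) by auto
          ultimately show "z \<in> ball (y + h *\<^sub>R e) (c * h)"
            using dist_triangle[of "y + h *\<^sub>R e" z "x i + h *\<^sub>R e"] by (simp add: dist_commute)
        qed
        then show "(\<integral>\<^sup>+z. ennreal ((u y - u z)\<^sup>2) \<partial>lebesgue_on (B i)) \<le>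
            (\<integral>\<^sup>+z. ennreal ((u y - u z)\<^sup>2) * indicator (ball (y + h *\<^sub>R e) (c * h)) z \<partial>lborel)"
          unfolding nn_integral_lebesgue_on[OF Bsets]
          by (intro nn_integral_mono mult_left_mono) (auto simp: indicator_def)
      qed
      finally show ?thesis .
    qed
    have "(\<lambda>x. u x - T u x) \<in> L2 V" using L2_subset[OF L2_diff[OF u(1) TuL] V(2) XL VL] .
    then have "ennreal ((l2_norm V (\<lambda>x. u x - T u x))\<^sup>2) = (\<integral>\<^sup>+y. ennreal ((u y - T u y)\<^sup>2) * indicator V y \<partial>lborel)"
      by (simp add: ennreal_l2_norm_sq nn_integral_lebesgue_on[OF VL])
    also have "\<dots> \<le> (\<integral>\<^sup>+y. ((\<integral>\<^sup>+z. ennreal ((u y - u z)\<^sup>2) * indicator (ball (y + h *\<^sub>R e) (c * h)) z \<partial>lborel) * indicator V y) / ennreal b \<partial>lborel)"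
      using pw by (intro nn_integral_mono) (auto simp: indicator_def)
    also have "\<dots> = modulus_integral V e c h u / ennreal b"
      unfolding modulus_integral_def using u(2) V(1)
      by (intro nn_integral_divide) (measurable; simp add: ball_def)
    finally show "ennreal ((l2_norm V (\<lambda>x. u x - T u x))\<^sup>2) \<le> modulus_integral V e c h u / ennreal (unit_ball_vol (real DIM('a)) * (c * h / 2) ^ DIM('a))"
      by (simp add: b_def)
  qed
qed

section \<open>The cone property of Lipschitz domains\<close>

lemma lipschitz_domain_cone:
  fixes X :: "'a::euclidean_space set"
  assumes X: "bounded_lipschitz_domain X" and p: "p \<in> closure X"
  shows "\<exists>r e c h0. r > 0 \<and> norm e \<le> 1 \<and> 0 < c \<and> c \<le> 1 \<and> h0 > 0 \<and>
    (\<forall>x\<in>X \<inter> ball p r. \<forall>h. 0 < h \<and> h < h0 \<longrightarrow> ball (x + h *\<^sub>R e) (c * h) \<subseteq> X)"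
proof (cases "p \<in> X")
  case True
  have "open X" using X by (simp add: bounded_lipschitz_domain_def)
  then obtain r where r: "r > 0" "ball p r \<subseteq> X" using True by (meson open_contains_ball)
  have "ball (x + h *\<^sub>R 0) (1 * h) \<subseteq> X" if "x \<in> X \<inter> ball p (r/2)" "0 < h" "h < r/2" for x h
  proof
    fix y assume "y \<in> ball (x + h *\<^sub>R 0) (1 * h)"
    then have "dist p y < r" using that dist_triangle[of p y x] by (simp add: dist_commute)
    then show "y \<in> X" using r(2) by auto
  qed
  then show ?thesis
    using r(1) by (intro exI[of _ "r/2"] exI[of _ 0] exI[of _ 1]) auto
next
  case False
  have "open X" using X by (simp add: bounded_lipschitz_domain_def)
  then have "p \<in> frontier X" using p False by (simp add: frontier_def interior_open)
  then obtain e r g C where erg: "norm e = 1" "r > 0" "C-lipschitz_on UNIV (g :: 'a \<Rightarrow> real)"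
    "X \<inter> ball p r = {x \<in> ball p r. x \<bullet> e > g (x - (x \<bullet> e) *\<^sub>R e)}"
    using X unfolding bounded_lipschitz_domain_def by blast
  have C: "C \<ge> 0" using lipschitz_on_nonneg[OF erg(3)] .
  \<comment> \<open>A deviation v lowers the height by at most |v| and moves the base point by at
    most 2 |v|, where the graph rises at most 2 C |v|. The total (1 + 2 C) |v| stays below the gain
    h exactly when |v| < c h.\<close>
  define c where "c = 1 / (1 + 2 * C)"
  have c: "0 < c" "c \<le> 1" "c * (1 + 2 * C) = 1" using C by (auto simp: c_def)
  have "ball (x + h *\<^sub>R e) (c * h) \<subseteq> X" if x: "x \<in> X \<inter> ball p (r/2)" and h: "0 < h" "h < r/4" for x h
  proof
    fix y assume y: "y \<in> ball (x + h *\<^sub>R e) (c * h)"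
    define v where "v = y - x - h *\<^sub>R e"
    have yv: "y = x + h *\<^sub>R e + v" by (simp add: v_def)
    have v: "norm v < c * h" using y by (simp add: v_def dist_norm norm_minus_commute algebra_simps)
    have ve: "\<bar>v \<bullet> e\<bar> \<le> norm v" using Cauchy_Schwarz_ineq2[of v e] erg(1) by simp
    have ee: "e \<bullet> e = 1" using erg(1) by (simp add: norm_eq_1)
    have "c * h \<le> h" using c h by (simp add: mult_left_le_one_le)
    have "dist p y \<le> dist p x + norm (h *\<^sub>R e + v)"
    proof -
      have "dist x (x + (h *\<^sub>R e + v)) = norm (h *\<^sub>R e + v)"
        by (metis add_diff_cancel_left' dist_commute dist_norm)
      then show ?thesis unfolding yv using dist_triangle[of p "x + (h *\<^sub>R e + v)" x] by (simp add: add.assoc)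
    qed
    also have "\<dots> \<le> dist p x + (h + norm v)" using norm_triangle_ineq[of "h *\<^sub>R e" v] h erg(1) by simp
    also have "\<dots> < r"
    proof -
      have "dist p x < r / 2" using x by simp
      then show ?thesis using h v \<open>c * h \<le> h\<close> by linarith
    qed
    finally have yp: "y \<in> ball p r" by simp
    have xp: "x \<in> ball p r" using x erg(2) by auto
    have gx: "x \<bullet> e > g (x - (x \<bullet> e) *\<^sub>R e)" using x xp erg(4) by blast
    have ye: "y \<bullet> e = x \<bullet> e + h + v \<bullet> e" by (simp add: yv inner_add_left ee)
    have "y - (y \<bullet> e) *\<^sub>R e = (x - (x \<bullet> e) *\<^sub>R e) + (v - (v \<bullet> e) *\<^sub>R e)"
      unfolding ye unfolding yv by (simp add: algebra_simps)
    then have "dist (y - (y \<bullet> e) *\<^sub>R e) (x - (x \<bullet> e) *\<^sub>R e) = norm (v - (v \<bullet> e) *\<^sub>R e)"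
      by (simp add: dist_norm)
    also have "\<dots> \<le> norm v + \<bar>v \<bullet> e\<bar>" using norm_triangle_ineq4[of v "(v \<bullet> e) *\<^sub>R e"] erg(1) by simp
    also have "\<dots> \<le> 2 * norm v" using ve by simp
    finally have d: "dist (y - (y \<bullet> e) *\<^sub>R e) (x - (x \<bullet> e) *\<^sub>R e) \<le> 2 * norm v" .
    have "g (y - (y \<bullet> e) *\<^sub>R e) \<le> g (x - (x \<bullet> e) *\<^sub>R e) + C * (2 * norm v)"
      using lipschitz_onD[OF erg(3), of "y - (y \<bullet> e) *\<^sub>R e" "x - (x \<bullet> e) *\<^sub>R e"] mult_left_mono[OF d C]
      by (simp add: dist_real_def)
    also have "\<dots> < x \<bullet> e + C * (2 * norm v)" using gx by simp
    also have "\<dots> \<le> x \<bullet> e + h + v \<bullet> e"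
    proof -
      have "(1 + 2 * C) * norm v \<le> (1 + 2 * C) * (c * h)" using v C by (intro mult_left_mono) auto
      also have "\<dots> = h" using c(3) by (metis mult.assoc mult.commute mult_1)
      finally have "norm v + 2 * C * norm v \<le> h" by (simp add: distrib_right)
      then show ?thesis using ve by linarith
    qed
    finally have "y \<bullet> e > g (y - (y \<bullet> e) *\<^sub>R e)" by (simp add: ye)
    then show "y \<in> X" using yp erg(4) by blast
  qed
  then show ?thesis
    using erg(1,2) c by (intro exI[of _ "r/2"] exI[of _ e] exI[of _ c] exI[of _ "r/4"]) auto
qed

section \<open>Moduli of continuity in \<open>H\<^sup>s\<close>\<close>

lemma gagliardo_cong:
  assumes "ae_eq X u u'" shows "gagliardo X s u = gagliardo X s u'"
  unfolding gagliardo_def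
proof (rule nn_integral_cong_AE)
  have ae: "AE x in lebesgue_on X. u x = u' x" using assms by (simp add: ae_eq_def)
  then show "AE x in lebesgue_on X. (\<integral>\<^sup>+y. ennreal ((u x - u y)\<^sup>2 / dist x y powr (real DIM('a) + 2 * s)) \<partial>lebesgue_on X)
     = (\<integral>\<^sup>+y. ennreal ((u' x - u' y)\<^sup>2 / dist x y powr (real DIM('a) + 2 * s)) \<partial>lebesgue_on X)"
  proof eventually_elim
    case (elim x)
    show ?case
      by (rule nn_integral_cong_AE) (use ae in eventually_elim, simp add: elim)
  qed
qed

lemma weak_gradient_cong:
  assumes u: "u \<in> borel_measurable (lebesgue_on X)" "u' \<in> borel_measurable (lebesgue_on X)"
    and ae: "ae_eq X u u'" and g: "weak_gradient X u g"
  shows "weak_gradient X u' g"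
  unfolding weak_gradient_def
proof (intro ballI conjI allI impI)
  fix b :: 'a and \<phi> assume b: "b \<in> Basis"
  then show "(\<lambda>x. g x \<bullet> b) \<in> L2 X" using g by (simp add: weak_gradient_def)
  assume \<phi>: "test_function X \<phi>"
  then have "(\<lambda>x. frechet_derivative \<phi> (at x) b) \<in> borel_measurable (lebesgue_on X)"
    using b by (intro continuous_imp_lebesgue_on_measurable smooth_continuous_derivative) (auto simp: test_function_def)
  then have "l2_inner X u' (\<lambda>x. frechet_derivative \<phi> (at x) b) = l2_inner X u (\<lambda>x. frechet_derivative \<phi> (at x) b)"
    using u ae by (intro l2_inner_cong) (auto intro: ae_eq_sym)
  then show "l2_inner X u' (\<lambda>x. frechet_derivative \<phi> (at x) b) = - l2_inner X (\<lambda>x. g x \<bullet> b) \<phi>"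
    using g b \<phi> by (simp add: weak_gradient_def)
qed

text \<open>All points of the displaced ball are within 2 h of x, so there the singular weight of
  the Gagliardo integral is at least (2 h) to the power -(d + 2 s).\<close>

lemma modulus_fractional:
  fixes X V :: "'a::euclidean_space set"
  assumes X: "X \<in> sets borel" and V: "V \<subseteq> X" and u: "u \<in> borel_measurable borel"
    and s: "s > 0" and h: "h > 0" and e: "norm e \<le> 1" and c: "c \<le> 1"
    and cone: "\<And>x. x \<in> V \<Longrightarrow> ball (x + h *\<^sub>R e) (c * h) \<subseteq> X"
  shows "modulus_integral V e c h u \<le> ennreal ((2 * h) powr (real DIM('a) + 2 * s)) * gagliardo X s u"
proof -
  define p where "p = real DIM('a) + 2 * s"
  have p: "p > 0" using s by (simp add: p_def add_pos_pos)
  define k where "k x y = ennreal ((u x - u y)\<^sup>2 / dist x y powr p) * indicator X y" for x y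
  have XL: "X \<in> sets lebesgue" using X by simp
  have pw: "ennreal ((u x - u y)\<^sup>2) * indicator (ball (x + h *\<^sub>R e) (c * h)) y \<le> ennreal ((2 * h) powr p) * k x y"
    if "x \<in> V" for x y
  proof (cases "y \<in> ball (x + h *\<^sub>R e) (c * h)")
    case True
    have "dist x y \<le> dist x (x + h *\<^sub>R e) + dist (x + h *\<^sub>R e) y" by (rule dist_triangle)
    also have "\<dots> \<le> h + h"
    proof (rule add_mono)
      show "dist x (x + h *\<^sub>R e) \<le> h" using h e by (simp add: dist_norm mult_left_le)
      have "c * h \<le> h" using c h by simp
      then show "dist (x + h *\<^sub>R e) y \<le> h" using True by simp
    qed
    finally have d: "dist x y \<le> 2 * h" by simp
    have "(u x - u y)\<^sup>2 \<le> (2 * h) powr p * ((u x - u y)\<^sup>2 / dist x y powr p)"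
    proof (cases "x = y")
      case False
      then have "dist x y powr p > 0" by simp
      moreover have "dist x y powr p \<le> (2 * h) powr p"
        using d p by (intro powr_mono2) auto
      ultimately show ?thesis
        using mult_right_mono[of "dist x y powr p" "(2 * h) powr p" "(u x - u y)\<^sup>2"] by (simp add: field_simps)
    qed simp
    then have "ennreal ((u x - u y)\<^sup>2) \<le> ennreal ((2 * h) powr p) * ennreal ((u x - u y)\<^sup>2 / dist x y powr p)"
      by (simp add: ennreal_mult'[symmetric] ennreal_leI)
    moreover have "y \<in> X" using True cone[OF that] by blast
    ultimately show ?thesis using True by (simp add: k_def)
  qed simp
  have meas: "(\<lambda>x. \<integral>\<^sup>+y. k x y \<partial>lborel) \<in> borel_measurable lborel"
    unfolding k_def using u X by measurable
  have "modulus_integral V e c h u \<le> (\<integral>\<^sup>+x. (\<integral>\<^sup>+y. ennreal ((2 * h) powr p) * k x y \<partial>lborel) * indicator X x \<partial>lborel)"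
    unfolding modulus_integral_def
  proof (rule nn_integral_mono)
    fix x
    show "(\<integral>\<^sup>+y. ennreal ((u x - u y)\<^sup>2) * indicator (ball (x + h *\<^sub>R e) (c * h)) y \<partial>lborel) * indicator V x
       \<le> (\<integral>\<^sup>+y. ennreal ((2 * h) powr p) * k x y \<partial>lborel) * indicator X x"
    proof (cases "x \<in> V")
      case True
      then have "x \<in> X" using V by blast
      then show ?thesis using True pw[OF True] by (simp add: nn_integral_mono)
    qed simp
  qed
  also have "\<dots> = (\<integral>\<^sup>+x. ennreal ((2 * h) powr p) * ((\<integral>\<^sup>+y. k x y \<partial>lborel) * indicator X x) \<partial>lborel)"
  proof (rule nn_integral_cong)
    fix x
    have "(\<lambda>y. k x y) \<in> borel_measurable lborel" unfolding k_def using u X by measurable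
    then have "(\<integral>\<^sup>+y. ennreal ((2 * h) powr p) * k x y \<partial>lborel) = ennreal ((2 * h) powr p) * (\<integral>\<^sup>+y. k x y \<partial>lborel)"
      by (rule nn_integral_cmult)
    then show "(\<integral>\<^sup>+y. ennreal ((2 * h) powr p) * k x y \<partial>lborel) * indicator X x
       = ennreal ((2 * h) powr p) * ((\<integral>\<^sup>+y. k x y \<partial>lborel) * indicator X x)" by (simp add: mult.assoc)
  qed
  also have "\<dots> = ennreal ((2 * h) powr p) * (\<integral>\<^sup>+x. (\<integral>\<^sup>+y. k x y \<partial>lborel) * indicator X x \<partial>lborel)"
    using meas X by (intro nn_integral_cmult) auto
  also have "(\<integral>\<^sup>+x. (\<integral>\<^sup>+y. k x y \<partial>lborel) * indicator X x \<partial>lborel) = gagliardo X s u"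
    unfolding gagliardo_def nn_integral_lebesgue_on[OF XL] k_def p_def ..
  finally show ?thesis by (simp add: p_def)
qed

subsection \<open>Translations and weak gradients\<close>

lemma frechet_derivative_shift:
  assumes "smooth f"
  shows "frechet_derivative (\<lambda>x. f (x + c)) (at x) = frechet_derivative f (at (x + c))"
proof -
  have "((\<lambda>x. x + c) has_derivative (\<lambda>h. h)) (at x)"
    by (auto intro!: derivative_eq_intros)
  from has_derivative_compose[OF this smooth_has_derivative[OF assms]]
  show ?thesis by (intro frechet_derivative_at[symmetric])
qed

lemma test_function_shift:
  assumes \<phi>: "test_function V \<phi>" and sub: "\<And>x. x \<in> V \<Longrightarrow> x - c \<in> X"
  shows "test_function X (\<lambda>x. \<phi> (x + c))"
proof -
  have eq: "{x. \<phi> (x + c) \<noteq> 0} = (\<lambda>x. x - c) ` {x. \<phi> x \<noteq> 0}"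
  proof
    show "{x. \<phi> (x + c) \<noteq> 0} \<subseteq> (\<lambda>x. x - c) ` {x. \<phi> x \<noteq> 0}"
    proof
      fix x assume "x \<in> {x. \<phi> (x + c) \<noteq> 0}"
      then show "x \<in> (\<lambda>x. x - c) ` {x. \<phi> x \<noteq> 0}" by (intro image_eqI[of _ _ "x + c"]) auto
    qed
  qed auto
  have cl: "closure {x. \<phi> (x + c) \<noteq> 0} = (\<lambda>x. x - c) ` closure {x. \<phi> x \<noteq> 0}"
    unfolding eq using closure_translation_subtract[of c "{x. \<phi> x \<noteq> 0}"] by simp
  have "compact ((\<lambda>x. x - c) ` closure {x. \<phi> x \<noteq> 0})"
    using \<phi> by (intro compact_continuous_image continuous_intros) (auto simp: test_function_def)
  then show ?thesis
    using \<phi> sub unfolding test_function_def cl by auto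
qed

lemma smooth_directional_derivative:
  fixes \<phi> :: "'a::euclidean_space \<Rightarrow> real"
  assumes "smooth \<phi>"
  shows "((\<lambda>t. \<phi> (y + t *\<^sub>R w)) has_real_derivative
    (\<Sum>b\<in>Basis. (w \<bullet> b) * frechet_derivative \<phi> (at (y + t *\<^sub>R w)) b)) (at t)"
proof -
  have "((\<lambda>t. y + t *\<^sub>R w) has_derivative (\<lambda>h. h *\<^sub>R w)) (at t)"
    by (auto intro!: derivative_eq_intros)
  from has_derivative_compose[OF this smooth_has_derivative[OF assms]]
  have D: "((\<lambda>t. \<phi> (y + t *\<^sub>R w)) has_derivative (\<lambda>h. frechet_derivative \<phi> (at (y + t *\<^sub>R w)) (h *\<^sub>R w))) (at t)" .
  interpret L: linear "frechet_derivative \<phi> (at (y + t *\<^sub>R w))"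
    using smooth_has_derivative[OF assms] by (rule has_derivative_linear)
  have "frechet_derivative \<phi> (at (y + t *\<^sub>R w)) w = (\<Sum>b\<in>Basis. (w \<bullet> b) * frechet_derivative \<phi> (at (y + t *\<^sub>R w)) b)"
    by (subst euclidean_representation[of w, symmetric]) (simp add: L.sum L.scale del: euclidean_representation)
  then show ?thesis
    using D by (simp add: has_field_derivative_def L.scale mult.commute[of _ "sum _ _"])
qed

lemma test_function_derivative_bounded:
  assumes \<phi>: "test_function V \<phi>" and b: "b \<in> Basis"
  shows "\<exists>C. \<forall>x. \<bar>frechet_derivative \<phi> (at x) b\<bar> \<le> C"
proof -
  have smooth: "smooth \<phi>" and cpt: "compact (closure {x. \<phi> x \<noteq> 0})" using \<phi> by (auto simp: test_function_def)
  obtain C where C: "\<forall>x\<in>closure {x. \<phi> x \<noteq> 0}. \<bar>frechet_derivative \<phi> (at x) b\<bar> \<le> C"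
    using compact_continuous_abs_bound[OF cpt continuous_on_subset[OF smooth_continuous_derivative[OF smooth b] subset_UNIV]] by blast
  have "frechet_derivative \<phi> (at x) b = 0" if "x \<notin> closure {x. \<phi> x \<noteq> 0}" for x
  proof -
    have "x \<in> - closure {x. \<phi> x \<noteq> 0}" "open (- closure {x. \<phi> x \<noteq> 0})" using that by auto
    moreover have "0 = \<phi> y" if "y \<in> - closure {x. \<phi> x \<noteq> 0}" for y
    proof (rule ccontr)
      assume "0 \<noteq> \<phi> y"
      then have "y \<in> closure {x. \<phi> x \<noteq> 0}" by (intro subsetD[OF closure_subset]) simp
      then show False using that by simp
    qed
    ultimately have "(\<phi> has_derivative (\<lambda>h. 0)) (at x)"
      by (intro has_derivative_transform_within_open[OF has_derivative_const[of 0]])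
    then show ?thesis using frechet_derivative_at by metis
  qed
  then have "\<bar>frechet_derivative \<phi> (at x) b\<bar> \<le> max C 0" for x
    using C by (cases "x \<in> closure {x. \<phi> x \<noteq> 0}") (fastforce simp: le_max_iff_disj)+
  then show ?thesis by blast
qed

text \<open>Along w the test function is Lipschitz with constant M, so the difference quotients are
  dominated by M |u|. The derivative is taken along sequences because dominated convergence is a
  sequential statement.\<close>

lemma DERIV_integral_shift:
  fixes \<phi> :: "'a::euclidean_space \<Rightarrow> real"
  assumes \<phi>: "test_function V \<phi>" and u: "integrable lborel u"
  shows "((\<lambda>t. \<integral>y. u y * \<phi> (y + t *\<^sub>R w) \<partial>lborel) has_real_derivative
    (\<integral>y. u y * (\<Sum>b\<in>Basis. (w \<bullet> b) * frechet_derivative \<phi> (at (y + t *\<^sub>R w)) b) \<partial>lborel)) (at t)"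
proof -
  have smooth: "smooth \<phi>" using \<phi> by (simp add: test_function_def)
  define D where "D x = (\<Sum>b\<in>Basis. (w \<bullet> b) * frechet_derivative \<phi> (at x) b)" for x
  have D_cont: "continuous_on UNIV D"
    unfolding D_def by (intro continuous_intros smooth_continuous_derivative smooth)
  have "\<forall>b\<in>Basis. \<exists>C. \<forall>x. \<bar>frechet_derivative \<phi> (at x) b\<bar> \<le> C"
    using test_function_derivative_bounded[OF \<phi>] by blast
  then obtain C where C: "\<And>b x. b \<in> Basis \<Longrightarrow> \<bar>frechet_derivative \<phi> (at x) b\<bar> \<le> C b" by metis
  define M where "M = (\<Sum>b\<in>Basis. \<bar>w \<bullet> b\<bar> * C b)"
  have D_bound: "\<bar>D x\<bar> \<le> M" for x
    unfolding D_def M_def using C by (intro order_trans[OF sum_abs] sum_mono) (auto simp: abs_mult intro!: mult_left_mono)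
  have der: "((\<lambda>t. \<phi> (y + t *\<^sub>R w)) has_real_derivative D (y + t *\<^sub>R w)) (at t)" for y t
    unfolding D_def by (rule smooth_directional_derivative[OF smooth])
  have lip: "\<bar>\<phi> (y + t' *\<^sub>R w) - \<phi> (y + t *\<^sub>R w)\<bar> \<le> M * \<bar>t' - t\<bar>" for y t t'
    using field_differentiable_bound[of UNIV "\<lambda>t. \<phi> (y + t *\<^sub>R w)" "\<lambda>t. D (y + t *\<^sub>R w)" M t' t]
      der D_bound by (simp add: has_field_derivative_at_within)
  have \<phi>_cont: "continuous_on UNIV \<phi>" by (rule smooth_continuous[OF smooth])
  have \<phi>_meas: "(\<lambda>y. \<phi> (y + t *\<^sub>R w)) \<in> borel_measurable borel" for t
    by (intro borel_measurable_continuous_onI continuous_on_compose2[OF \<phi>_cont] continuous_intros) auto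
  have D_meas: "(\<lambda>y. D (y + t *\<^sub>R w)) \<in> borel_measurable borel" for t
    by (intro borel_measurable_continuous_onI continuous_on_compose2[OF D_cont] continuous_intros) auto
  obtain C0 where C0: "\<And>x. \<bar>\<phi> x\<bar> \<le> C0" using test_function_bounded[OF \<phi>] by metis
  have int: "integrable lborel (\<lambda>y. u y * \<phi> (y + t *\<^sub>R w))" for t
  proof (rule Bochner_Integration.integrable_bound[OF integrable_mult_right[OF u, of C0]])
    show "AE y in lborel. norm (u y * \<phi> (y + t *\<^sub>R w)) \<le> norm (C0 * u y)"
    proof (rule AE_I2)
      fix y show "norm (u y * \<phi> (y + t *\<^sub>R w)) \<le> norm (C0 * u y)"
        using C0[of "y + t *\<^sub>R w"] mult_left_mono[of "\<bar>\<phi> (y + t *\<^sub>R w)\<bar>" "\<bar>C0\<bar>" "\<bar>u y\<bar>"]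
        by (simp add: abs_mult mult.commute)
    qed
  qed (use u \<phi>_meas in measurable)
  show ?thesis
    unfolding D_def[symmetric] DERIV_def tendsto_at_iff_sequentially comp_def
  proof (intro allI impI)
    fix h :: "nat \<Rightarrow> real" assume h: "\<forall>i. h i \<in> UNIV - {0}" "h \<longlonglongrightarrow> 0"
    have "(\<lambda>i. \<integral>y. u y * ((\<phi> (y + (t + h i) *\<^sub>R w) - \<phi> (y + t *\<^sub>R w)) / h i) \<partial>lborel)
        \<longlonglongrightarrow> (\<integral>y. u y * D (y + t *\<^sub>R w) \<partial>lborel)"
    proof (rule integral_dominated_convergence[where w = "\<lambda>y. M * \<bar>u y\<bar>"])
      show "integrable lborel (\<lambda>y. M * \<bar>u y\<bar>)" using u by auto
      show "AE y in lborel. (\<lambda>i. u y * ((\<phi> (y + (t + h i) *\<^sub>R w) - \<phi> (y + t *\<^sub>R w)) / h i)) \<longlonglongrightarrow> u y * D (y + t *\<^sub>R w)"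
      proof (rule AE_I2)
        fix y
        have "(\<lambda>i. (\<phi> (y + (t + h i) *\<^sub>R w) - \<phi> (y + t *\<^sub>R w)) / h i) \<longlonglongrightarrow> D (y + t *\<^sub>R w)"
          by (rule der[of y t, unfolded DERIV_def tendsto_at_iff_sequentially comp_def, rule_format, OF _ h(2)])
            (use h(1) in auto)
        then show "(\<lambda>i. u y * ((\<phi> (y + (t + h i) *\<^sub>R w) - \<phi> (y + t *\<^sub>R w)) / h i)) \<longlonglongrightarrow> u y * D (y + t *\<^sub>R w)"
          by (intro tendsto_intros)
      qed
      show "AE y in lborel. norm (u y * ((\<phi> (y + (t + h i) *\<^sub>R w) - \<phi> (y + t *\<^sub>R w)) / h i)) \<le> M * \<bar>u y\<bar>" for i
      proof (rule AE_I2)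
        fix y
        have "\<bar>\<phi> (y + (t + h i) *\<^sub>R w) - \<phi> (y + t *\<^sub>R w)\<bar> \<le> M * \<bar>h i\<bar>" using lip[of y "t + h i" t] by simp
        then have "\<bar>(\<phi> (y + (t + h i) *\<^sub>R w) - \<phi> (y + t *\<^sub>R w)) / h i\<bar> \<le> M"
          using h(1) by (simp add: abs_divide divide_le_eq)
        then show "norm (u y * ((\<phi> (y + (t + h i) *\<^sub>R w) - \<phi> (y + t *\<^sub>R w)) / h i)) \<le> M * \<bar>u y\<bar>"
          using mult_left_mono[of _ M "\<bar>u y\<bar>"] by (simp only: real_norm_def abs_mult mult.commute[of M] abs_ge_zero)
      qed
    qed (use u \<phi>_meas D_meas in measurable)
    moreover have "(\<integral>y. u y * ((\<phi> (y + (t + h i) *\<^sub>R w) - \<phi> (y + t *\<^sub>R w)) / h i) \<partial>lborel) =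
        ((\<integral>y. u y * \<phi> (y + (t + h i) *\<^sub>R w) \<partial>lborel) - (\<integral>y. u y * \<phi> (y + t *\<^sub>R w) \<partial>lborel)) / h i" for i
      using int by (simp add: right_diff_distrib flip: Bochner_Integration.integral_diff)
    ultimately show "(\<lambda>i. ((\<integral>y. u y * \<phi> (y + (t + h i) *\<^sub>R w) \<partial>lborel) - (\<integral>y. u y * \<phi> (y + t *\<^sub>R w) \<partial>lborel)) / h i)
        \<longlonglongrightarrow> (\<integral>y. u y * D (y + t *\<^sub>R w) \<partial>lborel)" by (simp only:)
  qed
qed

lemma integral_lebesgue_on_lborel:
  fixes f :: "'a::euclidean_space \<Rightarrow> real"
  assumes "X \<in> sets lebesgue" "f \<in> borel_measurable borel" "\<And>x. x \<notin> X \<Longrightarrow> f x = 0"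
  shows "(\<integral>x. f x \<partial>lebesgue_on X) = (\<integral>x. f x \<partial>lborel)"
proof -
  have "(\<integral>x. f x \<partial>lebesgue_on X) = (\<integral>x. indicator X x *\<^sub>R f x \<partial>lebesgue)"
    using assms(1) by (simp add: integral_restrict_space)
  also have "(\<lambda>x. indicator X x *\<^sub>R f x) = f"
    by (rule ext) (use assms(3) in \<open>auto simp: indicator_def\<close>)
  also have "(\<integral>x. f x \<partial>lebesgue) = (\<integral>x. f x \<partial>lborel)"
    using assms(2) by (intro integral_completion) simp
  finally show ?thesis .
qed

lemma lborel_integral_shift:
  fixes f :: "'a::euclidean_space \<Rightarrow> real"
  assumes "f \<in> borel_measurable borel"
  shows "(\<integral>x. f (x + z) \<partial>lborel) = (\<integral>x. f x \<partial>lborel)"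
  using integral_distr[of "(+) z" lborel borel f] assms lborel_distr_plus[of z] by (simp add: add.commute)

lemma lborel_nn_integral_shift:
  fixes f :: "'a::euclidean_space \<Rightarrow> ennreal"
  assumes "f \<in> borel_measurable borel"
  shows "(\<integral>\<^sup>+x. f (x + z) \<partial>lborel) = (\<integral>\<^sup>+x. f x \<partial>lborel)"
  using nn_integral_distr[of "(+) z" lborel borel f] assms lborel_distr_plus[of z] by (simp add: add.commute)

text \<open>By duality: tested against \<open>\<phi>\<close>, the increment is \<open>F(1) - F(0)\<close> for
  \<open>F(t) = \<integral> u \<phi>(\<cdot> - tz)\<close>, whose derivative is controlled by the weak gradient.\<close>

lemma translation_bound:
  fixes X V :: "(real ^ 'd) set"
  assumes X: "open X" "closure X \<subseteq> torus_cell" and V: "open V" "V \<subseteq> X"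
    and seg: "\<And>x t. x \<in> V \<Longrightarrow> 0 \<le> t \<Longrightarrow> t \<le> 1 \<Longrightarrow> x + t *\<^sub>R z \<in> X"
    and u: "u \<in> L2 X" "u \<in> borel_measurable borel" "\<And>x. x \<notin> X \<Longrightarrow> u x = 0"
    and g: "weak_gradient X u g"
  shows "(\<lambda>x. u (x + z) - u x) \<in> L2 V"
    "l2_norm V (\<lambda>x. u (x + z) - u x) \<le> norm z * sqrt (\<Sum>b\<in>Basis. (l2_norm X (\<lambda>x. g x \<bullet> b))\<^sup>2)"
proof -
  have XL: "X \<in> sets lebesgue" and VL: "V \<in> sets lebesgue" using X V by auto
  have bdd: "bounded X" using bounded_subset[of torus_cell X] X(2) closure_subset
    by (auto simp: torus_cell_def bounded_box)
  then have Xm: "X \<in> lmeasurable" using X(1) by (simp add: lmeasurable_open)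
  have Vm: "V \<in> lmeasurable" using bounded_subset[OF bdd V(2)] V(1) by (simp add: lmeasurable_open)
  have Vcl: "closure V \<subseteq> torus_cell" using closure_mono[OF V(2)] X(2) by blast
  have u_int: "integrable lborel u"
  proof -
    have "integrable (lebesgue_on X) u" using L2_mult_integrable[OF u(1) L2_const[OF Xm, of 1]] by simp
    then have "integrable lebesgue (\<lambda>x. indicator X x *\<^sub>R u x)" using XL by (simp add: integrable_restrict_space)
    also have "(\<lambda>x. indicator X x *\<^sub>R u x) = u" by (rule ext) (use u(3) in \<open>auto simp: indicator_def\<close>)
    finally show ?thesis using u(2) by (simp add: integrable_completion)
  qed
  have shift_meas: "(\<lambda>x. u (x + z)) \<in> borel_measurable borel" using u(2) by measurable
  have shift_L2: "(\<lambda>x. u (x + z)) \<in> L2 V"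
  proof -
    have "integrable (lebesgue_on V) (\<lambda>x. (u (x + z))\<^sup>2)"
    proof (rule integrableI_nonneg)
      show "(\<lambda>x. (u (x + z))\<^sup>2) \<in> borel_measurable (lebesgue_on V)"
        using shift_meas by (intro borel_imp_lebesgue_on) measurable
      have "(\<integral>\<^sup>+x. ennreal ((u (x + z))\<^sup>2) \<partial>lebesgue_on V) \<le> (\<integral>\<^sup>+x. ennreal ((u (x + z))\<^sup>2) \<partial>lborel)"
        unfolding nn_integral_lebesgue_on[OF VL] by (intro nn_integral_mono) (auto simp: indicator_def)
      also have "\<dots> = (\<integral>\<^sup>+x. ennreal ((u x)\<^sup>2) \<partial>lborel)"
        using u(2) by (intro lborel_nn_integral_shift[of "\<lambda>x. ennreal ((u x)\<^sup>2)"]) measurable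
      also have "\<dots> = (\<integral>\<^sup>+x. ennreal ((u x)\<^sup>2) \<partial>lebesgue_on X)"
        unfolding nn_integral_lebesgue_on[OF XL] by (intro nn_integral_cong) (use u(3) in \<open>auto simp: indicator_def\<close>)
      also have "\<dots> < \<infinity>" by (simp flip: ennreal_l2_norm_sq[OF u(1)])
      finally show "(\<integral>\<^sup>+x. ennreal ((u (x + z))\<^sup>2) \<partial>lebesgue_on V) < \<infinity>" .
    qed auto
    then show ?thesis using borel_imp_lebesgue_on[OF shift_meas] by (simp add: L2_def)
  qed
  have uV: "u \<in> L2 V" by (rule L2_subset[OF u(1) V(2) XL VL])
  show w: "(\<lambda>x. u (x + z) - u x) \<in> L2 V" using shift_L2 uV by auto
  define \<Gamma> where "\<Gamma> = sqrt (\<Sum>b\<in>Basis. (l2_norm X (\<lambda>x. g x \<bullet> b))\<^sup>2)"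
  show "l2_norm V (\<lambda>x. u (x + z) - u x) \<le> norm z * \<Gamma>"
  proof (rule l2_norm_le_of_test_functions[OF V(1) Vcl w])
    show "0 \<le> norm z * \<Gamma>" by (simp add: \<Gamma>_def sum_nonneg)
    fix \<phi> assume \<phi>: "test_function V \<phi>"
    have smooth: "smooth \<phi>" using \<phi> by (simp add: test_function_def)
    have \<phi>_cont: "continuous_on UNIV \<phi>" by (rule smooth_continuous[OF smooth])
    have \<phi>_meas: "\<phi> \<in> borel_measurable borel" by (rule borel_measurable_continuous_onI[OF \<phi>_cont])
    have \<phi>0: "\<phi> x = 0" if "x \<notin> V" for x
    proof (rule ccontr)
      assume "\<phi> x \<noteq> 0"
      then have "x \<in> closure {x. \<phi> x \<noteq> 0}" by (intro subsetD[OF closure_subset]) simp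
      then show False using \<phi> that by (auto simp: test_function_def)
    qed
    define F where "F t = (\<integral>y. u y * \<phi> (y + t *\<^sub>R (- z)) \<partial>lborel)" for t
    define F' where "F' t = (\<integral>y. u y * (\<Sum>b\<in>Basis. (- z \<bullet> b) * frechet_derivative \<phi> (at (y + t *\<^sub>R (- z))) b) \<partial>lborel)" for t
    have F_der: "(F has_real_derivative F' t) (at t)" for t
      unfolding F_def F'_def by (rule DERIV_integral_shift[OF \<phi> u_int])
    have inner: "l2_inner V (\<lambda>x. u (x + z) - u x) \<phi> = F 1 - F 0"
    proof -
      have "l2_inner V (\<lambda>x. u (x + z) - u x) \<phi> = l2_inner V (\<lambda>x. u (x + z)) \<phi> - l2_inner V u \<phi>"
        using shift_L2 uV test_function_L2[OF Vm \<phi>] by (rule l2_inner_diff_left)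
      also have "l2_inner V u \<phi> = F 0"
        unfolding l2_inner_def F_def using VL u(2) \<phi>_meas \<phi>0 by (subst integral_lebesgue_on_lborel) auto
      also have "l2_inner V (\<lambda>x. u (x + z)) \<phi> = (\<integral>x. u (x + z) * \<phi> x \<partial>lborel)"
        unfolding l2_inner_def using VL shift_meas \<phi>_meas \<phi>0 by (intro integral_lebesgue_on_lborel) auto
      also have "\<dots> = (\<integral>x. (\<lambda>y. u y * \<phi> (y - z)) (x + z) \<partial>lborel)" by simp
      also have "\<dots> = (\<integral>y. u y * \<phi> (y - z) \<partial>lborel)"
        by (rule lborel_integral_shift) (use u(2) \<phi>_meas in measurable)
      also have "\<dots> = F 1" by (simp add: F_def)
      finally show ?thesis .
    qed
    have F'_bound: "\<bar>F' t\<bar> \<le> norm z * \<Gamma> * l2_norm V \<phi>" if t: "0 \<le> t" "t \<le> 1" for t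
    proof -
      define \<phi>t where "\<phi>t x = \<phi> (x + t *\<^sub>R (- z))" for x
      \<comment> \<open>The support of \<phi> lies in V and is moved forward along z; the segment
        hypothesis keeps it in X. Without it the weak gradient on X could not be tested with this
        function.\<close>
      have \<phi>t: "test_function X \<phi>t"
        unfolding \<phi>t_def using seg t by (intro test_function_shift[OF \<phi>]) auto
      have dt: "frechet_derivative \<phi>t (at y) b = frechet_derivative \<phi> (at (y + t *\<^sub>R (- z))) b" for y b
        unfolding \<phi>t_def frechet_derivative_shift[OF smooth] ..
      have \<phi>tL: "\<phi>t \<in> L2 X" by (rule test_function_L2[OF Xm \<phi>t])
      have dt_cont: "continuous_on UNIV (\<lambda>y. frechet_derivative \<phi>t (at y) b)" if "b \<in> Basis" for b
        using \<phi>t that by (intro smooth_continuous_derivative) (auto simp: test_function_def)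
      have dtL: "(\<lambda>y. frechet_derivative \<phi>t (at y) b) \<in> L2 X" if b: "b \<in> Basis" for b
      proof -
        obtain C where C: "\<forall>x. \<bar>frechet_derivative \<phi>t (at x) b\<bar> \<le> C"
          using test_function_derivative_bounded[OF \<phi>t b] by blast
        show ?thesis
          by (rule L2_bounded[OF Xm continuous_imp_lebesgue_on_measurable[OF dt_cont[OF b]], of C]) (use C in auto)
      qed
      have "F' t = l2_inner X u (\<lambda>y. \<Sum>b\<in>Basis. (- z \<bullet> b) * frechet_derivative \<phi>t (at y) b)"
        unfolding F'_def l2_inner_def dt[symmetric]
      proof (rule integral_lebesgue_on_lborel[symmetric, OF XL])
        have "continuous_on UNIV (\<lambda>y. \<Sum>b\<in>Basis. (- z \<bullet> b) * frechet_derivative \<phi>t (at y) b)"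
          by (intro continuous_intros dt_cont)
        then show "(\<lambda>y. u y * (\<Sum>b\<in>Basis. (- z \<bullet> b) * frechet_derivative \<phi>t (at y) b)) \<in> borel_measurable borel"
          by (intro borel_measurable_times[OF u(2)] borel_measurable_continuous_onI)
      qed (use u(3) in auto)
      also have "\<dots> = (\<Sum>b\<in>Basis. l2_inner X (\<lambda>y. (- z \<bullet> b) * frechet_derivative \<phi>t (at y) b) u)"
        by (subst l2_inner_commute) (intro l2_inner_sum_left L2_scale dtL u(1))
      also have "\<dots> = (\<Sum>b\<in>Basis. (z \<bullet> b) * l2_inner X (\<lambda>x. g x \<bullet> b) \<phi>t)"
        using g \<phi>t by (intro sum.cong) (auto simp: l2_inner_scale_left l2_inner_uminus_left weak_gradient_def l2_inner_commute[of X _ u])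
      finally have "\<bar>F' t\<bar> \<le> (\<Sum>b\<in>Basis. \<bar>z \<bullet> b\<bar> * (l2_norm X (\<lambda>x. g x \<bullet> b) * l2_norm X \<phi>t))"
        using g \<phi>tL by (auto intro!: order_trans[OF sum_abs] sum_mono mult_left_mono l2_cauchy_schwarz simp: abs_mult weak_gradient_def)
      also have "\<dots> = (\<Sum>b\<in>Basis. \<bar>z \<bullet> b\<bar> * l2_norm X (\<lambda>x. g x \<bullet> b)) * l2_norm X \<phi>t"
        by (simp add: sum_distrib_right mult.assoc)
      also have "\<dots> \<le> (norm z * \<Gamma>) * l2_norm V \<phi>"
      proof (rule mult_mono)
        have "(\<Sum>b\<in>Basis. \<bar>z \<bullet> b\<bar> * l2_norm X (\<lambda>x. g x \<bullet> b))\<^sup>2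
            \<le> (\<Sum>b\<in>Basis. \<bar>z \<bullet> b\<bar>\<^sup>2) * (\<Sum>b\<in>Basis. (l2_norm X (\<lambda>x. g x \<bullet> b))\<^sup>2)"
          by (rule Cauchy_Schwarz_ineq_sum)
        also have "\<dots> = (norm z * \<Gamma>)\<^sup>2"
        proof -
          have "(\<Sum>b\<in>Basis. \<bar>z \<bullet> b\<bar>\<^sup>2) = (norm z)\<^sup>2"
            unfolding power2_norm_eq_inner euclidean_inner[of z z] by (simp add: power2_eq_square)
          then show ?thesis by (simp add: power_mult_distrib \<Gamma>_def sum_nonneg)
        qed
        finally show "(\<Sum>b\<in>Basis. \<bar>z \<bullet> b\<bar> * l2_norm X (\<lambda>x. g x \<bullet> b)) \<le> norm z * \<Gamma>"
          by (rule power2_le_imp_le) (simp add: \<Gamma>_def sum_nonneg)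
        have "(l2_norm X \<phi>t)\<^sup>2 = (\<integral>x. (\<phi>t x)\<^sup>2 \<partial>lborel)"
          unfolding l2_norm_sq_integral
        proof (rule integral_lebesgue_on_lborel[OF XL])
          show "(\<lambda>x. (\<phi>t x)\<^sup>2) \<in> borel_measurable borel" unfolding \<phi>t_def using \<phi>_meas by measurable
          fix x assume "x \<notin> X"
          then have "x - t *\<^sub>R z \<notin> V" using seg[of "x - t *\<^sub>R z" t] t by auto
          then show "(\<phi>t x)\<^sup>2 = 0" by (simp add: \<phi>t_def \<phi>0)
        qed
        also have "\<dots> = (\<integral>x. (\<phi> x)\<^sup>2 \<partial>lborel)"
          unfolding \<phi>t_def using \<phi>_meas by (intro lborel_integral_shift[of "\<lambda>x. (\<phi> x)\<^sup>2"]) measurable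
        also have "\<dots> = (l2_norm V \<phi>)\<^sup>2"
          unfolding l2_norm_sq_integral using \<phi>_meas \<phi>0 by (intro integral_lebesgue_on_lborel[OF VL, symmetric]) auto
        finally show "l2_norm X \<phi>t \<le> l2_norm V \<phi>" by simp
      qed (auto simp: \<Gamma>_def sum_nonneg)
      finally show ?thesis .
    qed
    obtain t where "0 < t" "t < 1" "F 1 - F 0 = (1 - 0) * F' t"
      using MVT2[of 0 1 F F'] F_der by auto
    then show "\<bar>l2_inner V (\<lambda>x. u (x + z) - u x) \<phi>\<bar> \<le> norm z * \<Gamma> * l2_norm V \<phi>"
      using F'_bound[of t] by (simp add: inner)
  qed
qed

text \<open>After the substitution y = x + z and an exchange of integrals, the inner integral for
  fixed z is the squared norm of u(x + z) - u(x), controlled by \<open>translation_bound\<close>.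
  Since |z| is at most 2 h, the rest is the volume of the ball of displacements, enlarged so that
  the power of h has the form d + 2 s with s = 1.\<close>

lemma modulus_gradient:
  fixes X V :: "(real ^ 'd) set"
  assumes X: "open X" "closure X \<subseteq> torus_cell" and V: "open V" "V \<subseteq> X"
    and h: "h > 0" and e: "norm e \<le> 1" and c: "0 < c" "c \<le> 1"
    and cone: "\<And>x t. x \<in> V \<Longrightarrow> 0 < t \<Longrightarrow> t \<le> h \<Longrightarrow> ball (x + t *\<^sub>R e) (c * t) \<subseteq> X"
    and u: "u \<in> L2 X" "u \<in> borel_measurable borel" "\<And>x. x \<notin> X \<Longrightarrow> u x = 0"
    and g: "weak_gradient X u g"
  shows "modulus_integral V e c h u \<le> ennreal (unit_ball_vol (real CARD('d)) * (2 * h) powr (real CARD('d) + 2)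
    * (\<Sum>b\<in>Basis. (l2_norm X (\<lambda>x. g x \<bullet> b))\<^sup>2))"
proof -
  define G where "G = (\<Sum>b\<in>Basis. (l2_norm X (\<lambda>x. g x \<bullet> b))\<^sup>2)"
  have G: "G \<ge> 0" by (simp add: G_def sum_nonneg)
  define B where "B = ball (h *\<^sub>R e) (c * h)"
  have VL: "V \<in> sets lebesgue" using V by auto
  have Vb: "V \<in> sets borel" using V by auto
  have inner: "(\<integral>\<^sup>+x. ennreal ((u x - u (x + z))\<^sup>2) * indicator V x \<partial>lborel) \<le> ennreal ((2 * h)\<^sup>2 * G)"
    if z: "z \<in> B" for z
  proof -
    have nz: "norm z \<le> 2 * h"
    proof -
      have "norm z \<le> norm (h *\<^sub>R e) + dist (h *\<^sub>R e) z"
        using norm_triangle_ineq[of "h *\<^sub>R e" "z - h *\<^sub>R e"] by (simp add: dist_norm norm_minus_commute)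
      also have "\<dots> \<le> h + c * h" using z h e by (intro add_mono) (auto simp: B_def mult_left_le)
      also have "\<dots> \<le> 2 * h" using c h by simp
      finally show ?thesis .
    qed
    \<comment> \<open>The point x + t z lies in the ball of the cone condition at the smaller step t
      h, since scaling by t shrinks both the displacement and the radius. This is why the cone
      condition is demanded for all steps up to h.\<close>
    have seg: "x + t *\<^sub>R z \<in> X" if x: "x \<in> V" and t: "0 \<le> t" "t \<le> 1" for x t
    proof (cases "t = 0")
      case True
      then show ?thesis using x V by auto
    next
      case False
      have "dist (x + (t * h) *\<^sub>R e) (x + t *\<^sub>R z) = t * dist (h *\<^sub>R e) z"
        using t by (simp add: dist_norm flip: scaleR_scaleR scaleR_diff_right)
      also have "\<dots> < t * (c * h)" using z False t by (simp add: B_def)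
      finally have "x + t *\<^sub>R z \<in> ball (x + (t * h) *\<^sub>R e) (c * (t * h))" by (simp add: mult_ac)
      moreover have "t * h > 0" "t * h \<le> h" using t False h by (auto simp: mult_left_le_one_le)
      ultimately show ?thesis using cone[OF x, of "t * h"] by blast
    qed
    have tb: "(\<lambda>x. u (x + z) - u x) \<in> L2 V" by (rule translation_bound(1)[OF X V seg u g])
    have tb2: "l2_norm V (\<lambda>x. u (x + z) - u x) \<le> norm z * sqrt (\<Sum>b\<in>Basis. (l2_norm X (\<lambda>x. g x \<bullet> b))\<^sup>2)"
      by (rule translation_bound(2)[OF X V seg u g])
    have "(\<integral>\<^sup>+x. ennreal ((u x - u (x + z))\<^sup>2) * indicator V x \<partial>lborel)
        = ennreal ((l2_norm V (\<lambda>x. u (x + z) - u x))\<^sup>2)"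
      by (subst ennreal_l2_norm_sq[OF tb], subst nn_integral_lebesgue_on[OF VL]) (subst power2_commute, rule refl)
    also have "\<dots> \<le> ennreal ((2 * h)\<^sup>2 * G)"
    proof (rule ennreal_leI)
      have "(l2_norm V (\<lambda>x. u (x + z) - u x))\<^sup>2 \<le> (norm z * sqrt G)\<^sup>2"
        using tb2 unfolding G_def by (intro power_mono) auto
      also have "\<dots> = (norm z)\<^sup>2 * G" using G by (simp add: power_mult_distrib)
      also have "\<dots> \<le> (2 * h)\<^sup>2 * G" using nz G by (intro mult_right_mono power_mono) auto
      finally show "(l2_norm V (\<lambda>x. u (x + z) - u x))\<^sup>2 \<le> (2 * h)\<^sup>2 * G" .
    qed
    finally show ?thesis .
  qed
  have [measurable]: "u \<in> borel_measurable borel" "V \<in> sets borel" "B \<in> sets borel"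
    using u Vb by (auto simp: B_def)
  have "modulus_integral V e c h u =
      (\<integral>\<^sup>+x. (\<integral>\<^sup>+z. ennreal ((u x - u (x + z))\<^sup>2) * indicator B z * indicator V x \<partial>lborel) \<partial>lborel)"
    unfolding modulus_integral_def
  proof (rule nn_integral_cong)
    fix x
    have "(\<lambda>y. ennreal ((u x - u y)\<^sup>2) * indicator (ball (x + h *\<^sub>R e) (c * h)) y) \<in> borel_measurable borel"
      by (measurable; simp)
    from lborel_nn_integral_shift[OF this, of x, symmetric]
    have "(\<integral>\<^sup>+y. ennreal ((u x - u y)\<^sup>2) * indicator (ball (x + h *\<^sub>R e) (c * h)) y \<partial>lborel)
        = (\<integral>\<^sup>+z. ennreal ((u x - u (x + z))\<^sup>2) * indicator B z \<partial>lborel)"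
      by (simp add: B_def indicator_def dist_norm add.commute algebra_simps)
    moreover have "(\<integral>\<^sup>+z. ennreal ((u x - u (x + z))\<^sup>2) * indicator B z * indicator V x \<partial>lborel)
        = (\<integral>\<^sup>+z. ennreal ((u x - u (x + z))\<^sup>2) * indicator B z \<partial>lborel) * indicator V x"
      by (intro nn_integral_multc) measurable
    ultimately show "(\<integral>\<^sup>+y. ennreal ((u x - u y)\<^sup>2) * indicator (ball (x + h *\<^sub>R e) (c * h)) y \<partial>lborel) * indicator V x
        = (\<integral>\<^sup>+z. ennreal ((u x - u (x + z))\<^sup>2) * indicator B z * indicator V x \<partial>lborel)" by simp
  qed
  also have "\<dots> = (\<integral>\<^sup>+z. (\<integral>\<^sup>+x. ennreal ((u x - u (x + z))\<^sup>2) * indicator B z * indicator V x \<partial>lborel) \<partial>lborel)"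
    by (rule lborel_pair.Fubini') measurable
  also have "\<dots> \<le> (\<integral>\<^sup>+z. ennreal ((2 * h)\<^sup>2 * G) * indicator B z \<partial>lborel)"
  proof (rule nn_integral_mono)
    fix z show "(\<integral>\<^sup>+x. ennreal ((u x - u (x + z))\<^sup>2) * indicator B z * indicator V x \<partial>lborel) \<le> ennreal ((2 * h)\<^sup>2 * G) * indicator B z"
      using inner[of z] by (cases "z \<in> B") auto
  qed
  also have "\<dots> = ennreal ((2 * h)\<^sup>2 * G) * emeasure lborel B" by (simp add: nn_integral_cmult_indicator)
  also have "emeasure lborel B = ennreal (unit_ball_vol (real CARD('d)) * (c * h) ^ CARD('d))"
    unfolding B_def using c h by (subst emeasure_ball) auto
  also have "ennreal ((2 * h)\<^sup>2 * G) * \<dots> = ennreal (((2 * h)\<^sup>2 * G) * (unit_ball_vol (real CARD('d)) * (c * h) ^ CARD('d)))"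
    using G c h by (intro ennreal_mult[symmetric]) auto
  also have "\<dots> \<le> ennreal (unit_ball_vol (real CARD('d)) * (2 * h) powr (real CARD('d) + 2) * G)"
  proof (rule ennreal_leI)
    have "(c * h) ^ CARD('d) \<le> (2 * h) ^ CARD('d)" using c h by (intro power_mono) auto
    then have "((2 * h)\<^sup>2 * G) * (unit_ball_vol (real CARD('d)) * (c * h) ^ CARD('d))
      \<le> ((2 * h)\<^sup>2 * G) * (unit_ball_vol (real CARD('d)) * (2 * h) ^ CARD('d))"
      using G by (intro mult_left_mono) auto
    also have "\<dots> = unit_ball_vol (real CARD('d)) * ((2 * h) ^ CARD('d) * (2 * h)\<^sup>2) * G" by (simp add: mult_ac)
    also have "(2 * h) ^ CARD('d) * (2 * h)\<^sup>2 = (2 * h) powr (real CARD('d) + 2)"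
      using h by (simp add: powr_add powr_realpow)
    finally show "((2 * h)\<^sup>2 * G) * (unit_ball_vol (real CARD('d)) * (c * h) ^ CARD('d))
      \<le> unit_ball_vol (real CARD('d)) * (2 * h) powr (real CARD('d) + 2) * G" .
  qed
  finally show ?thesis by (simp add: G_def)
qed

section \<open>Compactness of the embedding of \<open>H\<^sup>s\<close>\<close>

lemma Hs_L2: "v \<in> Hs X s \<Longrightarrow> v \<in> L2 X"
  by (simp add: Hs_def)

lemma hs_norm_nonneg [simp]: "0 \<le> hs_norm X s v"
  by (auto simp: hs_norm_def sum_nonneg)

lemma hs_norm_sq:
  "(hs_norm X s u)\<^sup>2 = (l2_norm X u)\<^sup>2 +
     (if s = 1 then \<Sum>b\<in>Basis. (l2_norm X (\<lambda>x. (SOME g. weak_gradient X u g) x \<bullet> b))\<^sup>2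
      else enn2real (gagliardo X s u))"
  unfolding hs_norm_def by (intro real_sqrt_pow2) (auto simp: sum_nonneg)

lemma l2_norm_le_hs_norm: "l2_norm X v \<le> hs_norm X s v"
  by (rule power2_le_imp_le) (auto simp: hs_norm_sq sum_nonneg)

text \<open>The two definitions of the norm give the same power of h; only the constants differ, 1
  for the Gagliardo seminorm and the volume of the unit ball for the gradient, and their maximum
  covers both.\<close>

lemma Hs_modulus:
  fixes X V :: "(real ^ 'd) set"
  assumes X: "open X" "closure X \<subseteq> torus_cell" and V: "open V" "V \<subseteq> X"
    and h: "h > 0" and e: "norm e \<le> 1" and c: "0 < c" "c \<le> 1"
    and cone: "\<And>x t. x \<in> V \<Longrightarrow> 0 < t \<Longrightarrow> t \<le> h \<Longrightarrow> ball (x + t *\<^sub>R e) (c * t) \<subseteq> X"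
    and s: "0 < s" and v: "v \<in> Hs X s"
    and u: "u \<in> borel_measurable borel" "\<And>x. x \<notin> X \<Longrightarrow> u x = 0" "ae_eq X v u"
  shows "modulus_integral V e c h u \<le> ennreal (max 1 (unit_ball_vol (real CARD('d)))
    * (2 * h) powr (real CARD('d) + 2 * s) * (hs_norm X s v)\<^sup>2)"
proof -
  have uL: "u \<in> L2 X"
    using L2_ae_cong[OF Hs_L2[OF v] borel_imp_lebesgue_on[OF u(1)] ae_eq_sym[OF u(3)]] .
  show ?thesis
  proof (cases "s = 1")
    case True
    define g where "g = (SOME g. weak_gradient X v g)"
    have "\<exists>g. weak_gradient X v g" using v True by (simp add: Hs_def)
    then have "weak_gradient X v g" unfolding g_def by (rule someI_ex)
    then have g: "weak_gradient X u g"
      by (rule weak_gradient_cong[OF L2_measurable[OF Hs_L2[OF v]] L2_measurable[OF uL] u(3)])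
    have G: "(\<Sum>b\<in>Basis. (l2_norm X (\<lambda>x. g x \<bullet> b))\<^sup>2) \<le> (hs_norm X s v)\<^sup>2"
      using True by (simp add: hs_norm_sq g_def)
    have "modulus_integral V e c h u \<le> ennreal (unit_ball_vol (real CARD('d)) * (2 * h) powr (real CARD('d) + 2)
      * (\<Sum>b\<in>Basis. (l2_norm X (\<lambda>x. g x \<bullet> b))\<^sup>2))"
      by (rule modulus_gradient[OF X V h e c cone uL u(1,2) g])
    also have "\<dots> \<le> ennreal (max 1 (unit_ball_vol (real CARD('d))) * (2 * h) powr (real CARD('d) + 2) * (hs_norm X s v)\<^sup>2)"
      using G by (intro ennreal_leI mult_mono) (auto simp: sum_nonneg)
    finally show ?thesis using True by simp
  next
    case False
    have fin: "gagliardo X s v < \<infinity>" using v False by (simp add: Hs_def)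
    have "modulus_integral V e c h u \<le> ennreal ((2 * h) powr (real DIM(real ^ 'd) + 2 * s)) * gagliardo X s u"
      using X h by (intro modulus_fractional[OF _ V(2) u(1) s h e c(2)] cone) auto
    also have "gagliardo X s u = ennreal (enn2real (gagliardo X s v))"
      using gagliardo_cong[OF u(3)] fin by simp
    also have "\<dots> \<le> ennreal ((hs_norm X s v)\<^sup>2)"
      using False by (intro ennreal_leI) (simp add: hs_norm_sq)
    also have "ennreal ((2 * h) powr (real DIM(real ^ 'd) + 2 * s)) * ennreal ((hs_norm X s v)\<^sup>2)
        = ennreal ((2 * h) powr (real CARD('d) + 2 * s) * (hs_norm X s v)\<^sup>2)"
      by (simp add: ennreal_mult)
    also have "\<dots> \<le> ennreal (max 1 (unit_ball_vol (real CARD('d))) * (2 * h) powr (real CARD('d) + 2 * s) * (hs_norm X s v)\<^sup>2)"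
    proof (rule ennreal_leI)
      have "1 * ((2 * h) powr (real CARD('d) + 2 * s) * (hs_norm X s v)\<^sup>2)
        \<le> max 1 (unit_ball_vol (real CARD('d))) * ((2 * h) powr (real CARD('d) + 2 * s) * (hs_norm X s v)\<^sup>2)"
        by (intro mult_right_mono) auto
      then show "(2 * h) powr (real CARD('d) + 2 * s) * (hs_norm X s v)\<^sup>2
        \<le> max 1 (unit_ball_vol (real CARD('d))) * (2 * h) powr (real CARD('d) + 2 * s) * (hs_norm X s v)\<^sup>2"
        by (simp add: mult.assoc)
    qed
    finally show ?thesis by (simp add: mult_left_mono)
  qed
qed

lemma fin_rank_cong:
  assumes "fin_rank X \<Phi> T" "u \<in> borel_measurable (lebesgue_on X)" "v \<in> borel_measurable (lebesgue_on X)" "ae_eq X u v"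
  shows "T u = T v"
  using assms(1)
proof (induction rule: fin_rank.induct)
  case (fin_rank_step T a \<phi>)
  then have "l2_inner X a u = l2_inner X a v"
    using assms by (intro l2_inner_cong) (auto dest: L2_measurable)
  then show ?case using fin_rank_step by simp
qed simp

lemma ae_eq_subset:
  assumes "ae_eq X u v" "Y \<subseteq> X" "X \<in> sets lebesgue" "Y \<in> sets lebesgue"
  shows "ae_eq Y u v"
  using assms(1,2) unfolding ae_eq_def AE_lebesgue_on_iff[OF assms(3)] AE_lebesgue_on_iff[OF assms(4)]
  by (auto elim: eventually_mono)

text \<open>The modulus is of order h^(d + 2 s) and the averaging ball has volume of order h^d, so
  the quotient tends to 0 like h^(2 s). The radius r precedes \<eta> in the statement, so a finite
  subcover can be chosen once for all accuracies.\<close>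

lemma patch_compact:
  fixes X :: "(real ^ 'd) set"
  assumes X: "bounded_lipschitz_domain X" "closure X \<subseteq> torus_cell" and p: "p \<in> closure X" and s: "0 < s"
  shows "\<exists>r>0. \<forall>\<eta>>0. \<exists>T. fin_rank X (bounded_L2 X) T \<and>
    (\<forall>v\<in>Hs X s. l2_norm (X \<inter> ball p r) (\<lambda>x. v x - T v x) \<le> \<eta> * hs_norm X s v)"
proof -
  have Xo: "open X" and Xb: "bounded X" using X(1) by (auto simp: bounded_lipschitz_domain_def)
  have Xm: "X \<in> lmeasurable" using Xo Xb by (simp add: lmeasurable_open)
  obtain r e c h0 where r: "r > 0" and e: "norm e \<le> 1" and c: "0 < c" "c \<le> 1" and h0: "h0 > 0"
    and cone: "\<forall>x\<in>X \<inter> ball p r. \<forall>h. 0 < h \<and> h < h0 \<longrightarrow> ball (x + h *\<^sub>R e) (c * h) \<subseteq> X"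
    using lipschitz_domain_cone[OF X(1) p] by blast
  define V where "V = X \<inter> ball p r"
  have V: "open V" "V \<subseteq> X" "bounded V" "V \<in> sets borel" using Xo bounded_subset[OF Xb, of V] by (auto simp: V_def)
  have XL: "X \<in> sets lebesgue" and VL: "V \<in> sets lebesgue" using Xo V by auto
  define n where "n = CARD('d)"
  define \<omega> where "\<omega> = unit_ball_vol (real n)"
  have \<omega>: "\<omega> > 0" by (simp add: \<omega>_def)
  define A where "A = max 1 \<omega> * 2 powr (real n + 2 * s) / (\<omega> * (c / 2) ^ n)"
  have A: "A > 0" unfolding A_def using \<omega> c by (intro divide_pos_pos mult_pos_pos) auto
  have "\<exists>T. fin_rank X (bounded_L2 X) T \<and> (\<forall>v\<in>Hs X s. l2_norm V (\<lambda>x. v x - T v x) \<le> \<eta> * hs_norm X s v)"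
    if \<eta>: "\<eta> > 0" for \<eta>
  proof -
    \<comment> \<open>The second entry solves A h^(2 s) = \<eta>^2, where \<open>A\<close> collects
      all constants independent of h; the first keeps h inside the range of the cone
      condition.\<close>
    define h where "h = min (h0 / 2) ((\<eta>\<^sup>2 / A) powr (1 / (2 * s)))"
    have h: "0 < h" "h < h0" using h0 \<eta> A by (auto simp: h_def)
    have hA: "A * h powr (2 * s) \<le> \<eta>\<^sup>2"
    proof -
      have "h powr (2 * s) \<le> ((\<eta>\<^sup>2 / A) powr (1 / (2 * s))) powr (2 * s)"
        using h s by (intro powr_mono2) (auto simp: h_def)
      also have "\<dots> = \<eta>\<^sup>2 / A" using s \<eta> A by (simp add: powr_powr)
      finally show ?thesis using A by (simp add: field_simps)
    qed
    have cone': "ball (x + t *\<^sub>R e) (c * t) \<subseteq> X" if "x \<in> V" "0 < t" "t \<le> h" for x t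
      using cone that h by (auto simp: V_def)
    obtain T where T: "fin_rank X (bounded_L2 X) T"
      "\<forall>u\<in>L2 X. u \<in> borel_measurable borel \<longrightarrow>
        ennreal ((l2_norm V (\<lambda>x. u x - T u x))\<^sup>2)
        \<le> modulus_integral V e c h u / ennreal (unit_ball_vol (real DIM(real ^ 'd)) * (c * h / 2) ^ DIM(real ^ 'd))"
      using patch_average[OF Xm V(4,2,3) h(1) c(1), of e] cone'[OF _ h(1) order_refl] by blast
    have "l2_norm V (\<lambda>x. v x - T v x) \<le> \<eta> * hs_norm X s v" if v: "v \<in> Hs X s" for v
    proof -
      have vL: "v \<in> L2 X" using Hs_L2[OF v] .
      obtain u where u: "u \<in> borel_measurable borel" "\<And>x. x \<notin> X \<Longrightarrow> u x = 0" "ae_eq X v u"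
        using borel_representative[OF _ L2_measurable[OF vL]] Xo by (metis borel_open)
      have uL: "u \<in> L2 X" using L2_ae_cong[OF vL borel_imp_lebesgue_on[OF u(1)] ae_eq_sym[OF u(3)]] .
      have TT: "T v = T u" by (rule fin_rank_cong[OF T(1) L2_measurable[OF vL] L2_measurable[OF uL] u(3)])
      have TuL: "T u \<in> L2 X" by (rule fin_rank_L2[OF T(1) bounded_L2_subset])
      define b where "b = \<omega> * (c * h / 2) ^ n"
      have b: "b > 0" unfolding b_def using \<omega> c h by simp
      have "ennreal ((l2_norm V (\<lambda>x. u x - T u x))\<^sup>2) \<le> modulus_integral V e c h u / ennreal b"
        using T(2) uL u(1) by (simp add: b_def \<omega>_def n_def)
      also have "\<dots> \<le> ennreal (max 1 \<omega> * (2 * h) powr (real n + 2 * s) * (hs_norm X s v)\<^sup>2) / ennreal b"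
        unfolding \<omega>_def n_def
        by (intro divide_right_mono_ennreal Hs_modulus[OF Xo X(2) V(1,2) h(1) e c cone' s v u])
      also have "\<dots> = ennreal (max 1 \<omega> * (2 * h) powr (real n + 2 * s) * (hs_norm X s v)\<^sup>2 / b)"
        using b \<omega> by (intro divide_ennreal) auto
      finally have "(l2_norm V (\<lambda>x. u x - T u x))\<^sup>2 \<le> max 1 \<omega> * (2 * h) powr (real n + 2 * s) * (hs_norm X s v)\<^sup>2 / b"
        using b \<omega> by (subst (asm) ennreal_le_iff) auto
      also have "\<dots> = A * h powr (2 * s) * (hs_norm X s v)\<^sup>2"
      proof -
        have "(2 * h) powr (real n + 2 * s) = 2 powr (real n + 2 * s) * (h ^ n * h powr (2 * s))"
          using h by (simp add: powr_mult powr_add powr_realpow)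
        moreover have "b = (\<omega> * (c / 2) ^ n) * h ^ n" by (simp add: b_def power_mult_distrib power_divide)
        ultimately show ?thesis using h by (simp add: A_def)
      qed
      also have "\<dots> \<le> \<eta>\<^sup>2 * (hs_norm X s v)\<^sup>2" using hA by (intro mult_right_mono) auto
      also have "\<dots> = (\<eta> * hs_norm X s v)\<^sup>2" by (simp add: power_mult_distrib)
      finally have "l2_norm V (\<lambda>x. u x - T u x) \<le> \<eta> * hs_norm X s v"
        using \<eta> by (intro power2_le_imp_le[of "l2_norm V (\<lambda>x. u x - T u x)"]) auto
      moreover have "l2_norm V (\<lambda>x. v x - T v x) = l2_norm V (\<lambda>x. u x - T u x)"
      proof (rule l2_norm_cong)
        show "(\<lambda>x. v x - T v x) \<in> borel_measurable (lebesgue_on V)" "(\<lambda>x. u x - T u x) \<in> borel_measurable (lebesgue_on V)"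
          unfolding TT using L2_subset[OF _ V(2) XL VL] vL uL TuL by (auto intro!: L2_measurable L2_diff)
        show "ae_eq V (\<lambda>x. v x - T v x) (\<lambda>x. u x - T u x)"
          using ae_eq_subset[OF u(3) V(2) XL VL] unfolding ae_eq_def TT by eventually_elim simp
      qed
      ultimately show ?thesis by simp
    qed
    then show ?thesis using T(1) by blast
  qed
  then show ?thesis using r unfolding V_def by blast
qed

lemma l2_norm_Un:
  assumes "A \<in> sets lebesgue" "B \<in> sets lebesgue" "A \<inter> B = {}" "f \<in> L2 A" "f \<in> L2 B"
  shows "(l2_norm (A \<union> B) f)\<^sup>2 = (l2_norm A f)\<^sup>2 + (l2_norm B f)\<^sup>2"
proof -
  have eq: "(l2_norm C f)\<^sup>2 = (LINT x:C|lebesgue. (f x)\<^sup>2)" if "C \<in> sets lebesgue" for C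
    using that by (simp add: l2_norm_sq_integral integral_restrict_space set_lebesgue_integral_def)
  have int: "set_integrable lebesgue C (\<lambda>x. (f x)\<^sup>2)" if "C \<in> sets lebesgue" "f \<in> L2 C" for C
    using L2_integrable_sq[OF that(2)] that(1) by (simp add: set_integrable_def integrable_restrict_space)
  show ?thesis
    using assms by (simp add: eq set_integral_Un int sets.Un)
qed

lemma bounded_L2_indicator:
  assumes "\<phi> \<in> bounded_L2 X" "W \<in> sets borel" shows "(\<lambda>x. indicator W x * \<phi> x) \<in> bounded_L2 X"
proof -
  obtain C where C: "\<And>x. \<bar>\<phi> x\<bar> \<le> C" and \<phi>: "\<phi> \<in> L2 X" using assms(1) by (auto simp: bounded_L2_def)
  have "(\<lambda>x. indicator W x :: real) \<in> borel_measurable (lebesgue_on X)"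
    using assms(2) by (intro borel_imp_lebesgue_on borel_measurable_indicator)
  then have "(\<lambda>x. indicator W x * \<phi> x) \<in> borel_measurable (lebesgue_on X)"
    using L2_measurable[OF \<phi>] by (rule borel_measurable_times)
  then have "(\<lambda>x. indicator W x * \<phi> x) \<in> L2 X"
    by (rule L2_dominated[OF \<phi>]) (simp add: indicator_def)
  moreover have "\<bar>indicator W x * \<phi> x\<bar> \<le> C" for x
    using C[of x] by (auto simp: indicator_def)
  ultimately show ?thesis by (auto simp: bounded_L2_def)
qed

text \<open>Finitely many patches cover X. When a patch is added, its own approximant is used on it
  and the previous one elsewhere, so overlaps cause no double counting and the squared errors on
  disjoint sets add. Halving \<eta> at each step is enough.\<close>

theorem Hs_compactly_embedded:
  fixes X :: "(real ^ 'd) set"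
  assumes X: "bounded_lipschitz_domain X" "closure X \<subseteq> torus_cell" and s: "0 < s" and "\<eta> > 0"
  shows "\<exists>T. fin_rank X (bounded_L2 X) T \<and> (\<forall>v\<in>Hs X s. l2_norm X (\<lambda>x. v x - T v x) \<le> \<eta> * hs_norm X s v)"
proof -
  have Xo: "open X" and Xb: "bounded X" using X(1) by (auto simp: bounded_lipschitz_domain_def)
  have XL: "X \<in> sets lebesgue" using Xo by auto
  have "\<forall>p\<in>closure X. \<exists>r>0. \<forall>\<eta>>0. \<exists>T. fin_rank X (bounded_L2 X) T \<and>
    (\<forall>v\<in>Hs X s. l2_norm (X \<inter> ball p r) (\<lambda>x. v x - T v x) \<le> \<eta> * hs_norm X s v)"
    using patch_compact[OF X _ s] by blast
  from bchoice[OF this] obtain r where r: "\<And>p. p \<in> closure X \<Longrightarrow> r p > 0"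
    and patch: "\<And>p \<eta>. p \<in> closure X \<Longrightarrow> \<eta> > 0 \<Longrightarrow> \<exists>T. fin_rank X (bounded_L2 X) T \<and>
    (\<forall>v\<in>Hs X s. l2_norm (X \<inter> ball p (r p)) (\<lambda>x. v x - T v x) \<le> \<eta> * hs_norm X s v)" by blast
  have "closure X \<subseteq> (\<Union>p\<in>closure X. ball p (r p))" using r by force
  moreover have "compact (closure X)" using Xb by simp
  ultimately obtain D where D: "D \<subseteq> closure X" "finite D" "closure X \<subseteq> (\<Union>p\<in>D. ball p (r p))"
    by (elim compactE_image[where C = "closure X" and f = "\<lambda>p. ball p (r p)"]) auto
  define U where "U D = (\<Union>p\<in>D. X \<inter> ball p (r p))" for D
  have "\<forall>\<eta>>0. \<exists>T. fin_rank X (bounded_L2 X) T \<and> (\<forall>v\<in>Hs X s. l2_norm (U D) (\<lambda>x. v x - T v x) \<le> \<eta> * hs_norm X s v)"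
    using D(2,1)
  proof (induction rule: finite_induct)
    case empty
    have "l2_norm {} f = 0" for f :: "real ^ 'd \<Rightarrow> real"
      by (simp add: l2_norm_def l2_inner_def integral_restrict_space)
    then show ?case using fin_rank_zero[of X "bounded_L2 X"] by (auto simp: U_def)
  next
    case (insert p D)
    show ?case
    proof (intro allI impI)
      fix \<eta> :: real assume "\<eta> > 0"
      define W where "W = X \<inter> ball p (r p)"
      obtain T1 where T1: "fin_rank X (bounded_L2 X) T1"
        "\<And>v. v \<in> Hs X s \<Longrightarrow> l2_norm W (\<lambda>x. v x - T1 v x) \<le> \<eta> / 2 * hs_norm X s v"
        using patch[of p "\<eta> / 2"] insert.prems \<open>\<eta> > 0\<close> unfolding W_def by auto
      obtain T2 where T2: "fin_rank X (bounded_L2 X) T2"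
        "\<And>v. v \<in> Hs X s \<Longrightarrow> l2_norm (U D) (\<lambda>x. v x - T2 v x) \<le> \<eta> / 2 * hs_norm X s v"
        using insert.IH insert.prems \<open>\<eta> > 0\<close> by (metis half_gt_zero insert_subset)
      have Wo: "open W" and Uo: "open (U D)" and sub: "W \<subseteq> X" "U D \<subseteq> X" using Xo by (auto simp: W_def U_def)
      have sets: "W \<in> sets lebesgue" "U D \<in> sets lebesgue" "U D - W \<in> sets lebesgue" "W \<in> sets borel" "- W \<in> sets borel"
        using Wo Uo by auto
      define T where "T v x = indicator W x * T1 v x + indicator (- W) x * T2 v x" for v x
      have T: "fin_rank X (bounded_L2 X) T"
        unfolding T_def using T1(1) T2(1) sets by (intro fin_rank_add fin_rank_indicator bounded_L2_indicator)
      have "l2_norm (U (insert p D)) (\<lambda>x. v x - T v x) \<le> \<eta> * hs_norm X s v" if v: "v \<in> Hs X s" for v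
      proof (rule power2_le_imp_le)
        define f where "f = (\<lambda>x. v x - T v x)"
        have fL: "f \<in> L2 X"
          unfolding f_def using Hs_L2[OF v] fin_rank_L2[OF T bounded_L2_subset] by auto
        have f1: "(\<lambda>x. v x - T1 v x) \<in> L2 X" and f2: "(\<lambda>x. v x - T2 v x) \<in> L2 X"
          using Hs_L2[OF v] fin_rank_L2[OF T1(1) bounded_L2_subset] fin_rank_L2[OF T2(1) bounded_L2_subset] by auto
        have "U (insert p D) = W \<union> (U D - W)" by (auto simp: U_def W_def)
        moreover have "f \<in> L2 W" "f \<in> L2 (U D - W)"
          using L2_subset[OF fL sub(1) XL sets(1)] L2_subset[OF fL order_trans[OF Diff_subset sub(2)] XL sets(3)] by auto
        ultimately have e1: "(l2_norm (U (insert p D)) f)\<^sup>2 = (l2_norm W f)\<^sup>2 + (l2_norm (U D - W) f)\<^sup>2"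
          using l2_norm_Un[of W "U D - W" f] sets by auto
        have e2: "l2_norm W f = l2_norm W (\<lambda>x. v x - T1 v x)"
          using L2_subset[OF fL sub(1) XL sets(1)] L2_subset[OF f1 sub(1) XL sets(1)]
          by (intro l2_norm_cong L2_measurable) (auto simp: ae_eq_def f_def T_def)
        have e3: "l2_norm (U D - W) f \<le> l2_norm (U D) (\<lambda>x. v x - T2 v x)"
        proof -
          have "l2_norm (U D - W) f = l2_norm (U D - W) (\<lambda>x. v x - T2 v x)"
            using L2_subset[OF fL _ XL sets(3)] L2_subset[OF f2 _ XL sets(3)] sub
            by (intro l2_norm_cong L2_measurable) (auto simp: ae_eq_def f_def T_def)
          also have "\<dots> \<le> l2_norm (U D) (\<lambda>x. v x - T2 v x)"
          proof (rule power2_le_imp_le)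
            have "(l2_norm ((U D - W) \<union> (U D \<inter> W)) (\<lambda>x. v x - T2 v x))\<^sup>2 =
              (l2_norm (U D - W) (\<lambda>x. v x - T2 v x))\<^sup>2 + (l2_norm (U D \<inter> W) (\<lambda>x. v x - T2 v x))\<^sup>2"
              using sets sub by (intro l2_norm_Un L2_subset[OF f2 _ XL]) auto
            moreover have "(U D - W) \<union> (U D \<inter> W) = U D" by auto
            ultimately show "(l2_norm (U D - W) (\<lambda>x. v x - T2 v x))\<^sup>2 \<le> (l2_norm (U D) (\<lambda>x. v x - T2 v x))\<^sup>2"
              by simp
          qed simp
          finally show ?thesis .
        qed
        have "(l2_norm (U (insert p D)) f)\<^sup>2 \<le> (l2_norm W (\<lambda>x. v x - T1 v x))\<^sup>2 + (l2_norm (U D) (\<lambda>x. v x - T2 v x))\<^sup>2"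
          using e1 e2 power_mono[OF e3, of 2] by simp
        also have "\<dots> \<le> (\<eta> / 2 * hs_norm X s v)\<^sup>2 + (\<eta> / 2 * hs_norm X s v)\<^sup>2"
          using T1(2)[OF v] T2(2)[OF v] by (intro add_mono power_mono) auto
        also have "\<dots> \<le> (\<eta> * hs_norm X s v)\<^sup>2" by (simp add: power_mult_distrib power_divide)
        finally show "(l2_norm (U (insert p D)) (\<lambda>x. v x - T v x))\<^sup>2 \<le> (\<eta> * hs_norm X s v)\<^sup>2"
          by (simp add: f_def)
      qed (use \<open>\<eta> > 0\<close> in auto)
      then show "\<exists>T. fin_rank X (bounded_L2 X) T \<and> (\<forall>v\<in>Hs X s. l2_norm (U (insert p D)) (\<lambda>x. v x - T v x) \<le> \<eta> * hs_norm X s v)"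
        using T by blast
    qed
  qed
  moreover have "U D = X" using D(3) closure_subset by (fastforce simp: U_def)
  ultimately show ?thesis using \<open>\<eta> > 0\<close> by simp
qed

section \<open>Approximable operators\<close>

text \<open>Compactness of an operator on a Hilbert space, expressed as approximation in operator
  norm by operators of finite rank.\<close>

definition approximable :: "'a::euclidean_space set \<Rightarrow> (('a \<Rightarrow> real) \<Rightarrow> ('a \<Rightarrow> real)) \<Rightarrow> bool" where
  "approximable X A \<longleftrightarrow> (\<forall>\<eta>>0. \<exists>T. fin_rank X (L2 X) T \<and>
     (\<forall>u\<in>L2 X. l2_norm X (\<lambda>x. A u x - T u x) \<le> \<eta> * l2_norm X u))"

lemma fin_rank_mono:
  assumes "fin_rank X \<Phi> T" "\<Phi> \<subseteq> \<Psi>" shows "fin_rank X \<Psi> T"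
  using assms(1) by (induction rule: fin_rank.induct) (use assms(2) in \<open>auto intro: fin_rank.intros\<close>)

text \<open>Each functional <a, S u> is <adj a, u> with the adjoint of S, so the composition is
  again of the required form. The two sides are compared on \<open>L2 X\<close>, where the adjoint
  identity holds.\<close>

lemma fin_rank_comp:
  assumes S: "l2_bounded_linear X X S" and T: "fin_rank X \<Phi> T"
  shows "\<exists>T'. fin_rank X \<Phi> T' \<and> (\<forall>u\<in>L2 X. T' u = T (S u))"
  using T
proof (induction rule: fin_rank.induct)
  case fin_rank_zero
  show ?case by (intro exI[of _ "\<lambda>u x. 0"]) (simp add: fin_rank.fin_rank_zero)
next
  case (fin_rank_step T a \<phi>)
  then obtain T' where T': "fin_rank X \<Phi> T'" "\<forall>u\<in>L2 X. T' u = T (S u)" by blast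
  have "fin_rank X \<Phi> (\<lambda>u x. T' u x + l2_inner X (l2_adjoint X S a) u * \<phi> x)"
    using T'(1) l2_adjoint_props(1)[OF S fin_rank_step(2)] fin_rank_step(3) by (rule fin_rank.fin_rank_step)
  moreover have "l2_inner X (l2_adjoint X S a) u = l2_inner X a (S u)" if "u \<in> L2 X" for u
    using l2_adjoint_props(2)[OF S fin_rank_step(2) that] by (simp add: l2_inner_commute)
  ultimately show ?case using T'(2) by (intro exI[of _ "\<lambda>u x. T' u x + l2_inner X (l2_adjoint X S a) u * \<phi> x"]) simp
qed

lemma fin_rank_adjoint:
  assumes T: "fin_rank X (L2 X) T"
  shows "\<exists>T'. fin_rank X (L2 X) T' \<and> (\<forall>u\<in>L2 X. \<forall>p\<in>L2 X. l2_inner X (T u) p = l2_inner X u (T' p))"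
  using T
proof (induction rule: fin_rank.induct)
  case fin_rank_zero
  show ?case by (intro exI[of _ "\<lambda>u x. 0"]) (simp add: fin_rank.fin_rank_zero)
next
  case (fin_rank_step T a \<phi>)
  then obtain T' where T': "fin_rank X (L2 X) T'" "\<forall>u\<in>L2 X. \<forall>p\<in>L2 X. l2_inner X (T u) p = l2_inner X u (T' p)" by blast
  have L: "T u \<in> L2 X" "T' u \<in> L2 X" for u using fin_rank_L2[OF fin_rank_step(1)] fin_rank_L2[OF T'(1)] by auto
  have "l2_inner X (\<lambda>x. T u x + l2_inner X a u * \<phi> x) p = l2_inner X u (\<lambda>x. T' p x + l2_inner X \<phi> p * a x)"
    if "u \<in> L2 X" "p \<in> L2 X" for u p
    using that L T'(2) fin_rank_step(2,3)
    by (simp add: l2_inner_add_left l2_inner_add_right l2_inner_scale_left l2_inner_scale_right L2_scale l2_inner_commute[of X u a])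
  then show ?case using fin_rank.fin_rank_step[OF T'(1) fin_rank_step(3,2)] by blast
qed

text \<open>Let z be the error of the transposed operator at p. Testing z against itself gives <(S -
  T) z, p>, so the bound for S - T passes to the adjoint with the same \<eta>.\<close>

lemma approximable_adjoint:
  assumes S: "l2_bounded_linear X X S" and A: "approximable X S"
  shows "approximable X (l2_adjoint X S)"
  unfolding approximable_def
proof (intro allI impI)
  fix \<eta> :: real assume \<eta>: "\<eta> > 0"
  obtain T where T: "fin_rank X (L2 X) T" "\<forall>u\<in>L2 X. l2_norm X (\<lambda>x. S u x - T u x) \<le> \<eta> * l2_norm X u"
    using A \<eta> unfolding approximable_def by blast
  obtain T' where T': "fin_rank X (L2 X) T'" "\<forall>u\<in>L2 X. \<forall>p\<in>L2 X. l2_inner X (T u) p = l2_inner X u (T' p)"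
    using fin_rank_adjoint[OF T(1)] by blast
  have TL: "T u \<in> L2 X" "T' u \<in> L2 X" for u using fin_rank_L2[OF T(1)] fin_rank_L2[OF T'(1)] by auto
  have "l2_norm X (\<lambda>x. l2_adjoint X S p x - T' p x) \<le> \<eta> * l2_norm X p" if p: "p \<in> L2 X" for p
  proof (rule l2_norm_le_of_inner)
    define z where "z = (\<lambda>x. l2_adjoint X S p x - T' p x)"
    have Sp: "l2_adjoint X S p \<in> L2 X" by (rule l2_adjoint_props(1)[OF S p])
    show zL: "(\<lambda>x. l2_adjoint X S p x - T' p x) \<in> L2 X" using Sp TL by auto
    then have z: "z \<in> L2 X" by (simp add: z_def)
    have SzL: "S z \<in> L2 X" by (rule l2_bounded_linear_in[OF S z])
    have "l2_inner X z z = l2_inner X z (l2_adjoint X S p) - l2_inner X z (T' p)"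
      using z Sp TL by (subst (2) z_def) (simp add: l2_inner_diff_right)
    also have "\<dots> = l2_inner X (S z) p - l2_inner X (T z) p"
      using l2_adjoint_props(2)[OF S p z] T'(2) z p by simp
    also have "\<dots> = l2_inner X (\<lambda>x. S z x - T z x) p" using SzL TL p by (simp add: l2_inner_diff_left)
    also have "\<dots> \<le> l2_norm X (\<lambda>x. S z x - T z x) * l2_norm X p"
      using l2_cauchy_schwarz[OF L2_diff[OF SzL TL(1)] p] by (meson abs_le_D1)
    also have "\<dots> \<le> (\<eta> * l2_norm X z) * l2_norm X p" using T(2) z by (intro mult_right_mono) auto
    finally show "l2_inner X (\<lambda>x. l2_adjoint X S p x - T' p x) (\<lambda>x. l2_adjoint X S p x - T' p x)
      \<le> \<eta> * l2_norm X p * l2_norm X (\<lambda>x. l2_adjoint X S p x - T' p x)" by (simp add: z_def mult_ac)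
    show "0 \<le> \<eta> * l2_norm X p" using \<eta> by simp
  qed
  then show "\<exists>T. fin_rank X (L2 X) T \<and> (\<forall>u\<in>L2 X. l2_norm X (\<lambda>x. l2_adjoint X S u x - T u x) \<le> \<eta> * l2_norm X u)"
    using T'(1) by blast
qed

text \<open>For s = 1 the norm refers to some chosen weak gradient, so it must be shown that every
  weak gradient of 0 has norm 0; it vanishes against all test functions. The zero function then
  makes the supremum in \<open>hs_dual_norm\<close> one over a non-empty set and is an admissible
  initialization.\<close>

lemma zero_in_Hs:
  fixes X :: "(real ^ 'd) set"
  assumes X: "open X" "closure X \<subseteq> torus_cell"
  shows "(\<lambda>x. 0) \<in> Hs X s" "hs_norm X s (\<lambda>x. 0) = 0"
proof -
  have wg: "weak_gradient X (\<lambda>x. 0) (\<lambda>x. 0 :: real ^ 'd)"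
    by (simp add: weak_gradient_def)
  show "(\<lambda>x. 0) \<in> Hs X s" using wg by (auto simp: Hs_def gagliardo_def)
  define g where "g = (SOME g. weak_gradient X (\<lambda>x. 0) g)"
  have g: "weak_gradient X (\<lambda>x. 0) g" unfolding g_def by (rule someI[of "weak_gradient X (\<lambda>x. 0)", OF wg])
  have "l2_norm X (\<lambda>x. g x \<bullet> b) = 0" if b: "b \<in> Basis" for b
  proof -
    have "l2_norm X (\<lambda>x. g x \<bullet> b) \<le> 0"
      using g b by (intro l2_norm_le_of_test_functions[OF X]) (auto simp: weak_gradient_def)
    then show ?thesis using l2_norm_nonneg[of X "\<lambda>x. g x \<bullet> b"] by linarith
  qed
  then show "hs_norm X s (\<lambda>x. 0) = 0" by (simp add: hs_norm_def g_def gagliardo_def)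
qed

text \<open>The functional <u, .> has dual norm at most the L^2 norm of u, because the L^2 norm is
  below the Sobolev norm. A representative v is returned because \<open>S u\<close> agrees with the
  Sobolev function only almost everywhere.\<close>

lemma factors_through_hs_bound:
  fixes X :: "(real ^ 'd) set"
  assumes X: "open X" "closure X \<subseteq> torus_cell" and S: "factors_through_hs X s S"
  shows "\<exists>C\<ge>0. \<forall>u\<in>L2 X. \<exists>v\<in>Hs X s. ae_eq X (S u) v \<and> hs_norm X s v \<le> C * l2_norm X u"
proof -
  obtain A where A: "dual_to_hs_bounded_linear X s A"
    and SA: "\<forall>u\<in>L2 X. ae_eq X (S u) (A (\<lambda>v. l2_inner X u v))"
    using S by (auto simp: factors_through_hs_def)
  obtain C where C: "\<forall>l\<in>Hs_dual X s. hs_norm X s (A l) \<le> C * hs_dual_norm X s l"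
    using A by (auto simp: dual_to_hs_bounded_linear_def)
  have "\<exists>v\<in>Hs X s. ae_eq X (S u) v \<and> hs_norm X s v \<le> \<bar>C\<bar> * l2_norm X u" if u: "u \<in> L2 X" for u
  proof -
    define l where "l v = l2_inner X u v" for v
    have bound: "\<bar>l v\<bar> \<le> l2_norm X u * hs_norm X s v" if "v \<in> Hs X s" for v
    proof -
      have "\<bar>l v\<bar> \<le> l2_norm X u * l2_norm X v" unfolding l_def by (rule l2_cauchy_schwarz[OF u Hs_L2[OF that]])
      also have "\<dots> \<le> l2_norm X u * hs_norm X s v" by (intro mult_left_mono l2_norm_le_hs_norm) simp
      finally show ?thesis .
    qed
    have l: "l \<in> Hs_dual X s"
      unfolding Hs_dual_def using bound
      by (auto simp: l_def l2_inner_add_right[OF Hs_L2 Hs_L2 u] l2_inner_scale_right)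
    have "hs_dual_norm X s l \<le> l2_norm X u"
      unfolding hs_dual_norm_def
    proof (rule cSUP_least)
      show "{v \<in> Hs X s. hs_norm X s v \<le> 1} \<noteq> {}"
        using zero_in_Hs[OF X, of s] by force
      fix v assume "v \<in> {v \<in> Hs X s. hs_norm X s v \<le> 1}"
      then show "\<bar>l v\<bar> \<le> l2_norm X u"
        using bound[of v] mult_left_mono[of "hs_norm X s v" 1 "l2_norm X u"] by auto
    qed
    moreover have "0 \<le> hs_dual_norm X s l"
      unfolding hs_dual_norm_def
    proof (rule cSUP_upper2[where x = "\<lambda>x. 0"])
      show "bdd_above ((\<lambda>v. \<bar>l v\<bar>) ` {v \<in> Hs X s. hs_norm X s v \<le> 1})"
      proof (rule bdd_aboveI2)
        fix v assume "v \<in> {v \<in> Hs X s. hs_norm X s v \<le> 1}"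
        then show "\<bar>l v\<bar> \<le> l2_norm X u"
          using bound[of v] mult_left_mono[of "hs_norm X s v" 1 "l2_norm X u"] by auto
      qed
    qed (use zero_in_Hs[OF X, of s] in auto)
    ultimately have "C * hs_dual_norm X s l \<le> \<bar>C\<bar> * l2_norm X u" by (intro mult_mono) auto
    then have "hs_norm X s (A l) \<le> \<bar>C\<bar> * l2_norm X u" using C l by fastforce
    moreover have "A l \<in> Hs X s" using A l by (simp add: dual_to_hs_bounded_linear_def)
    moreover have "ae_eq X (S u) (A l)" using SA u unfolding l_def by blast
    ultimately show ?thesis by blast
  qed
  then show ?thesis by (intro exI[of _ "\<bar>C\<bar>"]) auto
qed

text \<open>The embedding is approximated by a finite-rank T up to \<eta> / (C + 1), and T is then
  applied after S, whose values have Sobolev norm at most C times the norm of u.\<close>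

lemma approximable_of_factors_through_hs:
  fixes X :: "(real ^ 'd) set"
  assumes X: "bounded_lipschitz_domain X" "closure X \<subseteq> torus_cell" and s: "0 < s"
    and S: "l2_bounded_linear X X S" "factors_through_hs X s S"
  shows "approximable X S"
  unfolding approximable_def
proof (intro allI impI)
  fix \<eta> :: real assume \<eta>: "\<eta> > 0"
  have Xo: "open X" using X(1) by (simp add: bounded_lipschitz_domain_def)
  obtain C where C: "C \<ge> 0" "\<forall>u\<in>L2 X. \<exists>v\<in>Hs X s. ae_eq X (S u) v \<and> hs_norm X s v \<le> C * l2_norm X u"
    using factors_through_hs_bound[OF Xo X(2) S(2)] by blast
  define e where "e = \<eta> / (C + 1)"
  have e: "e > 0" "e * C \<le> \<eta>" using C(1) \<eta> by (auto simp: e_def field_simps)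
  obtain T where T: "fin_rank X (bounded_L2 X) T" "\<forall>v\<in>Hs X s. l2_norm X (\<lambda>x. v x - T v x) \<le> e * hs_norm X s v"
    using Hs_compactly_embedded[OF X s e(1)] by blast
  obtain T' where T': "fin_rank X (bounded_L2 X) T'" "\<forall>u\<in>L2 X. T' u = T (S u)"
    using fin_rank_comp[OF S(1) T(1)] by blast
  have "l2_norm X (\<lambda>x. S u x - T' u x) \<le> \<eta> * l2_norm X u" if u: "u \<in> L2 X" for u
  proof -
    obtain v where v: "v \<in> Hs X s" "ae_eq X (S u) v" "hs_norm X s v \<le> C * l2_norm X u" using C(2) u by blast
    have SuL: "S u \<in> L2 X" by (rule l2_bounded_linear_in[OF S(1) u])
    have vL: "v \<in> L2 X" by (rule Hs_L2[OF v(1)])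
    have eq: "T' u = T v"
      using T'(2) u fin_rank_cong[OF T(1) L2_measurable[OF SuL] L2_measurable[OF vL] v(2)] by simp
    have TvL: "T v \<in> L2 X" by (rule fin_rank_L2[OF T(1) bounded_L2_subset])
    have "ae_eq X (\<lambda>x. S u x - T v x) (\<lambda>x. v x - T v x)"
      using v(2) unfolding ae_eq_def by eventually_elim simp
    then have "l2_norm X (\<lambda>x. S u x - T' u x) = l2_norm X (\<lambda>x. v x - T v x)"
      unfolding eq using SuL vL TvL by (intro l2_norm_cong L2_measurable L2_diff)
    also have "\<dots> \<le> e * hs_norm X s v" using T(2) v(1) by blast
    also have "\<dots> \<le> e * (C * l2_norm X u)" using v(3) e by (intro mult_left_mono) auto
    also have "\<dots> \<le> \<eta> * l2_norm X u"
      using mult_right_mono[OF e(2), of "l2_norm X u"] by (simp add: mult.assoc)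
    finally show ?thesis .
  qed
  then show "\<exists>T. fin_rank X (L2 X) T \<and> (\<forall>u\<in>L2 X. l2_norm X (\<lambda>x. S u x - T u x) \<le> \<eta> * l2_norm X u)"
    using fin_rank_mono[OF T'(1) bounded_L2_subset] by blast
qed

text \<open>Each range function is replaced by a trigonometric polynomial, with an accuracy that
  compensates the norm of its functional. The output then has finitely many frequencies, as a
  truncated Fourier layer requires.\<close>

lemma fin_rank_trig_approx:
  fixes X :: "(real ^ 'd) set"
  assumes X: "X \<in> lmeasurable" "closure X \<subseteq> torus_cell" and T: "fin_rank X (L2 X) T" and \<eta>: "\<eta> > 0"
  shows "\<exists>T'. fin_rank X (Collect rtrig) T' \<and> (\<forall>u\<in>L2 X. l2_norm X (\<lambda>x. T u x - T' u x) \<le> \<eta> * l2_norm X u)"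
  using T \<eta>
proof (induction arbitrary: \<eta> rule: fin_rank.induct)
  case fin_rank_zero
  then show ?case by (intro exI[of _ "\<lambda>u x. 0"]) (simp add: fin_rank.fin_rank_zero)
next
  case (fin_rank_step T a \<phi>)
  obtain T' where T': "fin_rank X (Collect rtrig) T'" "\<forall>u\<in>L2 X. l2_norm X (\<lambda>x. T u x - T' u x) \<le> \<eta> / 2 * l2_norm X u"
    using fin_rank_step.IH[of "\<eta> / 2"] fin_rank_step.prems by auto
  define e where "e = \<eta> / 2 / (l2_norm X a + 1)"
  have pos: "l2_norm X a + 1 > 0" using l2_norm_nonneg[of X a] by linarith
  have e: "e > 0" "l2_norm X a * e \<le> \<eta> / 2"
    using fin_rank_step.prems pos by (auto simp: e_def field_simps)
  obtain q where q: "rtrig q" "l2_norm X (\<lambda>x. \<phi> x - q x) < e"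
    using rtrig_dense_L2[OF X fin_rank_step(3) e(1)] by blast
  have qL: "q \<in> L2 X" by (rule rtrig_in_L2[OF X q(1)])
  have sub: "Collect rtrig \<subseteq> L2 X" using rtrig_in_L2[OF X] by blast
  have "l2_norm X (\<lambda>x. (T u x + l2_inner X a u * \<phi> x) - (T' u x + l2_inner X a u * q x)) \<le> \<eta> * l2_norm X u"
    if u: "u \<in> L2 X" for u
  proof -
    have L: "T u \<in> L2 X" "T' u \<in> L2 X" using fin_rank_L2[OF fin_rank_step(1)] fin_rank_L2[OF T'(1) sub] by auto
    have "l2_norm X (\<lambda>x. (T u x + l2_inner X a u * \<phi> x) - (T' u x + l2_inner X a u * q x))
        = l2_norm X (\<lambda>x. (T u x - T' u x) + l2_inner X a u * (\<phi> x - q x))" by (simp add: algebra_simps)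
    also have "\<dots> \<le> l2_norm X (\<lambda>x. T u x - T' u x) + l2_norm X (\<lambda>x. l2_inner X a u * (\<phi> x - q x))"
      using L fin_rank_step(3) qL by (intro l2_norm_triangle L2_scale L2_diff)
    also have "\<dots> \<le> \<eta> / 2 * l2_norm X u + \<eta> / 2 * l2_norm X u"
    proof (rule add_mono)
      have "l2_norm X (\<lambda>x. l2_inner X a u * (\<phi> x - q x)) \<le> (l2_norm X a * l2_norm X u) * e"
        unfolding l2_norm_scale using q(2) e l2_cauchy_schwarz[OF fin_rank_step(2) u] by (intro mult_mono) auto
      also have "\<dots> = (l2_norm X a * e) * l2_norm X u" by (simp add: mult_ac)
      also have "\<dots> \<le> \<eta> / 2 * l2_norm X u" by (rule mult_right_mono[OF e(2)]) simp
      finally show "l2_norm X (\<lambda>x. l2_inner X a u * (\<phi> x - q x)) \<le> \<eta> / 2 * l2_norm X u" .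
    qed (use T'(2) u in auto)
    finally show ?thesis by simp
  qed
  then show ?case
    using fin_rank.fin_rank_step[OF T'(1) fin_rank_step(2), of q] q(1) by blast
qed

section \<open>Prescribing Fourier coefficients outside the domain\<close>

lemma character_distinct_at:
  assumes "k \<noteq> (l :: int ^ 'd)" "e > 0"
  shows "\<exists>a. norm a < e \<and> character k a \<noteq> character l a"
proof -
  obtain i where i: "k $ i \<noteq> l $ i" using assms(1) by (auto simp: vec_eq_iff)
  define m where "m = real_of_int (k $ i - l $ i)"
  have m: "m \<noteq> 0" using i by (simp add: m_def)
  \<comment> \<open>The bound 1 / |m| keeps m t strictly between -pi and pi, where the sine vanishes
    only at 0; so the two characters cannot agree at this shift.\<close>
  define t where "t = min (e / 2) (1 / \<bar>m\<bar>)"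
  have t: "t > 0" "t < e" "\<bar>m * t\<bar> \<le> 1"
    using assms(2) m by (auto simp: t_def abs_mult min_def field_simps)
  define a where "a = t *\<^sub>R (axis i 1 :: real ^ 'd)"
  have char: "character j a = cis (real_of_int (j $ i) * t)" for j :: "int ^ 'd"
  proof -
    have "(\<Sum>n\<in>UNIV. of_int (j $ n) * a $ n) = (\<Sum>n\<in>UNIV. if n = i then of_int (j $ i) * t else 0)"
      by (intro sum.cong) (auto simp: a_def axis_def)
    then show ?thesis by (simp add: character_def cis_conv_exp)
  qed
  have "character k a \<noteq> character l a"
  proof
    assume "character k a = character l a"
    then have "cis (real_of_int (k $ i) * t) / cis (real_of_int (l $ i) * t) = 1" by (simp add: char)
    then have "cis (m * t) = 1" by (simp add: cis_divide m_def left_diff_distrib)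
    then have "sin (m * t) = 0" by (metis cis.sel(2) one_complex.sel(2))
    moreover have "\<bar>m * t\<bar> < pi" using t(3) pi_gt3 by linarith
    ultimately have "m * t = 0" using sin_eq_0_pi by (metis abs_less_iff minus_less_iff)
    then show False using m t by simp
  qed
  moreover have "norm a < e" using t by (simp add: a_def norm_axis_1)
  ultimately show ?thesis by blast
qed

text \<open>Comparing \<open>f\<close> with its translate by \<open>a\<close> removes one frequency from \<open>f\<close>.\<close>

lemma characters_independent:
  fixes D :: "(real ^ 'd) set"
  assumes "finite J" "open D" "D \<noteq> {}" "\<And>x. x \<in> D \<Longrightarrow> (\<Sum>k\<in>J. c k * character k x) = 0"
  shows "\<forall>k\<in>J. c k = 0"
  using assms
proof (induction J arbitrary: c D rule: finite_induct)
  case (insert k0 J)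
  have c: "c k = 0" if k: "k \<in> J" for k
  proof -
    have "k \<noteq> k0" using k insert.hyps by auto
    obtain x0 e where x0: "x0 \<in> D" and e: "e > 0" "ball x0 e \<subseteq> D"
      using insert.prems(1,2) open_contains_ball by blast
    obtain a where a: "norm a < e" "character k a \<noteq> character k0 a"
      using character_distinct_at[OF \<open>k \<noteq> k0\<close> e(1)] by blast
    define D' where "D' = D \<inter> (\<lambda>x. x + a) -` D"
    have "open ((\<lambda>x. x + a) -` D)"
      using insert.prems(1) by (intro open_vimage) (auto intro: continuous_intros)
    then have D': "open D'" using insert.prems(1) by (simp add: D'_def open_Int)
    have "x0 + a \<in> D" using e(2) a(1) by (auto simp: dist_norm subset_iff)
    then have "D' \<noteq> {}" using x0 by (auto simp: D'_def)
    moreover have "(\<Sum>k\<in>J. (c k * (character k a - character k0 a)) * character k x) = 0" if "x \<in> D'" for x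
    proof -
      have "(\<Sum>k\<in>insert k0 J. c k * character k (x + a)) - character k0 a * (\<Sum>k\<in>insert k0 J. c k * character k x) = 0"
        using insert.prems(3)[of x] insert.prems(3)[of "x + a"] that by (simp add: D'_def del: sum.insert)
      then have "(\<Sum>k\<in>insert k0 J. (c k * (character k a - character k0 a)) * character k x) = 0"
        unfolding sum_distrib_left sum_subtractf[symmetric] character_shift by (simp add: algebra_simps)
      then show ?thesis using insert.hyps by simp
    qed
    ultimately have "\<forall>k\<in>J. c k * (character k a - character k0 a) = 0"
      by (intro insert.IH[OF D'])
    then show ?thesis using k a(2) by auto
  qed
  obtain x where x: "x \<in> D" using insert.prems(2) by blast
  have "c k0 * character k0 x = 0" using insert.prems(3)[OF x] insert.hyps c by simp
  moreover have "character k0 x \<noteq> 0" using cmod_character[of k0 x] by (metis norm_zero zero_neq_one)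
  ultimately show ?case using c by simp
qed simp

section \<open>A biorthogonal system for the characters on a compact set\<close>

lemma ctrig_continuous: "ctrig f \<Longrightarrow> continuous_on UNIV f"
  by (induction rule: ctrig.induct) (auto intro!: continuous_intros)

lemma ctrig_scale: "ctrig f \<Longrightarrow> ctrig (\<lambda>x. c * f x)"
  using ctrig_mult_char[of f c 0] by simp

lemma ctrig_sum: "finite I \<Longrightarrow> (\<And>i. i \<in> I \<Longrightarrow> ctrig (f i)) \<Longrightarrow> ctrig (\<lambda>x. \<Sum>i\<in>I. f i x)"
proof (induction I rule: finite_induct)
  case empty
  then show ?case using ctrig_char[of 0 0] by simp
next
  case (insert i I)
  then show ?case by (simp add: ctrig_add)
qed

lemma ctrig_diff: "ctrig f \<Longrightarrow> ctrig g \<Longrightarrow> ctrig (\<lambda>x. f x - g x)"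
  using ctrig_add[of f "\<lambda>x. (-1) * g x"] ctrig_scale[of g "-1"] by simp

lemma ctrig_character: "ctrig (character k)"
  using ctrig_char[of 1 k] by simp

lemma continuous_compact_integrable:
  fixes f :: "'a::euclidean_space \<Rightarrow> complex"
  assumes "compact K" "continuous_on UNIV f"
  shows "integrable (lebesgue_on K) f"
proof -
  have K: "K \<in> sets lebesgue" using assms(1) by (simp add: borel_compact)
  have "integrable lborel (\<lambda>x. indicator K x *\<^sub>R f x)"
    using assms by (intro borel_integrable_compact continuous_on_subset[OF assms(2)]) auto
  then have "integrable lebesgue (\<lambda>x. indicator K x *\<^sub>R f x)"
    by (subst integrable_completion) (auto dest: borel_measurable_integrable)
  then show ?thesis using K by (simp add: integrable_restrict_space)
qed

definition cinner_on :: "'a::euclidean_space set \<Rightarrow> ('a \<Rightarrow> complex) \<Rightarrow> ('a \<Rightarrow> complex) \<Rightarrow> complex" where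
  "cinner_on K f g = (\<integral>x. f x * cnj (g x) \<partial>lebesgue_on K)"

lemma cinner_integrable:
  assumes "compact K" "ctrig f" "ctrig g"
  shows "integrable (lebesgue_on K) (\<lambda>x. f x * cnj (g x))"
  using assms by (intro continuous_compact_integrable continuous_intros ctrig_continuous)

lemma cinner_diff_left:
  "compact K \<Longrightarrow> ctrig f \<Longrightarrow> ctrig f' \<Longrightarrow> ctrig g \<Longrightarrow>
    cinner_on K (\<lambda>x. f x - f' x) g = cinner_on K f g - cinner_on K f' g"
  by (simp add: cinner_on_def left_diff_distrib cinner_integrable)

lemma cinner_scale_left: "cinner_on K (\<lambda>x. c * f x) g = c * cinner_on K f g"
  by (simp add: cinner_on_def mult.assoc)

lemma cinner_commute: "cinner_on K f g = cnj (cinner_on K g f)"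
  by (simp add: cinner_on_def mult.commute flip: Bochner_Integration.integral_cnj)

lemma cinner_sum_left:
  assumes "compact K" "finite I" "\<And>i. i \<in> I \<Longrightarrow> ctrig (f i)" "ctrig g"
  shows "cinner_on K (\<lambda>x. \<Sum>i\<in>I. c i * f i x) g = (\<Sum>i\<in>I. c i * cinner_on K (f i) g)"
proof -
  have "cinner_on K (\<lambda>x. \<Sum>i\<in>I. c i * f i x) g = (\<integral>x. (\<Sum>i\<in>I. c i * (f i x * cnj (g x))) \<partial>lebesgue_on K)"
    by (simp add: cinner_on_def sum_distrib_right mult.assoc)
  also have "\<dots> = (\<Sum>i\<in>I. \<integral>x. c i * (f i x * cnj (g x)) \<partial>lebesgue_on K)"
    using assms by (intro Bochner_Integration.integral_sum integrable_mult_right cinner_integrable)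
  finally show ?thesis by (simp add: cinner_on_def)
qed

text \<open>A non-zero value at an interior point would persist on a non-empty open set, which is
  not negligible. Vanishing on the interior is the input for
  \<open>characters_independent\<close>.\<close>

lemma cinner_self_zero:
  assumes K: "compact K" and f: "ctrig f" and 0: "cinner_on K f f = 0" and x: "x \<in> interior K"
  shows "f x = 0"
proof (rule ccontr)
  assume "f x \<noteq> 0"
  have cont: "continuous_on UNIV f" using f by (rule ctrig_continuous)
  have KL: "K \<in> sets lebesgue" using K by (simp add: borel_compact)
  define W where "W = interior K \<inter> f -` (- {0})"
  have "open (f -` (- {0}))" using cont by (intro open_vimage) auto
  then have "open W" unfolding W_def by auto
  have "complex_of_real (\<integral>x. (cmod (f x))\<^sup>2 \<partial>lebesgue_on K) = 0"
    using 0 unfolding cinner_on_def by (simp add: complex_norm_square[symmetric] flip: integral_complex_of_real)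
  then have "(\<integral>x. (cmod (f x))\<^sup>2 \<partial>lebesgue_on K) = 0" by simp
  moreover have "integrable (lebesgue_on K) (\<lambda>x. (cmod (f x))\<^sup>2)"
  proof -
    have "integrable (lebesgue_on K) (\<lambda>x. complex_of_real ((cmod (f x))\<^sup>2))"
      using cont by (intro continuous_compact_integrable[OF K] continuous_intros)
    then show ?thesis by (simp only: complex_of_real_integrable_eq)
  qed
  ultimately have "AE x in lebesgue_on K. (cmod (f x))\<^sup>2 = 0"
    by (subst (asm) integral_nonneg_eq_0_iff_AE) auto
  then have "AE x in lebesgue. x \<in> K \<longrightarrow> f x = 0" by (simp add: AE_lebesgue_on_iff[OF KL])
  then have "AE x in lebesgue. x \<notin> W" by eventually_elim (use interior_subset in \<open>auto simp: W_def\<close>)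
  then have "negligible W"
    using \<open>open W\<close> by (simp add: negligible_iff_null_sets AE_iff_null_sets)
  then have "W = {}" using \<open>open W\<close> open_not_negligible by blast
  then show False using x \<open>f x \<noteq> 0\<close> by (auto simp: W_def)
qed

text \<open>On K the characters are no longer orthogonal, only independent. The dual system is built
  one frequency at a time, and each \<open>h k\<close> stays a trigonometric polynomial, hence
  continuous and integrable on K.\<close>

lemma characters_biorthogonal:
  fixes K :: "(real ^ 'd) set"
  assumes K: "compact K" "interior K \<noteq> {}" and J: "finite J"
  shows "\<exists>h. \<forall>k\<in>J. ctrig (h k) \<and> (\<forall>l\<in>J. cinner_on K (h k) (character l) = (if k = l then 1 else 0))"
  using J
proof (induction J rule: finite_induct)
  case (insert k0 J)
  then obtain h where h: "\<And>k. k \<in> J \<Longrightarrow> ctrig (h k)"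
    "\<And>k l. k \<in> J \<Longrightarrow> l \<in> J \<Longrightarrow> cinner_on K (h k) (character l) = (if k = l then 1 else 0)" by blast
  \<comment> \<open>These coefficients make \<open>r\<close> orthogonal to every \<open>h l\<close>.
    Independence of the characters on the interior of K is what prevents <r, r> from
    vanishing.\<close>
  define \<alpha> where "\<alpha> l = cnj (cinner_on K (h l) (character k0))" for l
  define r where "r x = character k0 x - (\<Sum>l\<in>J. \<alpha> l * character l x)" for x
  have r: "ctrig r"
    unfolding r_def using insert.hyps by (intro ctrig_diff ctrig_sum ctrig_scale ctrig_character)
  have hr: "cinner_on K (h l) r = 0" if l: "l \<in> J" for l
  proof -
    have "cinner_on K r (h l) = cinner_on K (character k0) (h l) - (\<Sum>j\<in>J. \<alpha> j * cinner_on K (character j) (h l))"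
      unfolding r_def using K insert.hyps h(1)[OF l]
      by (subst cinner_diff_left) (auto intro!: ctrig_character ctrig_sum ctrig_scale simp: cinner_sum_left ctrig_character)
    also have "(\<Sum>j\<in>J. \<alpha> j * cinner_on K (character j) (h l)) = (\<Sum>j\<in>J. if j = l then \<alpha> l else 0)"
      using h(2)[OF l] by (intro sum.cong) (auto simp: cinner_commute[of K "character _"])
    also have "\<dots> = cinner_on K (character k0) (h l)"
      using insert.hyps l by (simp add: \<alpha>_def cinner_commute[of K "character k0"])
    finally show ?thesis using cinner_commute[of K "h l" r] by simp
  qed
  have rr: "cinner_on K r r \<noteq> 0"
  proof
    assume "cinner_on K r r = 0"
    then have "(\<Sum>k\<in>insert k0 J. (if k = k0 then 1 else - \<alpha> k) * character k x) = 0" if "x \<in> interior K" for x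
    proof -
      have "(\<Sum>k\<in>J. (if k = k0 then 1 else - \<alpha> k) * character k x) = - (\<Sum>k\<in>J. \<alpha> k * character k x)"
        unfolding sum_negf[symmetric] using insert.hyps by (intro sum.cong) auto
      then show ?thesis
        using cinner_self_zero[OF K(1) r \<open>cinner_on K r r = 0\<close> that] insert.hyps by (simp add: r_def)
    qed
    from characters_independent[OF _ open_interior K(2) this]
    show False using insert.hyps by auto
  qed
  \<comment> \<open>Subtracting these multiples of the \<open>h l\<close> makes h' orthogonal to all
    old characters. The new character differs from \<open>r\<close> by old characters, and
    \<open>r\<close> is orthogonal to the \<open>h l\<close>, so the product of h' with the new
    character is <r, r>.\<close>
  define h' where "h' x = r x - (\<Sum>l\<in>J. cinner_on K r (character l) * h l x)" for x
  have h': "ctrig h'" unfolding h'_def using insert.hyps h(1) r by (intro ctrig_diff ctrig_sum ctrig_scale)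
  have h'_inner: "cinner_on K h' g = cinner_on K r g - (\<Sum>l\<in>J. cinner_on K r (character l) * cinner_on K (h l) g)"
    if "ctrig g" for g
    unfolding h'_def using K insert.hyps h(1) r that
    by (subst cinner_diff_left) (auto intro!: ctrig_sum ctrig_scale simp: cinner_sum_left)
  have h'J: "cinner_on K h' (character j) = 0" if j: "j \<in> J" for j
  proof -
    have "(\<Sum>l\<in>J. cinner_on K r (character l) * cinner_on K (h l) (character j)) =
        (\<Sum>l\<in>J. if l = j then cinner_on K r (character j) else 0)"
      using h(2) j by (intro sum.cong) auto
    then show ?thesis using h'_inner[OF ctrig_character] insert.hyps j by simp
  qed
  have h'0: "cinner_on K h' (character k0) = cinner_on K r r"
  proof -
    define \<beta> where "\<beta> l = - \<alpha> l" for l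
    have char_eq: "character k0 = (\<lambda>x. r x - (\<Sum>l\<in>J. \<beta> l * character l x))"
      by (rule ext) (simp add: r_def \<beta>_def sum_negf)
    have "cinner_on K (character k0) h' = cinner_on K r h' - (\<Sum>l\<in>J. \<beta> l * cinner_on K (character l) h')"
      unfolding char_eq using K insert.hyps r h'
      by (subst cinner_diff_left) (auto intro!: ctrig_sum ctrig_scale ctrig_character simp: cinner_sum_left ctrig_character)
    also have "(\<Sum>l\<in>J. \<beta> l * cinner_on K (character l) h') = 0"
      using h'J by (intro sum.neutral) (auto simp: cinner_commute[of K "character _"])
    finally have "cinner_on K h' (character k0) = cinner_on K h' r"
      using cinner_commute[of K h' "character k0"] cinner_commute[of K h' r] by simp
    also have "\<dots> = cinner_on K r r" using h'_inner[OF r] hr by simp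
    finally show ?thesis .
  qed
  define g0 where "g0 x = (1 / cinner_on K r r) * h' x" for x
  have g0: "ctrig g0" unfolding g0_def using h' by (rule ctrig_scale)
  have g0_inner: "cinner_on K g0 (character j) = (if j = k0 then 1 else 0)" if "j \<in> insert k0 J" for j
    unfolding g0_def cinner_scale_left using that h'J h'0 rr insert.hyps by auto
  \<comment> \<open>The old members may have a non-zero product with the new character; a multiple
    of \<open>g0\<close> removes it and disturbs no product with an old one.\<close>
  define H where "H k = (if k = k0 then g0 else (\<lambda>x. h k x - cinner_on K (h k) (character k0) * g0 x))" for k
  have "ctrig (H k) \<and> (\<forall>l\<in>insert k0 J. cinner_on K (H k) (character l) = (if k = l then 1 else 0))"
    if k: "k \<in> insert k0 J" for k
  proof (cases "k = k0")
    case True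
    then show ?thesis using g0 g0_inner by (auto simp: H_def)
  next
    case False
    then have kJ: "k \<in> J" using k by simp
    have "cinner_on K (H k) (character l) = cinner_on K (h k) (character l)
        - cinner_on K (h k) (character k0) * cinner_on K g0 (character l)" for l
      using False K(1) h(1)[OF kJ] g0
      by (simp add: H_def cinner_diff_left ctrig_character ctrig_scale cinner_scale_left)
    then have "\<forall>l\<in>insert k0 J. cinner_on K (H k) (character l) = (if k = l then 1 else 0)"
      using g0_inner h(2)[OF kJ] False insert.hyps by auto
    moreover have "ctrig (H k)" using False h(1)[OF kJ] g0 by (simp add: H_def ctrig_diff ctrig_scale)
    ultimately show ?thesis by blast
  qed
  then show ?case by blast
qed simp

section \<open>Extension operators and Fourier coefficients of real functions\<close>

lemma integral_lebesgue_on_indicator: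
  fixes f :: "'a::euclidean_space \<Rightarrow> 'b::{banach, second_countable_topology}"
  assumes "S \<in> sets lebesgue"
  shows "(\<integral>x. f x \<partial>lebesgue_on S) = (\<integral>x. indicator S x *\<^sub>R f x \<partial>lebesgue)"
  using assms by (simp add: integral_restrict_space)

lemma fin_rank_additive:
  assumes "fin_rank X \<Phi> T" "u \<in> L2 X" "v \<in> L2 X"
  shows "T (\<lambda>x. u x + v x) y = T u y + T v y" "T (\<lambda>x. c * u x) y = c * T u y"
  using assms(1)
  by (induction rule: fin_rank.induct)
    (use assms(2,3) in \<open>auto simp: l2_inner_add_right l2_inner_scale_right algebra_simps\<close>)

lemma fin_rank_bound:
  assumes "fin_rank X (L2 Y) T"
  shows "\<exists>C\<ge>0. \<forall>u\<in>L2 X. l2_norm Y (T u) \<le> C * l2_norm X u"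
  using assms
proof (induction rule: fin_rank.induct)
  case fin_rank_zero
  show ?case by (rule exI[of _ 0]) simp
next
  case (fin_rank_step T a \<phi>)
  then obtain C where C: "C \<ge> 0" "\<forall>u\<in>L2 X. l2_norm Y (T u) \<le> C * l2_norm X u" by blast
  have TL: "T u \<in> L2 Y" for u
    using fin_rank_step(1) by (induction rule: fin_rank.induct) (auto intro!: L2_add L2_scale)
  have "l2_norm Y (\<lambda>x. T u x + l2_inner X a u * \<phi> x) \<le> (C + l2_norm X a * l2_norm Y \<phi>) * l2_norm X u"
    if u: "u \<in> L2 X" for u
  proof -
    have "l2_norm Y (\<lambda>x. T u x + l2_inner X a u * \<phi> x) \<le> l2_norm Y (T u) + l2_norm Y (\<lambda>x. l2_inner X a u * \<phi> x)"
      by (intro l2_norm_triangle TL L2_scale fin_rank_step(3))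
    also have "\<dots> \<le> C * l2_norm X u + (l2_norm X a * l2_norm X u) * l2_norm Y \<phi>"
      unfolding l2_norm_scale using C(2) u l2_cauchy_schwarz[OF fin_rank_step(2) u]
      by (intro add_mono mult_right_mono) auto
    finally show ?thesis by (simp add: algebra_simps)
  qed
  then show ?case using C(1) by (intro exI[of _ "C + l2_norm X a * l2_norm Y \<phi>"]) auto
qed

lemma L2_indicator_extend:
  assumes "u \<in> L2 X" "X \<subseteq> Y" "X \<in> sets lebesgue" "Y \<in> sets lebesgue"
  shows "(\<lambda>x. indicator X x * u x) \<in> L2 Y" "l2_norm Y (\<lambda>x. indicator X x * u x) = l2_norm X u"
proof -
  have eq: "indicator Y x *\<^sub>R (indicator X x * u x)\<^sup>2 = indicator X x *\<^sub>R (u x)\<^sup>2" for x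
    using assms(2) by (auto simp: indicator_def)
  have "integrable lebesgue (\<lambda>x. indicator X x *\<^sub>R (u x)\<^sup>2)"
    using L2_integrable_sq[OF assms(1)] assms(3) by (simp add: integrable_restrict_space)
  then have "integrable (lebesgue_on Y) (\<lambda>x. (indicator X x * u x)\<^sup>2)"
    using assms(4) by (simp only: integrable_restrict_space sets.Int_space_eq2 eq)
  moreover have "(\<lambda>x. indicator X x * u x) \<in> borel_measurable (lebesgue_on Y)"
  proof -
    have "(\<lambda>x. indicator X x *\<^sub>R u x) \<in> borel_measurable lebesgue"
      using L2_measurable[OF assms(1)] assms(3) by (simp add: borel_measurable_restrict_space_iff)
    then show ?thesis by (intro measurable_restrict_space1) simp
  qed
  ultimately show "(\<lambda>x. indicator X x * u x) \<in> L2 Y" by (simp add: L2_def)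
  have "(l2_norm Y (\<lambda>x. indicator X x * u x))\<^sup>2 = (l2_norm X u)\<^sup>2"
    unfolding l2_norm_sq_integral using assms(3,4)
    by (simp only: integral_restrict_space sets.Int_space_eq2 eq)
  then show "l2_norm Y (\<lambda>x. indicator X x * u x) = l2_norm X u" by simp
qed

text \<open>Extension by zero is bounded, and adding a finite-rank operator with range supported off
  X changes neither boundedness nor the restriction to X. All extension operators of the
  construction have this shape.\<close>

lemma extension_operatorI:
  fixes X :: "(real ^ 'd) set"
  assumes X: "X \<in> sets lebesgue" "X \<subseteq> torus_cell" and T: "fin_rank X (L2 torus_cell) T"
    and zero: "\<And>u x. x \<in> X \<Longrightarrow> T u x = 0"
  shows "extension_operator X (\<lambda>u x. indicator X x * u x + T u x)"
proof -
  have cell: "torus_cell \<in> sets lebesgue" by (simp add: torus_cell_def)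
  note ext = L2_indicator_extend[OF _ X(2,1) cell]
  have TL: "T u \<in> L2 torus_cell" for u
    using T by (induction rule: fin_rank.induct) (auto intro!: L2_add L2_scale)
  obtain C where C: "C \<ge> 0" "\<forall>u\<in>L2 X. l2_norm torus_cell (T u) \<le> C * l2_norm X u"
    using fin_rank_bound[OF T] by blast
  show ?thesis
    unfolding extension_operator_def l2_bounded_linear_def
  proof (intro conjI ballI allI)
    fix u :: "real ^ 'd \<Rightarrow> real" assume u: "u \<in> L2 X"
    show "(\<lambda>x. indicator X x * u x + T u x) \<in> L2 torus_cell" using ext(1)[OF u] TL by auto
    show "ae_eq torus_cell (\<lambda>x. indicator X x * (c * u x) + T (\<lambda>x. c * u x) x) (\<lambda>x. c * (indicator X x * u x + T u x))" for c
      using fin_rank_additive(2)[OF T u u, of c] by (simp add: ae_eq_def algebra_simps)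
    show "ae_eq X (\<lambda>x. indicator X x * u x + T u x) u"
      unfolding ae_eq_def by (rule AE_I2) (simp add: zero)
  next
    fix u v :: "real ^ 'd \<Rightarrow> real" assume u: "u \<in> L2 X" and v: "v \<in> L2 X"
    show "ae_eq torus_cell (\<lambda>x. indicator X x * (u x + v x) + T (\<lambda>x. u x + v x) x)
      (\<lambda>x. indicator X x * u x + T u x + (indicator X x * v x + T v x))"
      using fin_rank_additive(1)[OF T u v] by (simp add: ae_eq_def algebra_simps)
  next
    show "\<exists>C. \<forall>u\<in>L2 X. l2_norm torus_cell (\<lambda>x. indicator X x * u x + T u x) \<le> C * l2_norm X u"
    proof (intro exI[of _ "1 + C"] ballI)
      fix u assume u: "u \<in> L2 X"
      show "l2_norm torus_cell (\<lambda>x. indicator X x * u x + T u x) \<le> (1 + C) * l2_norm X u"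
        using l2_norm_triangle[OF ext(1)[OF u] TL, of u] ext(2)[OF u] C(2) u by (simp add: distrib_right) force
    qed
  qed
qed

lemma fourier_coeff_add:
  assumes "u \<in> L2 torus_cell" "v \<in> L2 torus_cell"
  shows "fourier_coeff (\<lambda>x. u x + v x) k = fourier_coeff u k + fourier_coeff v k"
proof -
  have cell: "torus_cell \<in> lmeasurable" by (simp add: torus_cell_def lmeasurable_box)
  have int: "integrable (lebesgue_on torus_cell) (\<lambda>x. of_real (w x) * character (- k) x)" if w: "w \<in> L2 torus_cell" for w
  proof (rule Bochner_Integration.integrable_bound)
    show "integrable (lebesgue_on torus_cell) w"
      using L2_mult_integrable[OF w L2_const[OF cell, of 1]] by simp
    have "character (- k) \<in> borel_measurable borel"
      by (intro borel_measurable_continuous_onI) (auto intro!: continuous_intros)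
    then have "character (- k) \<in> borel_measurable (lebesgue_on torus_cell)"
      by (intro measurable_restrict_space1 measurable_completion) simp
    then show "(\<lambda>x. of_real (w x) * character (- k) x) \<in> borel_measurable (lebesgue_on torus_cell)"
      using L2_measurable[OF w] by measurable
  qed (simp add: norm_mult)
  show ?thesis
    using int[OF assms(1)] int[OF assms(2)]
    by (simp add: fourier_coeff_def distrib_right add_divide_distrib)
qed

lemma fourier_coeff_zero [simp]: "fourier_coeff (\<lambda>x. 0) k = 0"
  by (simp add: fourier_coeff_def)

lemma fourier_coeff_sum:
  assumes "finite J" "\<And>j. j \<in> J \<Longrightarrow> f j \<in> L2 torus_cell"
  shows "fourier_coeff (\<lambda>x. \<Sum>j\<in>J. f j x) k = (\<Sum>j\<in>J. fourier_coeff (f j) k)"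
  using assms by (induction J rule: finite_induct) (simp_all add: fourier_coeff_add L2_sum)

lemma fourier_coeff_cnj: "fourier_coeff u (- k) = cnj (fourier_coeff u k)"
proof -
  have "(\<integral>x. of_real (u x) * character k x \<partial>lebesgue_on torus_cell)
      = (\<integral>x. cnj (of_real (u x) * character (- k) x) \<partial>lebesgue_on torus_cell)"
    by (intro Bochner_Integration.integral_cong) (simp_all add: character_uminus)
  also have "\<dots> = cnj (\<integral>x. of_real (u x) * character (- k) x \<partial>lebesgue_on torus_cell)"
    by (rule Bochner_Integration.integral_cnj)
  finally show ?thesis by (simp add: fourier_coeff_def)
qed

text \<open>If the closure of X filled the cell, the open box would be closed, which it is not since
  0 belongs only to its closure. The resulting ball off X is the room in which Fourier coefficients
  are adjusted.\<close>

lemma torus_cell_diff_ball: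
  fixes X :: "(real ^ 'd) set"
  assumes "bounded X" "closure X \<subseteq> torus_cell"
  obtains K :: "(real ^ 'd) set" where "compact K" "interior K \<noteq> {}" "K \<subseteq> torus_cell" "K \<inter> X = {}"
proof -
  define c :: "real ^ 'd" where "c = (\<chi> i. 2 * pi)"
  have cell: "torus_cell = box 0 c" by (simp add: torus_cell_def c_def)
  have ne: "box 0 c \<noteq> {}" by (simp add: interval_ne_empty_cart c_def)
  have "torus_cell - closure X \<noteq> {}"
  proof
    assume "torus_cell - closure X = {}"
    then have "torus_cell = closure X" using assms(2) by blast
    then have "closure (box 0 c) = box 0 c" by (metis cell closure_closure)
    then have "cbox 0 c = box 0 c" using closure_box[OF ne] by simp
    moreover have "0 \<in> cbox 0 c" by (simp add: mem_box_cart c_def)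
    moreover have "0 \<notin> box 0 c" by (simp add: mem_box_cart)
    ultimately show False by blast
  qed
  then obtain x where x: "x \<in> torus_cell - closure X" by blast
  have "open (torus_cell - closure X)" unfolding cell by (intro open_Diff open_box closed_closure)
  then obtain e where e: "e > 0" "cball x e \<subseteq> torus_cell - closure X" using x open_contains_cball by blast
  have "cball x e \<subseteq> torus_cell" "cball x e \<inter> X = {}" using e(2) closure_subset[of X] by auto
  then show thesis using e(1) by (intro that[of "cball x e"]) (auto simp: interior_cball)
qed

text \<open>Writing Re w = (w + cnj w) / 2 splits the coefficient into products with the characters
  l and -l. For h from the biorthogonal system these single out two opposite frequencies.\<close>

lemma fourier_coeff_Re:
  fixes K :: "(real ^ 'd) set"
  assumes K: "compact K" "K \<subseteq> torus_cell" and h: "ctrig h"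
  shows "(\<lambda>x. indicator K x * Re (\<zeta> * h x)) \<in> L2 torus_cell"
    "fourier_coeff (\<lambda>x. indicator K x * Re (\<zeta> * h x)) l
      = (\<zeta> * cinner_on K h (character l) + cnj (\<zeta> * cinner_on K h (character (- l)))) / (2 * of_real ((2 * pi) ^ CARD('d)))"
proof -
  have KL: "K \<in> sets lebesgue" and cell: "torus_cell \<in> sets lebesgue"
    using K(1) by (auto simp: borel_compact torus_cell_def)
  have Km: "K \<in> lmeasurable" using K(1) by (rule lmeasurable_compact)
  have cont: "continuous_on UNIV (\<lambda>x. Re (\<zeta> * h x))"
    using ctrig_continuous[OF h] by (intro continuous_intros)
  obtain C where "\<forall>x\<in>K. \<bar>Re (\<zeta> * h x)\<bar> \<le> C"
    using compact_continuous_abs_bound[OF K(1) continuous_on_subset[OF cont]] by blast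
  then have "(\<lambda>x. Re (\<zeta> * h x)) \<in> L2 K"
    by (intro L2_bounded[OF Km continuous_imp_lebesgue_on_measurable[OF cont], of C]) auto
  then show "(\<lambda>x. indicator K x * Re (\<zeta> * h x)) \<in> L2 torus_cell"
    by (rule L2_indicator_extend(1)[OF _ K(2) KL cell])
  define A where "A x = h x * cnj (character l x)" for x
  define B where "B x = h x * cnj (character (- l) x)" for x
  have int: "integrable (lebesgue_on K) A" "integrable (lebesgue_on K) B"
    unfolding A_def B_def by (intro cinner_integrable K(1) h ctrig_character)+
  have "(\<integral>x. of_real (indicator K x * Re (\<zeta> * h x)) * character (- l) x \<partial>lebesgue_on torus_cell)
      = (\<integral>x. indicator torus_cell x *\<^sub>R (of_real (indicator K x * Re (\<zeta> * h x)) * character (- l) x) \<partial>lebesgue)"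
    by (rule integral_lebesgue_on_indicator[OF cell])
  also have "\<dots> = (\<integral>x. indicator K x *\<^sub>R (of_real (Re (\<zeta> * h x)) * character (- l) x) \<partial>lebesgue)"
    by (intro Bochner_Integration.integral_cong) (use K(2) in \<open>auto simp: indicator_def\<close>)
  also have "\<dots> = (\<integral>x. of_real (Re (\<zeta> * h x)) * character (- l) x \<partial>lebesgue_on K)"
    by (rule integral_lebesgue_on_indicator[OF KL, symmetric])
  also have "\<dots> = (\<integral>x. (\<zeta> * A x + cnj (\<zeta> * B x)) / 2 \<partial>lebesgue_on K)"
  proof (rule Bochner_Integration.integral_cong)
    fix x
    have Re_eq: "of_real (Re (\<zeta> * h x)) = (\<zeta> * h x + cnj (\<zeta> * h x)) / 2" by (simp only: complex_add_cnj) simp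
    show "of_real (Re (\<zeta> * h x)) * character (- l) x = (\<zeta> * A x + cnj (\<zeta> * B x)) / 2"
      unfolding Re_eq A_def B_def character_uminus by (simp add: field_simps)
  qed simp
  also have "\<dots> = (\<zeta> * (\<integral>x. A x \<partial>lebesgue_on K) + cnj (\<zeta> * (\<integral>x. B x \<partial>lebesgue_on K))) / 2"
    using int by (simp add: integral_cnj)
  also have "\<dots> = (\<zeta> * cinner_on K h (character l) + cnj (\<zeta> * cinner_on K h (character (- l)))) / 2"
    by (simp add: A_def[abs_def] B_def[abs_def] cinner_on_def)
  finally have eq: "(\<integral>x. of_real (indicator K x * Re (\<zeta> * h x)) * character (- l) x \<partial>lebesgue_on torus_cell)
      = (\<zeta> * cinner_on K h (character l) + cnj (\<zeta> * cinner_on K h (character (- l)))) / 2" .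
  show "fourier_coeff (\<lambda>x. indicator K x * Re (\<zeta> * h x)) l
      = (\<zeta> * cinner_on K h (character l) + cnj (\<zeta> * cinner_on K h (character (- l)))) / (2 * of_real ((2 * pi) ^ CARD('d)))"
    unfolding fourier_coeff_def eq by (simp only: divide_divide_eq_left)
qed

text \<open>The values of \<open>E u\<close> outside the closure of the domain are free, which allows its low Fourier
  coefficients to be arbitrary bounded functionals of \<open>u\<close>.\<close>

lemma extension_prescribed_fourier:
  fixes X :: "(real ^ 'd) set" and a b :: "int ^ 'd \<Rightarrow> real ^ 'd \<Rightarrow> real"
  assumes X: "open X" "bounded X" "closure X \<subseteq> torus_cell"
    and ab: "\<And>k. a k \<in> L2 X" "\<And>k. b k \<in> L2 X"
  defines "z \<equiv> \<lambda>k u. Complex (l2_inner X (a k) u) (l2_inner X (b k) u)"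
  shows "\<exists>E. extension_operator X E \<and>
    (\<forall>u\<in>L2 X. \<forall>l\<in>modes K0. fourier_coeff (E u) l = (z l u + cnj (z (- l) u)) / 2)"
proof -
  have XL: "X \<in> sets lebesgue" and XT: "X \<subseteq> torus_cell" using X closure_subset by auto
  have Xm: "X \<in> lmeasurable" using X by (simp add: lmeasurable_open)
  have cell: "torus_cell \<in> sets lebesgue" by (simp add: torus_cell_def)
  obtain K :: "(real ^ 'd) set" where K: "compact K" "interior K \<noteq> {}" "K \<subseteq> torus_cell" "K \<inter> X = {}"
    using torus_cell_diff_ball[OF X(2,3)] .
  obtain h where h: "\<And>k. k \<in> modes K0 \<Longrightarrow> ctrig (h k)"
    "\<And>k l. k \<in> modes K0 \<Longrightarrow> l \<in> modes K0 \<Longrightarrow> cinner_on K (h k) (character l) = (if k = l then 1 else 0)"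
    using characters_biorthogonal[OF K(1,2) finite_modes[of K0]] by blast
  define P where "P = (2 * pi) ^ CARD('d)"
  have P: "P > 0" by (simp add: P_def)
  \<comment> \<open>\<open>C k\<close> and \<open>D k\<close> are the kernels of the real and
    imaginary parts of the Fourier coefficient that the extension of u by zero already has.\<close>
  define C where "C k x = Re (character k x) / P" for k :: "int ^ 'd" and x
  define D where "D k x = - Im (character k x) / P" for k :: "int ^ 'd" and x
  have char_cont: "continuous_on UNIV (character k)" for k :: "int ^ 'd"
    by (intro continuous_intros)
  have CD: "C k \<in> L2 X" "D k \<in> L2 X" for k
  proof -
    have "continuous_on UNIV (C k)" "continuous_on UNIV (D k)"
      unfolding C_def D_def using P by (auto intro!: continuous_intros char_cont)
    moreover have "\<bar>C k x\<bar> \<le> 1 / P" "\<bar>D k x\<bar> \<le> 1 / P" for x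
      using P abs_Re_le_cmod[of "character k x"] abs_Im_le_cmod[of "character k x"]
      by (auto simp: C_def D_def abs_divide divide_right_mono)
    ultimately show "C k \<in> L2 X" "D k \<in> L2 X"
      by (auto intro!: L2_bounded[OF Xm, of _ "1 / P"] continuous_imp_lebesgue_on_measurable)
  qed
  \<comment> \<open>What the correction on K must contribute: the wanted functional minus the
    coefficient already present, multiplied by (2 pi)^d because \<open>fourier_coeff\<close> divides
    by it.\<close>
  define \<alpha> where "\<alpha> k = (\<lambda>x. P * (a k x - C k x))" for k
  define \<beta> where "\<beta> k = (\<lambda>x. P * (b k x - D k x))" for k
  have \<alpha>\<beta>: "\<alpha> k \<in> L2 X" "\<beta> k \<in> L2 X" for k
    unfolding \<alpha>_def \<beta>_def using ab CD by (auto intro!: L2_scale L2_diff)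
  define \<zeta> where "\<zeta> k u = Complex (l2_inner X (\<alpha> k) u) (l2_inner X (\<beta> k) u)" for k u
  define T where "T u x = (\<Sum>k\<in>modes K0. indicator K x * Re (\<zeta> k u * h k x))" for u x
  have term_eq: "indicator K x * Re (\<zeta> k u * h k x) =
      l2_inner X (\<alpha> k) u * (indicator K x * Re (1 * h k x)) + l2_inner X (\<beta> k) u * (indicator K x * Re (\<i> * h k x))" for k u x
    by (simp add: \<zeta>_def algebra_simps)
  have Re_L2: "(\<lambda>x. indicator K x * Re (c * h k x)) \<in> L2 torus_cell" if "k \<in> modes K0" for c k
    by (rule fourier_coeff_Re(1)[OF K(1,3) h(1)[OF that]])
  have T: "fin_rank X (L2 torus_cell) T"
    unfolding T_def term_eq sum.distrib
    by (intro fin_rank_add fin_rank_sum finite_modes \<alpha>\<beta> Re_L2)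
  define E where "E u x = indicator X x * u x + T u x" for u x
  have "T u x = 0" if "x \<in> X" for u x
    using K(4) that by (auto simp: T_def indicator_def intro!: sum.neutral)
  then have "extension_operator X E"
    unfolding E_def[abs_def] by (intro extension_operatorI XL XT T)
  moreover have "fourier_coeff (E u) l = (z l u + cnj (z (- l) u)) / 2" if u: "u \<in> L2 X" and l: "l \<in> modes K0" for u l
  proof -
    have ml: "- l \<in> modes K0" using l by (simp add: modes_uminus)
    define w where "w k = fourier_coeff (\<lambda>x. indicator X x * u x) k" for k
    have uext: "(\<lambda>x. indicator X x * u x) \<in> L2 torus_cell"
      by (rule L2_indicator_extend(1)[OF u XT XL cell])
    have TL: "T u \<in> L2 torus_cell"
      unfolding T_def by (intro L2_sum fourier_coeff_Re(1)[OF K(1,3) h(1)])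
    have w: "w k = Complex (l2_inner X (C k) u) (l2_inner X (D k) u)" for k
    proof -
      have int: "integrable (lebesgue_on X) (\<lambda>x. C k x * u x)" "integrable (lebesgue_on X) (\<lambda>x. D k x * u x)"
        using CD u by (auto intro: L2_mult_integrable)
      have "(\<integral>x. of_real (indicator X x * u x) * character (- k) x \<partial>lebesgue_on torus_cell)
          = (\<integral>x. indicator torus_cell x *\<^sub>R (of_real (indicator X x * u x) * character (- k) x) \<partial>lebesgue)"
        by (rule integral_lebesgue_on_indicator[OF cell])
      also have "\<dots> = (\<integral>x. indicator X x *\<^sub>R (of_real (u x) * character (- k) x) \<partial>lebesgue)"
        by (intro Bochner_Integration.integral_cong) (use XT in \<open>auto simp: indicator_def\<close>)
      also have "\<dots> = (\<integral>x. of_real (u x) * character (- k) x \<partial>lebesgue_on X)"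
        by (rule integral_lebesgue_on_indicator[OF XL, symmetric])
      also have "\<dots> = (\<integral>x. of_real P * (of_real (C k x * u x) + \<i> * of_real (D k x * u x)) \<partial>lebesgue_on X)"
        using P by (intro Bochner_Integration.integral_cong)
          (simp_all add: C_def D_def complex_eq_iff character_uminus)
      also have "\<dots> = of_real P * (of_real (\<integral>x. C k x * u x \<partial>lebesgue_on X) + \<i> * of_real (\<integral>x. D k x * u x \<partial>lebesgue_on X))"
        using int by (simp del: of_real_mult)
      finally show ?thesis
        unfolding w_def fourier_coeff_def P_def[symmetric] using P by (simp add: l2_inner_def complex_eq_iff)
    qed
    have \<zeta>: "\<zeta> k u = of_real P * (z k u - w k)" for k
      unfolding \<zeta>_def z_def w \<alpha>_def \<beta>_def using ab CD u
      by (simp add: complex_eq_iff l2_inner_scale_left l2_inner_diff_left)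
    have "fourier_coeff (T u) l = (\<Sum>k\<in>modes K0. fourier_coeff (\<lambda>x. indicator K x * Re (\<zeta> k u * h k x)) l)"
      unfolding T_def by (rule fourier_coeff_sum[OF finite_modes Re_L2])
    also have "\<dots> = (\<Sum>k\<in>modes K0. (\<zeta> k u * cinner_on K (h k) (character l)
        + cnj (\<zeta> k u * cinner_on K (h k) (character (- l)))) / (2 * of_real P))"
      unfolding P_def by (intro sum.cong refl fourier_coeff_Re(2)[OF K(1,3) h(1)])
    also have "\<dots> = (\<Sum>k\<in>modes K0. (if k = l then \<zeta> k u / (2 * of_real P) else 0) + (if k = - l then cnj (\<zeta> k u) / (2 * of_real P) else 0))"
    proof (intro sum.cong refl)
      fix k :: "int ^ 'd" assume "k \<in> modes K0"
      have if_eq: "(c * (if A then 1 else 0) + cnj (c * (if B then 1 else 0))) / p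
        = (if A then c / p else 0) + (if B then cnj c / p else 0)" for c p :: complex and A B
        by (simp add: add_divide_distrib)
      show "(\<zeta> k u * cinner_on K (h k) (character l) + cnj (\<zeta> k u * cinner_on K (h k) (character (- l)))) / (2 * of_real P)
        = (if k = l then \<zeta> k u / (2 * of_real P) else 0) + (if k = - l then cnj (\<zeta> k u) / (2 * of_real P) else 0)"
        unfolding h(2)[OF \<open>k \<in> modes K0\<close> l] h(2)[OF \<open>k \<in> modes K0\<close> ml] by (rule if_eq)
    qed
    also have "\<dots> = (\<zeta> l u + cnj (\<zeta> (- l) u)) / (2 * of_real P)"
      using l ml by (simp add: sum.distrib add_divide_distrib)
    also have "\<dots> = ((z l u - w l) + cnj (z (- l) u - w (- l))) / 2"
      using P by (simp add: \<zeta> field_simps)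
    finally have "fourier_coeff (T u) l = ((z l u - w l) + cnj (z (- l) u - w (- l))) / 2" .
    moreover have "w (- l) = cnj (w l)" unfolding w_def by (rule fourier_coeff_cnj)
    moreover have "fourier_coeff (E u) l = w l + fourier_coeff (T u) l"
      unfolding E_def[abs_def] w_def using fourier_coeff_add[OF uext TL] .
    ultimately show ?thesis by (simp add: field_simps)
  qed
  ultimately show ?thesis by blast
qed

section \<open>Approximation by Fourier neural operators\<close>

text \<open>Here the operator appears as a truncated Fourier sum whose coefficients are bounded
  functionals of u, given by pairs of real representers; this is the format accepted by
  \<open>extension_prescribed_fourier\<close>.\<close>

lemma fin_rank_trig_modes:
  assumes "fin_rank X (Collect rtrig) T"
  shows "\<exists>K0. \<forall>K\<ge>K0. \<exists>a b. (\<forall>k. a k \<in> L2 X \<and> b k \<in> L2 X) \<and>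
    (\<forall>u\<in>L2 X. \<forall>x. T u x = Re (\<Sum>k\<in>modes K. Complex (l2_inner X (a k) u) (l2_inner X (b k) u) * character k x))"
  using assms
proof (induction rule: fin_rank.induct)
  case fin_rank_zero
  have "\<exists>a b. (\<forall>k :: int ^ 'a. a k \<in> L2 X \<and> b k \<in> L2 X) \<and>
    (\<forall>u\<in>L2 X. \<forall>x. (0 :: real) = Re (\<Sum>k\<in>modes K. Complex (l2_inner X (a k) u) (l2_inner X (b k) u) * character k x))" for K
    by (intro exI[of _ "\<lambda>k x. 0"]) (auto simp: Complex_eq_0 intro!: sum.neutral)
  then show ?case by blast
next
  case (fin_rank_step T c \<phi>)
  obtain K1 where K1: "\<And>K. K \<ge> K1 \<Longrightarrow> \<exists>a b. (\<forall>k. a k \<in> L2 X \<and> b k \<in> L2 X) \<and>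
    (\<forall>u\<in>L2 X. \<forall>x. T u x = Re (\<Sum>k\<in>modes K. Complex (l2_inner X (a k) u) (l2_inner X (b k) u) * character k x))"
    using fin_rank_step.IH by blast
  have "ctrig (\<lambda>x. complex_of_real (\<phi> x))" using fin_rank_step(3) by (simp add: rtrig_imp_ctrig)
  from ctrig_modes[OF this] obtain K2 where
    K2: "\<And>K. K \<ge> K2 \<Longrightarrow> \<exists>d. (\<lambda>x. complex_of_real (\<phi> x)) = (\<lambda>x. \<Sum>k\<in>modes K. d k * character k x)" by blast
  have "\<exists>a b. (\<forall>k. a k \<in> L2 X \<and> b k \<in> L2 X) \<and> (\<forall>u\<in>L2 X. \<forall>x. T u x + l2_inner X c u * \<phi> x =
      Re (\<Sum>k\<in>modes K. Complex (l2_inner X (a k) u) (l2_inner X (b k) u) * character k x))" if K: "K \<ge> max K1 K2" for K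
  proof -
    obtain a b where ab: "\<And>k. a k \<in> L2 X" "\<And>k. b k \<in> L2 X"
      "\<And>u x. u \<in> L2 X \<Longrightarrow> T u x = Re (\<Sum>k\<in>modes K. Complex (l2_inner X (a k) u) (l2_inner X (b k) u) * character k x)"
    proof -
      have "K \<ge> K1" using K by simp
      from K1[OF this] show thesis using that by blast
    qed
    have "K \<ge> K2" using K by simp
    from K2[OF this] obtain d where d: "(\<lambda>x. complex_of_real (\<phi> x)) = (\<lambda>x. \<Sum>k\<in>modes K. d k * character k x)" by blast
    have d': "\<phi> x = Re (\<Sum>k\<in>modes K. d k * character k x)" for x using fun_cong[OF d, of x] by (metis Re_complex_of_real)
    define a' where "a' k = (\<lambda>x. a k x + Re (d k) * c x)" for k
    define b' where "b' k = (\<lambda>x. b k x + Im (d k) * c x)" for k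
    have "a' k \<in> L2 X \<and> b' k \<in> L2 X" for k
      unfolding a'_def b'_def using ab fin_rank_step(2) by (auto intro!: L2_add L2_scale)
    moreover have "T u x + l2_inner X c u * \<phi> x =
      Re (\<Sum>k\<in>modes K. Complex (l2_inner X (a' k) u) (l2_inner X (b' k) u) * character k x)" if u: "u \<in> L2 X" for u x
    proof -
      have "Complex (l2_inner X (a' k) u) (l2_inner X (b' k) u)
        = Complex (l2_inner X (a k) u) (l2_inner X (b k) u) + of_real (l2_inner X c u) * d k" for k
        unfolding a'_def b'_def using ab fin_rank_step(2) u
        by (simp add: complex_eq_iff l2_inner_add_left l2_inner_scale_left L2_scale)
      then have "(\<Sum>k\<in>modes K. Complex (l2_inner X (a' k) u) (l2_inner X (b' k) u) * character k x)
        = (\<Sum>k\<in>modes K. Complex (l2_inner X (a k) u) (l2_inner X (b k) u) * character k x)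
          + of_real (l2_inner X c u) * (\<Sum>k\<in>modes K. d k * character k x)"
        by (simp add: distrib_right sum.distrib sum_distrib_left mult.assoc)
      then show ?thesis using ab(3)[OF u, of x] d'[of x] by simp
    qed
    ultimately show ?thesis by blast
  qed
  then show ?case by blast
qed

lemma rtrig_bounded: "rtrig q \<Longrightarrow> \<exists>C. \<forall>x. \<bar>q x\<bar> \<le> C"
proof (induction rule: rtrig.induct)
  case (rtrig_add f g)
  then obtain C D where "\<And>x. \<bar>f x\<bar> \<le> C" "\<And>x. \<bar>g x\<bar> \<le> D" by blast
  then have "\<bar>f x + g x\<bar> \<le> C + D" for x by (meson abs_triangle_ineq add_mono order_trans)
  then show ?case by blast
next
  case (rtrig_mult f g)
  then obtain C D where CD: "\<And>x. \<bar>f x\<bar> \<le> C" "\<And>x. \<bar>g x\<bar> \<le> D" by blast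
  have "C \<ge> 0" using CD(1)[of undefined] by linarith
  then have "\<bar>f x * g x\<bar> \<le> C * D" for x unfolding abs_mult using CD by (intro mult_mono) auto
  then show ?case by blast
qed (auto intro: exI[of _ 1])

text \<open>A derivative vanishing everywhere would make the activation constant, and constants are
  polynomials.\<close>

lemma activation_nonconstant:
  fixes \<sigma> :: "real \<Rightarrow> real"
  assumes "smooth \<sigma>" "\<nexists>q :: real poly. \<forall>x. \<sigma> x = poly q x"
  shows "\<exists>t D. D \<noteq> 0 \<and> (\<sigma> has_real_derivative D) (at t)"
proof (rule ccontr)
  assume none: "\<not> ?thesis"
  have "(\<sigma> has_real_derivative 0) (at t)" for t
  proof -
    have "\<sigma> differentiable (at t)" using assms(1) unfolding smooth_def by (metis C_k.simps(2))
    then obtain D where "(\<sigma> has_real_derivative D) (at t)" by (auto simp: real_differentiable_def)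
    then show ?thesis using none by metis
  qed
  then have "\<exists>c. \<forall>x\<in>UNIV. \<sigma> x = c"
    by (intro has_field_derivative_zero_constant) (auto simp: has_field_derivative_at_within)
  then obtain c where "\<And>x. \<sigma> x = c" by auto
  then have "\<forall>x. \<sigma> x = poly [:c:] x" by simp
  then show False using assms(2) by blast
qed

text \<open>The first-order remainder at t is at most e times |h y|; after division by h D it is
  independent of h, and e is chosen so that it stays below \<eta> for all |y| up to Y.\<close>

lemma linearised_activation:
  fixes \<sigma> :: "real \<Rightarrow> real"
  assumes D: "D \<noteq> 0" "(\<sigma> has_real_derivative D) (at t)" and "Y \<ge> 0" "\<eta> > 0"
  shows "\<exists>h>0. \<forall>y. \<bar>y\<bar> \<le> Y \<longrightarrow> \<bar>(\<sigma> (t + h * y) - \<sigma> t) / (h * D) - y\<bar> \<le> \<eta>"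
proof -
  define e where "e = \<eta> * \<bar>D\<bar> / (Y + 1)"
  have e: "e > 0" using assms by (simp add: e_def)
  have "(\<sigma> has_derivative (\<lambda>h. D * h)) (at t)" using D(2) by (simp add: has_field_derivative_def)
  then obtain d where d: "d > 0" "\<And>s. \<bar>s - t\<bar> < d \<Longrightarrow> \<bar>\<sigma> s - \<sigma> t - D * (s - t)\<bar> \<le> e * \<bar>s - t\<bar>"
    using e unfolding has_derivative_at_alt by (metis real_norm_def)
  define h where "h = d / 2 / (Y + 1)"
  have h: "h > 0" using d(1) assms(3) by (simp add: h_def)
  have "\<bar>(\<sigma> (t + h * y) - \<sigma> t) / (h * D) - y\<bar> \<le> \<eta>" if y: "\<bar>y\<bar> \<le> Y" for y
  proof -
    have "\<bar>h * y\<bar> \<le> h * (Y + 1)" using h y by (simp add: abs_mult)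
    also have "h * (Y + 1) = d / 2" using assms(3) nonzero_eq_divide_eq[of "Y + 1" h "d / 2"] by (auto simp: h_def)
    also have "\<dots> < d" using d(1) by simp
    finally have "\<bar>\<sigma> (t + h * y) - \<sigma> t - D * (h * y)\<bar> \<le> e * \<bar>h * y\<bar>" using d(2)[of "t + h * y"] by simp
    then have "\<bar>\<sigma> (t + h * y) - \<sigma> t - D * (h * y)\<bar> / \<bar>h * D\<bar> \<le> e * \<bar>h * y\<bar> / \<bar>h * D\<bar>"
      by (intro divide_right_mono) auto
    also have "\<dots> = \<eta> * (\<bar>y\<bar> / (Y + 1))" using h D(1) by (simp add: e_def abs_mult)
    also have "\<dots> \<le> \<eta> * 1" using y assms(3,4) by (intro mult_left_mono) auto
    finally have "\<bar>(\<sigma> (t + h * y) - \<sigma> t - D * (h * y)) / (h * D)\<bar> \<le> \<eta>" by (simp add: abs_divide)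
    moreover have "(\<sigma> (t + h * y) - \<sigma> t - D * (h * y)) / (h * D) = (\<sigma> (t + h * y) - \<sigma> t) / (h * D) - y"
      using h D(1) by (simp add: field_simps)
    ultimately show ?thesis by simp
  qed
  then show ?thesis using h by blast
qed

text \<open>A single layer suffices: the extension already carries the values of the functionals as
  Fourier coefficients, the multiplier scales them by h and resynthesises h T u, and the bias t
  moves the result to the point of linearisation. The claim is restricted to a ball of radius \<rho>
  because h depends on the range of T u.\<close>

lemma fno_approximates_trig:
  fixes X :: "(real ^ 'd) set" and \<sigma> :: "real \<Rightarrow> real"
  assumes X: "open X" "bounded X" "closure X \<subseteq> torus_cell"
    and \<sigma>: "smooth \<sigma>" "\<nexists>q :: real poly. \<forall>x. \<sigma> x = poly q x"
    and T: "fin_rank X (Collect rtrig) T" and \<eta>: "\<eta> > 0"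
  shows "\<exists>F M. fno_module X F \<and> (\<forall>u. continuous_on UNIV (fno_apply \<sigma> F u)) \<and>
    (\<forall>u\<in>L2 X. l2_norm X u \<le> \<rho> \<longrightarrow> (\<forall>x. \<bar>fno_apply \<sigma> F u x - T u x\<bar> \<le> \<eta> \<and> \<bar>fno_apply \<sigma> F u x\<bar> \<le> M))"
proof -
  have Xm: "X \<in> lmeasurable" using X by (simp add: lmeasurable_open)
  obtain t D where D: "D \<noteq> 0" "(\<sigma> has_real_derivative D) (at t)" using activation_nonconstant[OF \<sigma>] by blast
  have "Collect rtrig \<subseteq> bounded_L2 X"
    using rtrig_in_L2[OF Xm X(3)] rtrig_bounded by (auto simp: bounded_L2_def)
  then have "fin_rank X (bounded_L2 X) T" using T by (rule fin_rank_mono[rotated])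
  from fin_rank_sup_bound[OF this] obtain C where C: "C \<ge> 0" "\<forall>u\<in>L2 X. \<forall>x. \<bar>T u x\<bar> \<le> C * l2_norm X u" by blast
  define Y where "Y = C * \<bar>\<rho>\<bar>"
  have Y: "Y \<ge> 0" using C(1) by (simp add: Y_def)
  have TY: "\<bar>T u x\<bar> \<le> Y" if "u \<in> L2 X" "l2_norm X u \<le> \<rho>" for u x
  proof -
    have "C * l2_norm X u \<le> Y" unfolding Y_def using C(1) that(2) by (intro mult_left_mono) auto
    then show ?thesis using C(2) that(1) by (meson order_trans)
  qed
  obtain h where h: "h > 0" "\<And>y. \<bar>y\<bar> \<le> Y \<Longrightarrow> \<bar>(\<sigma> (t + h * y) - \<sigma> t) / (h * D) - y\<bar> \<le> \<eta>"
    using linearised_activation[OF D Y \<eta>] by blast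
  obtain K where "\<exists>a b. (\<forall>k. a k \<in> L2 X \<and> b k \<in> L2 X) \<and>
    (\<forall>u\<in>L2 X. \<forall>x. T u x = Re (\<Sum>k\<in>modes K. Complex (l2_inner X (a k) u) (l2_inner X (b k) u) * character k x))"
    using fin_rank_trig_modes[OF T] by blast
  then obtain a b where ab: "\<And>k. a k \<in> L2 X" "\<And>k. b k \<in> L2 X"
    "\<And>u x. u \<in> L2 X \<Longrightarrow> T u x = Re (\<Sum>k\<in>modes K. Complex (l2_inner X (a k) u) (l2_inner X (b k) u) * character k x)"
    by blast
  define z where "z = (\<lambda>k u. Complex (l2_inner X (a k) u) (l2_inner X (b k) u))"
  obtain E where E: "extension_operator X E"
    "\<And>u l. u \<in> L2 X \<Longrightarrow> l \<in> modes K \<Longrightarrow> fourier_coeff (E u) l = (z l u + cnj (z (- l) u)) / 2"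
    using extension_prescribed_fourier[OF X, of a b K] ab(1,2) unfolding z_def by blast
  \<comment> \<open>Two channels: channel 0 computes \<sigma>(t + h y) and channel 1 the constant
    \<sigma>(t). The readout is linear without bias, so the second channel is what subtracts the
    constant.\<close>
  define F where "F = \<lparr> fno_E = E, fno_width = 2, fno_depth = 1, fno_kmax = K,
      fno_P = (\<lambda>i. if i = 0 then 1 else 0), fno_Q = (\<lambda>i. if i = 0 then 1 / (h * D) else - 1 / (h * D)),
      fno_W = (\<lambda>l i j. 0), fno_b = (\<lambda>l i x. t), fno_R = (\<lambda>l k i j. if i = 0 \<and> j = 0 then of_real h else 0) \<rparr>"
  have "fno_module X F"
    unfolding fno_module_def F_def using E(1) by (auto simp: smooth_on_torus_def)
  moreover have apply_eq: "fno_apply \<sigma> F u x =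
      (\<sigma> (t + h * Re (\<Sum>k\<in>modes K. fourier_coeff (E u) k * character k x)) - \<sigma> t) / (h * D)" for u x
  proof -
    have "Re (\<Sum>k\<in>modes K. of_real h * fourier_coeff (E u) k * character k x)
        = h * Re (\<Sum>k\<in>modes K. fourier_coeff (E u) k * character k x)"
    proof -
      have "(\<Sum>k\<in>modes K. of_real h * fourier_coeff (E u) k * character k x)
          = of_real h * (\<Sum>k\<in>modes K. fourier_coeff (E u) k * character k x)"
        by (simp add: sum_distrib_left mult.assoc)
      then show ?thesis by (simp del: Re_sum)
    qed
    then show ?thesis
      by (simp add: fno_apply_def F_def numeral_2_eq_2 diff_divide_distrib del: Re_sum)
  qed
  moreover have "continuous_on UNIV (fno_apply \<sigma> F u)" for u
  proof -
    have "continuous_on UNIV \<sigma>" by (rule smooth_continuous[OF \<sigma>(1)])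
    then show ?thesis
      unfolding apply_eq[abs_def] using h(1) D(1)
      by (auto intro!: continuous_intros continuous_on_compose2[of UNIV \<sigma>] simp del: Re_sum)
  qed
  moreover have "\<bar>fno_apply \<sigma> F u x - T u x\<bar> \<le> \<eta> \<and> \<bar>fno_apply \<sigma> F u x\<bar> \<le> Y + \<eta>"
    if u: "u \<in> L2 X" "l2_norm X u \<le> \<rho>" for u x
  proof -
    \<comment> \<open>The coefficients of the real function \<open>E u\<close> realise only the
      conjugate-symmetric part of \<open>z\<close>. Replacing k by -k shows that both have the same
      real part of the Fourier sum.\<close>
    have "(\<Sum>k\<in>modes K. cnj (z (- k) u) * character k x) = (\<Sum>k\<in>modes K. cnj (z k u * character k x))"
      by (rule sum.reindex_bij_witness[of _ uminus uminus]) (auto simp: modes_uminus character_uminus)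
    then have conj: "Re (\<Sum>k\<in>modes K. cnj (z (- k) u) * character k x) = Re (\<Sum>k\<in>modes K. z k u * character k x)"
      by simp
    have "(\<Sum>k\<in>modes K. fourier_coeff (E u) k * character k x)
        = ((\<Sum>k\<in>modes K. z k u * character k x) + (\<Sum>k\<in>modes K. cnj (z (- k) u) * character k x)) / 2"
      unfolding sum.distrib[symmetric] sum_divide_distrib
      using E(2)[OF u(1)] by (intro sum.cong) (auto simp: field_simps)
    then have "Re (\<Sum>k\<in>modes K. fourier_coeff (E u) k * character k x)
        = (Re (\<Sum>k\<in>modes K. z k u * character k x) + Re (\<Sum>k\<in>modes K. cnj (z (- k) u) * character k x)) / 2"
      by (simp only: Re_divide_numeral plus_complex.sel)
    then have "Re (\<Sum>k\<in>modes K. fourier_coeff (E u) k * character k x) = T u x"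
      using conj ab(3)[OF u(1), of x] by (simp add: z_def del: Re_sum)
    then have "\<bar>fno_apply \<sigma> F u x - T u x\<bar> \<le> \<eta>"
      unfolding apply_eq using h(2)[OF TY[OF u]] by simp
    moreover have "\<bar>T u x\<bar> \<le> Y" by (rule TY[OF u])
    ultimately show ?thesis by linarith
  qed
  ultimately show ?thesis by blast
qed

text \<open>The error splits as \<eta> / 4 for finite rank, \<eta> / 4 for trigonometric ranges and
  \<eta> / 2 for the network. The pointwise bound M on an L^2 ball is retained because the invariant
  of \<open>control_network\<close> rests on it.\<close>

lemma approximable_fno:
  fixes X :: "(real ^ 'd) set" and \<sigma> :: "real \<Rightarrow> real"
  assumes X: "open X" "bounded X" "closure X \<subseteq> torus_cell"
    and \<sigma>: "smooth \<sigma>" "\<nexists>q :: real poly. \<forall>x. \<sigma> x = poly q x"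
    and A: "approximable X A" "\<And>u. u \<in> L2 X \<Longrightarrow> A u \<in> L2 X" and \<rho>: "\<rho> > 0" and \<eta>: "\<eta> > 0"
  shows "\<exists>F M. fno_module X F \<and> (\<forall>u. fno_apply \<sigma> F u \<in> borel_measurable (lebesgue_on X)) \<and>
    (\<forall>u\<in>L2 X. l2_norm X u \<le> \<rho> \<longrightarrow> fno_apply \<sigma> F u \<in> L2 X \<and>
      l2_norm X (\<lambda>x. fno_apply \<sigma> F u x - A u x) \<le> \<eta> \<and> (\<forall>x. \<bar>fno_apply \<sigma> F u x\<bar> \<le> M))"
proof -
  have Xm: "X \<in> lmeasurable" using X by (simp add: lmeasurable_open)
  define e where "e = \<eta> / (4 * \<rho>)"
  have e: "e > 0" "e * \<rho> = \<eta> / 4" using \<rho> \<eta> by (auto simp: e_def)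
  obtain T where T: "fin_rank X (L2 X) T" "\<forall>u\<in>L2 X. l2_norm X (\<lambda>x. A u x - T u x) \<le> e * l2_norm X u"
    using A(1) e(1) unfolding approximable_def by blast
  obtain T' where T': "fin_rank X (Collect rtrig) T'" "\<forall>u\<in>L2 X. l2_norm X (\<lambda>x. T u x - T' u x) \<le> e * l2_norm X u"
    using fin_rank_trig_approx[OF Xm X(3) T(1) e(1)] by blast
  define m where "m = sqrt (measure lebesgue X)"
  have m: "m \<ge> 0" by (simp add: m_def)
  define e' where "e' = \<eta> / (2 * (m + 1))"
  have e': "e' > 0" "e' * m \<le> \<eta> / 2" using \<eta> m by (auto simp: e'_def field_simps)
  obtain F M where F: "fno_module X F" "\<forall>u. continuous_on UNIV (fno_apply \<sigma> F u)"
    "\<forall>u\<in>L2 X. l2_norm X u \<le> \<rho> \<longrightarrow> (\<forall>x. \<bar>fno_apply \<sigma> F u x - T' u x\<bar> \<le> e' \<and> \<bar>fno_apply \<sigma> F u x\<bar> \<le> M)"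
    using fno_approximates_trig[OF X \<sigma> T'(1) e'(1)] by blast
  have meas: "fno_apply \<sigma> F u \<in> borel_measurable (lebesgue_on X)" for u
    using F(2) by (intro continuous_imp_lebesgue_on_measurable) auto
  have "fno_apply \<sigma> F u \<in> L2 X \<and> l2_norm X (\<lambda>x. fno_apply \<sigma> F u x - A u x) \<le> \<eta> \<and> (\<forall>x. \<bar>fno_apply \<sigma> F u x\<bar> \<le> M)"
    if u: "u \<in> L2 X" "l2_norm X u \<le> \<rho>" for u
  proof (intro conjI)
    show bound: "\<forall>x. \<bar>fno_apply \<sigma> F u x\<bar> \<le> M" using F(3) u by blast
    then show FL: "fno_apply \<sigma> F u \<in> L2 X" by (intro L2_bounded[OF Xm meas, of _ M]) auto
    have TL: "T u \<in> L2 X" by (rule fin_rank_L2[OF T(1) order_refl])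
    have T'L: "T' u \<in> L2 X"
      by (rule fin_rank_L2[OF T'(1)]) (use rtrig_in_L2[OF Xm X(3)] in auto)
    have "l2_norm X (\<lambda>x. fno_apply \<sigma> F u x - T' u x) \<le> l2_norm X (\<lambda>x. e')"
      using F(3) u L2_diff[OF FL T'L] e'(1)
      by (intro l2_norm_mono[OF L2_const[OF Xm]] L2_measurable) auto
    also have "\<dots> \<le> \<eta> / 2" using e' by (simp add: l2_norm_const[OF Xm] m_def)
    finally have 1: "l2_norm X (\<lambda>x. fno_apply \<sigma> F u x - T' u x) \<le> \<eta> / 2" .
    have "e * l2_norm X u \<le> e * \<rho>" using u(2) e(1) by (intro mult_left_mono) auto
    then have small: "e * l2_norm X u \<le> \<eta> / 4" by (simp only: e(2))
    have 2: "l2_norm X (\<lambda>x. T' u x - T u x) \<le> \<eta> / 4"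
      using T'(2) u(1) small l2_norm_minus_commute[of X "T' u" "T u"] by fastforce
    have 3: "l2_norm X (\<lambda>x. T u x - A u x) \<le> \<eta> / 4"
      using T(2) u(1) small l2_norm_minus_commute[of X "T u" "A u"] by fastforce
    have "l2_norm X (\<lambda>x. fno_apply \<sigma> F u x - A u x)
      \<le> l2_norm X (\<lambda>x. fno_apply \<sigma> F u x - T' u x) + (l2_norm X (\<lambda>x. T' u x - T u x) + l2_norm X (\<lambda>x. T u x - A u x))"
      using l2_dist_triangle[OF FL T'L A(2)[OF u(1)]] l2_dist_triangle[OF T'L TL A(2)[OF u(1)]] by linarith
    then show "l2_norm X (\<lambda>x. fno_apply \<sigma> F u x - A u x) \<le> \<eta>" using 1 2 3 by linarith
  qed
  then show ?thesis using F(1) meas by blast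
qed

section \<open>One-dimensional proximal maps\<close>

text \<open>Lower semicontinuity bounds \<psi> from below by v0 - 1 near q0. Convexity carries the
  bound outwards with linear loss: a lower value further away would pull the chord to q0 below v0 -
  1 at distance \<rho>.\<close>

lemma proper_convex_lsc_lower:
  assumes \<psi>: "proper_convex_lsc \<psi>"
  obtains q0 v0 \<rho> where "\<psi> q0 = ereal v0" "\<rho> > 0" "\<And>q. \<psi> q \<ge> ereal (v0 - 1 - \<bar>q - q0\<bar> / \<rho>)"
proof -
  have notm: "\<psi> q \<noteq> -\<infinity>" for q using \<psi> by (simp add: proper_convex_lsc_def)
  obtain q0 where "\<psi> q0 \<noteq> \<infinity>" using \<psi> by (auto simp: proper_convex_lsc_def)
  then obtain v0 where v0: "\<psi> q0 = ereal v0" using notm[of q0] by (cases "\<psi> q0") auto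
  have "\<forall>\<^sub>F q in at q0. ereal (v0 - 1) < \<psi> q"
    using \<psi> v0 by (simp add: proper_convex_lsc_def)
  then obtain d where d: "d > 0" "\<And>q. q \<noteq> q0 \<Longrightarrow> dist q q0 < d \<Longrightarrow> ereal (v0 - 1) < \<psi> q"
    unfolding eventually_at by auto
  define \<rho> where "\<rho> = d / 2"
  have \<rho>: "\<rho> > 0" "\<rho> < d" using d(1) by (auto simp: \<rho>_def)
  have near: "ereal (v0 - 1) \<le> \<psi> q" if "\<bar>q - q0\<bar> \<le> \<rho>" for q
    using d(2)[of q] that \<rho> v0 by (cases "q = q0") (auto simp: dist_real_def less_imp_le)
  have "\<psi> q \<ge> ereal (v0 - 1 - \<bar>q - q0\<bar> / \<rho>)" for q
  proof (cases "\<bar>q - q0\<bar> \<le> \<rho>")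
    case True
    have "ereal (v0 - 1 - \<bar>q - q0\<bar> / \<rho>) \<le> ereal (v0 - 1)" using \<rho> by simp
    then show ?thesis using near[OF True] by (rule order_trans)
  next
    case False
    define t where "t = \<rho> / \<bar>q - q0\<bar>"
    have t: "0 < t" "t < 1" "t * \<bar>q - q0\<bar> = \<rho>" using False \<rho> by (auto simp: t_def)
    have "(1 - t) * q0 + t * q - q0 = t * (q - q0)" by (simp add: algebra_simps)
    then have "\<bar>(1 - t) * q0 + t * q - q0\<bar> = \<rho>" using t by (simp add: abs_mult)
    then have "ereal (v0 - 1) \<le> \<psi> ((1 - t) * q0 + t * q)" by (intro near) simp
    also have "\<dots> \<le> ereal (1 - t) * \<psi> q0 + ereal t * \<psi> q"
      using \<psi> t by (simp add: proper_convex_lsc_def)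
    finally have le: "ereal (v0 - 1) \<le> ereal (1 - t) * \<psi> q0 + ereal t * \<psi> q" .
    show ?thesis
    proof (cases "\<psi> q")
      case (real v)
      then have "v0 - 1 \<le> (1 - t) * v0 + t * v" using le v0 by simp
      then have "t * (v0 - v) \<le> 1" by (simp add: algebra_simps)
      then have "v0 - v \<le> 1 / t" using t by (simp add: field_simps)
      also have "1 / t = \<bar>q - q0\<bar> / \<rho>" by (simp add: t_def)
      finally show ?thesis using real by simp
    qed (use notm[of q] in auto)
  qed
  then show thesis using that v0 \<rho>(1) by blast
qed

text \<open>The point z minimises \<psi>(q) + a q^2 / 2 - r q. The quadratic term beats the linear
  lower bound on \<psi>, so minimising sequences are bounded, and the optimality condition at z is
  the subgradient inequality.\<close>

lemma prox_exists:
  assumes \<psi>: "proper_convex_lsc \<psi>" and a: "a > 0"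
  shows "\<exists>z. (z, r - a * z) \<in> subdiff_graph \<psi>"
proof -
  have notm: "\<psi> q \<noteq> -\<infinity>" for q using \<psi> by (simp add: proper_convex_lsc_def)
  obtain q0 v0 \<rho> where q0: "\<psi> q0 = ereal v0" "\<rho> > 0" "\<And>q. \<psi> q \<ge> ereal (v0 - 1 - \<bar>q - q0\<bar> / \<rho>)"
    by (rule proper_convex_lsc_lower[OF \<psi>]) (rule that)
  define Q where "Q q = a / 2 * q\<^sup>2 - r * q" for q
  define S where "S = {v + Q q | q v. \<psi> q = ereal v}"
  define c1 where "c1 = \<bar>r\<bar> + 1 / \<rho>"
  define c3 where "c3 = v0 - 1 - \<bar>q0\<bar> / \<rho>"
  have c1: "c1 > 0" using q0(2) by (simp add: c1_def add_nonneg_pos)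
  have lower: "a / 2 * q\<^sup>2 - c1 * \<bar>q\<bar> + c3 \<le> v + Q q" if "\<psi> q = ereal v" for q v
  proof -
    have "v0 - 1 - \<bar>q - q0\<bar> / \<rho> \<le> v" using q0(3)[of q] that by simp
    moreover have "\<bar>q - q0\<bar> / \<rho> \<le> \<bar>q\<bar> / \<rho> + \<bar>q0\<bar> / \<rho>"
      using q0(2) by (simp add: add_divide_distrib[symmetric] divide_right_mono)
    moreover have "r * q \<le> \<bar>r\<bar> * \<bar>q\<bar>" by (metis abs_ge_self abs_mult)
    moreover have "c1 * \<bar>q\<bar> = \<bar>r\<bar> * \<bar>q\<bar> + \<bar>q\<bar> / \<rho>" by (simp add: c1_def distrib_right)
    ultimately show ?thesis unfolding Q_def c3_def by linarith
  qed
  have bdd: "bdd_below S"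
  proof (rule bdd_belowI)
    fix y assume "y \<in> S"
    then obtain q v where qv: "y = v + Q q" "\<psi> q = ereal v" by (auto simp: S_def)
    have "0 \<le> (a * \<bar>q\<bar> - c1)\<^sup>2" by simp
    then have "0 \<le> (a * \<bar>q\<bar> - c1)\<^sup>2 / (2 * a)" using a by simp
    also have "\<dots> = a / 2 * q\<^sup>2 - c1 * \<bar>q\<bar> + c1\<^sup>2 / (2 * a)"
      unfolding power2_abs[of q, symmetric] using a by (simp only: power2_eq_square) (simp add: field_simps)
    finally show "c3 - c1\<^sup>2 / (2 * a) \<le> y" using lower[OF qv(2)] qv(1) by simp
  qed
  define m where "m = Inf S"
  have m_le: "m \<le> v + Q q" if "\<psi> q = ereal v" for q v
    unfolding m_def using bdd that by (intro cInf_lower) (auto simp: S_def)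
  have "v0 + Q q0 \<in> S" using q0(1) by (auto simp: S_def)
  then have ne: "S \<noteq> {}" by blast
  have "\<exists>q v. \<psi> q = ereal v \<and> v + Q q < m + 1 / real (Suc n)" for n
  proof -
    have "Inf S < m + 1 / real (Suc n)" unfolding m_def by simp
    then obtain y where "y \<in> S" "y < m + 1 / real (Suc n)" using cInf_lessD[OF ne] by blast
    then show ?thesis by (auto simp: S_def)
  qed
  then obtain q v where qv: "\<And>n. \<psi> (q n) = ereal (v n)" "\<And>n. v n + Q (q n) < m + 1 / real (Suc n)" by metis
  \<comment> \<open>Beyond \<open>B\<close> the quadratic lower bound exceeds m + 1, hence every
    value of the minimising sequence. The maximum with 1 lets constants be absorbed into multiples
    of |q n|.\<close>
  define B where "B = max 1 (2 * (c1 + \<bar>m + 1 - c3\<bar>) / a)"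
  have "\<bar>q n\<bar> \<le> B" for n
  proof (rule ccontr)
    assume "\<not> \<bar>q n\<bar> \<le> B"
    then have big: "1 < \<bar>q n\<bar>" "2 * (c1 + \<bar>m + 1 - c3\<bar>) / a < \<bar>q n\<bar>" by (auto simp: B_def)
    then have "c1 + \<bar>m + 1 - c3\<bar> < a / 2 * \<bar>q n\<bar>" using a by (simp add: field_simps)
    then have "(c1 + \<bar>m + 1 - c3\<bar>) * \<bar>q n\<bar> < a / 2 * \<bar>q n\<bar> * \<bar>q n\<bar>" using big(1) by (intro mult_strict_right_mono) auto
    moreover have "m + 1 - c3 \<le> \<bar>m + 1 - c3\<bar> * \<bar>q n\<bar>"
      using big(1) mult_left_mono[of 1 "\<bar>q n\<bar>" "\<bar>m + 1 - c3\<bar>"] by simp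
    moreover have "a / 2 * \<bar>q n\<bar> * \<bar>q n\<bar> = a / 2 * (q n)\<^sup>2" by (simp add: power2_eq_square)
    ultimately have "m + 1 < a / 2 * (q n)\<^sup>2 - c1 * \<bar>q n\<bar> + c3" unfolding distrib_right by linarith
    moreover have "1 / real (Suc n) \<le> 1" by simp
    ultimately show False using lower[OF qv(1)[of n]] qv(2)[of n] by linarith
  qed
  then have "\<forall>n. q n \<in> {-B..B}" by (auto simp: abs_le_iff minus_le_iff)
  then obtain z s where s: "strict_mono s" "(q \<circ> s) \<longlonglongrightarrow> z"
    using compact_Icc[of "-B" B] unfolding compact_def by metis
  have Qlim: "(\<lambda>n. Q (q (s n))) \<longlonglongrightarrow> Q z"
    unfolding Q_def using s(2) by (intro tendsto_intros) (auto simp: o_def)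
  have \<Phi>z: "\<psi> z \<le> ereal (m - Q z)"
  proof (rule ccontr)
    assume "\<not> ?thesis"
    then have "ereal (m - Q z) < \<psi> z" by (simp only: not_le)
    then obtain b where b: "ereal (m - Q z) < ereal b" "ereal b < \<psi> z" using ereal_dense2 by blast
    have "\<forall>\<^sub>F w in at z. ereal b < \<psi> w" using \<psi> b(2) by (simp add: proper_convex_lsc_def)
    then have "\<forall>\<^sub>F w in nhds z. ereal b < \<psi> w" using b(2) by (simp add: eventually_nhds_conv_at)
    then have "\<forall>\<^sub>F n in sequentially. ereal b < \<psi> (q (s n))" using s(2) by (auto simp: filterlim_iff o_def)
    then have ev: "\<forall>\<^sub>F n in sequentially. b + Q (q (s n)) \<le> m + 1 / real (Suc n)"
    proof eventually_elim
      case (elim n)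
      then have "b < v (s n)" using qv(1)[of "s n"] by simp
      moreover have "1 / real (Suc (s n)) \<le> 1 / real (Suc n)"
        using seq_suble[OF s(1), of n] by (intro divide_left_mono) auto
      ultimately show ?case using qv(2)[of "s n"] by linarith
    qed
    have "(\<lambda>n. m + 1 / real (Suc n)) \<longlonglongrightarrow> m + 0" by (intro tendsto_intros LIMSEQ_Suc lim_1_over_n)
    then have "b + Q z \<le> m + 0" using ev Qlim by (intro tendsto_le[OF _ _ tendsto_add[OF tendsto_const Qlim]]) auto
    then show False using b(1) by simp
  qed
  then have "\<psi> z \<noteq> \<infinity>" by auto
  then obtain vz where vz: "\<psi> z = ereal vz" using notm[of z] by (cases "\<psi> z") auto
  have min: "vz + Q z \<le> v + Q q" if "\<psi> q = ereal v" for q v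
    using \<Phi>z m_le[OF that] vz by simp
  have "ereal (vz + (r - a * z) * (q - z)) \<le> \<psi> q" for q
  proof (cases "\<psi> q")
    case (real v)
    define d where "d = q - z"
    \<comment> \<open>Minimality is compared with the point z + t d, where convexity bounds \<psi>.
      One factor t cancels, and letting t tend to 0 from the right removes the quadratic
      term.\<close>
    have ineq: "0 \<le> v - vz + (a * z - r) * d + a / 2 * t * d\<^sup>2" if t: "0 < t" "t < 1" for t
    proof -
      have "\<psi> ((1 - t) * z + t * q) \<le> ereal (1 - t) * \<psi> z + ereal t * \<psi> q"
        using \<psi> t by (simp add: proper_convex_lsc_def)
      then have "\<psi> (z + t * d) \<le> ereal ((1 - t) * vz + t * v)"
        using vz real by (simp add: d_def algebra_simps)
      moreover then obtain w where w: "\<psi> (z + t * d) = ereal w" using notm[of "z + t * d"] by (cases "\<psi> (z + t * d)") auto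
      ultimately have "vz + Q z \<le> (1 - t) * vz + t * v + Q (z + t * d)" using min[OF w] by simp
      then have "0 \<le> t * (v - vz + (a * z - r) * d + a / 2 * t * d\<^sup>2)"
        by (simp add: Q_def power2_eq_square algebra_simps)
      then show ?thesis using t by (simp add: zero_le_mult_iff)
    qed
    have lim: "((\<lambda>t. v - vz + (a * z - r) * d + a / 2 * t * d\<^sup>2) \<longlongrightarrow> v - vz + (a * z - r) * d + a / 2 * 0 * d\<^sup>2) (at_right 0)"
      by (intro tendsto_intros)
    have "\<forall>\<^sub>F t in at_right 0. 0 \<le> v - vz + (a * z - r) * d + a / 2 * t * d\<^sup>2"
    proof (rule eventually_mono[OF eventually_at_right_real[of 0 1]])
      fix t :: real assume "t \<in> {0<..<1}"
      then show "0 \<le> v - vz + (a * z - r) * d + a / 2 * t * d\<^sup>2" by (intro ineq) auto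
    qed simp
    then have "0 \<le> v - vz + (a * z - r) * d + a / 2 * 0 * d\<^sup>2" by (rule tendsto_lowerbound[OF lim]) simp
    then show ?thesis using real by (simp add: d_def algebra_simps)
  qed (use notm[of q] in auto)
  then show ?thesis using vz by (auto simp: subdiff_graph_def intro!: exI[of _ z])
qed

lemma subdiff_graph_finite:
  assumes "proper_convex_lsc \<psi>" "(z, p) \<in> subdiff_graph \<psi>"
  obtains v where "\<psi> z = ereal v"
proof -
  obtain q where "\<psi> q \<noteq> \<infinity>" using assms(1) by (auto simp: proper_convex_lsc_def)
  moreover have "\<psi> z + ereal (p * (q - z)) \<le> \<psi> q" using assms(2) by (simp add: subdiff_graph_def)
  ultimately have "\<psi> z \<noteq> \<infinity>" by auto
  moreover have "\<psi> z \<noteq> -\<infinity>" using assms(1) by (simp add: proper_convex_lsc_def)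
  ultimately show thesis using that by (cases "\<psi> z") auto
qed

lemma subdiff_graph_monotone:
  assumes \<psi>: "proper_convex_lsc \<psi>" and 1: "(z, p) \<in> subdiff_graph \<psi>" and 2: "(z', p') \<in> subdiff_graph \<psi>"
  shows "0 \<le> (z - z') * (p - p')"
proof -
  obtain v where v: "\<psi> z = ereal v" using subdiff_graph_finite[OF \<psi> 1] .
  obtain v' where v': "\<psi> z' = ereal v'" using subdiff_graph_finite[OF \<psi> 2] .
  have "\<psi> z + ereal (p * (z' - z)) \<le> \<psi> z'" "\<psi> z' + ereal (p' * (z - z')) \<le> \<psi> z"
    using 1 2 by (auto simp: subdiff_graph_def)
  then show ?thesis by (simp add: v v' algebra_simps)
qed

definition prox :: "(real \<Rightarrow> ereal) \<Rightarrow> real \<Rightarrow> real \<Rightarrow> real" where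
  "prox \<psi> a r = (SOME z. (z, r - a * z) \<in> subdiff_graph \<psi>)"

lemma prox_in_graph:
  "proper_convex_lsc \<psi> \<Longrightarrow> a > 0 \<Longrightarrow> (prox \<psi> a r, r - a * prox \<psi> a r) \<in> subdiff_graph \<psi>"
  unfolding prox_def using prox_exists by (rule someI_ex)

lemma strongly_monotone_bound:
  fixes a c x :: real
  assumes "a > 0" "0 \<le> x * (c - a * x)" shows "\<bar>x\<bar> \<le> \<bar>c\<bar> / a"
proof -
  have "a * (\<bar>x\<bar> * \<bar>x\<bar>) \<le> \<bar>c\<bar> * \<bar>x\<bar>"
    using assms(2) abs_ge_self[of "x * c"] by (simp add: right_diff_distrib abs_mult mult_ac)
  then have "a * \<bar>x\<bar> \<le> \<bar>c\<bar>"
    using mult_right_le_imp_le[of "a * \<bar>x\<bar>" "\<bar>x\<bar>" "\<bar>c\<bar>"] by (cases "x = 0") (auto simp only: mult.assoc zero_less_abs_iff abs_zero mult_zero_right abs_ge_zero)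
  then show ?thesis using assms(1) by (simp add: field_simps)
qed

lemma prox_lipschitz:
  assumes "proper_convex_lsc \<psi>" "a > 0"
  shows "\<bar>prox \<psi> a r - prox \<psi> a r'\<bar> \<le> \<bar>r - r'\<bar> / a"
proof (rule strongly_monotone_bound[OF assms(2)])
  show "0 \<le> (prox \<psi> a r - prox \<psi> a r') * (r - r' - a * (prox \<psi> a r - prox \<psi> a r'))"
    using subdiff_graph_monotone[OF assms(1) prox_in_graph[OF assms, of r] prox_in_graph[OF assms, of r']]
    by (simp add: algebra_simps)
qed

text \<open>The pair (z, p) need not lie on the graph of \<psi>, but a nearby pair (z', p') does.
  Monotonicity between that pair and the graph point of the proximal map bounds the remaining
  distance. It serves as the common estimate for changes of argument, weight and function.\<close>

lemma prox_perturbed: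
  assumes \<psi>: "proper_convex_lsc \<psi>" and a': "a' > 0" and zp: "p = r - a * z"
    and dist: "infdist (z, p) (subdiff_graph \<psi>) \<le> d"
  shows "\<bar>prox \<psi> a' r' - z\<bar> \<le> d + (\<bar>r' - r\<bar> + \<bar>a' - a\<bar> * \<bar>z\<bar> + (1 + a') * d) / a'"
proof (rule field_le_epsilon)
  fix e :: real assume e: "e > 0"
  \<comment> \<open>Slack for choosing a graph point almost realising \<open>infdist\<close>; it
    enters once directly and once multiplied by (1 + a') / a', and is scaled so that the total is
    \<open>e\<close>.\<close>
  define e' where "e' = e / (1 + (1 + a') / a')"
  have pos: "1 + (1 + a') / a' > 0" using a' by (simp add: add_pos_pos)
  have e': "e' > 0" using e pos by (simp add: e'_def)
  have "e' * (1 + (1 + a') / a') = e" using pos by (simp add: e'_def)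
  then have e'_eq: "e' + (1 + a') * e' / a' = e" by (simp add: distrib_left mult.commute)
  have ne: "subdiff_graph \<psi> \<noteq> {}" using prox_in_graph[OF \<psi> a'] by blast
  then have "(INF x\<in>subdiff_graph \<psi>. dist (z, p) x) < d + e'"
    using dist e' by (simp add: infdist_notempty)
  moreover have "dist (z, p) ` subdiff_graph \<psi> \<noteq> {}" using ne by simp
  ultimately obtain y where y: "y \<in> subdiff_graph \<psi>" "dist (z, p) y < d + e'"
    using cInf_lessD by (metis (no_types, lifting) imageE)
  obtain z' p' where y_eq: "y = (z', p')" by (cases y)
  have z': "\<bar>z' - z\<bar> \<le> d + e'" and p': "\<bar>p' - p\<bar> \<le> d + e'"
    using y(2) dist_fst_le[of "(z, p)" y] dist_snd_le[of "(z, p)" y] by (auto simp: y_eq dist_real_def)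
  define w where "w = prox \<psi> a' r'"
  have mono: "0 \<le> (w - z') * ((r' - a' * w) - p')"
    unfolding w_def using subdiff_graph_monotone[OF \<psi> prox_in_graph[OF \<psi> a', of r']] y(1) y_eq by simp
  define c where "c = (r' - r) - (p' - p) - (a' - a) * z - a' * (z' - z)"
  have "(r' - a' * w) - p' = c - a' * (w - z')" unfolding c_def zp by (simp add: algebra_simps)
  then have "\<bar>w - z'\<bar> \<le> \<bar>c\<bar> / a'" using mono by (intro strongly_monotone_bound[OF a']) simp
  also have "\<dots> \<le> (\<bar>r' - r\<bar> + \<bar>a' - a\<bar> * \<bar>z\<bar> + (1 + a') * (d + e')) / a'"
  proof (rule divide_right_mono)
    have "\<bar>c\<bar> \<le> \<bar>r' - r\<bar> + \<bar>p' - p\<bar> + \<bar>(a' - a) * z\<bar> + \<bar>a' * (z' - z)\<bar>" unfolding c_def by linarith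
    also have "\<bar>a' * (z' - z)\<bar> \<le> a' * (d + e')" using z' a' by (simp add: abs_mult mult_left_mono)
    finally show "\<bar>c\<bar> \<le> \<bar>r' - r\<bar> + \<bar>a' - a\<bar> * \<bar>z\<bar> + (1 + a') * (d + e')"
      using p' by (simp add: abs_mult distrib_right)
  qed (use a' in simp)
  finally have "\<bar>w - z\<bar> \<le> (d + e') + (\<bar>r' - r\<bar> + \<bar>a' - a\<bar> * \<bar>z\<bar> + (1 + a') * (d + e')) / a'"
    using z' by linarith
  also have "\<dots> = d + (\<bar>r' - r\<bar> + \<bar>a' - a\<bar> * \<bar>z\<bar> + (1 + a') * d) / a' + (e' + (1 + a') * e' / a')"
    by (simp add: distrib_left add_divide_distrib)
  finally show "\<bar>prox \<psi> a' r' - z\<bar> \<le> d + (\<bar>r' - r\<bar> + \<bar>a' - a\<bar> * \<bar>z\<bar> + (1 + a') * d) / a' + e"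
    by (simp add: e'_eq w_def)
qed

lemma sub_lipschitz_infdist:
  assumes "sub_lipschitz_graphs E \<psi>" "\<rho> > 0"
  obtains \<kappa> where "\<kappa> > 0" "\<And>\<xi> \<xi>' z. \<xi> \<in> E \<Longrightarrow> \<xi>' \<in> E \<Longrightarrow> z \<in> subdiff_graph (\<psi> \<xi>) \<Longrightarrow> norm z \<le> \<rho> \<Longrightarrow>
    infdist z (subdiff_graph (\<psi> \<xi>')) \<le> \<kappa> * norm (\<xi> - \<xi>')"
proof -
  obtain \<kappa> where \<kappa>: "\<kappa> > 0" "\<And>\<xi> \<xi>' z. \<xi> \<in> E \<Longrightarrow> \<xi>' \<in> E \<Longrightarrow> norm z \<le> \<rho> \<Longrightarrow>
    \<bar>infdist z (subdiff_graph (\<psi> \<xi>)) - infdist z (subdiff_graph (\<psi> \<xi>'))\<bar> \<le> \<kappa> * norm (\<xi> - \<xi>')"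
    using assms unfolding sub_lipschitz_graphs_def by meson
  show thesis
  proof (rule that[OF \<kappa>(1)])
    fix \<xi> \<xi>' z assume *: "\<xi> \<in> E" "\<xi>' \<in> E" "z \<in> subdiff_graph (\<psi> \<xi>)" "norm z \<le> \<rho>"
    have "infdist z (subdiff_graph (\<psi> \<xi>)) = 0" using *(3) by simp
    then show "infdist z (subdiff_graph (\<psi> \<xi>')) \<le> \<kappa> * norm (\<xi> - \<xi>')"
      using \<kappa>(2)[OF *(1,2,4)] by simp
  qed
qed

text \<open>All functions are compared with a single reference \<xi>0: its graph point at weight
  \<alpha> is within \<kappa> (norm \<xi>0 + |m|) of every other graph considered, and
  \<open>prox_perturbed\<close> turns this into a bound on the proximal points.\<close>

lemma prox_bounded:
  fixes E :: "'b::real_normed_vector set"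
  assumes \<psi>: "\<And>\<xi>. \<xi> \<in> E \<Longrightarrow> proper_convex_lsc (\<psi> \<xi>)" and lip: "sub_lipschitz_graphs E \<psi>"
    and \<alpha>: "\<alpha> > 0"
  shows "\<exists>G\<ge>0. \<forall>\<xi>\<in>E. \<forall>a. norm \<xi> \<le> m \<and> \<alpha> \<le> a \<and> a \<le> A \<longrightarrow> \<bar>prox (\<psi> \<xi>) a 0\<bar> \<le> G"
proof (cases "E = {}")
  case False
  then obtain \<xi>0 where \<xi>0: "\<xi>0 \<in> E" by blast
  define z where "z = prox (\<psi> \<xi>0) \<alpha> 0"
  have z: "(z, 0 - \<alpha> * z) \<in> subdiff_graph (\<psi> \<xi>0)"
    unfolding z_def by (rule prox_in_graph[OF \<psi>[OF \<xi>0] \<alpha>])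
  obtain \<kappa> where \<kappa>: "\<kappa> > 0" "\<And>\<xi> \<xi>' y. \<xi> \<in> E \<Longrightarrow> \<xi>' \<in> E \<Longrightarrow> y \<in> subdiff_graph (\<psi> \<xi>) \<Longrightarrow> norm y \<le> norm (z, 0 - \<alpha> * z) + 1 \<Longrightarrow>
    infdist y (subdiff_graph (\<psi> \<xi>')) \<le> \<kappa> * norm (\<xi> - \<xi>')"
    by (rule sub_lipschitz_infdist[OF lip, of "norm (z, 0 - \<alpha> * z) + 1"]) (auto simp: add_nonneg_pos)
  define d where "d = \<kappa> * (norm \<xi>0 + \<bar>m\<bar>)"
  have d: "d \<ge> 0" using \<kappa>(1) by (simp add: d_def)
  define G where "G = \<bar>z\<bar> + d + (\<bar>A\<bar> + \<bar>\<alpha>\<bar>) * \<bar>z\<bar> / \<alpha> + (1 + \<bar>A\<bar>) * d / \<alpha>"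
  have "\<bar>prox (\<psi> \<xi>) a 0\<bar> \<le> G" if *: "\<xi> \<in> E" "norm \<xi> \<le> m" "\<alpha> \<le> a" "a \<le> A" for \<xi> a
  proof -
    have a: "a > 0" using \<alpha> * by linarith
    have "infdist (z, 0 - \<alpha> * z) (subdiff_graph (\<psi> \<xi>)) \<le> \<kappa> * norm (\<xi>0 - \<xi>)"
      by (rule \<kappa>(2)[OF \<xi>0 *(1) z]) simp
    also have "\<dots> \<le> d"
      unfolding d_def using \<kappa>(1) norm_triangle_ineq4[of \<xi>0 \<xi>] *(2) by (intro mult_left_mono) auto
    finally have "\<bar>prox (\<psi> \<xi>) a 0 - z\<bar> \<le> d + (\<bar>0 - 0\<bar> + \<bar>a - \<alpha>\<bar> * \<bar>z\<bar> + (1 + a) * d) / a"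
      by (intro prox_perturbed[OF \<psi>[OF *(1)] a refl])
    also have "\<dots> \<le> d + (\<bar>0 - 0\<bar> + (\<bar>A\<bar> + \<bar>\<alpha>\<bar>) * \<bar>z\<bar> + (1 + \<bar>A\<bar>) * d) / \<alpha>"
      using * \<alpha> d a by (intro add_left_mono frac_le add_mono mult_right_mono) (auto intro!: add_nonneg_nonneg mult_nonneg_nonneg)
    finally have "\<bar>prox (\<psi> \<xi>) a 0 - z\<bar> \<le> d + ((\<bar>A\<bar> + \<bar>\<alpha>\<bar>) * \<bar>z\<bar> / \<alpha> + (1 + \<bar>A\<bar>) * d / \<alpha>)"
      by (simp add: add_divide_distrib)
    then show ?thesis unfolding G_def by linarith
  qed
  moreover have "G \<ge> 0" unfolding G_def using d \<alpha> by (intro add_nonneg_nonneg divide_nonneg_nonneg mult_nonneg_nonneg) auto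
  ultimately show ?thesis by blast
qed (auto intro: exI[of _ 0])

text \<open>The sub-Lipschitz constant depends on a radius, so the graph points (prox, r - a prox)
  must first be confined to a ball; \<open>prox_bounded\<close> does this. Only the unprimed point
  has to be confined, hence no bound on r' or on the norm of the second parameter.\<close>

lemma prox_locally_lipschitz:
  fixes E :: "'b::real_normed_vector set"
  assumes \<psi>: "\<And>\<xi>. \<xi> \<in> E \<Longrightarrow> proper_convex_lsc (\<psi> \<xi>)" and lip: "sub_lipschitz_graphs E \<psi>"
    and \<alpha>: "\<alpha> > 0"
  shows "\<exists>C\<ge>0. \<forall>\<xi>\<in>E. \<forall>\<xi>'\<in>E. \<forall>a a' r r'. norm \<xi> \<le> m \<and> \<alpha> \<le> a \<and> a \<le> A \<and> \<alpha> \<le> a' \<and> a' \<le> A \<and> \<bar>r\<bar> \<le> M \<longrightarrow>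
    \<bar>prox (\<psi> \<xi>') a' r' - prox (\<psi> \<xi>) a r\<bar> \<le> C * (\<bar>r' - r\<bar> + norm (\<xi>' - \<xi>) + \<bar>a' - a\<bar>)"
proof -
  obtain G where G: "G \<ge> 0" "\<And>\<xi> a. \<xi> \<in> E \<Longrightarrow> norm \<xi> \<le> m \<Longrightarrow> \<alpha> \<le> a \<Longrightarrow> a \<le> A \<Longrightarrow> \<bar>prox (\<psi> \<xi>) a 0\<bar> \<le> G"
    using prox_bounded[OF \<psi> lip \<alpha>, of m A] by blast
  define zb where "zb = G + \<bar>M\<bar> / \<alpha>"
  have zb: "zb \<ge> 0" using G(1) \<alpha> by (simp add: zb_def)
  define \<rho> where "\<rho> = zb + (\<bar>M\<bar> + \<bar>A\<bar> * zb) + 1"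
  have \<rho>: "\<rho> > 0" using zb by (simp add: \<rho>_def add_nonneg_pos)
  obtain \<kappa> where \<kappa>: "\<kappa> > 0" "\<And>\<xi> \<xi>' z. \<xi> \<in> E \<Longrightarrow> \<xi>' \<in> E \<Longrightarrow> z \<in> subdiff_graph (\<psi> \<xi>) \<Longrightarrow> norm z \<le> \<rho> \<Longrightarrow>
    infdist z (subdiff_graph (\<psi> \<xi>')) \<le> \<kappa> * norm (\<xi> - \<xi>')"
    by (rule sub_lipschitz_infdist[OF lip \<rho>]) blast
  define C where "C = 1 / \<alpha> + zb / \<alpha> + (\<kappa> + (1 + \<bar>A\<bar>) * \<kappa> / \<alpha>)"
  have C: "1 / \<alpha> \<le> C" "zb / \<alpha> \<le> C" "\<kappa> + (1 + \<bar>A\<bar>) * \<kappa> / \<alpha> \<le> C" "0 \<le> C"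
    using \<alpha> zb \<kappa>(1) by (auto simp: C_def)
  have "\<bar>prox (\<psi> \<xi>') a' r' - prox (\<psi> \<xi>) a r\<bar> \<le> C * (\<bar>r' - r\<bar> + norm (\<xi>' - \<xi>) + \<bar>a' - a\<bar>)"
    if *: "\<xi> \<in> E" "\<xi>' \<in> E" "norm \<xi> \<le> m" "\<alpha> \<le> a" "a \<le> A" "\<alpha> \<le> a'" "a' \<le> A" "\<bar>r\<bar> \<le> M" for \<xi> \<xi>' a a' r r'
  proof -
    have a: "a > 0" "a' > 0" using \<alpha> * by auto
    define z where "z = prox (\<psi> \<xi>) a r"
    have "\<bar>z\<bar> \<le> \<bar>prox (\<psi> \<xi>) a 0\<bar> + \<bar>r - 0\<bar> / a"
      using prox_lipschitz[OF \<psi>[OF *(1)] a(1), of r 0] unfolding z_def by linarith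
    also have "\<dots> \<le> G + \<bar>M\<bar> / \<alpha>" using G(2)[OF *(1,3,4,5)] * \<alpha> a by (intro add_mono frac_le) auto
    finally have z: "\<bar>z\<bar> \<le> zb" by (simp add: zb_def)
    have az: "\<bar>a * z\<bar> \<le> \<bar>A\<bar> * zb" unfolding abs_mult using z * a zb by (intro mult_mono) auto
    have "norm (z, r - a * z) \<le> \<bar>z\<bar> + \<bar>r - a * z\<bar>" using norm_Pair_le[of z "r - a * z"] by simp
    also have "\<dots> \<le> \<rho>" using z az *(8) unfolding \<rho>_def by linarith
    finally have "norm (z, r - a * z) \<le> \<rho>" .
    then have "infdist (z, r - a * z) (subdiff_graph (\<psi> \<xi>')) \<le> \<kappa> * norm (\<xi> - \<xi>')"
      unfolding z_def by (intro \<kappa>(2)[OF *(1,2)] prox_in_graph[OF \<psi>[OF *(1)] a(1)])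
    then have "\<bar>prox (\<psi> \<xi>') a' r' - z\<bar> \<le> \<kappa> * norm (\<xi> - \<xi>') + (\<bar>r' - r\<bar> + \<bar>a' - a\<bar> * \<bar>z\<bar> + (1 + a') * (\<kappa> * norm (\<xi> - \<xi>'))) / a'"
      by (rule prox_perturbed[OF \<psi>[OF *(2)] a(2) refl])
    also have "\<dots> \<le> \<kappa> * norm (\<xi> - \<xi>') + (\<bar>r' - r\<bar> + \<bar>a' - a\<bar> * zb + (1 + \<bar>A\<bar>) * (\<kappa> * norm (\<xi> - \<xi>'))) / \<alpha>"
      using * \<alpha> \<kappa>(1) z zb a by (intro add_left_mono frac_le add_mono mult_right_mono mult_left_mono)
        (auto intro!: add_nonneg_nonneg mult_nonneg_nonneg)
    also have "\<dots> = 1 / \<alpha> * \<bar>r' - r\<bar> + zb / \<alpha> * \<bar>a' - a\<bar> + (\<kappa> + (1 + \<bar>A\<bar>) * \<kappa> / \<alpha>) * norm (\<xi>' - \<xi>)"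
      using \<alpha> by (simp add: field_simps norm_minus_commute)
    also have "\<dots> \<le> C * \<bar>r' - r\<bar> + C * \<bar>a' - a\<bar> + C * norm (\<xi>' - \<xi>)"
      using C by (intro add_mono mult_right_mono) auto
    finally show ?thesis by (simp add: z_def distrib_left)
  qed
  then show ?thesis using C(4) by blast
qed

section \<open>Functions realised by ReLU networks\<close>

text \<open>The index bounds the nesting of ReLUs. Affine functions occur at every level because
  each layer of the network receives the raw inputs again.\<close>

inductive relu_fun :: "nat \<Rightarrow> (real \<Rightarrow> real ^ 'm \<Rightarrow> real \<Rightarrow> real) \<Rightarrow> bool" where
  relu_fun_affine: "relu_fun l (\<lambda>r \<xi> \<eta>. a * r + w \<bullet> \<xi> + c * \<eta> + b)"
| relu_fun_add: "relu_fun l f \<Longrightarrow> relu_fun l g \<Longrightarrow> relu_fun l (\<lambda>r \<xi> \<eta>. f r \<xi> \<eta> + g r \<xi> \<eta>)"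
| relu_fun_scale: "relu_fun l f \<Longrightarrow> relu_fun l (\<lambda>r \<xi> \<eta>. c * f r \<xi> \<eta>)"
| relu_fun_relu: "relu_fun l f \<Longrightarrow> relu_fun (Suc l) (\<lambda>r \<xi> \<eta>. max 0 (f r \<xi> \<eta>))"

lemma relu_fun_Suc: "relu_fun l f \<Longrightarrow> relu_fun (Suc l) f"
  by (induction rule: relu_fun.induct) (auto intro: relu_fun.intros)

lemma relu_fun_mono: "relu_fun l f \<Longrightarrow> l \<le> l' \<Longrightarrow> relu_fun l' f"
  by (rotate_tac, induction rule: dec_induct) (auto intro: relu_fun_Suc)

definition affine_fun :: "(real \<Rightarrow> real ^ 'm \<Rightarrow> real \<Rightarrow> real) \<Rightarrow> bool" where
  "affine_fun f \<longleftrightarrow> (\<exists>a w c b. f = (\<lambda>r \<xi> \<eta>. a * r + w \<bullet> \<xi> + c * \<eta> + b))"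

lemma affine_fun_add: "affine_fun f \<Longrightarrow> affine_fun g \<Longrightarrow> affine_fun (\<lambda>r \<xi> \<eta>. f r \<xi> \<eta> + g r \<xi> \<eta>)"
  unfolding affine_fun_def
proof (elim exE)
  fix a w c b a' w' c' b'
  assume "f = (\<lambda>r \<xi> \<eta>. a * r + w \<bullet> \<xi> + c * \<eta> + b)" "g = (\<lambda>r \<xi> \<eta>. a' * r + w' \<bullet> \<xi> + c' * \<eta> + b')"
  then have "(\<lambda>r \<xi> \<eta>. f r \<xi> \<eta> + g r \<xi> \<eta>) = (\<lambda>r \<xi> \<eta>. (a + a') * r + (w + w') \<bullet> \<xi> + (c + c') * \<eta> + (b + b'))"
    by (simp add: algebra_simps inner_add_left)
  then show "\<exists>a w c b. (\<lambda>r \<xi> \<eta>. f r \<xi> \<eta> + g r \<xi> \<eta>) = (\<lambda>r \<xi> \<eta>. a * r + w \<bullet> \<xi> + c * \<eta> + b)" by blast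
qed

lemma affine_fun_scale: "affine_fun f \<Longrightarrow> affine_fun (\<lambda>r \<xi> \<eta>. k * f r \<xi> \<eta>)"
  unfolding affine_fun_def
proof (elim exE)
  fix a w c b
  assume "f = (\<lambda>r \<xi> \<eta>. a * r + w \<bullet> \<xi> + c * \<eta> + b)"
  then have "(\<lambda>r \<xi> \<eta>. k * f r \<xi> \<eta>) = (\<lambda>r \<xi> \<eta>. (k * a) * r + (k *\<^sub>R w) \<bullet> \<xi> + (k * c) * \<eta> + k * b)"
    by (simp add: algebra_simps)
  then show "\<exists>a w c b. (\<lambda>r \<xi> \<eta>. k * f r \<xi> \<eta>) = (\<lambda>r \<xi> \<eta>. a * r + w \<bullet> \<xi> + c * \<eta> + b)" by blast
qed

lemma affine_fun_zero: "affine_fun (\<lambda>r \<xi> \<eta>. 0)"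
  unfolding affine_fun_def by (intro exI[of _ 0]) simp

text \<open>The normal form matching one layer: above level 0 a function is an affine map of the
  inputs plus a combination of ReLUs of functions one level lower. A list with repetitions serves as
  the collection of neurons.\<close>

lemma relu_fun_decompose:
  assumes "relu_fun l f"
  shows "(l = 0 \<longrightarrow> affine_fun f) \<and> (\<forall>l'. l = Suc l' \<longrightarrow> (\<exists>A xs. affine_fun A \<and> (\<forall>(c, g)\<in>set xs. relu_fun l' g) \<and>
    f = (\<lambda>r \<xi> \<eta>. A r \<xi> \<eta> + (\<Sum>(c, g)\<leftarrow>xs. c * max 0 (g r \<xi> \<eta>)))))"
  using assms
proof (induction rule: relu_fun.induct)
  case (relu_fun_affine l a w c b)
  have A: "affine_fun (\<lambda>r \<xi> \<eta>. a * r + w \<bullet> \<xi> + c * \<eta> + b)" unfolding affine_fun_def by blast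
  then show ?case
    by (intro conjI impI allI A exI[of _ "\<lambda>r \<xi> \<eta>. a * r + w \<bullet> \<xi> + c * \<eta> + b"] exI[of _ "[]"]) auto
next
  case (relu_fun_add l f g)
  show ?case
  proof (intro conjI impI allI)
    assume "l = 0" then show "affine_fun (\<lambda>r \<xi> \<eta>. f r \<xi> \<eta> + g r \<xi> \<eta>)" using relu_fun_add.IH by (simp add: affine_fun_add)
  next
    fix l' assume "l = Suc l'"
    obtain A xs where 1: "affine_fun A" "\<forall>(c, g)\<in>set xs. relu_fun l' g"
      "f = (\<lambda>r \<xi> \<eta>. A r \<xi> \<eta> + (\<Sum>(c, g)\<leftarrow>xs. c * max 0 (g r \<xi> \<eta>)))"
      using relu_fun_add.IH(1) \<open>l = Suc l'\<close> by blast
    obtain B ys where 2: "affine_fun B" "\<forall>(c, g)\<in>set ys. relu_fun l' g"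
      "g = (\<lambda>r \<xi> \<eta>. B r \<xi> \<eta> + (\<Sum>(c, g)\<leftarrow>ys. c * max 0 (g r \<xi> \<eta>)))"
      using relu_fun_add.IH(2) \<open>l = Suc l'\<close> by blast
    note * = 1 2
    show "\<exists>A xs. affine_fun A \<and> (\<forall>(c, g)\<in>set xs. relu_fun l' g) \<and>
      (\<lambda>r \<xi> \<eta>. f r \<xi> \<eta> + g r \<xi> \<eta>) = (\<lambda>r \<xi> \<eta>. A r \<xi> \<eta> + (\<Sum>(c, g)\<leftarrow>xs. c * max 0 (g r \<xi> \<eta>)))"
      using * by (intro exI[of _ "\<lambda>r \<xi> \<eta>. A r \<xi> \<eta> + B r \<xi> \<eta>"] exI[of _ "xs @ ys"]) (auto simp: affine_fun_add fun_eq_iff)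
  qed
next
  case (relu_fun_scale l f k)
  show ?case
  proof (intro conjI impI allI)
    assume "l = 0" then show "affine_fun (\<lambda>r \<xi> \<eta>. k * f r \<xi> \<eta>)" using relu_fun_scale.IH by (simp add: affine_fun_scale)
  next
    fix l' assume "l = Suc l'"
    then obtain A xs where *: "affine_fun A" "\<forall>(c, g)\<in>set xs. relu_fun l' g"
      "f = (\<lambda>r \<xi> \<eta>. A r \<xi> \<eta> + (\<Sum>(c, g)\<leftarrow>xs. c * max 0 (g r \<xi> \<eta>)))"
      using relu_fun_scale.IH by blast
    have "k * (\<Sum>(c, g)\<leftarrow>xs. c * max 0 (g r \<xi> \<eta>)) = (\<Sum>(c, g)\<leftarrow>map (\<lambda>(c, g). (k * c, g)) xs. c * max 0 (g r \<xi> \<eta>))" for r \<xi> \<eta>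
      by (induction xs) (auto simp: distrib_left mult.assoc)
    then show "\<exists>A xs. affine_fun A \<and> (\<forall>(c, g)\<in>set xs. relu_fun l' g) \<and>
      (\<lambda>r \<xi> \<eta>. k * f r \<xi> \<eta>) = (\<lambda>r \<xi> \<eta>. A r \<xi> \<eta> + (\<Sum>(c, g)\<leftarrow>xs. c * max 0 (g r \<xi> \<eta>)))"
      using * by (intro exI[of _ "\<lambda>r \<xi> \<eta>. k * A r \<xi> \<eta>"] exI[of _ "map (\<lambda>(c, g). (k * c, g)) xs"])
        (auto simp: affine_fun_scale distrib_left)
  qed
next
  case (relu_fun_relu l f)
  show ?case
  proof (intro conjI impI allI)
    fix l' assume "Suc l = Suc l'"
    then show "\<exists>A xs. affine_fun A \<and> (\<forall>(c, g)\<in>set xs. relu_fun l' g) \<and>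
      (\<lambda>r \<xi> \<eta>. max 0 (f r \<xi> \<eta>)) = (\<lambda>r \<xi> \<eta>. A r \<xi> \<eta> + (\<Sum>(c, g)\<leftarrow>xs. c * max 0 (g r \<xi> \<eta>)))"
      using relu_fun_relu(1) by (intro exI[of _ "\<lambda>r \<xi> \<eta>. 0"] exI[of _ "[(1, f)]"]) (simp add: affine_fun_zero)
  qed simp
qed

section \<open>Realisation of the normal form by layers\<close>

definition qa_readout :: "'m::finite qa \<Rightarrow> nat \<Rightarrow> (real \<Rightarrow> real ^ 'm \<Rightarrow> real \<Rightarrow> real) \<Rightarrow> bool" where
  "qa_readout H l f \<longleftrightarrow> (\<exists>k A. affine_fun A \<and>
     f = (\<lambda>r \<xi> \<eta>. (\<Sum>j<qa_width H l. k j * qa_hidden H r \<xi> \<eta> l j) + A r \<xi> \<eta>))"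

lemma qa_readout_affine: "affine_fun f \<Longrightarrow> qa_readout H l f"
  unfolding qa_readout_def by (intro exI[of _ "\<lambda>j. 0"] exI[of _ f]) simp

lemma qa_readout_add:
  assumes "qa_readout H l f" "qa_readout H l g" shows "qa_readout H l (\<lambda>r \<xi> \<eta>. f r \<xi> \<eta> + g r \<xi> \<eta>)"
proof -
  obtain k A k' B where "affine_fun A" "affine_fun B"
    "f = (\<lambda>r \<xi> \<eta>. (\<Sum>j<qa_width H l. k j * qa_hidden H r \<xi> \<eta> l j) + A r \<xi> \<eta>)"
    "g = (\<lambda>r \<xi> \<eta>. (\<Sum>j<qa_width H l. k' j * qa_hidden H r \<xi> \<eta> l j) + B r \<xi> \<eta>)"
    using assms unfolding qa_readout_def by blast
  then show ?thesis
    unfolding qa_readout_def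
    by (intro exI[of _ "\<lambda>j. k j + k' j"] exI[of _ "\<lambda>r \<xi> \<eta>. A r \<xi> \<eta> + B r \<xi> \<eta>"])
      (simp add: affine_fun_add distrib_right sum.distrib add_ac)
qed

lemma qa_readout_neuron:
  assumes "i < qa_width H l" shows "qa_readout H l (\<lambda>r \<xi> \<eta>. c * qa_hidden H r \<xi> \<eta> l i)"
proof -
  have "(\<Sum>j<qa_width H l. (if j = i then c else 0) * x j) = c * x i" for x :: "nat \<Rightarrow> real"
    using assms by (simp add: if_distrib[of "\<lambda>z. z * _"] cong: if_cong)
  then show ?thesis
    unfolding qa_readout_def
    by (intro exI[of _ "\<lambda>j. if j = i then c else 0"] exI[of _ "\<lambda>r \<xi> \<eta>. 0"]) (simp add: affine_fun_zero)
qed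

text \<open>Hidden layer l reads only parameters with index at most l, so a network can be extended
  by overwriting later parameters.\<close>

lemma qa_hidden_cong:
  assumes "\<And>j. j \<le> l \<Longrightarrow> qa_width H j = qa_width H' j \<and> qa_Wv H j = qa_Wv H' j \<and> qa_Wr H j = qa_Wr H' j \<and>
    qa_Wxi H j = qa_Wxi H' j \<and> qa_Weta H j = qa_Weta H' j \<and> qa_b H j = qa_b H' j"
  shows "qa_hidden H r \<xi> \<eta> l = qa_hidden H' r \<xi> \<eta> l"
  using assms
proof (induction l)
  case 0
  then show ?case by simp
next
  case (Suc l)
  have "qa_hidden H r \<xi> \<eta> l = qa_hidden H' r \<xi> \<eta> l" using Suc by simp
  then show ?case using Suc.prems[of "Suc l"] Suc.prems[of l] by simp
qed

text \<open>The induction needs a whole list of functions read from the same layer: decomposing even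
  one function one level down produces several functions, which must be neurons of a common
  layer.\<close>

lemma qa_realise_family:
  fixes fs :: "(real \<Rightarrow> real ^ 'm \<Rightarrow> real \<Rightarrow> real) list"
  shows "(\<forall>f\<in>set fs. relu_fun l f) \<Longrightarrow>
    \<exists>H :: 'm qa. (\<forall>j. qa_width H j \<ge> 1) \<and> (\<forall>f\<in>set fs. qa_readout H l f)"
proof (induction l arbitrary: fs)
  case 0
  define H where "H = \<lparr>qa_depth = 1, qa_width = (\<lambda>_. 1), qa_Wv = (\<lambda>_ _ _. 0), qa_Wr = (\<lambda>_ _. 0),
    qa_Wxi = (\<lambda>_ _. 0 :: real ^ 'm), qa_Weta = (\<lambda>_ _. 0), qa_b = (\<lambda>_ _. 0)\<rparr>"
  have "qa_readout H 0 f" if "f \<in> set fs" for f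
    using relu_fun_decompose[of 0 f] 0 that by (auto intro: qa_readout_affine)
  moreover have "qa_width H j \<ge> 1" for j by (simp add: H_def)
  ultimately show ?case by blast
next
  case (Suc l)
  have "\<forall>f\<in>set fs. \<exists>A xs. affine_fun A \<and> (\<forall>(c, g)\<in>set xs. relu_fun l g) \<and>
    f = (\<lambda>r \<xi> \<eta>. A r \<xi> \<eta> + (\<Sum>(c, g)\<leftarrow>xs. c * max 0 (g r \<xi> \<eta>)))"
    using relu_fun_decompose Suc.prems by blast
  from bchoice[OF this] obtain A where "\<forall>f\<in>set fs. \<exists>xs. affine_fun (A f) \<and> (\<forall>(c, g)\<in>set xs. relu_fun l g) \<and>
    f = (\<lambda>r \<xi> \<eta>. A f r \<xi> \<eta> + (\<Sum>(c, g)\<leftarrow>xs. c * max 0 (g r \<xi> \<eta>)))" by (elim exE)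
  from bchoice[OF this] obtain xs where *: "\<forall>f\<in>set fs. affine_fun (A f) \<and> (\<forall>(c, g)\<in>set (xs f). relu_fun l g) \<and>
    f = (\<lambda>r \<xi> \<eta>. A f r \<xi> \<eta> + (\<Sum>(c, g)\<leftarrow>xs f. c * max 0 (g r \<xi> \<eta>)))" by (elim exE)
  have Axs: "\<And>f. f \<in> set fs \<Longrightarrow> affine_fun (A f)" "\<And>f c g. f \<in> set fs \<Longrightarrow> (c, g) \<in> set (xs f) \<Longrightarrow> relu_fun l g"
    "\<And>f. f \<in> set fs \<Longrightarrow> f = (\<lambda>r \<xi> \<eta>. A f r \<xi> \<eta> + (\<Sum>(c, g)\<leftarrow>xs f. c * max 0 (g r \<xi> \<eta>)))"
    subgoal using * by blast
    subgoal using * by blast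
    subgoal using * by blast
    done
  define gs where "gs = concat (map (\<lambda>f. map snd (xs f)) fs)"
  have "\<forall>g\<in>set gs. relu_fun l g" using Axs(2) by (auto simp: gs_def)
  then obtain H :: "'m qa" where H: "\<And>j. qa_width H j \<ge> 1" "\<And>g. g \<in> set gs \<Longrightarrow> qa_readout H l g"
    using Suc.IH[of gs] by blast
  \<comment> \<open>All parameters of one neuron are packed into a tuple, so that a single choice
    over i yields the whole layer.\<close>
  define F where "F p = (\<lambda>r \<xi> \<eta>. (\<Sum>j<qa_width H l. fst p j * qa_hidden H r \<xi> \<eta> l j) +
    (fst (snd p) * r + fst (snd (snd p)) \<bullet> \<xi> + fst (snd (snd (snd p))) * \<eta> + snd (snd (snd (snd p)))))" for p
  have "\<forall>i. \<exists>p. i < length gs \<longrightarrow> gs ! i = F p"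
  proof (intro allI)
    fix i
    show "\<exists>p. i < length gs \<longrightarrow> gs ! i = F p"
    proof (cases "i < length gs")
      case True
      then have "qa_readout H l (gs ! i)" by (simp add: H(2))
      then obtain k a w c b where "gs ! i = (\<lambda>r \<xi> \<eta>. (\<Sum>j<qa_width H l. k j * qa_hidden H r \<xi> \<eta> l j) + (a * r + w \<bullet> \<xi> + c * \<eta> + b))"
        unfolding qa_readout_def affine_fun_def by blast
      then have "gs ! i = F (k, a, w, c, b)" by (simp add: F_def)
      then show ?thesis by blast
    qed simp
  qed
  from choice[OF this] obtain p where p: "\<And>i. i < length gs \<Longrightarrow> gs ! i = F (p i)" by blast
  define k a w c b where "k i = fst (p i)" and "a i = fst (snd (p i))" and "w i = fst (snd (snd (p i)))"
    and "c i = fst (snd (snd (snd (p i))))" and "b i = snd (snd (snd (snd (p i))))" for i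
  have par: "gs ! i = (\<lambda>r \<xi> \<eta>. (\<Sum>j<qa_width H l. k i j * qa_hidden H r \<xi> \<eta> l j) + (a i * r + w i \<bullet> \<xi> + c i * \<eta> + b i))"
    if "i < length gs" for i
    unfolding p[OF that] by (simp add: F_def k_def a_def w_def c_def b_def)
  \<comment> \<open>One spare neuron keeps the width positive when \<open>gs\<close> is
    empty.\<close>
  define H' where "H' = H\<lparr>qa_width := (qa_width H)(Suc l := length gs + 1), qa_Wv := (qa_Wv H)(Suc l := k),
    qa_Wr := (qa_Wr H)(Suc l := a), qa_Wxi := (qa_Wxi H)(Suc l := w), qa_Weta := (qa_Weta H)(Suc l := c),
    qa_b := (qa_b H)(Suc l := b)\<rparr>"
  have hid: "qa_hidden H' r \<xi> \<eta> l = qa_hidden H r \<xi> \<eta> l" for r \<xi> \<eta>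
    by (rule qa_hidden_cong) (auto simp: H'_def)
  have neuron: "qa_hidden H' r \<xi> \<eta> (Suc l) i = max 0 ((gs ! i) r \<xi> \<eta>)" if "i < length gs" for i r \<xi> \<eta>
    unfolding par[OF that] by (simp add: hid) (simp add: H'_def add_ac)
  have "qa_readout H' (Suc l) f" if f: "f \<in> set fs" for f
  proof -
    have "qa_readout H' (Suc l) (\<lambda>r \<xi> \<eta>. \<Sum>(c, g)\<leftarrow>ys. c * max 0 (g r \<xi> \<eta>))" if "set ys \<subseteq> set (xs f)" for ys
      using that
    proof (induction ys)
      case Nil
      then show ?case by (simp add: qa_readout_affine affine_fun_zero)
    next
      case (Cons y ys)
      obtain c g where y: "y = (c, g)" by (cases y)
      then have "g \<in> set gs" using Cons.prems f by (force simp: gs_def)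
      then obtain i where i: "i < length gs" "gs ! i = g" by (metis in_set_conv_nth)
      have "i < qa_width H' (Suc l)" using i by (simp add: H'_def)
      from qa_readout_neuron[OF this, of c]
      have "qa_readout H' (Suc l) (\<lambda>r \<xi> \<eta>. c * max 0 (g r \<xi> \<eta>))" using neuron[OF i(1)] i(2) by simp
      from qa_readout_add[OF this] Cons show ?case by (simp add: y)
    qed
    from qa_readout_add[OF qa_readout_affine[OF Axs(1)[OF f]] this[OF order_refl]]
    show ?thesis using Axs(3)[OF f] by simp
  qed
  moreover have "qa_width H' j \<ge> 1" for j using H(1) by (simp add: H'_def)
  ultimately show ?case by blast
qed

lemma relu_fun_realised:
  fixes f :: "real \<Rightarrow> real ^ 'm \<Rightarrow> real \<Rightarrow> real"
  assumes "relu_fun l f"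
  shows "\<exists>H :: 'm qa. qa_module H \<and> qa_net H = f"
proof -
  obtain H :: "'m qa" where H: "\<And>j. qa_width H j \<ge> 1" "qa_readout H l f"
    using qa_realise_family[of "[f]" l] assms by auto
  then obtain k a w c b where f: "f = (\<lambda>r \<xi> \<eta>. (\<Sum>j<qa_width H l. k j * qa_hidden H r \<xi> \<eta> l j) + (a * r + w \<bullet> \<xi> + c * \<eta> + b))"
    unfolding qa_readout_def affine_fun_def by blast
  define H' where "H' = H\<lparr>qa_depth := Suc l, qa_Wv := (qa_Wv H)(Suc l := \<lambda>i. k),
    qa_Wr := (qa_Wr H)(Suc l := \<lambda>i. a), qa_Wxi := (qa_Wxi H)(Suc l := \<lambda>i. w), qa_Weta := (qa_Weta H)(Suc l := \<lambda>i. c),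
    qa_b := (qa_b H)(Suc l := \<lambda>i. b)\<rparr>"
  have hid: "qa_hidden H' r \<xi> \<eta> l = qa_hidden H r \<xi> \<eta> l" for r \<xi> \<eta>
    by (rule qa_hidden_cong) (auto simp: H'_def)
  have "qa_net H' r \<xi> \<eta> = f r \<xi> \<eta>" for r \<xi> \<eta>
  proof -
    have "qa_depth H' = Suc l" by (simp add: H'_def)
    then show ?thesis unfolding qa_net_def f by (simp add: hid) (simp add: H'_def)
  qed
  then have "qa_net H' = f" by (intro ext)
  moreover have "qa_module H'" using H(1) by (simp add: qa_module_def H'_def)
  ultimately show ?thesis by blast
qed

section \<open>Lattice operations on ReLU functions and approximation of Lipschitz functions\<close>

definition relu_class :: "(real \<Rightarrow> real ^ 'm \<Rightarrow> real \<Rightarrow> real) \<Rightarrow> bool" where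
  "relu_class f \<longleftrightarrow> (\<exists>l. relu_fun l f)"

lemma relu_class_affine: "relu_class (\<lambda>r \<xi> \<eta>. a * r + w \<bullet> \<xi> + c * \<eta> + b)"
  unfolding relu_class_def using relu_fun_affine by blast

lemma relu_class_add:
  assumes "relu_class f" "relu_class g" shows "relu_class (\<lambda>r \<xi> \<eta>. f r \<xi> \<eta> + g r \<xi> \<eta>)"
proof -
  obtain l l' where "relu_fun l f" "relu_fun l' g" using assms by (auto simp: relu_class_def)
  then have "relu_fun (max l l') f" "relu_fun (max l l') g" by (auto intro: relu_fun_mono)
  then show ?thesis unfolding relu_class_def using relu_fun_add by blast
qed

lemma relu_class_scale: "relu_class f \<Longrightarrow> relu_class (\<lambda>r \<xi> \<eta>. c * f r \<xi> \<eta>)"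
  unfolding relu_class_def using relu_fun_scale by blast

lemma relu_class_relu: "relu_class f \<Longrightarrow> relu_class (\<lambda>r \<xi> \<eta>. max 0 (f r \<xi> \<eta>))"
  unfolding relu_class_def using relu_fun_relu by blast

lemma relu_class_const: "relu_class (\<lambda>r \<xi> \<eta>. b)"
  using relu_class_affine[of 0 0 0 b] by simp

lemma relu_class_diff:
  "relu_class f \<Longrightarrow> relu_class g \<Longrightarrow> relu_class (\<lambda>r \<xi> \<eta>. f r \<xi> \<eta> - g r \<xi> \<eta>)"
  using relu_class_add[of f "\<lambda>r \<xi> \<eta>. (-1) * g r \<xi> \<eta>"] relu_class_scale[of g "-1"] by simp

lemma relu_class_max:
  assumes "relu_class f" "relu_class g" shows "relu_class (\<lambda>r \<xi> \<eta>. max (f r \<xi> \<eta>) (g r \<xi> \<eta>))"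
proof -
  have "(\<lambda>r \<xi> \<eta>. max (f r \<xi> \<eta>) (g r \<xi> \<eta>)) = (\<lambda>r \<xi> \<eta>. f r \<xi> \<eta> + max 0 (g r \<xi> \<eta> - f r \<xi> \<eta>))"
    by (intro ext) auto
  then show ?thesis using assms by (simp only: relu_class_add relu_class_relu relu_class_diff)
qed

lemma relu_class_min:
  assumes "relu_class f" "relu_class g" shows "relu_class (\<lambda>r \<xi> \<eta>. min (f r \<xi> \<eta>) (g r \<xi> \<eta>))"
proof -
  have "(\<lambda>r \<xi> \<eta>. min (f r \<xi> \<eta>) (g r \<xi> \<eta>)) = (\<lambda>r \<xi> \<eta>. f r \<xi> \<eta> - max 0 (f r \<xi> \<eta> - g r \<xi> \<eta>))"
    by (intro ext) auto
  then show ?thesis using assms by (simp only: relu_class_diff relu_class_relu)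
qed

lemma relu_class_abs:
  assumes "relu_class f" shows "relu_class (\<lambda>r \<xi> \<eta>. \<bar>f r \<xi> \<eta>\<bar>)"
proof -
  have "(\<lambda>r \<xi> \<eta>. \<bar>f r \<xi> \<eta>\<bar>) = (\<lambda>r \<xi> \<eta>. max (f r \<xi> \<eta>) ((-1) * f r \<xi> \<eta>))"
    by (intro ext) auto
  then show ?thesis using assms by (simp only: relu_class_max relu_class_scale)
qed

lemma relu_class_sum:
  "finite I \<Longrightarrow> (\<And>i. i \<in> I \<Longrightarrow> relu_class (f i)) \<Longrightarrow> relu_class (\<lambda>r \<xi> \<eta>. \<Sum>i\<in>I. f i r \<xi> \<eta>)"
  by (induction I rule: finite_induct) (auto simp: relu_class_const relu_class_add)

lemma relu_class_Min:
  assumes "finite P" "P \<noteq> {}" "\<And>p. p \<in> P \<Longrightarrow> relu_class (f p)"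
  shows "\<exists>h. relu_class h \<and> (\<forall>r \<xi> \<eta>. (\<forall>p\<in>P. h r \<xi> \<eta> \<le> f p r \<xi> \<eta>) \<and> (\<exists>p\<in>P. h r \<xi> \<eta> = f p r \<xi> \<eta>))"
  using assms
proof (induction P rule: finite_ne_induct)
  case (singleton p)
  then show ?case by (intro exI[of _ "f p"]) auto
next
  case (insert p P)
  then obtain h where h: "relu_class h" "\<And>r \<xi> \<eta>. (\<forall>p\<in>P. h r \<xi> \<eta> \<le> f p r \<xi> \<eta>) \<and> (\<exists>p\<in>P. h r \<xi> \<eta> = f p r \<xi> \<eta>)" by blast
  show ?case
  proof (intro exI[of _ "\<lambda>r \<xi> \<eta>. min (f p r \<xi> \<eta>) (h r \<xi> \<eta>)"] conjI allI)
    show "relu_class (\<lambda>r \<xi> \<eta>. min (f p r \<xi> \<eta>) (h r \<xi> \<eta>))" using insert.prems h(1) by (intro relu_class_min) auto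
    fix r \<xi> \<eta>
    show "\<forall>q\<in>insert p P. min (f p r \<xi> \<eta>) (h r \<xi> \<eta>) \<le> f q r \<xi> \<eta>" using h(2)[of r \<xi> \<eta>] by force
    show "\<exists>q\<in>insert p P. min (f p r \<xi> \<eta>) (h r \<xi> \<eta>) = f q r \<xi> \<eta>" using h(2)[of r \<xi> \<eta>] by (auto simp: min_def)
  qed
qed

text \<open>McShane-type formula \<open>min\<^sub>i (g(z\<^sub>i) + C \<parallel>z - z\<^sub>i\<parallel>\<^sub>1)\<close> over a finite net \<open>z\<^sub>i\<close>, with the first
  argument clipped to \<open>[-M, M]\<close>.\<close>

lemma relu_approximates_lipschitz:
  fixes g :: "real \<Rightarrow> real ^ 'm \<Rightarrow> real \<Rightarrow> real"
  assumes K: "compact K" and M: "M \<ge> 0" and C: "C \<ge> 0" and \<eta>: "\<delta> > 0"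
    and lip: "\<And>r \<xi> a r' \<xi>' a'. \<bar>r\<bar> \<le> M \<Longrightarrow> \<bar>r'\<bar> \<le> M \<Longrightarrow> (\<xi>, a) \<in> K \<Longrightarrow> (\<xi>', a') \<in> K \<Longrightarrow>
      \<bar>g r' \<xi>' a' - g r \<xi> a\<bar> \<le> C * (\<bar>r' - r\<bar> + norm (\<xi>' - \<xi>) + \<bar>a' - a\<bar>)"
  shows "\<exists>H :: 'm qa. qa_module H \<and> (\<forall>r \<xi> a. (\<xi>, a) \<in> K \<longrightarrow>
    \<bar>qa_net H r \<xi> a - g (max (- M) (min M r)) \<xi> a\<bar> \<le> \<delta>)"
proof (cases "K = {}")
  case True
  obtain H :: "'m qa" where "qa_module H" using relu_fun_realised[OF relu_fun_affine] by blast
  then show ?thesis using True by blast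
next
  case False
  define Z where "Z = {- M..M} \<times> K"
  have Z: "compact Z" "Z \<noteq> {}" using K M False by (auto simp: Z_def intro: compact_Times)
  define n where "n = real CARD('m)"
  have n: "n \<ge> 0" by (simp add: n_def)
  \<comment> \<open>Half of \<delta>, since the distance term occurs twice in the upper estimate:
    once in \<open>F\<close> and once through the Lipschitz bound. The divisor n + 2 in
    \<open>e\<close> counts the n coordinates of \<xi> together with r and a.\<close>
  define e1 where "e1 = \<delta> / 2 / (C + 1)"
  define e where "e = e1 / (n + 2)"
  have e1: "e1 > 0" using C \<eta> by (simp add: e1_def)
  then have e: "e > 0" using n by (simp add: e_def)
  have "Z \<subseteq> (\<Union>z\<in>Z. ball z e)" using e by force
  then obtain P where P: "P \<subseteq> Z" "finite P" "Z \<subseteq> (\<Union>z\<in>P. ball z e)"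
    using Z(1) by (elim compactE_image[where C = Z and f = "\<lambda>z. ball z e"]) auto
  have Pne: "P \<noteq> {}" using P(3) Z(2) by auto
  define clip where "clip r = max (- M) (min M r)" for r
  \<comment> \<open>The l^1 distance is a sum of absolute values, hence a ReLU function, and it
    dominates the Euclidean norm in the Lipschitz hypothesis.\<close>
  define D where "D p r \<xi> a = \<bar>clip r - fst p\<bar> + (\<Sum>i\<in>UNIV. \<bar>\<xi> $ i - fst (snd p) $ i\<bar>) + \<bar>a - snd (snd p)\<bar>"
    for p :: "real \<times> (real ^ 'm) \<times> real" and r \<xi> a
  define F where "F p r \<xi> a = g (fst p) (fst (snd p)) (snd (snd p)) + C * D p r \<xi> a" for p r \<xi> a
  have coord: "relu_class (\<lambda>r \<xi> (a :: real). r)" "relu_class (\<lambda>r (\<xi> :: real ^ 'm) a. a)" "relu_class (\<lambda>r \<xi> a. \<xi> $ i)" for i :: 'm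
    using relu_class_affine[of 1 0 0 0] relu_class_affine[of 0 0 1 0] relu_class_affine[of 0 "axis i 1" 0 0]
    by (simp_all add: inner_axis' )
  have "relu_class (F p)" for p
    unfolding F_def[abs_def] D_def clip_def
    by (intro relu_class_add relu_class_scale relu_class_const relu_class_abs relu_class_diff relu_class_max
        relu_class_min relu_class_sum coord finite_UNIV finite)
  then obtain h where h: "relu_class h" "\<And>r \<xi> a. (\<forall>p\<in>P. h r \<xi> a \<le> F p r \<xi> a) \<and> (\<exists>p\<in>P. h r \<xi> a = F p r \<xi> a)"
    using relu_class_Min[OF P(2) Pne, of F] by blast
  obtain H :: "'m qa" where H: "qa_module H" "qa_net H = h"
    using h(1) relu_fun_realised unfolding relu_class_def by blast
  have "\<bar>h r \<xi> a - g (clip r) \<xi> a\<bar> \<le> \<delta>" if \<xi>a: "(\<xi>, a) \<in> K" for r \<xi> a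
  proof -
    have clip: "\<bar>clip r\<bar> \<le> M" using M by (auto simp: clip_def)
    have glip: "\<bar>g (clip r) \<xi> a - g (fst p) (fst (snd p)) (snd (snd p))\<bar> \<le> C * D p r \<xi> a" if p: "p \<in> P" for p
    proof -
      have "p \<in> Z" using p P(1) by blast
      then have "\<bar>fst p\<bar> \<le> M" "(fst (snd p), snd (snd p)) \<in> K" by (auto simp: Z_def)
      then have "\<bar>g (clip r) \<xi> a - g (fst p) (fst (snd p)) (snd (snd p))\<bar>
        \<le> C * (\<bar>clip r - fst p\<bar> + norm (\<xi> - fst (snd p)) + \<bar>a - snd (snd p)\<bar>)" by (intro lip clip \<xi>a)
      also have "\<dots> \<le> C * D p r \<xi> a"
        unfolding D_def using norm_le_l1_cart[of "\<xi> - fst (snd p)"] C by (intro mult_left_mono) auto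
      finally show ?thesis .
    qed
    obtain p where p: "p \<in> P" "h r \<xi> a = F p r \<xi> a" using h(2) by blast
    have lower: "g (clip r) \<xi> a \<le> h r \<xi> a" using glip[OF p(1)] p(2) by (simp add: F_def)
    have "(clip r, \<xi>, a) \<in> Z" using clip \<xi>a by (auto simp: Z_def)
    then obtain q where q: "q \<in> P" "dist q (clip r, \<xi>, a) < e" using P(3) by auto
    have "D q r \<xi> a \<le> e + n * e + e"
      unfolding D_def
    proof (intro add_mono)
      have 1: "dist (fst q) (clip r) \<le> dist q (clip r, \<xi>, a)" using dist_fst_le[of q "(clip r, \<xi>, a)"] by simp
      have 2: "dist (snd q) (\<xi>, a) \<le> dist q (clip r, \<xi>, a)" using dist_snd_le[of q "(clip r, \<xi>, a)"] by simp
      have 3: "dist (fst (snd q)) \<xi> \<le> dist (snd q) (\<xi>, a)" using dist_fst_le[of "snd q" "(\<xi>, a)"] by simp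
      have 4: "dist (snd (snd q)) a \<le> dist (snd q) (\<xi>, a)" using dist_snd_le[of "snd q" "(\<xi>, a)"] by simp
      show "\<bar>clip r - fst q\<bar> \<le> e" using 1 q(2) by (simp add: dist_real_def abs_minus_commute)
      show "\<bar>a - snd (snd q)\<bar> \<le> e" using 2 4 q(2) by (simp add: dist_real_def abs_minus_commute)
      have "\<bar>\<xi> $ i - fst (snd q) $ i\<bar> \<le> e" for i
        using dist_vec_nth_le[of "fst (snd q)" i \<xi>] 2 3 q(2) by (simp add: dist_real_def abs_minus_commute)
      then have "(\<Sum>i\<in>UNIV. \<bar>\<xi> $ i - fst (snd q) $ i\<bar>) \<le> (\<Sum>i\<in>(UNIV :: 'm set). e)" by (intro sum_mono) auto
      then show "(\<Sum>i\<in>UNIV. \<bar>\<xi> $ i - fst (snd q) $ i\<bar>) \<le> n * e" by (simp add: n_def)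
    qed
    also have "\<dots> = (n + 2) * e" by (simp add: algebra_simps)
    finally have Dq: "C * D q r \<xi> a \<le> (C + 1) * ((n + 2) * e)"
      using C n e by (intro mult_mono) (auto simp: D_def sum_nonneg)
    have half: "(C + 1) * ((n + 2) * e) = \<delta> / 2"
    proof -
      have "(n + 2) * e = e1" using n by (simp add: e_def)
      moreover have "(C + 1) * e1 = \<delta> / 2"
        using C nonzero_eq_divide_eq[of "C + 1" e1 "\<delta> / 2"] by (auto simp: e1_def mult.commute)
      ultimately show ?thesis by simp
    qed
    have "h r \<xi> a \<le> F q r \<xi> a" using h(2) q(1) by blast
    also have "\<dots> \<le> g (clip r) \<xi> a + 2 * (C * D q r \<xi> a)" using glip[OF q(1)] by (simp add: F_def)
    also have "\<dots> \<le> g (clip r) \<xi> a + \<delta>" using Dq half by linarith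
    finally show ?thesis using lower by simp
  qed
  then show ?thesis using H by (auto simp: clip_def)
qed

section \<open>Integral functionals and resolvents\<close>

text \<open>Values are split into positive and negative parts and every subtracted part is moved to
  the other side, so no difference of infinities arises and the inequality can be
  integrated.\<close>

lemma ereal_pos_neg_add_le:
  assumes "h + ereal d \<le> k"
  shows "e2ennreal h + e2ennreal (- k) + ennreal d \<le> e2ennreal k + e2ennreal (- h) + ennreal (- d)"
proof (cases h)
  case (real h')
  show ?thesis
  proof (cases k)
    case k: (real k')
    have "max 0 h' + max 0 (- k') + max 0 d \<le> max 0 k' + max 0 (- h') + max 0 (- d)"
      using assms real k by auto
    then have "ennreal (max 0 h' + max 0 (- k') + max 0 d) \<le> ennreal (max 0 k' + max 0 (- h') + max 0 (- d))"
      by (rule ennreal_leI)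
    then have "ennreal (max 0 h') + ennreal (max 0 (- k')) + ennreal (max 0 d)
        \<le> ennreal (max 0 k') + ennreal (max 0 (- h')) + ennreal (max 0 (- d))"
      by (simp add: ennreal_plus)
    moreover have "ennreal (max 0 x) = ennreal x" for x by (simp add: max_def ennreal_neg)
    ultimately show ?thesis using real k by simp
  next
    case PInf
    then show ?thesis by (simp add: e2ennreal_infty)
  next
    case MInf
    then show ?thesis using assms real by simp
  qed
next
  case PInf
  then have "k = \<infinity>" using assms by simp
  then show ?thesis by (simp add: e2ennreal_infty)
next
  case MInf
  then show ?thesis by (simp add: e2ennreal_infty)
qed

text \<open>A companion for positive parts alone. It still says something when the integral of the
  negative part of h is infinite and the balanced inequality becomes trivial.\<close>

lemma ereal_pos_add_le:
  assumes "h + ereal d \<le> k"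
  shows "e2ennreal h \<le> e2ennreal k + ennreal (- d)"
proof (cases "\<exists>h' k'. h = ereal h' \<and> k = ereal k'")
  case True
  then obtain h' k' where hk: "h = ereal h'" "k = ereal k'" by blast
  have "max 0 h' \<le> max 0 k' + max 0 (- d)" using assms hk by auto
  then have "ennreal (max 0 h') \<le> ennreal (max 0 k') + ennreal (max 0 (- d))"
    by (simp add: ennreal_leI flip: ennreal_plus)
  moreover have "ennreal (max 0 x) = ennreal x" for x by (simp add: max_def ennreal_neg)
  ultimately show ?thesis using hk by simp
next
  case False
  then have "h = - \<infinity> \<or> k = \<infinity>" using assms by (cases h; cases k) auto
  then show ?thesis by (auto simp: e2ennreal_neg)
qed

text \<open>The balanced inequality between the six integrals yields the claim once the four parts
  of h and k are finite. The cases with infinite parts are settled by the convention \<infinity> -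
  \<infinity> = \<infinity> and by the exclusion of -\<infinity>.\<close>

lemma ereal_integral_mono_add:
  assumes h: "h \<in> borel_measurable M" and k: "k \<in> borel_measurable M" and d: "integrable M d"
    and le: "AE x in M. h x + ereal (d x) \<le> k x"
    and fin: "ereal_integral M h \<noteq> - \<infinity>" "ereal_integral M k \<noteq> - \<infinity>"
  shows "ereal_integral M h + ereal (\<integral>x. d x \<partial>M) \<le> ereal_integral M k"
proof -
  define hp hm kp km dp dm where "hp = (\<integral>\<^sup>+x. e2ennreal (h x) \<partial>M)" and "hm = (\<integral>\<^sup>+x. e2ennreal (- h x) \<partial>M)"
    and "kp = (\<integral>\<^sup>+x. e2ennreal (k x) \<partial>M)" and "km = (\<integral>\<^sup>+x. e2ennreal (- k x) \<partial>M)"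
    and "dp = (\<integral>\<^sup>+x. ennreal (d x) \<partial>M)" and "dm = (\<integral>\<^sup>+x. ennreal (- d x) \<partial>M)"
  have [measurable]: "h \<in> borel_measurable M" "k \<in> borel_measurable M" "d \<in> borel_measurable M" using h k d by auto
  have h_eq: "ereal_integral M h = enn2ereal hp - enn2ereal hm" and k_eq: "ereal_integral M k = enn2ereal kp - enn2ereal km"
    by (simp_all add: ereal_integral_def hp_def hm_def kp_def km_def)
  have "dp < \<infinity>" "dm < \<infinity>"
    using d unfolding dp_def dm_def real_integrable_def by (auto simp: less_top)
  then obtain dp' dm' where D: "dp = ennreal dp'" "dp' \<ge> 0" "dm = ennreal dm'" "dm' \<ge> 0"
    by (metis ennreal_cases infinity_ennreal_def less_irrefl)
  have d_int: "(\<integral>x. d x \<partial>M) = dp' - dm'"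
    using D unfolding real_lebesgue_integral_def[OF d] dp_def[symmetric] dm_def[symmetric] by simp
  have "(\<integral>\<^sup>+x. e2ennreal (h x) + e2ennreal (- k x) + ennreal (d x) \<partial>M)
      \<le> (\<integral>\<^sup>+x. e2ennreal (k x) + e2ennreal (- h x) + ennreal (- d x) \<partial>M)"
    by (rule nn_integral_mono_AE) (use le in eventually_elim, rule ereal_pos_neg_add_le)
  then have main: "hp + km + dp \<le> kp + hm + dm"
    unfolding hp_def hm_def kp_def km_def dp_def dm_def by (simp add: nn_integral_add)
  show ?thesis
  proof (cases "kp = \<infinity>")
    case True
    then show ?thesis by (simp add: k_eq)
  next
    case kp: False
    then obtain kp' where KP: "kp = ennreal kp'" "kp' \<ge> 0" by (metis ennreal_cases infinity_ennreal_def)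
    have "km \<noteq> \<infinity>" using fin(2) KP unfolding k_eq by auto
    then obtain km' where KM: "km = ennreal km'" "km' \<ge> 0" by (metis ennreal_cases infinity_ennreal_def)
    show ?thesis
    proof (cases "hm = \<infinity>")
      case True
      show ?thesis
      proof (cases "hp = \<infinity>")
        case False
        then obtain hp' where "hp = ennreal hp'" "hp' \<ge> 0" by (metis ennreal_cases infinity_ennreal_def)
        then have "ereal_integral M h = - \<infinity>" using True by (simp add: h_eq)
        then show ?thesis using fin(1) by simp
      next
        case hp: True
        \<comment> \<open>Both parts of h are infinite while \<open>kp\<close> is finite. Comparing
          positive parts bounds \<open>hp\<close> by \<open>kp + dm\<close>, which is finite, so
          this case is contradictory.\<close>
        have "(\<integral>\<^sup>+x. e2ennreal (h x) \<partial>M) \<le> (\<integral>\<^sup>+x. e2ennreal (k x) + ennreal (- d x) \<partial>M)"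
          by (rule nn_integral_mono_AE) (use le in eventually_elim, rule ereal_pos_add_le)
        also have "\<dots> = kp + dm" unfolding kp_def dm_def by (intro nn_integral_add) measurable
        finally have "hp \<le> kp + dm" by (simp add: hp_def)
        then show ?thesis using hp KP D by (simp add: top_unique)
      qed
    next
      case False
      then obtain hm' where HM: "hm = ennreal hm'" "hm' \<ge> 0" by (metis ennreal_cases infinity_ennreal_def)
      have "hp \<noteq> \<infinity>" using main KP HM D by (auto simp: top_unique)
      then obtain hp' where HP: "hp = ennreal hp'" "hp' \<ge> 0" by (metis ennreal_cases infinity_ennreal_def)
      have "ennreal (hp' + km' + dp') \<le> ennreal (kp' + hm' + dm')"
        using main HP HM KP KM D by (simp add: ennreal_plus)
      then have "hp' + km' + dp' \<le> kp' + hm' + dm'" using HP HM KP KM D by (subst (asm) ennreal_le_iff) auto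
      then show ?thesis using HP HM KP KM by (simp add: h_eq k_eq d_int)
    qed
  qed
qed

text \<open>The pointwise subgradient inequality is integrated against an arbitrary competitor v.
  Properness of \<theta> guarantees that neither integral is -\<infinity>.\<close>

lemma l2_subdiff_integral_functional:
  assumes \<theta>: "is_integral_functional X \<psi> \<mu> \<theta>" "\<forall>u\<in>L2 X. \<theta> u \<noteq> - \<infinity>"
    and u: "u \<in> L2 X" and p: "p \<in> L2 X"
    and sub: "AE x in lebesgue_on X. (u x, p x) \<in> subdiff_graph (\<psi> (\<mu> x))"
  shows "p \<in> l2_subdiff X \<theta> u"
  unfolding l2_subdiff_def
proof (intro CollectI conjI ballI p)
  fix v assume v: "v \<in> L2 X"
  have int: "integrable (lebesgue_on X) (\<lambda>x. p x * (v x - u x))"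
    using p u v by (intro L2_mult_integrable L2_diff)
  have "ereal_integral (lebesgue_on X) (\<lambda>x. \<psi> (\<mu> x) (u x)) + ereal (\<integral>x. p x * (v x - u x) \<partial>lebesgue_on X)
      \<le> ereal_integral (lebesgue_on X) (\<lambda>x. \<psi> (\<mu> x) (v x))"
  proof (rule ereal_integral_mono_add[OF _ _ int])
    show "AE x in lebesgue_on X. \<psi> (\<mu> x) (u x) + ereal (p x * (v x - u x)) \<le> \<psi> (\<mu> x) (v x)"
      using sub by eventually_elim (simp add: subdiff_graph_def)
  qed (use \<theta> u v in \<open>auto simp: is_integral_functional_def\<close>)
  then show "\<theta> u + ereal (l2_inner X p (\<lambda>x. v x - u x)) \<le> \<theta> v"
    using \<theta>(1) u v by (simp add: is_integral_functional_def l2_inner_def)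
qed

lemma l2_subdiff_cong:
  assumes "q \<in> l2_subdiff X \<theta> u" "u \<in> L2 X" "q' \<in> L2 X" "ae_eq X q q'"
  shows "q' \<in> l2_subdiff X \<theta> u"
proof -
  have "l2_inner X q' (\<lambda>x. v x - u x) = l2_inner X q (\<lambda>x. v x - u x)" if "v \<in> L2 X" for v
    using assms that by (intro l2_inner_cong L2_measurable L2_diff) (auto simp: l2_subdiff_def intro: ae_eq_sym)
  then show ?thesis using assms by (simp add: l2_subdiff_def)
qed

lemma l2_subdiff_finite:
  assumes \<theta>: "l2_proper_convex_lsc X \<theta>" and "u \<in> L2 X" "q \<in> l2_subdiff X \<theta> u"
  obtains t where "\<theta> u = ereal t"
proof -
  obtain v where v: "v \<in> L2 X" "\<theta> v \<noteq> \<infinity>" using \<theta> by (auto simp: l2_proper_convex_lsc_def)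
  have "\<theta> u + ereal (l2_inner X q (\<lambda>x. v x - u x)) \<le> \<theta> v" using assms(3) v(1) by (simp add: l2_subdiff_def)
  then have "\<theta> u \<noteq> \<infinity>" using v(2) by auto
  moreover have "\<theta> u \<noteq> - \<infinity>" using \<theta> assms(2) by (simp add: l2_proper_convex_lsc_def)
  ultimately show thesis using that by (cases "\<theta> u") auto
qed

lemma l2_subdiff_monotone:
  assumes \<theta>: "l2_proper_convex_lsc X \<theta>" and u: "u \<in> L2 X" "u' \<in> L2 X"
    and q: "q \<in> l2_subdiff X \<theta> u" "q' \<in> l2_subdiff X \<theta> u'"
  shows "0 \<le> l2_inner X (\<lambda>x. q x - q' x) (\<lambda>x. u x - u' x)"
proof -
  obtain t where t: "\<theta> u = ereal t" using l2_subdiff_finite[OF \<theta> u(1) q(1)] .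
  obtain t' where t': "\<theta> u' = ereal t'" using l2_subdiff_finite[OF \<theta> u(2) q(2)] .
  have qL: "q \<in> L2 X" "q' \<in> L2 X" using q by (auto simp: l2_subdiff_def)
  have "\<theta> u + ereal (l2_inner X q (\<lambda>x. u' x - u x)) \<le> \<theta> u'" "\<theta> u' + ereal (l2_inner X q' (\<lambda>x. u x - u' x)) \<le> \<theta> u"
    using q u by (auto simp: l2_subdiff_def)
  then show ?thesis
    using u qL by (simp add: t t' l2_inner_diff_left l2_inner_diff_right L2_diff)
qed

section \<open>The resolvent as a pointwise proximal map\<close>

locale control_problem =
  fixes \<Omega> :: "(real ^ 'd) set"
    and S N :: "(real ^ 'd \<Rightarrow> real) \<Rightarrow> (real ^ 'd \<Rightarrow> real)"
    and \<theta> :: "(real ^ 'd \<Rightarrow> real) \<Rightarrow> ereal"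
    and lam :: "real ^ 'd \<Rightarrow> real"
    and \<mu> :: "real ^ 'd \<Rightarrow> real ^ 'm"
    and E :: "(real ^ 'm) set"
    and \<psi> :: "real ^ 'm \<Rightarrow> real \<Rightarrow> ereal"
    and s c0 \<tau> :: real
  assumes domain: "bounded_lipschitz_domain \<Omega>" "closure \<Omega> \<subseteq> torus_cell"
    and N: "l2_bounded_linear \<Omega> \<Omega> N" "l2_self_adjoint \<Omega> N" "c0 > 0" "l2_coercive \<Omega> c0 N"
    and S: "l2_bounded_linear \<Omega> \<Omega> S"
    and theta: "l2_proper_convex_lsc \<Omega> \<theta>"
    and s: "0 < s" "s \<le> 1"
    and reg_S: "factors_through_hs \<Omega> s S"
    and reg_N: "\<forall>u\<in>L2 \<Omega>. ae_eq \<Omega> (N u) (\<lambda>x. lam x * u x)"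
      "AE x in lebesgue_on \<Omega>. lam x \<ge> c0"
    and reg_theta: "closed E" "\<forall>\<xi>\<in>E. proper_convex_lsc (\<psi> \<xi>)"
      "AE x in lebesgue_on \<Omega>. \<mu> x \<in> E" "is_integral_functional \<Omega> \<psi> \<mu> \<theta>"
    and reg_coeff: "lam \<in> Hs \<Omega> s \<inter> Linf \<Omega>" "\<forall>i. (\<lambda>x. \<mu> x $ i) \<in> Hs \<Omega> s \<inter> Linf \<Omega>"
    and sub_lipschitz: "sub_lipschitz_graphs E \<psi>"
    and tau: "\<tau> \<ge> 0"
begin

lemma domain_props: "open \<Omega>" "bounded \<Omega>" "\<Omega> \<in> lmeasurable" "\<Omega> \<in> sets lebesgue"
  using domain(1) by (auto simp: bounded_lipschitz_domain_def lmeasurable_open)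

text \<open>N + \<tau> I multiplies by lam + \<tau>, so the inclusion defining the resolvent
  decouples into one scalar proximal problem at each point.\<close>

definition pw_res :: "real \<Rightarrow> real ^ 'm \<Rightarrow> real \<Rightarrow> real" where
  "pw_res r \<xi> \<eta> = prox (\<psi> \<xi>) (\<eta> + \<tau>) r"

text \<open>Essential boundedness of the coefficients and closedness of E place almost all
  coefficient values in a compact set. A network that is accurate uniformly on this set is accurate
  almost everywhere on the domain.\<close>

lemma coefficient_range:
  obtains K where "compact K" "\<And>\<xi> \<eta>. (\<xi>, \<eta>) \<in> K \<Longrightarrow> \<xi> \<in> E \<and> c0 \<le> \<eta>" "AE x in lebesgue_on \<Omega>. (\<mu> x, lam x) \<in> K"
proof -
  obtain \<Lambda> where \<Lambda>: "AE x in lebesgue_on \<Omega>. \<bar>lam x\<bar> \<le> \<Lambda>" using reg_coeff(1) by (auto simp: Linf_def)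
  have "\<forall>i. \<exists>C. AE x in lebesgue_on \<Omega>. \<bar>\<mu> x $ i\<bar> \<le> C" using reg_coeff(2) by (auto simp: Linf_def)
  then obtain C where C: "\<And>i. AE x in lebesgue_on \<Omega>. \<bar>\<mu> x $ i\<bar> \<le> C i" by metis
  then have C': "AE x in lebesgue_on \<Omega>. \<forall>i\<in>UNIV. \<bar>\<mu> x $ i\<bar> \<le> C i" by (subst AE_finite_all) auto
  define K where "K = (E \<inter> cball 0 (\<Sum>i\<in>UNIV. C i)) \<times> {c0..\<Lambda>}"
  show thesis
  proof (rule that[of K])
    show "compact K" unfolding K_def using reg_theta(1) by (intro compact_Times closed_Int_compact) auto
    show "\<xi> \<in> E \<and> c0 \<le> \<eta>" if "(\<xi>, \<eta>) \<in> K" for \<xi> \<eta> using that by (simp add: K_def)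
    show "AE x in lebesgue_on \<Omega>. (\<mu> x, lam x) \<in> K"
      using \<Lambda> C' reg_N(2) reg_theta(3)
    proof eventually_elim
      case (elim x)
      have "norm (\<mu> x) \<le> (\<Sum>i\<in>UNIV. C i)"
        using norm_le_l1_cart[of "\<mu> x"] elim(2) by (meson order_trans sum_mono)
      then show ?case using elim by (auto simp: K_def)
    qed
  qed
qed

definition coeff_set :: "((real ^ 'm) \<times> real) set" where
  "coeff_set = (SOME K. compact K \<and> (\<forall>\<xi> \<eta>. (\<xi>, \<eta>) \<in> K \<longrightarrow> \<xi> \<in> E \<and> c0 \<le> \<eta>) \<and>
     (AE x in lebesgue_on \<Omega>. (\<mu> x, lam x) \<in> K))"

lemma coeff_set: "compact coeff_set" "(\<xi>, \<eta>) \<in> coeff_set \<Longrightarrow> \<xi> \<in> E \<and> c0 \<le> \<eta>"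
  "AE x in lebesgue_on \<Omega>. (\<mu> x, lam x) \<in> coeff_set"
proof -
  have "\<exists>K. compact K \<and> (\<forall>\<xi> \<eta>. (\<xi>, \<eta>) \<in> K \<longrightarrow> \<xi> \<in> E \<and> c0 \<le> \<eta>) \<and> (AE x in lebesgue_on \<Omega>. (\<mu> x, lam x) \<in> K)"
    by (rule coefficient_range) blast
  from someI_ex[OF this] show "compact coeff_set" "(\<xi>, \<eta>) \<in> coeff_set \<Longrightarrow> \<xi> \<in> E \<and> c0 \<le> \<eta>"
    "AE x in lebesgue_on \<Omega>. (\<mu> x, lam x) \<in> coeff_set" unfolding coeff_set_def[symmetric] by blast+
qed

lemma coeff_set_bound:
  obtains m \<Lambda> where "\<And>\<xi> \<eta>. (\<xi>, \<eta>) \<in> coeff_set \<Longrightarrow> norm \<xi> \<le> m \<and> \<eta> \<le> \<Lambda>"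
proof -
  obtain b where b: "\<And>y. y \<in> coeff_set \<Longrightarrow> norm y \<le> b"
    using compact_imp_bounded[OF coeff_set(1)] by (auto simp: bounded_iff)
  have "norm \<xi> \<le> b \<and> \<eta> \<le> b" if "(\<xi>, \<eta>) \<in> coeff_set" for \<xi> \<eta>
    using b[OF that] norm_fst_le[of \<xi> \<eta>] norm_snd_le[of \<eta> \<xi>] by auto
  then show thesis by (rule that)
qed

lemma pw_res_props:
  assumes "(\<xi>, \<eta>) \<in> coeff_set"
  shows "(pw_res r \<xi> \<eta>, r - (\<eta> + \<tau>) * pw_res r \<xi> \<eta>) \<in> subdiff_graph (\<psi> \<xi>)"
    "\<bar>pw_res r \<xi> \<eta> - pw_res r' \<xi> \<eta>\<bar> \<le> \<bar>r - r'\<bar> / (c0 + \<tau>)"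
proof -
  have \<xi>: "\<xi> \<in> E" "c0 \<le> \<eta>" using coeff_set(2)[OF assms] by auto
  have pos: "\<eta> + \<tau> > 0" "c0 + \<tau> > 0" using \<xi> N(3) tau by auto
  have \<psi>: "proper_convex_lsc (\<psi> \<xi>)" using reg_theta(2) \<xi> by blast
  show "(pw_res r \<xi> \<eta>, r - (\<eta> + \<tau>) * pw_res r \<xi> \<eta>) \<in> subdiff_graph (\<psi> \<xi>)"
    unfolding pw_res_def by (rule prox_in_graph[OF \<psi> pos(1)])
  have "\<bar>pw_res r \<xi> \<eta> - pw_res r' \<xi> \<eta>\<bar> \<le> \<bar>r - r'\<bar> / (\<eta> + \<tau>)"
    unfolding pw_res_def by (rule prox_lipschitz[OF \<psi> pos(1)])
  also have "\<dots> \<le> \<bar>r - r'\<bar> / (c0 + \<tau>)" using \<xi> pos by (intro divide_left_mono) auto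
  finally show "\<bar>pw_res r \<xi> \<eta> - pw_res r' \<xi> \<eta>\<bar> \<le> \<bar>r - r'\<bar> / (c0 + \<tau>)" .
qed

lemma pw_res_growth:
  obtains G where "G \<ge> 0" "\<And>r \<xi> \<eta>. (\<xi>, \<eta>) \<in> coeff_set \<Longrightarrow> \<bar>pw_res r \<xi> \<eta>\<bar> \<le> G + \<bar>r\<bar> / (c0 + \<tau>)"
proof -
  obtain m \<Lambda> where m: "\<And>\<xi> \<eta>. (\<xi>, \<eta>) \<in> coeff_set \<Longrightarrow> norm \<xi> \<le> m \<and> \<eta> \<le> \<Lambda>" using coeff_set_bound by blast
  have pos: "c0 + \<tau> > 0" using N(3) tau by simp
  obtain G where G: "G \<ge> 0" "\<forall>\<xi>\<in>E. \<forall>a. norm \<xi> \<le> m \<and> c0 + \<tau> \<le> a \<and> a \<le> \<Lambda> + \<tau> \<longrightarrow> \<bar>prox (\<psi> \<xi>) a 0\<bar> \<le> G"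
    using prox_bounded[of E \<psi>, OF _ sub_lipschitz pos] reg_theta(2) by metis
  have "\<bar>pw_res r \<xi> \<eta>\<bar> \<le> G + \<bar>r\<bar> / (c0 + \<tau>)" if "(\<xi>, \<eta>) \<in> coeff_set" for r \<xi> \<eta>
  proof -
    have "\<bar>pw_res 0 \<xi> \<eta>\<bar> \<le> G" unfolding pw_res_def using G(2) m[OF that] coeff_set(2)[OF that] by auto
    then show ?thesis using pw_res_props(2)[OF that, of r 0] by simp
  qed
  then show thesis using that G(1) by blast
qed

lemma pw_res_network:
  assumes "M \<ge> 0" "\<delta> > 0"
  shows "\<exists>H :: 'm qa. qa_module H \<and> (\<forall>r \<xi> \<eta>. (\<xi>, \<eta>) \<in> coeff_set \<longrightarrow>
    \<bar>qa_net H r \<xi> \<eta> - pw_res (max (- M) (min M r)) \<xi> \<eta>\<bar> \<le> \<delta>)"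
proof -
  obtain m \<Lambda> where m: "\<And>\<xi> \<eta>. (\<xi>, \<eta>) \<in> coeff_set \<Longrightarrow> norm \<xi> \<le> m \<and> \<eta> \<le> \<Lambda>" using coeff_set_bound by blast
  have pos: "c0 + \<tau> > 0" using N(3) tau by simp
  have \<psi>: "\<And>\<xi>. \<xi> \<in> E \<Longrightarrow> proper_convex_lsc (\<psi> \<xi>)" using reg_theta(2) by blast
  obtain C where C: "C \<ge> 0" "\<forall>\<xi>\<in>E. \<forall>\<xi>'\<in>E. \<forall>a a' r r'. norm \<xi> \<le> m \<and> c0 + \<tau> \<le> a \<and> a \<le> \<Lambda> + \<tau> \<and> c0 + \<tau> \<le> a' \<and> a' \<le> \<Lambda> + \<tau> \<and> \<bar>r\<bar> \<le> M \<longrightarrow>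
    \<bar>prox (\<psi> \<xi>') a' r' - prox (\<psi> \<xi>) a r\<bar> \<le> C * (\<bar>r' - r\<bar> + norm (\<xi>' - \<xi>) + \<bar>a' - a\<bar>)"
    using prox_locally_lipschitz[OF \<psi> sub_lipschitz pos, of m "\<Lambda> + \<tau>" M] by blast
  show ?thesis
  proof (rule relu_approximates_lipschitz[OF coeff_set(1) assms(1) C(1) assms(2)])
    fix r \<xi> \<eta> r' \<xi>' \<eta>'
    assume *: "\<bar>r\<bar> \<le> M" "\<bar>r'\<bar> \<le> M" "(\<xi>, \<eta>) \<in> coeff_set" "(\<xi>', \<eta>') \<in> coeff_set"
    have "\<bar>prox (\<psi> \<xi>') (\<eta>' + \<tau>) r' - prox (\<psi> \<xi>) (\<eta> + \<tau>) r\<bar> \<le> C * (\<bar>r' - r\<bar> + norm (\<xi>' - \<xi>) + \<bar>(\<eta>' + \<tau>) - (\<eta> + \<tau>)\<bar>)"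
    proof -
      have "\<xi> \<in> E" "\<xi>' \<in> E" "norm \<xi> \<le> m \<and> c0 + \<tau> \<le> \<eta> + \<tau> \<and> \<eta> + \<tau> \<le> \<Lambda> + \<tau> \<and> c0 + \<tau> \<le> \<eta>' + \<tau> \<and> \<eta>' + \<tau> \<le> \<Lambda> + \<tau> \<and> \<bar>r\<bar> \<le> M"
        using * m[OF *(3)] m[OF *(4)] coeff_set(2)[OF *(3)] coeff_set(2)[OF *(4)] by auto
      then show ?thesis by (rule C(2)[rule_format])
    qed
    then show "\<bar>pw_res r' \<xi>' \<eta>' - pw_res r \<xi> \<eta>\<bar> \<le> C * (\<bar>r' - r\<bar> + norm (\<xi>' - \<xi>) + \<bar>\<eta>' - \<eta>\<bar>)"
      by (simp add: pw_res_def)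
  qed
qed

lemma qa_apply_measurable:
  fixes H :: "'m qa"
  assumes u: "u \<in> borel_measurable (lebesgue_on \<Omega>)"
  shows "qa_apply H \<mu> lam u \<in> borel_measurable (lebesgue_on \<Omega>)"
proof -
  have [measurable]: "u \<in> borel_measurable (lebesgue_on \<Omega>)" "lam \<in> borel_measurable (lebesgue_on \<Omega>)"
    "\<And>i. (\<lambda>x. \<mu> x $ i) \<in> borel_measurable (lebesgue_on \<Omega>)"
    using u reg_coeff by (auto simp: Linf_def)
  have inner[measurable]: "(\<lambda>x. w \<bullet> \<mu> x) \<in> borel_measurable (lebesgue_on \<Omega>)" for w
    unfolding inner_vec_def by measurable
  have [measurable]: "(\<lambda>x. qa_hidden H (u x) (\<mu> x) (lam x) l i) \<in> borel_measurable (lebesgue_on \<Omega>)" for l i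
  proof (induction l arbitrary: i)
    case (Suc l)
    note Suc[measurable]
    show ?case by (simp) measurable
  qed simp
  show ?thesis unfolding qa_apply_def qa_net_def Let_def by measurable
qed

text \<open>The candidate is the pointwise proximal value. Its measurability is not evident, since
  \<open>prox\<close> is a choice; it is obtained by exhibiting the candidate as an almost
  everywhere limit of ReLU networks applied to measurable data. The growth bound then puts it in
  L^2.\<close>

lemma resolvent_exists:
  assumes w: "w \<in> L2 \<Omega>"
  obtains u where "u \<in> L2 \<Omega>" "AE x in lebesgue_on \<Omega>. u x = pw_res (w x) (\<mu> x) (lam x)"
    "(\<lambda>x. w x - (N u x + \<tau> * u x)) \<in> l2_subdiff \<Omega> \<theta> u"
proof -
  have "\<exists>H :: 'm qa. \<forall>r \<xi> \<eta>. (\<xi>, \<eta>) \<in> coeff_set \<longrightarrow>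
      \<bar>qa_net H r \<xi> \<eta> - pw_res (max (- real n) (min (real n) r)) \<xi> \<eta>\<bar> \<le> 1 / real (Suc n)" for n
    using pw_res_network[of "real n" "1 / real (Suc n)"] by auto
  then obtain H :: "nat \<Rightarrow> 'm qa" where H: "\<And>n r \<xi> \<eta>. (\<xi>, \<eta>) \<in> coeff_set \<Longrightarrow>
      \<bar>qa_net (H n) r \<xi> \<eta> - pw_res (max (- real n) (min (real n) r)) \<xi> \<eta>\<bar> \<le> 1 / real (Suc n)" by metis
  define u where "u x = lim (\<lambda>n. qa_apply (H n) \<mu> lam w x)" for x
  have u_meas: "u \<in> borel_measurable (lebesgue_on \<Omega>)"
    unfolding u_def using qa_apply_measurable[OF L2_measurable[OF w]] by (rule borel_measurable_lim_metric)
  have u_eq: "AE x in lebesgue_on \<Omega>. u x = pw_res (w x) (\<mu> x) (lam x)"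
    using coeff_set(3)
  proof eventually_elim
    case (elim x)
    have "(\<lambda>n. qa_apply (H n) \<mu> lam w x) \<longlonglongrightarrow> pw_res (w x) (\<mu> x) (lam x)"
    proof (rule LIM_zero_cancel, rule Lim_null_comparison)
      show "(\<lambda>n. 1 / real (Suc n)) \<longlonglongrightarrow> 0" by (intro LIMSEQ_Suc lim_1_over_n)
      show "\<forall>\<^sub>F n in sequentially. norm (qa_apply (H n) \<mu> lam w x - pw_res (w x) (\<mu> x) (lam x)) \<le> 1 / real (Suc n)"
        using eventually_ge_at_top[of "nat \<lceil>\<bar>w x\<bar>\<rceil>"]
      proof eventually_elim
        case (elim n)
        then have "\<bar>w x\<bar> \<le> real n" by linarith
        then have "max (- real n) (min (real n) (w x)) = w x" by (auto simp: abs_le_iff)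
        then show ?case using H[OF \<open>(\<mu> x, lam x) \<in> coeff_set\<close>, of n "w x"] by (simp add: qa_apply_def)
      qed
    qed
    then show ?case unfolding u_def by (rule limI)
  qed
  obtain G where G: "G \<ge> 0" "\<And>r \<xi> \<eta>. (\<xi>, \<eta>) \<in> coeff_set \<Longrightarrow> \<bar>pw_res r \<xi> \<eta>\<bar> \<le> G + \<bar>r\<bar> / (c0 + \<tau>)"
    using pw_res_growth by blast
  have pos: "c0 + \<tau> > 0" using N(3) tau by simp
  have uL: "u \<in> L2 \<Omega>"
  proof (rule L2_dominated[OF _ u_meas])
    show "(\<lambda>x. G + \<bar>w x\<bar> / (c0 + \<tau>)) \<in> L2 \<Omega>"
      using w domain_props(3) by (intro L2_add L2_divide L2_abs L2_const)
    show "AE x in lebesgue_on \<Omega>. \<bar>u x\<bar> \<le> \<bar>G + \<bar>w x\<bar> / (c0 + \<tau>)\<bar>"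
      using u_eq coeff_set(3)
    proof eventually_elim
      case (elim x)
      show ?case using G(2)[OF elim(2), of "w x"] by (simp add: elim(1))
    qed
  qed
  have NuL: "N u \<in> L2 \<Omega>" by (rule l2_bounded_linear_in[OF N(1) uL])
  define q where "q = (\<lambda>x. w x - (N u x + \<tau> * u x))"
  have qL: "q \<in> L2 \<Omega>" unfolding q_def using w NuL uL by (intro L2_diff L2_add L2_scale)
  have "AE x in lebesgue_on \<Omega>. N u x = lam x * u x" using reg_N(1) uL by (simp add: ae_eq_def)
  then have "AE x in lebesgue_on \<Omega>. (u x, q x) \<in> subdiff_graph (\<psi> (\<mu> x))"
    using u_eq coeff_set(3)
  proof eventually_elim
    case (elim x)
    have "q x = w x - (lam x + \<tau>) * u x" using elim(1) by (simp add: q_def distrib_right)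
    then show ?case using pw_res_props(1)[OF elim(3), of "w x"] elim(2) by simp
  qed
  then have "q \<in> l2_subdiff \<Omega> \<theta> u"
    using theta by (intro l2_subdiff_integral_functional[OF reg_theta(4) _ uL qL]) (auto simp: l2_proper_convex_lsc_def)
  then show thesis using that[OF uL u_eq] by (simp add: q_def)
qed

abbreviation res :: "(real ^ 'd \<Rightarrow> real) \<Rightarrow> (real ^ 'd \<Rightarrow> real)" where
  "res \<equiv> resolvent \<Omega> N \<tau> \<theta>"

lemma resolvent_props:
  assumes "w \<in> L2 \<Omega>"
  shows "res w \<in> L2 \<Omega>" "(\<lambda>x. w x - (N (res w) x + \<tau> * res w x)) \<in> l2_subdiff \<Omega> \<theta> (res w)"
proof -
  have "\<exists>u. u \<in> L2 \<Omega> \<and> (\<lambda>x. w x - (N u x + \<tau> * u x)) \<in> l2_subdiff \<Omega> \<theta> u"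
    using resolvent_exists[OF assms] by metis
  from someI_ex[OF this] show "res w \<in> L2 \<Omega>" "(\<lambda>x. w x - (N (res w) x + \<tau> * res w x)) \<in> l2_subdiff \<Omega> \<theta> (res w)"
    unfolding resolvent_def by auto
qed

text \<open>Monotonicity of the subdifferential of \<theta> is combined with coercivity of N. It is
  stated for arbitrary solutions of the inclusion, so that it yields uniqueness as well as the
  estimates for \<open>res\<close>.\<close>

lemma inclusion_monotone:
  assumes w: "w \<in> L2 \<Omega>" "w' \<in> L2 \<Omega>" and u: "u \<in> L2 \<Omega>" "u' \<in> L2 \<Omega>"
    and sub: "(\<lambda>x. w x - (N u x + \<tau> * u x)) \<in> l2_subdiff \<Omega> \<theta> u"
      "(\<lambda>x. w' x - (N u' x + \<tau> * u' x)) \<in> l2_subdiff \<Omega> \<theta> u'"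
  shows "(c0 + \<tau>) * (l2_norm \<Omega> (\<lambda>x. u x - u' x))\<^sup>2 \<le> l2_inner \<Omega> (\<lambda>x. w x - w' x) (\<lambda>x. u x - u' x)"
proof -
  define a where "a = (\<lambda>x. u x - u' x)"
  have aL: "a \<in> L2 \<Omega>" unfolding a_def using u by auto
  have NL: "N u \<in> L2 \<Omega>" "N u' \<in> L2 \<Omega>" "N a \<in> L2 \<Omega>" using l2_bounded_linear_in[OF N(1)] u aL by auto
  have "0 \<le> l2_inner \<Omega> (\<lambda>x. (w x - (N u x + \<tau> * u x)) - (w' x - (N u' x + \<tau> * u' x))) a"
    unfolding a_def by (rule l2_subdiff_monotone[OF theta u sub])
  also have "(\<lambda>x. (w x - (N u x + \<tau> * u x)) - (w' x - (N u' x + \<tau> * u' x)))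
      = (\<lambda>x. ((w x - w' x) - (N u x - N u' x)) - \<tau> * a x)" by (simp add: a_def algebra_simps)
  also have "l2_inner \<Omega> \<dots> a = l2_inner \<Omega> (\<lambda>x. w x - w' x) a - l2_inner \<Omega> (\<lambda>x. N u x - N u' x) a - \<tau> * (l2_norm \<Omega> a)\<^sup>2"
    using w NL aL
    by (subst l2_inner_diff_left, auto intro!: L2_diff L2_scale)+ (simp add: l2_inner_scale_left l2_norm_sq l2_inner_diff_left)
  also have "l2_inner \<Omega> (\<lambda>x. N u x - N u' x) a = l2_inner \<Omega> a (N a)"
    unfolding l2_inner_commute[of \<Omega> a] using l2_bounded_linear_diff[OF N(1) u] NL aL
    by (intro l2_inner_cong L2_measurable L2_diff) (auto simp: a_def intro: ae_eq_sym)
  finally have "l2_inner \<Omega> a (N a) + \<tau> * (l2_norm \<Omega> a)\<^sup>2 \<le> l2_inner \<Omega> (\<lambda>x. w x - w' x) a" by simp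
  moreover have "c0 * (l2_norm \<Omega> a)\<^sup>2 \<le> l2_inner \<Omega> a (N a)" using N(4) aL by (simp add: l2_coercive_def)
  ultimately show ?thesis by (simp add: a_def distrib_right)
qed

lemma inclusion_lipschitz:
  assumes w: "w \<in> L2 \<Omega>" "w' \<in> L2 \<Omega>" and u: "u \<in> L2 \<Omega>" "u' \<in> L2 \<Omega>"
    and sub: "(\<lambda>x. w x - (N u x + \<tau> * u x)) \<in> l2_subdiff \<Omega> \<theta> u"
      "(\<lambda>x. w' x - (N u' x + \<tau> * u' x)) \<in> l2_subdiff \<Omega> \<theta> u'"
  shows "l2_norm \<Omega> (\<lambda>x. u x - u' x) \<le> l2_norm \<Omega> (\<lambda>x. w x - w' x) / (c0 + \<tau>)"
proof (rule l2_norm_le_of_inner)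
  have pos: "c0 + \<tau> > 0" using N(3) tau by simp
  show L: "(\<lambda>x. u x - u' x) \<in> L2 \<Omega>" using u by auto
  have "(c0 + \<tau>) * l2_inner \<Omega> (\<lambda>x. u x - u' x) (\<lambda>x. u x - u' x)
      \<le> l2_norm \<Omega> (\<lambda>x. w x - w' x) * l2_norm \<Omega> (\<lambda>x. u x - u' x)"
    using inclusion_monotone[OF w u sub] l2_cauchy_schwarz[OF L2_diff[OF w] L] unfolding l2_norm_sq by linarith
  then show "l2_inner \<Omega> (\<lambda>x. u x - u' x) (\<lambda>x. u x - u' x)
      \<le> l2_norm \<Omega> (\<lambda>x. w x - w' x) / (c0 + \<tau>) * l2_norm \<Omega> (\<lambda>x. u x - u' x)"
    using pos by (simp add: field_simps)
  show "0 \<le> l2_norm \<Omega> (\<lambda>x. w x - w' x) / (c0 + \<tau>)" using pos by simp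
qed

lemma resolvent_lipschitz:
  assumes w: "w \<in> L2 \<Omega>" "w' \<in> L2 \<Omega>"
  shows "l2_norm \<Omega> (\<lambda>x. res w x - res w' x) \<le> l2_norm \<Omega> (\<lambda>x. w x - w' x) / (c0 + \<tau>)"
  using inclusion_lipschitz[OF w resolvent_props(1)[OF w(1)] resolvent_props(1)[OF w(2)]
      resolvent_props(2)[OF w(1)] resolvent_props(2)[OF w(2)]] .

text \<open>\<open>res\<close> is a choice, but solutions are unique up to null sets:
  \<open>inclusion_lipschitz\<close> with equal right-hand sides identifies it with the solution
  built pointwise.\<close>

lemma resolvent_pointwise:
  assumes w: "w \<in> L2 \<Omega>"
  shows "AE x in lebesgue_on \<Omega>. res w x = pw_res (w x) (\<mu> x) (lam x)"
proof -
  obtain u where u: "u \<in> L2 \<Omega>" "AE x in lebesgue_on \<Omega>. u x = pw_res (w x) (\<mu> x) (lam x)"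
    "(\<lambda>x. w x - (N u x + \<tau> * u x)) \<in> l2_subdiff \<Omega> \<theta> u"
    using resolvent_exists[OF w] .
  have "l2_norm \<Omega> (\<lambda>x. res w x - u x) \<le> l2_norm \<Omega> (\<lambda>x. w x - w x) / (c0 + \<tau>)"
    by (rule inclusion_lipschitz[OF w w resolvent_props(1)[OF w] u(1) resolvent_props(2)[OF w] u(3)])
  then have "l2_norm \<Omega> (\<lambda>x. res w x - u x) = 0" using l2_norm_nonneg[of \<Omega> "\<lambda>x. res w x - u x"] by simp
  then have "ae_eq \<Omega> (\<lambda>x. res w x - u x) (\<lambda>x. 0)"
    using resolvent_props(1)[OF w] u(1) by (intro l2_norm_zero_ae) auto
  then show ?thesis using u(2) unfolding ae_eq_def by eventually_elim simp
qed

end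

section \<open>Contraction of the exact iteration\<close>

text \<open>The bounds \<beta> \<ge> 2 and 2 K^2 \<le> c0 \<beta> absorb the quadratic remainder in
  the contraction estimate; together with \<beta> \<ge> 2 K they give 1 + K \<le> \<beta>, which
  keeps the error of the p-update below \<delta>.\<close>

locale uzawa = control_problem \<Omega> S N \<theta> lam \<mu> E \<psi> s c0 \<tau>
  for \<Omega> :: "(real ^ 'd) set"
    and S N :: "(real ^ 'd \<Rightarrow> real) \<Rightarrow> (real ^ 'd \<Rightarrow> real)"
    and \<theta> :: "(real ^ 'd \<Rightarrow> real) \<Rightarrow> ereal"
    and lam :: "real ^ 'd \<Rightarrow> real"
    and \<mu> :: "real ^ 'd \<Rightarrow> real ^ 'm"
    and E :: "(real ^ 'm) set"
    and \<psi> :: "real ^ 'm \<Rightarrow> real \<Rightarrow> ereal"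
    and s c0 \<tau> :: real +
  fixes K \<beta> :: real
  assumes K: "K > 0" "\<And>u. u \<in> L2 \<Omega> \<Longrightarrow> l2_norm \<Omega> (S u) \<le> K * l2_norm \<Omega> u"
    and beta: "\<beta> \<ge> 2" "\<beta> \<ge> 2 * K" "2 * K\<^sup>2 \<le> c0 * \<beta>"
begin

abbreviation nrm :: "(real ^ 'd \<Rightarrow> real) \<Rightarrow> real" where "nrm \<equiv> l2_norm \<Omega>"
abbreviation inn :: "(real ^ 'd \<Rightarrow> real) \<Rightarrow> (real ^ 'd \<Rightarrow> real) \<Rightarrow> real" where "inn \<equiv> l2_inner \<Omega>"
abbreviation H :: "(real ^ 'd \<Rightarrow> real) set" where "H \<equiv> L2 \<Omega>"
abbreviation adj :: "(real ^ 'd \<Rightarrow> real) \<Rightarrow> (real ^ 'd \<Rightarrow> real)" where "adj \<equiv> l2_adjoint \<Omega> S"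

definition energy :: "(real ^ 'd \<Rightarrow> real) \<Rightarrow> (real ^ 'd \<Rightarrow> real) \<Rightarrow> real" where
  "energy a b = sqrt ((c0 + \<tau>) * (nrm a)\<^sup>2 + \<beta> * (nrm b)\<^sup>2)"

text \<open>The larger of the two factors by which the squared energy of the u-part and of the
  p-part shrinks. The second factor keeps the rate positive even when \<tau> = 0, as geometric
  convergence is stated for positive ratios.\<close>

definition rate :: real where
  "rate = sqrt (max (\<tau> / (c0 + \<tau>)) ((\<beta> - 1) / \<beta>))"

lemma pos: "c0 + \<tau> > 0" "\<beta> > 0"
  using N(3) tau beta(1) by auto

lemma rate: "0 < rate" "rate < 1"
proof -
  have "\<tau> / (c0 + \<tau>) < 1" "(\<beta> - 1) / \<beta> < 1" "0 < (\<beta> - 1) / \<beta>"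
    using pos N(3) beta(1) by (auto simp: field_simps)
  then show "0 < rate" "rate < 1" unfolding rate_def by auto
qed

lemma energy_eq: "energy a b = sqrt ((sqrt (c0 + \<tau>) * nrm a)\<^sup>2 + (sqrt \<beta> * nrm b)\<^sup>2)"
  using pos N(3) tau by (simp add: energy_def power_mult_distrib)

lemma energy_nonneg: "0 \<le> energy a b"
  using pos by (simp add: energy_def)

lemma energy_sq: "(energy a b)\<^sup>2 = (c0 + \<tau>) * (nrm a)\<^sup>2 + \<beta> * (nrm b)\<^sup>2"
  unfolding energy_def using pos less_imp_le[OF N(3)] tau by (intro real_sqrt_pow2 add_nonneg_nonneg mult_nonneg_nonneg) auto

lemma energy_cong: "nrm a = nrm a' \<Longrightarrow> nrm b = nrm b' \<Longrightarrow> energy a b = energy a' b'"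
  by (simp add: energy_def)

lemma energy_add:
  assumes "a \<in> H" "a' \<in> H" "b \<in> H" "b' \<in> H"
  shows "energy (\<lambda>x. a x + a' x) (\<lambda>x. b x + b' x) \<le> energy a b + energy a' b'"
proof -
  have "energy (\<lambda>x. a x + a' x) (\<lambda>x. b x + b' x)
      \<le> sqrt ((sqrt (c0 + \<tau>) * nrm a + sqrt (c0 + \<tau>) * nrm a')\<^sup>2 + (sqrt \<beta> * nrm b + sqrt \<beta> * nrm b')\<^sup>2)"
    unfolding energy_eq distrib_left[symmetric] using pos assms
    by (intro real_sqrt_le_mono add_mono power_mono mult_left_mono l2_norm_triangle) auto
  also have "\<dots> \<le> energy a b + energy a' b'"
    unfolding energy_eq by (rule real_sqrt_sum_squares_triangle_ineq)
  finally show ?thesis .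
qed

lemma energy_triangle:
  assumes "a \<in> H" "a' \<in> H" "a'' \<in> H" "b \<in> H" "b' \<in> H" "b'' \<in> H"
  shows "energy (\<lambda>x. a x - a'' x) (\<lambda>x. b x - b'' x)
    \<le> energy (\<lambda>x. a x - a' x) (\<lambda>x. b x - b' x) + energy (\<lambda>x. a' x - a'' x) (\<lambda>x. b' x - b'' x)"
  using energy_add[of "\<lambda>x. a x - a' x" "\<lambda>x. a' x - a'' x" "\<lambda>x. b x - b' x" "\<lambda>x. b' x - b'' x"] assms
  by (simp add: L2_diff)

lemma energy_le_dist:
  assumes "a \<in> H" "a' \<in> H" "b \<in> H" "b' \<in> H"
  shows "energy a b \<le> energy (\<lambda>x. a x - a' x) (\<lambda>x. b x - b' x) + energy a' b'"
  using energy_add[of "\<lambda>x. a x - a' x" a' "\<lambda>x. b x - b' x" b'] assms by (simp add: L2_diff)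

lemma energy_minus_commute:
  "energy (\<lambda>x. a x - a' x) (\<lambda>x. b x - b' x) = energy (\<lambda>x. a' x - a x) (\<lambda>x. b' x - b x)"
  by (intro energy_cong l2_norm_minus_commute)

lemma energy_le_norms: "energy a b \<le> sqrt (c0 + \<tau>) * nrm a + sqrt \<beta> * nrm b"
  unfolding energy_eq using pos by (intro sqrt_sum_squares_le_sum) auto

lemma norms_le_energy: "sqrt (c0 + \<tau>) * nrm a \<le> energy a b" "nrm b \<le> energy a b"
proof -
  show "sqrt (c0 + \<tau>) * nrm a \<le> energy a b"
    unfolding energy_eq by (rule real_sqrt_sum_squares_ge1)
  have "1 * nrm b \<le> sqrt \<beta> * nrm b" using beta(1) by (intro mult_right_mono) auto
  also have "\<dots> \<le> energy a b" unfolding energy_eq by (rule real_sqrt_sum_squares_ge2)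
  finally show "nrm b \<le> energy a b" by simp
qed

definition QS :: "(real ^ 'd \<Rightarrow> real) \<Rightarrow> (real ^ 'd \<Rightarrow> real)" where
  "QS u = (\<lambda>x. \<beta> * u x)"

lemma QS_props: "l2_bounded_linear \<Omega> \<Omega> QS" "l2_self_adjoint \<Omega> QS" "l2_positive_definite \<Omega> QS"
proof -
  show "l2_bounded_linear \<Omega> \<Omega> QS"
    unfolding l2_bounded_linear_def QS_def
    by (auto simp: l2_norm_scale distrib_left mult.left_commute intro!: exI[of _ "\<bar>\<beta>\<bar>"])
  show "l2_self_adjoint \<Omega> QS"
    by (simp add: l2_self_adjoint_def QS_def l2_inner_scale_left l2_inner_scale_right)
  show "l2_positive_definite \<Omega> QS"
    unfolding l2_positive_definite_def l2_coercive_def QS_def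
    using pos(2) by (auto simp: l2_inner_scale_right l2_norm_sq intro!: exI[of _ \<beta>])
qed

lemma QS_inverse:
  assumes "y \<in> H" shows "l2_inverse \<Omega> QS y \<in> H" "ae_eq \<Omega> (l2_inverse \<Omega> QS y) (\<lambda>x. y x / \<beta>)"
proof -
  have "(\<lambda>x. y x / \<beta>) \<in> H \<and> ae_eq \<Omega> (QS (\<lambda>x. y x / \<beta>)) y"
    using assms pos(2) by (auto simp: QS_def ae_eq_def)
  then have "\<exists>z. z \<in> H \<and> ae_eq \<Omega> (QS z) y" by blast
  from someI_ex[OF this] have z: "l2_inverse \<Omega> QS y \<in> H" "ae_eq \<Omega> (QS (l2_inverse \<Omega> QS y)) y"
    unfolding l2_inverse_def by auto
  show "l2_inverse \<Omega> QS y \<in> H" by (rule z(1))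
  show "ae_eq \<Omega> (l2_inverse \<Omega> QS y) (\<lambda>x. y x / \<beta>)"
    using z(2) unfolding ae_eq_def QS_def by eventually_elim (use pos(2) in \<open>simp add: field_simps\<close>)
qed

definition ustep :: "(real ^ 'd \<Rightarrow> real) \<Rightarrow> (real ^ 'd \<Rightarrow> real) \<Rightarrow> (real ^ 'd \<Rightarrow> real)" where
  "ustep u p = res (\<lambda>x. \<tau> * u x - adj p x)"

definition pstep :: "(real ^ 'd \<Rightarrow> real) \<Rightarrow> (real ^ 'd \<Rightarrow> real) \<Rightarrow> (real ^ 'd \<Rightarrow> real) \<Rightarrow> (real ^ 'd \<Rightarrow> real) \<Rightarrow> (real ^ 'd \<Rightarrow> real)" where
  "pstep yd f ub p = (\<lambda>x. p x + l2_inverse \<Omega> QS (\<lambda>z. S ub z - p z + S f z - yd z) x)"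

lemma S_L2: "u \<in> H \<Longrightarrow> S u \<in> H"
  by (rule l2_bounded_linear_in[OF S])

lemma adj_L2: "p \<in> H \<Longrightarrow> adj p \<in> H"
  by (rule l2_adjoint_props(1)[OF S])

lemma S_diff_bound:
  assumes "u \<in> H" "v \<in> H" shows "nrm (\<lambda>x. S u x - S v x) \<le> K * nrm (\<lambda>x. u x - v x)"
proof -
  have "nrm (\<lambda>x. S u x - S v x) = nrm (S (\<lambda>x. u x - v x))"
    using assms l2_bounded_linear_diff[OF S assms]
    by (intro l2_norm_cong L2_measurable L2_diff S_L2) (auto intro: ae_eq_sym)
  then show ?thesis using K(2)[OF L2_diff[OF assms]] by simp
qed

lemma ustep_arg_L2: "u \<in> H \<Longrightarrow> p \<in> H \<Longrightarrow> (\<lambda>x. \<tau> * u x - adj p x) \<in> H"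
  by (intro L2_diff L2_scale adj_L2)

lemma ustep_L2: "u \<in> H \<Longrightarrow> p \<in> H \<Longrightarrow> ustep u p \<in> H"
  unfolding ustep_def by (intro resolvent_props(1) ustep_arg_L2)

lemma pstep_props:
  assumes "yd \<in> H" "f \<in> H" "ub \<in> H" "p \<in> H"
  shows "pstep yd f ub p \<in> H" "ae_eq \<Omega> (pstep yd f ub p) (\<lambda>x. p x + (S ub x - p x + S f x - yd x) / \<beta>)"
proof -
  have y: "(\<lambda>z. S ub z - p z + S f z - yd z) \<in> H"
    using assms by (intro L2_diff L2_add S_L2)
  show "pstep yd f ub p \<in> H" unfolding pstep_def using assms QS_inverse(1)[OF y] by (intro L2_add)
  show "ae_eq \<Omega> (pstep yd f ub p) (\<lambda>x. p x + (S ub x - p x + S f x - yd x) / \<beta>)"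
    using QS_inverse(2)[OF y] unfolding pstep_def ae_eq_def by eventually_elim simp
qed

text \<open>With I = <S a, b>, twice the monotonicity estimate for the u-update contributes -2 I,
  and expanding \<beta> times the squared norm of the p-update contributes +2 I, so the coupling
  cancels. There remain -2 |b|^2 and the remainder |d|^2 / \<beta>; the latter is at most c0 |a|^2 +
  |b|^2 for large \<beta>, which leaves a net gain in both components.\<close>

lemma exact_step_contraction:
  assumes yf: "yd \<in> H" "f \<in> H" and u: "u1 \<in> H" "u2 \<in> H" and p: "p1 \<in> H" "p2 \<in> H"
  defines "v1 \<equiv> ustep u1 p1" and "v2 \<equiv> ustep u2 p2"
  shows "energy (\<lambda>x. v1 x - v2 x) (\<lambda>x. pstep yd f v1 p1 x - pstep yd f v2 p2 x)
    \<le> rate * energy (\<lambda>x. u1 x - u2 x) (\<lambda>x. p1 x - p2 x)"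
proof -
  have vL: "v1 \<in> H" "v2 \<in> H" unfolding v1_def v2_def using u p by (auto intro: ustep_L2)
  define a where "a = (\<lambda>x. v1 x - v2 x)"
  define e where "e = (\<lambda>x. u1 x - u2 x)"
  define b where "b = (\<lambda>x. p1 x - p2 x)"
  define Sa where "Sa = (\<lambda>x. S v1 x - S v2 x)"
  define d where "d = (\<lambda>x. Sa x - b x)"
  have L: "a \<in> H" "e \<in> H" "b \<in> H" "Sa \<in> H" "d \<in> H"
    unfolding d_def a_def e_def b_def Sa_def using u p vL S_L2 by (auto intro!: L2_diff)
  define I where "I = inn Sa b"
  have adj_eq: "inn (S v) q = inn v (adj q)" if "v \<in> H" "q \<in> H" for v q
    using l2_adjoint_props(2)[OF S that(2,1)] .
  have mono: "(c0 + \<tau>) * (nrm a)\<^sup>2 \<le> \<tau> * inn e a - I"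
  proof -
    have "(c0 + \<tau>) * (nrm a)\<^sup>2 \<le> inn (\<lambda>x. (\<tau> * u1 x - adj p1 x) - (\<tau> * u2 x - adj p2 x)) a"
      unfolding a_def v1_def v2_def ustep_def
      using u p by (intro inclusion_monotone resolvent_props ustep_arg_L2)
    also have "(\<lambda>x. (\<tau> * u1 x - adj p1 x) - (\<tau> * u2 x - adj p2 x)) = (\<lambda>x. \<tau> * e x - (adj p1 x - adj p2 x))"
      by (simp add: e_def algebra_simps)
    also have "inn \<dots> a = \<tau> * inn e a - inn (\<lambda>x. adj p1 x - adj p2 x) a"
      using L p adj_L2 by (subst l2_inner_diff_left) (auto intro!: L2_diff L2_scale simp: l2_inner_scale_left)
    also have "inn (\<lambda>x. adj p1 x - adj p2 x) a = I"
      unfolding I_def Sa_def a_def b_def using p vL adj_L2 S_L2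
      by (simp add: l2_inner_diff_left l2_inner_diff_right L2_diff adj_eq l2_inner_commute[of \<Omega> "adj _"])
    finally show ?thesis .
  qed
  have ea: "2 * inn e a \<le> (nrm e)\<^sup>2 + (nrm a)\<^sup>2"
    using l2_norm_diff_sq[OF L(2,1)] zero_le_power2[of "nrm (\<lambda>x. e x - a x)"] by linarith
  have Sa_bound: "(nrm Sa)\<^sup>2 \<le> K\<^sup>2 * (nrm a)\<^sup>2"
    using power_mono[OF S_diff_bound[OF vL], of 2] by (simp add: Sa_def a_def power_mult_distrib)
  have d_bound: "(nrm d)\<^sup>2 \<le> 2 * (nrm Sa)\<^sup>2 + 2 * (nrm b)\<^sup>2"
    using l2_norm_diff_sq[OF L(4,3)] l2_norm_add_sq[OF L(4,3)] zero_le_power2[of "nrm (\<lambda>x. Sa x + b x)"]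
    unfolding d_def by linarith
  have "ae_eq \<Omega> (\<lambda>x. pstep yd f v1 p1 x - pstep yd f v2 p2 x) (\<lambda>x. b x + (1 / \<beta>) * d x)"
    using pstep_props(2)[OF yf vL(1) p(1)] pstep_props(2)[OF yf vL(2) p(2)]
    unfolding ae_eq_def
  proof eventually_elim
    case (elim x)
    show ?case unfolding elim by (simp add: b_def d_def Sa_def diff_divide_distrib add_divide_distrib)
  qed
  then have b': "nrm (\<lambda>x. pstep yd f v1 p1 x - pstep yd f v2 p2 x) = nrm (\<lambda>x. b x + (1 / \<beta>) * d x)"
    using pstep_props(1)[OF yf vL(1) p(1)] pstep_props(1)[OF yf vL(2) p(2)] L
    by (intro l2_norm_cong L2_measurable L2_diff L2_add L2_scale)
  have bd: "inn b d = I - (nrm b)\<^sup>2"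
    unfolding d_def I_def using L by (simp add: l2_inner_diff_right l2_norm_sq l2_inner_commute)
  have "(nrm (\<lambda>x. b x + (1 / \<beta>) * d x))\<^sup>2 = (nrm b)\<^sup>2 + 2 * (inn b d / \<beta>) + (nrm d)\<^sup>2 / \<beta>\<^sup>2"
    unfolding l2_norm_add_sq[OF L(3) L2_scale[OF L(5)]] l2_inner_scale_right l2_norm_scale
    by (simp add: power_mult_distrib power_divide)
  then have "\<beta> * (nrm (\<lambda>x. b x + (1 / \<beta>) * d x))\<^sup>2
      = \<beta> * ((nrm b)\<^sup>2 + 2 * (inn b d / \<beta>) + (nrm d)\<^sup>2 / \<beta>\<^sup>2)" by (rule arg_cong)
  also have "\<dots> = \<beta> * (nrm b)\<^sup>2 + 2 * inn b d + (nrm d)\<^sup>2 / \<beta>"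
    using pos(2) by (simp add: distrib_left power2_eq_square)
  finally have expand: "\<beta> * (nrm (\<lambda>x. b x + (1 / \<beta>) * d x))\<^sup>2
      = \<beta> * (nrm b)\<^sup>2 + 2 * inn b d + (nrm d)\<^sup>2 / \<beta>" .
  have "(nrm d)\<^sup>2 / \<beta> \<le> c0 * (nrm a)\<^sup>2 + (nrm b)\<^sup>2"
  proof -
    have "(nrm d)\<^sup>2 \<le> 2 * (K\<^sup>2 * (nrm a)\<^sup>2) + 2 * (nrm b)\<^sup>2" using d_bound Sa_bound by linarith
    also have "\<dots> = (2 * K\<^sup>2) * (nrm a)\<^sup>2 + 2 * (nrm b)\<^sup>2" by simp
    also have "\<dots> \<le> (c0 * \<beta>) * (nrm a)\<^sup>2 + \<beta> * (nrm b)\<^sup>2"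
      by (rule add_mono[OF mult_right_mono[OF beta(3) zero_le_power2] mult_right_mono[OF beta(1) zero_le_power2]])
    also have "\<dots> = (c0 * (nrm a)\<^sup>2 + (nrm b)\<^sup>2) * \<beta>" by (simp add: algebra_simps)
    finally show ?thesis unfolding pos_divide_le_eq[OF pos(2)] .
  qed
  with expand have bb: "\<beta> * (nrm (\<lambda>x. b x + (1 / \<beta>) * d x))\<^sup>2
      \<le> \<beta> * (nrm b)\<^sup>2 + 2 * (I - (nrm b)\<^sup>2) + (c0 * (nrm a)\<^sup>2 + (nrm b)\<^sup>2)" unfolding bd by linarith
  have "\<tau> * (2 * inn e a) \<le> \<tau> * ((nrm e)\<^sup>2 + (nrm a)\<^sup>2)" using ea tau by (intro mult_left_mono)
  then have "(c0 + \<tau>) * (nrm a)\<^sup>2 + \<beta> * (nrm (\<lambda>x. b x + (1 / \<beta>) * d x))\<^sup>2 \<le> \<tau> * (nrm e)\<^sup>2 + (\<beta> - 1) * (nrm b)\<^sup>2"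
    using mono bb by (simp add: algebra_simps)
  also have "\<dots> \<le> rate\<^sup>2 * ((c0 + \<tau>) * (nrm e)\<^sup>2 + \<beta> * (nrm b)\<^sup>2)"
  proof -
    have r: "\<tau> / (c0 + \<tau>) \<le> rate\<^sup>2" "(\<beta> - 1) / \<beta> \<le> rate\<^sup>2"
      unfolding rate_def using tau pos by (simp_all add: max.coboundedI1)
    have "\<tau> \<le> rate\<^sup>2 * (c0 + \<tau>)" "\<beta> - 1 \<le> rate\<^sup>2 * \<beta>" using r pos by (simp_all add: pos_divide_le_eq)
    then have "\<tau> * (nrm e)\<^sup>2 \<le> rate\<^sup>2 * (c0 + \<tau>) * (nrm e)\<^sup>2" "(\<beta> - 1) * (nrm b)\<^sup>2 \<le> rate\<^sup>2 * \<beta> * (nrm b)\<^sup>2"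
      by (auto intro!: mult_right_mono)
    then show ?thesis by (simp add: algebra_simps)
  qed
  finally have "(energy a (\<lambda>x. b x + (1 / \<beta>) * d x))\<^sup>2 \<le> (rate * energy e b)\<^sup>2"
    by (simp add: energy_sq power_mult_distrib)
  then have "energy a (\<lambda>x. b x + (1 / \<beta>) * d x) \<le> rate * energy e b"
    by (rule power2_le_imp_le) (use rate energy_nonneg in \<open>auto intro: mult_nonneg_nonneg less_imp_le\<close>)
  then show ?thesis
    using energy_cong[OF refl b', of a] by (simp add: a_def e_def b_def)
qed

section \<open>The fixed point and the optimality system\<close>

primrec iterate :: "(real ^ 'd \<Rightarrow> real) \<Rightarrow> (real ^ 'd \<Rightarrow> real) \<Rightarrow> nat \<Rightarrow> (real ^ 'd \<Rightarrow> real) \<times> (real ^ 'd \<Rightarrow> real)" where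
  "iterate yd f 0 = ((\<lambda>x. 0), (\<lambda>x. 0))"
| "iterate yd f (Suc n) = (let u = fst (iterate yd f n); p = snd (iterate yd f n) in
     (ustep u p, pstep yd f (ustep u p) p))"

definition first_energy :: "(real ^ 'd \<Rightarrow> real) \<Rightarrow> (real ^ 'd \<Rightarrow> real) \<Rightarrow> real" where
  "first_energy yd f = energy (fst (iterate yd f 1)) (snd (iterate yd f 1))"

text \<open>Picard iteration from zero, with the contraction principle carried out for functions
  that are identified almost everywhere. The bound on the energy makes the later constants uniform
  over the data.\<close>

lemma fixed_point:
  assumes yf: "yd \<in> H" "f \<in> H"
  obtains u p where "u \<in> H" "p \<in> H" "ae_eq \<Omega> u (ustep u p)" "ae_eq \<Omega> p (pstep yd f (ustep u p) p)"
    "energy u p \<le> first_energy yd f / (1 - rate)"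
proof -
  define u where "u n = fst (iterate yd f n)" for n
  define p where "p n = snd (iterate yd f n)" for n
  have step: "u (Suc n) = ustep (u n) (p n)" "p (Suc n) = pstep yd f (ustep (u n) (p n)) (p n)" for n
    by (simp_all add: u_def p_def Let_def)
  have L: "u n \<in> H \<and> p n \<in> H" for n
    by (induction n) (auto simp: step ustep_L2 pstep_props(1)[OF yf] u_def[of 0] p_def[of 0])
  have uL: "u n \<in> H" and pL: "p n \<in> H" for n using L by auto
  have zero: "u 0 = (\<lambda>x. 0)" "p 0 = (\<lambda>x. 0)" by (simp_all add: u_def p_def)
  define D where "D = first_energy yd f"
  have D: "D = energy (u 1) (p 1)" by (simp add: D_def first_energy_def u_def p_def)
  have D0: "D \<ge> 0" unfolding D by (rule energy_nonneg)
  have contr: "energy (\<lambda>x. u (Suc n) x - ustep v q x) (\<lambda>x. p (Suc n) x - pstep yd f (ustep v q) q x)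
      \<le> rate * energy (\<lambda>x. u n x - v x) (\<lambda>x. p n x - q x)" if "v \<in> H" "q \<in> H" for n v q
    unfolding step by (rule exact_step_contraction[OF yf uL that(1) pL that(2)])
  have geo: "energy (\<lambda>x. u (Suc n) x - u n x) (\<lambda>x. p (Suc n) x - p n x) \<le> D * rate ^ n" for n
  proof (induction n)
    case 0
    then show ?case by (simp add: zero D)
  next
    case (Suc n)
    have "energy (\<lambda>x. u (Suc (Suc n)) x - u (Suc n) x) (\<lambda>x. p (Suc (Suc n)) x - p (Suc n) x)
      \<le> rate * energy (\<lambda>x. u (Suc n) x - u n x) (\<lambda>x. p (Suc n) x - p n x)"
      using contr[OF uL[of n] pL[of n], of "Suc n"] by (simp add: step[of n])
    also have "\<dots> \<le> rate * (D * rate ^ n)" using Suc rate by (intro mult_left_mono) auto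
    finally show ?case by (simp add: mult_ac)
  qed
  have "nrm (\<lambda>x. u (Suc n) x - u n x) \<le> (D / sqrt (c0 + \<tau>)) * rate ^ n" for n
  proof -
    have "sqrt (c0 + \<tau>) * nrm (\<lambda>x. u (Suc n) x - u n x) \<le> D * rate ^ n"
      using norms_le_energy(1) geo order_trans by blast
    then show ?thesis using pos(1) by (simp add: pos_le_divide_eq mult.commute)
  qed
  from l2_complete_geometric[OF uL this rate] obtain us where
    us: "us \<in> H" "(\<lambda>n. nrm (\<lambda>x. u n x - us x)) \<longlonglongrightarrow> 0" by blast
  have "nrm (\<lambda>x. p (Suc n) x - p n x) \<le> D * rate ^ n" for n
    using norms_le_energy(2) geo order_trans by blast
  from l2_complete_geometric[OF pL this rate] obtain ps where
    ps: "ps \<in> H" "(\<lambda>n. nrm (\<lambda>x. p n x - ps x)) \<longlonglongrightarrow> 0" by blast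
  have elim0: "(\<lambda>n. energy (\<lambda>x. u n x - us x) (\<lambda>x. p n x - ps x)) \<longlonglongrightarrow> 0"
  proof -
    have "(\<lambda>n. energy (\<lambda>x. u n x - us x) (\<lambda>x. p n x - ps x)) \<longlonglongrightarrow> sqrt ((c0 + \<tau>) * 0\<^sup>2 + \<beta> * 0\<^sup>2)"
      unfolding energy_def using us(2) ps(2) by (intro tendsto_intros)
    then show ?thesis by simp
  qed
  define ub where "ub = ustep us ps"
  define pb where "pb = pstep yd f ub ps"
  have ubL: "ub \<in> H" unfolding ub_def by (rule ustep_L2[OF us(1) ps(1)])
  have pbL: "pb \<in> H" unfolding pb_def by (rule pstep_props(1)[OF yf ubL ps(1)])
  define e where "e n = energy (\<lambda>x. u n x - us x) (\<lambda>x. p n x - ps x)" for n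
  have e0: "e \<longlonglongrightarrow> 0" using elim0 by (simp add: e_def[abs_def])
  have "energy (\<lambda>x. us x - ub x) (\<lambda>x. ps x - pb x) \<le> e (Suc n) + rate * e n" for n
  proof -
    have "energy (\<lambda>x. us x - ub x) (\<lambda>x. ps x - pb x)
      \<le> energy (\<lambda>x. us x - u (Suc n) x) (\<lambda>x. ps x - p (Suc n) x) + energy (\<lambda>x. u (Suc n) x - ub x) (\<lambda>x. p (Suc n) x - pb x)"
      by (rule energy_triangle[OF us(1) uL ubL ps(1) pL pbL])
    then show ?thesis
      using contr[OF us(1) ps(1), of n] energy_minus_commute[of us "u (Suc n)" ps "p (Suc n)"]
      unfolding e_def ub_def pb_def by linarith
  qed
  moreover have "(\<lambda>n. e (Suc n) + rate * e n) \<longlonglongrightarrow> 0 + rate * 0"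
    by (intro tendsto_intros e0 LIMSEQ_Suc[OF e0])
  ultimately have "energy (\<lambda>x. us x - ub x) (\<lambda>x. ps x - pb x) \<le> 0"
    by (intro LIMSEQ_le_const[of _ 0]) auto
  then have "sqrt (c0 + \<tau>) * nrm (\<lambda>x. us x - ub x) \<le> 0" "nrm (\<lambda>x. ps x - pb x) \<le> 0"
    using norms_le_energy(1)[of "\<lambda>x. us x - ub x" "\<lambda>x. ps x - pb x"] norms_le_energy(2)[of "\<lambda>x. ps x - pb x" "\<lambda>x. us x - ub x"] by linarith+
  then have "nrm (\<lambda>x. us x - ub x) = 0" "nrm (\<lambda>x. ps x - pb x) = 0"
    using pos(1) l2_norm_nonneg[of \<Omega> "\<lambda>x. us x - ub x"] l2_norm_nonneg[of \<Omega> "\<lambda>x. ps x - pb x"]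
    by (auto simp: mult_le_0_iff)
  then have "ae_eq \<Omega> (\<lambda>x. us x - ub x) (\<lambda>x. 0)" "ae_eq \<Omega> (\<lambda>x. ps x - pb x) (\<lambda>x. 0)"
    using us ps ubL pbL by (auto intro!: l2_norm_zero_ae)
  then have ae: "ae_eq \<Omega> us ub" "ae_eq \<Omega> ps pb" by (simp_all add: ae_eq_def)
  \<comment> \<open>By contraction towards the first iterate, the energies obey E' \<le> rate E + D,
    whose fixed point is D / (1 - rate).\<close>
  have bounded: "energy (u n) (p n) \<le> D / (1 - rate)" for n
  proof (induction n)
    case 0
    have "energy (u 0) (p 0) = 0" by (simp add: zero energy_def)
    then show ?case using D0 rate by simp
  next
    case (Suc n)
    have "energy (u (Suc n)) (p (Suc n)) \<le> energy (\<lambda>x. u (Suc n) x - u 1 x) (\<lambda>x. p (Suc n) x - p 1 x) + energy (u 1) (p 1)"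
      by (rule energy_le_dist[OF uL uL pL pL])
    also have "\<dots> \<le> rate * energy (u n) (p n) + D"
      using contr[OF uL[of 0] pL[of 0], of n, folded step(2)[of 0], folded step(1)[of 0]] by (simp add: zero D)
    also have "\<dots> \<le> rate * (D / (1 - rate)) + D" using Suc rate by (intro add_right_mono mult_left_mono) auto
    also have "\<dots> = D / (1 - rate)" using rate by (simp add: field_simps)
    finally show ?case .
  qed
  have "energy us ps \<le> e n + D / (1 - rate)" for n
    using energy_le_dist[OF us(1) uL[of n] ps(1) pL[of n]] bounded[of n] energy_minus_commute[of us "u n" ps "p n"]
    unfolding e_def by linarith
  moreover have "(\<lambda>n. e n + D / (1 - rate)) \<longlonglongrightarrow> 0 + D / (1 - rate)" by (intro tendsto_intros e0)
  ultimately have "energy us ps \<le> D / (1 - rate)" using LIMSEQ_le_const[of _ "0 + D / (1 - rate)"] by fastforce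
  then show thesis using that[OF us(1) ps(1)] ae by (simp add: ub_def pb_def D_def)
qed

text \<open>From the zero initialization the first control does not depend on the data, and the
  first p depends on them affinely; hence a bound over a ball of data.\<close>

lemma first_energy_bound:
  "\<exists>Z\<ge>0. \<forall>yd\<in>H. \<forall>f\<in>H. nrm yd \<le> R \<and> nrm f \<le> R \<longrightarrow> first_energy yd f \<le> Z"
proof -
  define v where "v = ustep (\<lambda>x. 0) (\<lambda>x. 0)"
  have vL: "v \<in> H" unfolding v_def by (intro ustep_L2) auto
  define Z where "Z = sqrt (c0 + \<tau>) * nrm v + sqrt \<beta> * (1 / \<beta> * (nrm (S v) + K * \<bar>R\<bar> + \<bar>R\<bar>))"
  have "first_energy yd f \<le> Z" if yf: "yd \<in> H" "f \<in> H" and R: "nrm yd \<le> R" "nrm f \<le> R" for yd f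
  proof -
    define q where "q = pstep yd f v (\<lambda>x. 0)"
    have "ae_eq \<Omega> q (\<lambda>x. (1 / \<beta>) * ((S v x + S f x) - yd x))"
      using pstep_props(2)[OF yf vL L2_zero] by (simp add: q_def)
    then have "nrm q = nrm (\<lambda>x. (1 / \<beta>) * ((S v x + S f x) - yd x))"
      using pstep_props(1)[OF yf vL L2_zero] yf vL S_L2
      by (intro l2_norm_cong L2_measurable L2_scale L2_diff L2_add) (auto simp: q_def)
    also have "\<dots> \<le> 1 / \<beta> * (nrm (S v) + K * \<bar>R\<bar> + \<bar>R\<bar>)"
    proof -
      have "nrm (\<lambda>x. (S v x + S f x) - yd x) \<le> nrm (\<lambda>x. S v x + S f x) + nrm yd"
        using yf vL S_L2 by (intro l2_norm_triangle_diff L2_add)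
      also have "\<dots> \<le> nrm (S v) + nrm (S f) + nrm yd"
        using yf vL S_L2 by (intro add_right_mono l2_norm_triangle)
      also have "nrm (S f) \<le> K * \<bar>R\<bar>"
        using K(2)[OF yf(2)] mult_left_mono[of "nrm f" "\<bar>R\<bar>" K] R(2) K(1) by linarith
      finally have "nrm (\<lambda>x. (S v x + S f x) - yd x) \<le> nrm (S v) + K * \<bar>R\<bar> + \<bar>R\<bar>" using R by simp
      then show ?thesis unfolding l2_norm_scale using pos(2) by (intro mult_mono) auto
    qed
    finally have "sqrt \<beta> * nrm q \<le> sqrt \<beta> * (1 / \<beta> * (nrm (S v) + K * \<bar>R\<bar> + \<bar>R\<bar>))"
      using pos(2) by (intro mult_left_mono) auto
    moreover have "first_energy yd f = energy v q"
      by (simp add: first_energy_def Let_def v_def q_def)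
    ultimately show ?thesis using energy_le_norms[of v q] by (simp add: Z_def)
  qed
  moreover have "Z \<ge> 0"
    unfolding Z_def using pos K(1) by (intro add_nonneg_nonneg mult_nonneg_nonneg) auto
  ultimately show ?thesis by blast
qed

text \<open>At a fixed point the p-update vanishes, so p is the residual S u + S f - yd, and the
  \<tau>-terms of the u-update cancel, leaving -adj p - N u in the subdifferential. Coercivity of N
  adds c0 / 2 times the squared distance to the cost, which gives minimality and uniqueness
  together.\<close>

lemma solution_operator_eq:
  assumes yf: "yd \<in> H" "f \<in> H" and us: "u \<in> H" "p \<in> H"
    and fp: "ae_eq \<Omega> u (ustep u p)" "ae_eq \<Omega> p (pstep yd f (ustep u p) p)"
  shows "solution_operator \<Omega> S N \<theta> yd f \<in> H" "ae_eq \<Omega> (solution_operator \<Omega> S N \<theta> yd f) u"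
proof -
  \<comment> \<open>The inclusion holds literally for v, as a value of the resolvent; u is equal to
    v only almost everywhere and is exchanged for it at the end.\<close>
  define v where "v = ustep u p"
  have vL: "v \<in> H" unfolding v_def by (rule ustep_L2[OF us])
  have L: "S v \<in> H" "S f \<in> H" "adj p \<in> H" "N v \<in> H"
    using vL yf us S_L2 adj_L2 l2_bounded_linear_in[OF N(1)] by auto
  define r where "r = (\<lambda>x. (S v x + S f x) - yd x)"
  have rL: "r \<in> H" unfolding r_def using L yf by (intro L2_diff L2_add)
  have r_p: "ae_eq \<Omega> r p"
    using fp(2) pstep_props(2)[OF yf vL us(2)] unfolding v_def[symmetric] ae_eq_def
  proof eventually_elim
    case (elim x)
    then have "(S v x - p x + S f x - yd x) / \<beta> = 0" by simp
    then show ?case using pos(2) by (simp add: r_def)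
  qed
  define q where "q = (\<lambda>x. - adj p x - N v x)"
  have qL: "q \<in> H" unfolding q_def using L by (intro L2_diff L2_uminus)
  have "q \<in> l2_subdiff \<Omega> \<theta> v"
  proof (rule l2_subdiff_cong[OF resolvent_props(2)[OF ustep_arg_L2[OF us], folded ustep_def, folded v_def] vL qL])
    show "ae_eq \<Omega> (\<lambda>x. (\<tau> * u x - adj p x) - (N v x + \<tau> * v x)) q"
      using fp(1) unfolding v_def[symmetric] ae_eq_def by eventually_elim (simp add: q_def)
  qed
  then have \<theta>_le: "\<theta> v + ereal (inn q (\<lambda>x. w x - v x)) \<le> \<theta> w" if "w \<in> H" for w
    using that by (simp add: l2_subdiff_def)
  obtain t where t: "\<theta> v = ereal t" using l2_subdiff_finite[OF theta vL \<open>q \<in> l2_subdiff \<Omega> \<theta> v\<close>] .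
  define cst where "cst w = (nrm (\<lambda>x. S (\<lambda>z. w z + f z) x - yd x))\<^sup>2 / 2 + inn w (N w) / 2" for w
  have cost_eq: "cost \<Omega> S N \<theta> yd f w = ereal (cst w) + \<theta> w" for w
    by (simp add: cost_def cst_def)
  have key: "cst w + inn q (\<lambda>x. w x - v x) \<ge> cst v + c0 / 2 * (nrm (\<lambda>x. w x - v x))\<^sup>2" if wL: "w \<in> H" for w
  proof -
    define d where "d = (\<lambda>x. w x - v x)"
    define Sd where "Sd = (\<lambda>x. S w x - S v x)"
    have dL: "d \<in> H" "Sd \<in> H" "N d \<in> H" "N w \<in> H"
      unfolding d_def Sd_def using wL vL S_L2 l2_bounded_linear_in[OF N(1)] by (auto intro!: L2_diff)
    have Sadd: "nrm (\<lambda>x. S (\<lambda>z. w' z + f z) x - yd x) = nrm (\<lambda>x. (S w' x + S f x) - yd x)" if "w' \<in> H" for w'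
    proof (rule l2_norm_cong)
      show "ae_eq \<Omega> (\<lambda>x. S (\<lambda>z. w' z + f z) x - yd x) (\<lambda>x. (S w' x + S f x) - yd x)"
        using l2_bounded_linear_add[OF S that yf(2)] unfolding ae_eq_def by eventually_elim simp
    qed (use that yf S_L2 L in \<open>auto intro!: L2_measurable L2_diff L2_add\<close>)
    have "(nrm (\<lambda>x. S (\<lambda>z. w z + f z) x - yd x))\<^sup>2 = (nrm (\<lambda>x. r x + Sd x))\<^sup>2"
      unfolding Sadd[OF wL] by (simp add: r_def Sd_def algebra_simps)
    also have "\<dots> = (nrm r)\<^sup>2 + 2 * inn r Sd + (nrm Sd)\<^sup>2" by (rule l2_norm_add_sq[OF rL dL(2)])
    also have "inn r Sd = inn p Sd"
      using r_p rL us dL by (intro l2_inner_cong L2_measurable) auto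
    also have "inn p Sd = inn (adj p) d"
      unfolding Sd_def d_def using us wL vL L S_L2 l2_adjoint_props(2)[OF S us(2)]
      by (simp add: l2_inner_diff_left l2_inner_diff_right l2_inner_commute[of \<Omega> p] l2_inner_commute[of \<Omega> "adj p"])
    also have "(nrm r)\<^sup>2 = (nrm (\<lambda>x. S (\<lambda>z. v z + f z) x - yd x))\<^sup>2"
      unfolding Sadd[OF vL] by (simp add: r_def)
    finally have 1: "(nrm (\<lambda>x. S (\<lambda>z. w z + f z) x - yd x))\<^sup>2
      \<ge> (nrm (\<lambda>x. S (\<lambda>z. v z + f z) x - yd x))\<^sup>2 + 2 * inn (adj p) d" by simp
    have Nd: "inn y (N d) = inn y (N w) - inn y (N v)" if "y \<in> H" for y
    proof -
      have "inn y (N d) = inn y (\<lambda>x. N w x - N v x)"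
        using that l2_bounded_linear_diff[OF N(1) wL vL] dL L
        by (intro l2_inner_cong L2_measurable L2_diff) (auto simp: d_def)
      then show ?thesis using that dL L by (simp add: l2_inner_diff_right)
    qed
    have sa: "inn (N a) b = inn a (N b)" if "a \<in> H" "b \<in> H" for a b
      using N(2) that by (simp add: l2_self_adjoint_def)
    have split: "inn d y = inn w y - inn v y" if "y \<in> H" for y
      unfolding d_def using that wL vL by (simp add: l2_inner_diff_left)
    have "inn d (N d) = inn w (N w) - inn w (N v) - (inn v (N w) - inn v (N v))"
      using split[OF dL(3)] Nd[OF wL] Nd[OF vL] by simp
    moreover have "inn v (N w) = inn w (N v)" using sa[OF vL wL] by (simp add: l2_inner_commute)
    moreover have "inn (N v) d = inn w (N v) - inn v (N v)"
      using split[OF L(4)] by (simp add: l2_inner_commute)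
    moreover have "c0 * (nrm d)\<^sup>2 \<le> inn d (N d)" using N(4) dL by (simp add: l2_coercive_def)
    ultimately have 2: "inn w (N w) \<ge> inn v (N v) + 2 * inn (N v) d + c0 * (nrm d)\<^sup>2" by linarith
    have 3: "inn q d = - inn (adj p) d - inn (N v) d"
      unfolding q_def using L dL by (simp add: l2_inner_diff_left l2_inner_uminus_left L2_uminus)
    show ?thesis using 1 2 3 unfolding cst_def d_def[symmetric] by (simp add: field_simps)
  qed
  have cost_v: "cost \<Omega> S N \<theta> yd f v = ereal (cst v + t)" by (simp add: cost_eq t)
  have cost_w: "ereal (cst v + t + c0 / 2 * (nrm (\<lambda>x. w x - v x))\<^sup>2) \<le> cost \<Omega> S N \<theta> yd f w" if "w \<in> H" for w
  proof -
    have "ereal (cst v + t + c0 / 2 * (nrm (\<lambda>x. w x - v x))\<^sup>2) \<le> ereal (cst w + (t + inn q (\<lambda>x. w x - v x)))"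
      using key[OF that] by simp
    also have "\<dots> = ereal (cst w) + (\<theta> v + ereal (inn q (\<lambda>x. w x - v x)))" by (simp add: t)
    also have "\<dots> \<le> cost \<Omega> S N \<theta> yd f w" unfolding cost_eq by (intro add_left_mono \<theta>_le that)
    finally show ?thesis .
  qed
  have unique: "ae_eq \<Omega> w v" if "w \<in> H" "cost \<Omega> S N \<theta> yd f w \<le> cost \<Omega> S N \<theta> yd f v" for w
  proof -
    have "ereal (cst v + t + c0 / 2 * (nrm (\<lambda>x. w x - v x))\<^sup>2) \<le> ereal (cst v + t)"
      using cost_w[OF that(1)] that(2) unfolding cost_v by (rule order_trans)
    then have "c0 / 2 * (nrm (\<lambda>x. w x - v x))\<^sup>2 \<le> 0" by simp
    then have "(nrm (\<lambda>x. w x - v x))\<^sup>2 \<le> 0" using N(3) by (simp add: mult_le_0_iff)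
    then have "nrm (\<lambda>x. w x - v x) = 0" by simp
    then have "ae_eq \<Omega> (\<lambda>x. w x - v x) (\<lambda>x. 0)" using that vL by (intro l2_norm_zero_ae) auto
    then show ?thesis by (simp add: ae_eq_def)
  qed
  have min: "cost \<Omega> S N \<theta> yd f v \<le> cost \<Omega> S N \<theta> yd f w" if "w \<in> H" for w
  proof -
    have "ereal (cst v + t) \<le> ereal (cst v + t + c0 / 2 * (nrm (\<lambda>x. w x - v x))\<^sup>2)" using N(3) by simp
    then show ?thesis using cost_w[OF that] unfolding cost_v by (rule order_trans)
  qed
  have "\<exists>v. v \<in> H \<and> (\<forall>w\<in>H. cost \<Omega> S N \<theta> yd f v \<le> cost \<Omega> S N \<theta> yd f w) \<and>
        (\<forall>w\<in>H. cost \<Omega> S N \<theta> yd f w \<le> cost \<Omega> S N \<theta> yd f v \<longrightarrow> ae_eq \<Omega> w v)"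
    using vL min unique by blast
  from someI_ex[OF this] have sol: "solution_operator \<Omega> S N \<theta> yd f \<in> H"
    "\<forall>w\<in>H. cost \<Omega> S N \<theta> yd f (solution_operator \<Omega> S N \<theta> yd f) \<le> cost \<Omega> S N \<theta> yd f w"
    unfolding solution_operator_def by auto
  show "solution_operator \<Omega> S N \<theta> yd f \<in> H" by (rule sol(1))
  have "ae_eq \<Omega> (solution_operator \<Omega> S N \<theta> yd f) v" using unique[OF sol(1)] sol(2) vL by blast
  then show "ae_eq \<Omega> (solution_operator \<Omega> S N \<theta> yd f) u"
    using ae_eq_sym[OF fp(1)] unfolding v_def by (rule ae_eq_trans)
qed

end

section \<open>The network\<close>

lemma logarithmic_depth:
  fixes q Z :: real
  assumes q: "0 < q" "q < 1" and Z: "Z \<ge> 0"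
  obtains L0 :: "real \<Rightarrow> nat" where "(\<lambda>\<epsilon>. real (L0 \<epsilon>)) \<in> O[at_right 0](\<lambda>\<epsilon>. ln (1 / \<epsilon>))"
    "\<And>\<epsilon> k. \<epsilon> > 0 \<Longrightarrow> L0 \<epsilon> \<le> k \<Longrightarrow> q ^ k * Z < \<epsilon>"
proof
  define g where "g = ln (1 / q)"
  have g: "g > 0" unfolding g_def using q by simp
  \<comment> \<open>The solution k of q^k (Z + 1) = \<epsilon>. The added 1 keeps the logarithm
    meaningful for Z = 0 and makes the final inequality strict.\<close>
  let ?L = "\<lambda>\<epsilon>. nat \<lceil>ln ((Z + 1) / \<epsilon>) / g\<rceil>"
  have "norm (real (?L \<epsilon>)) \<le> ((\<bar>ln (Z + 1)\<bar> + 1) / g + 1) * norm (ln (1 / \<epsilon>))"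
    if \<epsilon>: "0 < \<epsilon>" "\<epsilon> < exp (- 1)" for \<epsilon> :: real
  proof -
    have "ln \<epsilon> < ln (exp (- 1))" using \<epsilon> by (subst ln_less_cancel_iff) auto
    then have l: "ln (1 / \<epsilon>) \<ge> 1" using \<epsilon> by (simp add: ln_div)
    have "\<bar>ln (Z + 1)\<bar> * 1 \<le> \<bar>ln (Z + 1)\<bar> * ln (1 / \<epsilon>)" using l by (intro mult_left_mono) auto
    moreover have "ln ((Z + 1) / \<epsilon>) = ln (Z + 1) + ln (1 / \<epsilon>)" using \<epsilon> Z by (simp add: ln_div)
    ultimately have "\<bar>ln ((Z + 1) / \<epsilon>)\<bar> \<le> (\<bar>ln (Z + 1)\<bar> + 1) * ln (1 / \<epsilon>)"
      using l by (simp add: distrib_right)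
    then have "\<bar>ln ((Z + 1) / \<epsilon>) / g\<bar> \<le> (\<bar>ln (Z + 1)\<bar> + 1) * ln (1 / \<epsilon>) / g"
      using g by (simp add: divide_right_mono)
    moreover have "real (nat \<lceil>x\<rceil>) \<le> \<bar>x\<bar> + 1" for x :: real by linarith
    ultimately have "real (?L \<epsilon>) \<le> (\<bar>ln (Z + 1)\<bar> + 1) * ln (1 / \<epsilon>) / g + ln (1 / \<epsilon>)"
      using l by (meson add_mono order_trans)
    then show ?thesis using l by (simp add: distrib_right)
  qed
  then show "(\<lambda>\<epsilon>. real (?L \<epsilon>)) \<in> O[at_right 0](\<lambda>\<epsilon>. ln (1 / \<epsilon>))"
    by (intro bigoI) (auto simp: eventually_at_right[of 0 1] intro!: exI[of _ "exp (- 1)"])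
  show "q ^ k * Z < \<epsilon>" if \<epsilon>: "\<epsilon> > 0" and k: "?L \<epsilon> \<le> k" for \<epsilon> k
  proof -
    have "ln ((Z + 1) / \<epsilon>) / g \<le> real k" using k by linarith
    then have "ln ((Z + 1) / \<epsilon>) \<le> real k * g" using g by (simp add: pos_divide_le_eq)
    then have "ln (q ^ k * (Z + 1)) \<le> ln \<epsilon>"
      using q Z \<epsilon> by (simp add: g_def ln_div ln_mult ln_realpow)
    then have "q ^ k * (Z + 1) \<le> \<epsilon>" using q Z \<epsilon> by (subst (asm) ln_le_cancel_iff) auto
    moreover have "q ^ k * Z < q ^ k * (Z + 1)" using q by simp
    ultimately show ?thesis by linarith
  qed
qed

lemma scaling_qs_module:
  fixes X :: "(real ^ 'd) set"
  assumes X: "X \<in> sets lebesgue" "X \<subseteq> torus_cell" and \<gamma>: "\<gamma> > 0"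
  obtains G :: "'d qs" where "qs_module X G" "\<And>u. qs_apply G u = (\<lambda>x. \<gamma> * u x)"
proof
  \<comment> \<open>With P = 0 the kernel contributes nothing and the term \<gamma> u remains. The
    extension is by zero; the summand \<open>0\<close> fits the shape of
    \<open>extension_operatorI\<close>.\<close>
  let ?G = "\<lparr>qs_E = (\<lambda>u x. indicator X x * u x + 0), qs_width = 1, qs_P = (\<lambda>_. 0), qs_V = (\<lambda>_ _. 0),
    qs_Phi = (\<lambda>_ _ _. 0), qs_gamma = \<gamma>\<rparr> :: 'd qs"
  show "qs_module X ?G"
    using extension_operatorI[OF X fin_rank.fin_rank_zero] \<gamma> by (simp add: qs_module_def)
  show "qs_apply ?G u = (\<lambda>x. \<gamma> * u x)" for u
    by (simp add: qs_apply_def)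
qed

section \<open>Accuracy of one layer and propagation of errors\<close>

context uzawa
begin

abbreviation sobolev_ball :: "real \<Rightarrow> (real ^ 'd \<Rightarrow> real) set" where
  "sobolev_ball R \<equiv> {v \<in> Hs \<Omega> s. hs_norm \<Omega> s v \<le> R}"

lemma sobolev_ballD:
  assumes "v \<in> sobolev_ball R" shows "v \<in> H" "nrm v \<le> R"
  using assms Hs_L2 l2_norm_le_hs_norm order_trans by blast+

text \<open>The error \<delta> is shared equally between the network on its compact range, the
  clipped tail of the argument, and the error of the adjoint after division by c. The pointwise
  bound is both assumed and returned, so the same F and Q can be used at every layer. D does not
  depend on u0, which gives uniformity over the ball.\<close>

lemma control_network:
  assumes sigma: "smooth \<sigma>" "\<nexists>q :: real poly. \<forall>x. \<sigma> x = poly q x"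
    and R: "R > 0" and W: "W > 0" and \<delta>: "\<delta> > 0"
  obtains F :: "'d fno" and Q :: "'m qa" and D :: real where "fno_module \<Omega> F" "qa_module Q" "D \<ge> 0"
    "\<And>u0 u p v. u0 \<in> sobolev_ball R \<Longrightarrow> u \<in> H \<Longrightarrow> p \<in> H \<Longrightarrow> nrm p \<le> W \<Longrightarrow>
      AE x in lebesgue_on \<Omega>. \<bar>u x\<bar> \<le> \<bar>u0 x\<bar> + D \<Longrightarrow>
      v = qa_apply Q \<mu> lam (\<lambda>x. \<tau> * u x - fno_apply \<sigma> F p x) \<Longrightarrow>
      v \<in> H \<and> nrm (\<lambda>x. v x - ustep u p x) \<le> \<delta> \<and> (AE x in lebesgue_on \<Omega>. \<bar>v x\<bar> \<le> \<bar>u0 x\<bar> + D)"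
proof -
  define c where "c = c0 + \<tau>"
  have c: "c > 0" using pos(1) by (simp add: c_def)
  \<comment> \<open>The factor \<tau> / (c0 + \<tau>) is at most 1, so |u0| and the tail |t| pass
    through the resolvent without growing.\<close>
  have shrink: "\<tau> * y / c \<le> y" if "0 \<le> y" for y
    unfolding pos_divide_le_eq[OF c] using N(3) that by (simp add: c_def algebra_simps)
  have ap: "approximable \<Omega> adj"
    by (intro approximable_adjoint S approximable_of_factors_through_hs[OF domain s(1) S reg_S])
  have "\<delta> * c / 3 > 0" using \<delta> c by simp
  then have "\<exists>F A0. fno_module \<Omega> F \<and> (\<forall>p. fno_apply \<sigma> F p \<in> borel_measurable (lebesgue_on \<Omega>)) \<and>
      (\<forall>p\<in>H. nrm p \<le> W \<longrightarrow> fno_apply \<sigma> F p \<in> H \<and> nrm (\<lambda>x. fno_apply \<sigma> F p x - adj p x) \<le> \<delta> * c / 3 \<and>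
        (\<forall>x. \<bar>fno_apply \<sigma> F p x\<bar> \<le> A0))"
    by (intro approximable_fno domain_props(1,2) domain(2) sigma ap adj_L2 W)
  then obtain F A0 where F: "fno_module \<Omega> F"
    "\<And>p. p \<in> H \<Longrightarrow> nrm p \<le> W \<Longrightarrow> fno_apply \<sigma> F p \<in> H \<and>
      nrm (\<lambda>x. fno_apply \<sigma> F p x - adj p x) \<le> \<delta> * c / 3 \<and> (\<forall>x. \<bar>fno_apply \<sigma> F p x\<bar> \<le> A0)"
    by (elim exE conjE) (rule that, assumption, blast)
  define A where "A = max 0 A0"
  have A: "A \<ge> 0" "A0 \<le> A" by (simp_all add: A_def)
  from Hs_compactly_embedded[OF domain s(1), of "\<delta> / (3 * R)"] \<delta> R
  obtain T where T: "fin_rank \<Omega> (bounded_L2 \<Omega>) T"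
    "\<And>v. v \<in> Hs \<Omega> s \<Longrightarrow> nrm (\<lambda>x. v x - T v x) \<le> \<delta> / (3 * R) * hs_norm \<Omega> s v" by auto
  obtain CT where CT: "CT \<ge> 0" "\<And>u x. u \<in> H \<Longrightarrow> \<bar>T u x\<bar> \<le> CT * nrm u"
    using fin_rank_sup_bound[OF T(1)] by blast
  define M' where "M' = CT * R"
  have M': "M' \<ge> 0" using CT(1) R by (simp add: M'_def)
  obtain G where G: "G \<ge> 0" "\<And>r \<xi> \<eta>. (\<xi>, \<eta>) \<in> coeff_set \<Longrightarrow> \<bar>pw_res r \<xi> \<eta>\<bar> \<le> G + \<bar>r\<bar> / c"
    by (rule pw_res_growth[folded c_def]) (rule that)
  \<comment> \<open>the fixed point of \<open>D \<mapsto> 1 + G + (\<tau> D + A) / c\<close>, so that the bound \<open>|u| \<le> |u0| + D\<close> is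
    preserved by the step\<close>
  define D where "D = (1 + G + A / c) * c / c0"
  have D: "D \<ge> 0" unfolding D_def using G(1) A(1) c N(3) by simp
  have D_eq: "1 + G + (\<tau> * D + A) / c = D"
  proof -
    have "c0 * D = (1 + G + A / c) * c" using N(3) by (simp add: D_def)
    also have "\<dots> = (1 + G) * c + A" using c by (simp add: distrib_right)
    finally have "(1 + G) * c + (\<tau> * D + A) = D * c" by (simp add: c_def algebra_simps)
    moreover have "(1 + G + (\<tau> * D + A) / c) * c = (1 + G) * c + (\<tau> * D + A)"
      using c by (simp add: distrib_right[of "1 + G"])
    ultimately show ?thesis using c by (metis less_irrefl mult_cancel_right)
  qed
  define w where "w = sqrt (measure lebesgue \<Omega>)"
  define w' where "w' = w + 1"
  have w: "0 \<le> w" "w \<le> w'" "0 < w'" by (simp_all add: w_def w'_def add_nonneg_pos)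
  \<comment> \<open>The cap at 1 provides the summand 1 in the equation for \<open>D\<close>; the
    other entry makes the L^2 norm of the constant \<delta>1 at most \<delta> / 3.\<close>
  define \<delta>1 where "\<delta>1 = min 1 (\<delta> / (3 * w'))"
  have \<delta>1: "\<delta>1 > 0" "\<delta>1 \<le> 1" using \<delta> w by (auto simp: \<delta>1_def)
  have "\<delta>1 * w \<le> \<delta> / (3 * w') * w'" using \<delta> w \<delta>1 by (intro mult_mono) (auto simp: \<delta>1_def)
  then have \<delta>1w: "\<delta>1 * w \<le> \<delta> / 3" using w(3) by simp
  \<comment> \<open>The size of the argument when |u0| is replaced by the bound M' for its
    finite-rank part. Clipping then acts only where u0 exceeds M', and changes the argument by at
    most \<tau> |t|.\<close>
  define M where "M = \<tau> * (M' + D) + A"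
  have M: "M \<ge> 0" using tau M' D A by (simp add: M_def)
  obtain Q :: "'m qa" where Q: "qa_module Q" "\<And>r \<xi> \<eta>. (\<xi>, \<eta>) \<in> coeff_set \<Longrightarrow>
      \<bar>qa_net Q r \<xi> \<eta> - pw_res (max (- M) (min M r)) \<xi> \<eta>\<bar> \<le> \<delta>1"
    using pw_res_network[OF M \<delta>1(1)] by blast
  have "v \<in> H \<and> nrm (\<lambda>x. v x - ustep u p x) \<le> \<delta> \<and> (AE x in lebesgue_on \<Omega>. \<bar>v x\<bar> \<le> \<bar>u0 x\<bar> + D)"
    if u0: "u0 \<in> sobolev_ball R" and u: "u \<in> H" and p: "p \<in> H" "nrm p \<le> W"
      and uD: "AE x in lebesgue_on \<Omega>. \<bar>u x\<bar> \<le> \<bar>u0 x\<bar> + D"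
      and v: "v = qa_apply Q \<mu> lam (\<lambda>x. \<tau> * u x - fno_apply \<sigma> F p x)" for u0 u p v
  proof -
    define a where "a = fno_apply \<sigma> F p"
    have aL: "a \<in> H" and a_err: "nrm (\<lambda>x. a x - adj p x) \<le> \<delta> * c / 3" and aA: "\<And>x. \<bar>a x\<bar> \<le> A"
      using F(2)[OF p] A(2) unfolding a_def by (auto intro: order_trans)
    define r where "r = (\<lambda>x. \<tau> * u x - a x)"
    have rL: "r \<in> H" unfolding r_def using u aL by (intro L2_diff L2_scale)
    have v_eq: "v = qa_apply Q \<mu> lam r" by (simp add: v r_def a_def)
    define t where "t = (\<lambda>x. u0 x - T u0 x)"
    have u0L: "u0 \<in> H" "nrm u0 \<le> R" using sobolev_ballD[OF u0] by auto
    have tL: "t \<in> H" unfolding t_def using u0L fin_rank_L2[OF T(1) bounded_L2_subset] by (intro L2_diff)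
    have t_small: "nrm t \<le> \<delta> / 3"
    proof -
      have "nrm t \<le> \<delta> / (3 * R) * hs_norm \<Omega> s u0" unfolding t_def using u0 by (intro T(2)) auto
      also have "\<dots> \<le> \<delta> / (3 * R) * R" using u0 \<delta> R by (intro mult_left_mono) auto
      finally show ?thesis using R by simp
    qed
    have TM: "\<bar>T u0 x\<bar> \<le> M'" for x
      using CT(2)[OF u0L(1), of x] mult_left_mono[OF u0L(2) CT(1)] by (simp add: M'_def)
    have point: "\<bar>v x\<bar> \<le> \<bar>u0 x\<bar> + D" "\<bar>v x - pw_res (r x) (\<mu> x) (lam x)\<bar> \<le> \<bar>\<delta>1 + \<bar>t x\<bar>\<bar>"
      if co: "(\<mu> x, lam x) \<in> coeff_set" and ux: "\<bar>u x\<bar> \<le> \<bar>u0 x\<bar> + D" for x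
    proof -
      define k where "k = max (- M) (min M (r x))"
      have vk: "\<bar>v x - pw_res k (\<mu> x) (lam x)\<bar> \<le> \<delta>1"
        using Q(2)[OF co, of "r x"] by (simp add: v_eq qa_apply_def k_def)
      have tu: "\<tau> * \<bar>u x\<bar> \<le> \<tau> * \<bar>u0 x\<bar> + \<tau> * D"
        using mult_left_mono[OF ux tau] by (simp add: distrib_left)
      have rx: "\<bar>r x\<bar> \<le> \<tau> * \<bar>u0 x\<bar> + (\<tau> * D + A)"
      proof -
        have "\<bar>r x\<bar> \<le> \<bar>\<tau> * u x\<bar> + \<bar>a x\<bar>" unfolding r_def by (rule abs_triangle_ineq4)
        then show ?thesis using aA[of x] tu tau by (simp add: abs_mult)
      qed
      have "\<bar>k\<bar> \<le> \<bar>r x\<bar>" using M unfolding k_def by linarith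
      then have "\<bar>pw_res k (\<mu> x) (lam x)\<bar> \<le> G + (\<tau> * \<bar>u0 x\<bar> + (\<tau> * D + A)) / c"
        using G(2)[OF co, of k] divide_right_mono[of "\<bar>k\<bar>" "\<tau> * \<bar>u0 x\<bar> + (\<tau> * D + A)" c] rx c by simp
      also have "\<dots> = G + \<tau> * \<bar>u0 x\<bar> / c + (\<tau> * D + A) / c" by (simp add: add_divide_distrib)
      also have "\<dots> \<le> G + \<bar>u0 x\<bar> + (\<tau> * D + A) / c"
        using shrink[of "\<bar>u0 x\<bar>"] by simp
      finally show "\<bar>v x\<bar> \<le> \<bar>u0 x\<bar> + D" using vk \<delta>1(2) D_eq by linarith
      have ut: "\<bar>u0 x\<bar> - M' \<le> \<bar>t x\<bar>" using TM[of x] unfolding t_def by linarith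
      have "\<bar>k - r x\<bar> \<le> \<tau> * \<bar>t x\<bar>"
      proof (cases "\<bar>r x\<bar> \<le> M")
        case True
        then have "k = r x" by (auto simp: k_def)
        then show ?thesis using tau by simp
      next
        case False
        then have "\<bar>k - r x\<bar> \<le> \<bar>r x\<bar> - M" using M unfolding k_def by linarith
        also have "\<dots> \<le> \<tau> * (\<bar>u0 x\<bar> - M')" using rx by (simp add: M_def algebra_simps)
        also have "\<dots> \<le> \<tau> * \<bar>t x\<bar>" using ut tau by (intro mult_left_mono)
        finally show ?thesis .
      qed
      then have "\<bar>k - r x\<bar> / c \<le> \<tau> * \<bar>t x\<bar> / c" using c by (intro divide_right_mono) auto
      also have "\<dots> \<le> \<bar>t x\<bar>"
        by (rule shrink) simp
      finally have "\<bar>pw_res k (\<mu> x) (lam x) - pw_res (r x) (\<mu> x) (lam x)\<bar> \<le> \<bar>t x\<bar>"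
        using pw_res_props(2)[OF co, of k "r x"] unfolding c_def by linarith
      then show "\<bar>v x - pw_res (r x) (\<mu> x) (lam x)\<bar> \<le> \<bar>\<delta>1 + \<bar>t x\<bar>\<bar>" using vk \<delta>1(1) by linarith
    qed
    have vm: "v \<in> borel_measurable (lebesgue_on \<Omega>)"
      unfolding v_eq by (rule qa_apply_measurable[OF L2_measurable[OF rL]])
    have vD: "AE x in lebesgue_on \<Omega>. \<bar>v x\<bar> \<le> \<bar>u0 x\<bar> + D"
      using coeff_set(3) uD by eventually_elim (rule point(1))
    have constL: "(\<lambda>x. y) \<in> H" for y by (rule L2_const[OF domain_props(3)])
    have dom: "(\<lambda>x. \<bar>u0 x\<bar> + D) \<in> H" using u0L constL by (intro L2_add L2_abs)
    have vL: "v \<in> H"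
      by (rule L2_dominated[OF dom vm]) (use vD in eventually_elim, use D in auto)
    have resL: "res r \<in> H" by (rule resolvent_props(1)[OF rL])
    have "nrm (\<lambda>x. v x - res r x) \<le> nrm (\<lambda>x. \<delta>1 + \<bar>t x\<bar>)"
    proof (rule l2_norm_mono)
      show "(\<lambda>x. \<delta>1 + \<bar>t x\<bar>) \<in> H" using constL tL by (intro L2_add L2_abs)
      show "(\<lambda>x. v x - res r x) \<in> borel_measurable (lebesgue_on \<Omega>)"
        by (intro L2_measurable L2_diff vL resL)
      show "AE x in lebesgue_on \<Omega>. \<bar>v x - res r x\<bar> \<le> \<bar>\<delta>1 + \<bar>t x\<bar>\<bar>"
        using coeff_set(3) uD resolvent_pointwise[OF rL]
      proof eventually_elim
        case (elim x)
        then show ?case using point(2)[OF elim(1,2)] by simp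
      qed
    qed
    also have "\<dots> \<le> nrm (\<lambda>x. \<delta>1) + nrm (\<lambda>x. \<bar>t x\<bar>)" using constL tL by (intro l2_norm_triangle L2_abs)
    also have "\<dots> \<le> \<delta> / 3 + \<delta> / 3"
    proof (rule add_mono)
      show "nrm (\<lambda>x. \<delta>1) \<le> \<delta> / 3"
        using l2_norm_const[OF domain_props(3), of \<delta>1] \<delta>1w \<delta>1(1) by (simp add: w_def)
      have "nrm (\<lambda>x. \<bar>t x\<bar>) \<le> nrm t" using tL by (intro l2_norm_mono L2_measurable L2_abs) auto
      then show "nrm (\<lambda>x. \<bar>t x\<bar>) \<le> \<delta> / 3" using t_small by simp
    qed
    finally have e1: "nrm (\<lambda>x. v x - res r x) \<le> \<delta> / 3 + \<delta> / 3" .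
    have "nrm (\<lambda>x. res r x - ustep u p x) \<le> nrm (\<lambda>x. r x - (\<tau> * u x - adj p x)) / c"
      unfolding ustep_def c_def by (rule resolvent_lipschitz[OF rL ustep_arg_L2[OF u p(1)]])
    also have "nrm (\<lambda>x. r x - (\<tau> * u x - adj p x)) = nrm (\<lambda>x. a x - adj p x)"
      using l2_norm_minus_commute[of \<Omega> "adj p" a] by (simp add: r_def)
    also have "nrm (\<lambda>x. a x - adj p x) / c \<le> \<delta> * c / 3 / c" using a_err c by (intro divide_right_mono) auto
    finally have "nrm (\<lambda>x. res r x - ustep u p x) \<le> \<delta> / 3" using c by simp
    then have "nrm (\<lambda>x. v x - ustep u p x) \<le> \<delta>"
      using e1 l2_dist_triangle[OF vL resL ustep_L2[OF u p(1)]] by linarith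
    then show ?thesis using vL vD by blast
  qed
  then show thesis by (rule that[OF F(1) Q(1) D])
qed

text \<open>The module sees an approximation of S at the network control v, the exact step sees S at
  v'. The discrepancy is at most (1 + K) \<delta>, and division by \<beta> brings it back to
  \<delta>.\<close>

lemma pstep_error:
  assumes yf: "yd \<in> H" "f \<in> H" and v: "v \<in> H" "v' \<in> H" "nrm (\<lambda>x. v x - v' x) \<le> \<delta>" and p: "p \<in> H"
    and a: "a \<in> H" "nrm (\<lambda>x. a x - S (\<lambda>z. v z + f z) x) \<le> \<delta>"
  shows "nrm (\<lambda>x. p x + 1 / \<beta> * (a x - p x - yd x) - pstep yd f v' p x) \<le> \<delta>"
proof -
  have L: "S v \<in> H" "S v' \<in> H" "S (\<lambda>z. v z + f z) \<in> H" "pstep yd f v' p \<in> H"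
    using v yf S_L2 pstep_props(1)[OF yf v(2) p] by (auto intro: L2_add)
  define e where "e = (\<lambda>x. (a x - S (\<lambda>z. v z + f z) x) + (S v x - S v' x))"
  have eL: "e \<in> H" unfolding e_def using a L by (intro L2_add L2_diff)
  have "ae_eq \<Omega> (\<lambda>x. p x + 1 / \<beta> * (a x - p x - yd x) - pstep yd f v' p x) (\<lambda>x. 1 / \<beta> * e x)"
    using pstep_props(2)[OF yf v(2) p] l2_bounded_linear_add[OF S v(1) yf(2)] unfolding ae_eq_def
  proof eventually_elim
    case (elim x)
    show ?case unfolding elim(1) e_def elim(2) by (simp add: diff_divide_distrib add_divide_distrib)
  qed
  then have "nrm (\<lambda>x. p x + 1 / \<beta> * (a x - p x - yd x) - pstep yd f v' p x) = nrm (\<lambda>x. 1 / \<beta> * e x)"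
    using p a yf L eL by (intro l2_norm_cong L2_measurable L2_diff L2_add L2_scale)
  also have "\<dots> = nrm e / \<beta>" unfolding l2_norm_scale using pos(2) by simp
  also have "\<dots> \<le> \<delta>"
  proof -
    have "nrm e \<le> nrm (\<lambda>x. a x - S (\<lambda>z. v z + f z) x) + nrm (\<lambda>x. S v x - S v' x)"
      unfolding e_def using a L by (intro l2_norm_triangle L2_diff)
    moreover have "nrm (\<lambda>x. S v x - S v' x) \<le> K * \<delta>"
      using S_diff_bound[OF v(1,2)] mult_left_mono[OF v(3), of K] K(1) by linarith
    moreover have "\<delta> \<ge> 0" using v(3) l2_norm_nonneg[of \<Omega> "\<lambda>x. v x - v' x"] by linarith
    then have "(1 + K) * \<delta> \<le> \<beta> * \<delta>" using beta by (intro mult_right_mono) auto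
    ultimately have "nrm e \<le> \<delta> * \<beta>" using a(2) by (simp add: algebra_simps)
    then show ?thesis unfolding pos_divide_le_eq[OF pos(2)] .
  qed
  finally show ?thesis .
qed

definition fixed_pair :: "(real ^ 'd \<Rightarrow> real) \<Rightarrow> (real ^ 'd \<Rightarrow> real) \<Rightarrow> (real ^ 'd \<Rightarrow> real) \<Rightarrow> (real ^ 'd \<Rightarrow> real) \<Rightarrow> bool" where
  "fixed_pair yd f u p \<longleftrightarrow> u \<in> H \<and> p \<in> H \<and> ae_eq \<Omega> u (ustep u p) \<and> ae_eq \<Omega> p (pstep yd f (ustep u p) p)"

lemma exact_step_to_fixed:
  assumes yf: "yd \<in> H" "f \<in> H" and up: "u \<in> H" "p \<in> H" and fp: "fixed_pair yd f us ps"
  shows "energy (\<lambda>x. ustep u p x - us x) (\<lambda>x. pstep yd f (ustep u p) p x - ps x)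
    \<le> rate * energy (\<lambda>x. u x - us x) (\<lambda>x. p x - ps x)"
proof -
  note fp = fp[unfolded fixed_pair_def]
  have L: "ustep u p \<in> H" "ustep us ps \<in> H" "pstep yd f (ustep u p) p \<in> H" "pstep yd f (ustep us ps) ps \<in> H"
    using yf up fp by (auto intro: ustep_L2 pstep_props(1))
  have "nrm (\<lambda>x. ustep u p x - us x) = nrm (\<lambda>x. ustep u p x - ustep us ps x)"
  proof (rule l2_norm_cong)
    have "ae_eq \<Omega> us (ustep us ps)" using fp by blast
    then show "ae_eq \<Omega> (\<lambda>x. ustep u p x - us x) (\<lambda>x. ustep u p x - ustep us ps x)"
      unfolding ae_eq_def by eventually_elim (simp only:)
  qed (use L fp in \<open>auto intro!: L2_measurable L2_diff\<close>)
  moreover have "nrm (\<lambda>x. pstep yd f (ustep u p) p x - ps x)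
    = nrm (\<lambda>x. pstep yd f (ustep u p) p x - pstep yd f (ustep us ps) ps x)"
  proof (rule l2_norm_cong)
    have "ae_eq \<Omega> ps (pstep yd f (ustep us ps) ps)" using fp by blast
    then show "ae_eq \<Omega> (\<lambda>x. pstep yd f (ustep u p) p x - ps x)
        (\<lambda>x. pstep yd f (ustep u p) p x - pstep yd f (ustep us ps) ps x)"
      unfolding ae_eq_def by eventually_elim (simp only:)
  qed (use L fp in \<open>auto intro!: L2_measurable L2_diff\<close>)
  ultimately have "energy (\<lambda>x. ustep u p x - us x) (\<lambda>x. pstep yd f (ustep u p) p x - ps x)
    = energy (\<lambda>x. ustep u p x - ustep us ps x) (\<lambda>x. pstep yd f (ustep u p) p x - pstep yd f (ustep us ps) ps x)"
    by (rule energy_cong)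
  then show ?thesis using exact_step_contraction[OF yf up(1) _ up(2), of us ps] fp by simp
qed

definition step_cost :: real where "step_cost = sqrt (c0 + \<tau>) + sqrt \<beta>"

lemma step_cost_pos: "step_cost > 0"
  unfolding step_cost_def using pos by (intro add_pos_pos) auto

lemma energy_le_step_cost: "nrm a \<le> \<delta> \<Longrightarrow> nrm b \<le> \<delta> \<Longrightarrow> energy a b \<le> step_cost * \<delta>"
proof -
  assume ab: "nrm a \<le> \<delta>" "nrm b \<le> \<delta>"
  have "sqrt (c0 + \<tau>) * nrm a \<le> sqrt (c0 + \<tau>) * \<delta>" "sqrt \<beta> * nrm b \<le> sqrt \<beta> * \<delta>"
    using ab pos by (auto intro!: mult_left_mono)
  then show ?thesis using energy_le_norms[of a b] by (simp add: step_cost_def distrib_right)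
qed

text \<open>Accuracy is available only inside balls, and staying inside them depends on accuracy.
  The circle is broken by fixing the radii \<open>W\<close> and \<rho> from a-priori energy bounds
  and building the networks for those radii; induction over the layers then carries membership, the
  pointwise bound and the energy estimate together. Nothing depends on L.\<close>

lemma tracking_network:
  assumes sigma: "smooth \<sigma>" "\<nexists>q :: real poly. \<forall>x. \<sigma> x = poly q x"
    and R: "R > 0" and \<delta>: "\<delta> > 0" and Z: "Z \<ge> 0"
  obtains lay :: "('d, 'm) iuzawa_layer" where "\<And>L. iuzawa_net \<Omega> L (\<lambda>_. lay)"
    "\<And>yd f u0 p0 us ps k u p u' p'. yd \<in> sobolev_ball R \<Longrightarrow> f \<in> sobolev_ball R \<Longrightarrow>
      u0 \<in> sobolev_ball R \<Longrightarrow> p0 \<in> sobolev_ball R \<Longrightarrow>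
      fixed_pair yd f us ps \<Longrightarrow> energy us ps \<le> Z \<Longrightarrow>
      layer_output \<sigma> \<tau> \<mu> lam (\<lambda>_. lay) yd f u0 p0 k = (u, p) \<Longrightarrow>
      layer_output \<sigma> \<tau> \<mu> lam (\<lambda>_. lay) yd f u0 p0 (Suc k) = (u', p') \<Longrightarrow>
      u \<in> H \<and> nrm (\<lambda>x. u' x - ustep u p x) \<le> \<delta> \<and> nrm (\<lambda>x. p' x - pstep yd f (ustep u p) p x) \<le> \<delta> \<and>
      energy (\<lambda>x. u x - us x) (\<lambda>x. p x - ps x)
        \<le> rate ^ k * energy (\<lambda>x. u0 x - us x) (\<lambda>x. p0 x - ps x) + step_cost * \<delta> / (1 - rate)"
proof -
  define c where "c = sqrt (c0 + \<tau>)"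
  have c: "c > 0" using pos(1) by (simp add: c_def)
  \<comment> \<open>The fixed point of e -> rate e + step_cost \<delta>, the error level that
    contraction with perturbation preserves.\<close>
  define err where "err = step_cost * \<delta> / (1 - rate)"
  have err: "err \<ge> 0" "rate * err + step_cost * \<delta> = err"
    unfolding err_def using rate step_cost_pos \<delta> by (auto simp: field_simps)
  \<comment> \<open>The initial error is at most step_cost R + Z, the accumulated error is
    \<open>err\<close>, and a second Z returns from the distance to the fixed pair to the norm of
    the iterate.\<close>
  define W where "W = step_cost * R + 2 * Z + err"
  have W: "W > 0" unfolding W_def using step_cost_pos R Z err(1) by (simp add: add_pos_nonneg)
  obtain F Q D where F: "fno_module \<Omega> F" and Q: "qa_module Q" and D: "D \<ge> 0"
    and control: "\<And>u0 u p v. u0 \<in> sobolev_ball R \<Longrightarrow> u \<in> H \<Longrightarrow> p \<in> H \<Longrightarrow> nrm p \<le> W \<Longrightarrow>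
      AE x in lebesgue_on \<Omega>. \<bar>u x\<bar> \<le> \<bar>u0 x\<bar> + D \<Longrightarrow>
      v = qa_apply Q \<mu> lam (\<lambda>x. \<tau> * u x - fno_apply \<sigma> F p x) \<Longrightarrow>
      v \<in> H \<and> nrm (\<lambda>x. v x - ustep u p x) \<le> \<delta> \<and> (AE x in lebesgue_on \<Omega>. \<bar>v x\<bar> \<le> \<bar>u0 x\<bar> + D)"
    by (rule control_network[OF sigma R W \<delta>]) (rule that)
  \<comment> \<open>The state network is applied to u' + f. Here u' is within \<delta> of the exact
    control, that control within W / c of the fixed point, the fixed point bounded by W / c, and f
    by R.\<close>
  define \<rho> where "\<rho> = \<delta> + 2 * W / c + R"
  have \<rho>: "\<rho> > 0" unfolding \<rho>_def using \<delta> W c R by (simp add: add_pos_pos)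
  have "approximable \<Omega> S" by (rule approximable_of_factors_through_hs[OF domain s(1) S reg_S])
  from approximable_fno[OF domain_props(1,2) domain(2) sigma this S_L2 \<rho> \<delta>]
  obtain F' where F': "fno_module \<Omega> F'"
    and state: "\<And>u. u \<in> H \<Longrightarrow> nrm u \<le> \<rho> \<Longrightarrow> fno_apply \<sigma> F' u \<in> H \<and> nrm (\<lambda>x. fno_apply \<sigma> F' u x - S u x) \<le> \<delta>"
    by auto
  have sub: "\<Omega> \<subseteq> torus_cell" using domain(2) closure_subset by blast
  obtain P :: "'d qs" where P: "qs_module \<Omega> P" "\<And>u. qs_apply P u = (\<lambda>x. 1 / \<beta> * u x)"
    using scaling_qs_module[OF domain_props(4) sub, of "1 / \<beta>"] pos(2) by auto
  define lay where "lay = \<lparr>lay_S = F', lay_A = F, lay_QS = P, lay_QA = Q\<rparr>"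
  have net: "iuzawa_net \<Omega> L (\<lambda>_. lay)" for L
    using F F' P(1) Q by (simp add: iuzawa_net_def lay_def)
  have main: "u \<in> H \<and> nrm (\<lambda>x. u' x - ustep u p x) \<le> \<delta> \<and> nrm (\<lambda>x. p' x - pstep yd f (ustep u p) p x) \<le> \<delta> \<and>
      energy (\<lambda>x. u x - us x) (\<lambda>x. p x - ps x) \<le> rate ^ k * energy (\<lambda>x. u0 x - us x) (\<lambda>x. p0 x - ps x) + err"
    if yf: "yd \<in> sobolev_ball R" "f \<in> sobolev_ball R" and i: "u0 \<in> sobolev_ball R" "p0 \<in> sobolev_ball R"
      and fp: "fixed_pair yd f us ps" "energy us ps \<le> Z"
      and out: "layer_output \<sigma> \<tau> \<mu> lam (\<lambda>_. lay) yd f u0 p0 k = (u, p)"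
        "layer_output \<sigma> \<tau> \<mu> lam (\<lambda>_. lay) yd f u0 p0 (Suc k) = (u', p')"
    for yd f u0 p0 us ps k u p u' p'
  proof -
    note yfL = sobolev_ballD[OF yf(1)] sobolev_ballD[OF yf(2)] sobolev_ballD[OF i(1)] sobolev_ballD[OF i(2)]
    have sL: "us \<in> H" "ps \<in> H" using fp(1) by (auto simp: fixed_pair_def)
    define E0 where "E0 = energy (\<lambda>x. u0 x - us x) (\<lambda>x. p0 x - ps x)"
    have E0: "0 \<le> E0" unfolding E0_def by (rule energy_nonneg)
    have E0_le: "E0 \<le> step_cost * R + Z"
    proof -
      have "E0 \<le> energy (\<lambda>x. u0 x - 0) (\<lambda>x. p0 x - 0) + energy (\<lambda>x. 0 - us x) (\<lambda>x. 0 - ps x)"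
        unfolding E0_def by (rule energy_triangle) (use yfL sL in auto)
      moreover have "energy (\<lambda>x. 0 - us x) (\<lambda>x. 0 - ps x) = energy us ps" by (intro energy_cong) simp_all
      ultimately show ?thesis using energy_le_step_cost[OF yfL(6,8)] fp(2) by simp
    qed
    define U where "U k = fst (layer_output \<sigma> \<tau> \<mu> lam (\<lambda>_. lay) yd f u0 p0 k)" for k
    define V where "V k = snd (layer_output \<sigma> \<tau> \<mu> lam (\<lambda>_. lay) yd f u0 p0 k)" for k
    have step: "U (Suc k) = qa_apply Q \<mu> lam (\<lambda>x. \<tau> * U k x - fno_apply \<sigma> F (V k) x)"
      "V (Suc k) = (\<lambda>x. V k x + 1 / \<beta> * (fno_apply \<sigma> F' (\<lambda>w. U (Suc k) w + f w) x - V k x - yd x))" for k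
      by (simp_all add: U_def V_def lay_def P(2) Let_def)
    have one: "U (Suc k) \<in> H \<and> V (Suc k) \<in> H \<and> (AE x in lebesgue_on \<Omega>. \<bar>U (Suc k) x\<bar> \<le> \<bar>u0 x\<bar> + D) \<and>
        nrm (\<lambda>x. U (Suc k) x - ustep (U k) (V k) x) \<le> \<delta> \<and>
        nrm (\<lambda>x. V (Suc k) x - pstep yd f (ustep (U k) (V k)) (V k) x) \<le> \<delta> \<and>
        energy (\<lambda>x. U (Suc k) x - us x) (\<lambda>x. V (Suc k) x - ps x) \<le> rate ^ Suc k * E0 + err"
      if L: "U k \<in> H" "V k \<in> H" and UD: "AE x in lebesgue_on \<Omega>. \<bar>U k x\<bar> \<le> \<bar>u0 x\<bar> + D"
        and en: "energy (\<lambda>x. U k x - us x) (\<lambda>x. V k x - ps x) \<le> rate ^ k * E0 + err" for k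
    proof -
      have "rate ^ k * E0 \<le> 1 * E0" using rate E0 by (intro mult_right_mono power_le_one) auto
      then have en': "energy (\<lambda>x. U k x - us x) (\<lambda>x. V k x - ps x) \<le> W - Z"
        using en E0_le unfolding W_def by linarith
      have VW: "nrm (V k) \<le> W"
        using l2_norm_le_dist[OF L(2) sL(2)] norms_le_energy(2)[of "\<lambda>x. V k x - ps x" "\<lambda>x. U k x - us x"]
          norms_le_energy(2)[of ps us] en' fp(2) by linarith
      note U' = control[OF i(1) L VW UD step(1)]
      define ub where "ub = ustep (U k) (V k)"
      define pb where "pb = pstep yd f ub (V k)"
      have bL: "ub \<in> H" "pb \<in> H" unfolding pb_def ub_def using yfL L by (auto intro: ustep_L2 pstep_props(1))
      have ex: "energy (\<lambda>x. ub x - us x) (\<lambda>x. pb x - ps x) \<le> rate * energy (\<lambda>x. U k x - us x) (\<lambda>x. V k x - ps x)"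
        unfolding pb_def ub_def by (rule exact_step_to_fixed[OF yfL(1,3) L fp(1)])
      have "rate * energy (\<lambda>x. U k x - us x) (\<lambda>x. V k x - ps x) \<le> 1 * energy (\<lambda>x. U k x - us x) (\<lambda>x. V k x - ps x)"
        using rate energy_nonneg by (intro mult_right_mono) auto
      then have "c * nrm (\<lambda>x. ub x - us x) \<le> W"
        using ex en' Z norms_le_energy(1)[of "\<lambda>x. ub x - us x" "\<lambda>x. pb x - ps x"] unfolding c_def by linarith
      then have ubs: "nrm (\<lambda>x. ub x - us x) \<le> W / c" using c by (simp add: pos_le_divide_eq mult.commute)
      have "c * nrm us \<le> W"
        using norms_le_energy(1)[of us ps] fp(2) Z step_cost_pos R err(1) unfolding c_def W_def
        by (smt (verit) mult_pos_pos)
      then have "nrm us \<le> W / c" using c by (simp add: pos_le_divide_eq mult.commute)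
      then have "nrm (U (Suc k)) \<le> \<delta> + 2 * W / c"
        using U' ubs l2_norm_le_dist[OF _ bL(1), of "U (Suc k)"] l2_norm_le_dist[OF bL(1) sL(1)]
        unfolding ub_def by (simp add: add_divide_distrib[symmetric])
      then have "nrm (\<lambda>x. U (Suc k) x + f x) \<le> \<rho>"
        using l2_norm_triangle[OF conjunct1[OF U'] yfL(3)] yfL(4) unfolding \<rho>_def by linarith
      note st = state[OF L2_add[OF conjunct1[OF U'] yfL(3)] this]
      have V': "V (Suc k) \<in> H" unfolding step(2)[of k] using st L yfL by (intro L2_add L2_diff L2_scale) auto
      have Vb: "nrm (\<lambda>x. V (Suc k) x - pb x) \<le> \<delta>"
        unfolding step(2)[of k] pb_def using U' st L yfL bL(1)
        by (intro pstep_error[where v = "U (Suc k)"]) (auto simp: ub_def)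
      have "energy (\<lambda>x. U (Suc k) x - us x) (\<lambda>x. V (Suc k) x - ps x)
        \<le> energy (\<lambda>x. U (Suc k) x - ub x) (\<lambda>x. V (Suc k) x - pb x) + energy (\<lambda>x. ub x - us x) (\<lambda>x. pb x - ps x)"
        by (rule energy_triangle[OF _ bL(1) sL(1) V' bL(2) sL(2)]) (use U' in blast)
      also have "\<dots> \<le> step_cost * \<delta> + rate * (rate ^ k * E0 + err)"
      proof (rule add_mono)
        show "energy (\<lambda>x. U (Suc k) x - ub x) (\<lambda>x. V (Suc k) x - pb x) \<le> step_cost * \<delta>"
          using U' Vb unfolding ub_def by (intro energy_le_step_cost) auto
        show "energy (\<lambda>x. ub x - us x) (\<lambda>x. pb x - ps x) \<le> rate * (rate ^ k * E0 + err)"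
          using ex mult_left_mono[OF en, of rate] rate by linarith
      qed
      also have "\<dots> = rate ^ Suc k * E0 + err" using err(2) by (simp add: distrib_left)
      finally show ?thesis using U' V' Vb unfolding pb_def ub_def by blast
    qed
    have inv: "U k \<in> H \<and> V k \<in> H \<and> (AE x in lebesgue_on \<Omega>. \<bar>U k x\<bar> \<le> \<bar>u0 x\<bar> + D) \<and>
        energy (\<lambda>x. U k x - us x) (\<lambda>x. V k x - ps x) \<le> rate ^ k * E0 + err" for k
    proof (induction k)
      case 0
      have "U 0 = u0" "V 0 = p0" by (simp_all add: U_def V_def)
      then show ?case using yfL D err(1) by (simp add: E0_def)
    next
      case (Suc k)
      then show ?case using one[of k] by blast
    qed
    have eqs: "u = U k" "p = V k" "u' = U (Suc k)" "p' = V (Suc k)"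
      unfolding U_def V_def out by simp_all
    show ?thesis using one[of k] inv[of k] unfolding eqs E0_def by blast
  qed
  show thesis by (rule that[of lay, OF net main[unfolded err_def]])
qed

end

section \<open>Choice of the constants and the depth\<close>

theorem theorem5p11:
  fixes \<Omega> :: "(real ^ 'd) set"
    and S N :: "(real ^ 'd \<Rightarrow> real) \<Rightarrow> (real ^ 'd \<Rightarrow> real)"
    and \<theta> :: "(real ^ 'd \<Rightarrow> real) \<Rightarrow> ereal"
    and lam :: "real ^ 'd \<Rightarrow> real"
    and \<mu> :: "real ^ 'd \<Rightarrow> real ^ 'm"
    and E :: "(real ^ 'm) set"
    and \<psi> :: "real ^ 'm \<Rightarrow> real \<Rightarrow> ereal"
    and \<sigma> :: "real \<Rightarrow> real"
    and s c0 \<tau> R :: real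
    and B :: "(real ^ 'd \<Rightarrow> real) set"
  assumes domain: "bounded_lipschitz_domain \<Omega>" "closure \<Omega> \<subseteq> torus_cell"
    and N: "l2_bounded_linear \<Omega> \<Omega> N" "l2_self_adjoint \<Omega> N" "c0 > 0" "l2_coercive \<Omega> c0 N"
    and S: "l2_bounded_linear \<Omega> \<Omega> S"
    and theta: "l2_proper_convex_lsc \<Omega> \<theta>"
    and s: "0 < s" "s \<le> 1"
    and reg_S: "factors_through_hs \<Omega> s S"
    and reg_N: "\<forall>u\<in>L2 \<Omega>. ae_eq \<Omega> (N u) (\<lambda>x. lam x * u x)"
      "AE x in lebesgue_on \<Omega>. lam x \<ge> c0"
    and reg_theta: "closed E" "\<forall>\<xi>\<in>E. proper_convex_lsc (\<psi> \<xi>)"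
      "AE x in lebesgue_on \<Omega>. \<mu> x \<in> E" "is_integral_functional \<Omega> \<psi> \<mu> \<theta>"
    and reg_coeff: "lam \<in> Hs \<Omega> s \<inter> Linf \<Omega>" "\<forall>i. (\<lambda>x. \<mu> x $ i) \<in> Hs \<Omega> s \<inter> Linf \<Omega>"
    and sub_lipschitz: "sub_lipschitz_graphs E \<psi>"
    and sigma: "smooth \<sigma>" "\<nexists>q :: real poly. \<forall>x. \<sigma> x = poly q x" "\<exists>C. C-lipschitz_on UNIV \<sigma>"
    and tau: "\<tau> \<ge> 0"
    and R: "R > 0"
    and B: "B = {v \<in> Hs \<Omega> s. hs_norm \<Omega> s v \<le> R}"
  shows "\<exists>QS C. l2_bounded_linear \<Omega> \<Omega> QS \<and> l2_self_adjoint \<Omega> QS \<and> l2_positive_definite \<Omega> QS \<and> C > 0 \<and>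
    (\<exists>L0 :: real \<Rightarrow> nat. (\<lambda>\<epsilon>. real (L0 \<epsilon>)) \<in> O[at_right 0](\<lambda>\<epsilon>. ln (1 / \<epsilon>)) \<and>
      (\<forall>\<epsilon>>0. \<forall>\<delta> L. 0 < \<delta> \<and> \<delta> < C * \<epsilon> \<and> L0 \<epsilon> \<le> L \<longrightarrow>
        (\<exists>net :: nat \<Rightarrow> ('d, 'm) iuzawa_layer.
          iuzawa_net \<Omega> L net \<and> weight_tying L net \<and>
          algorithm_tracking \<Omega> S N \<theta> QS \<sigma> \<tau> \<mu> lam (B \<times> B) \<delta> L net \<and>
          (\<forall>yd\<in>B. \<forall>f\<in>B. \<forall>k. 1 \<le> k \<and> L0 \<epsilon> \<le> k \<and> k \<le> L \<longrightarrow>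
            l2_norm \<Omega> (\<lambda>x. solution_operator \<Omega> S N \<theta> yd f x
              - fst (layer_output \<sigma> \<tau> \<mu> lam net yd f (\<lambda>x. 0) (\<lambda>x. 0) k) x) < \<epsilon>))))"
proof -
  obtain K where K: "K > 0" "\<And>u. u \<in> L2 \<Omega> \<Longrightarrow> l2_norm \<Omega> (S u) \<le> K * l2_norm \<Omega> u"
    by (rule l2_bounded_linear_bound[OF S]) (rule that)
  define \<beta> where "\<beta> = max (max 2 (2 * K)) (2 * K\<^sup>2 / c0)"
  have "2 * K\<^sup>2 / c0 \<le> \<beta>" by (simp add: \<beta>_def)
  then have "2 * K\<^sup>2 \<le> c0 * \<beta>" using N(3) by (simp add: pos_divide_le_eq mult.commute)
  moreover have "\<beta> \<ge> 2" "\<beta> \<ge> 2 * K" by (simp_all add: \<beta>_def)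
  ultimately interpret uzawa \<Omega> S N \<theta> lam \<mu> E \<psi> s c0 \<tau> K \<beta>
    using domain N S theta s reg_S reg_N reg_theta reg_coeff sub_lipschitz tau K by unfold_locales auto
  obtain Z1 where Z1: "Z1 \<ge> 0" "\<And>yd f. yd \<in> H \<Longrightarrow> f \<in> H \<Longrightarrow> nrm yd \<le> R \<Longrightarrow> nrm f \<le> R \<Longrightarrow> first_energy yd f \<le> Z1"
    using first_energy_bound by blast
  define Z where "Z = Z1 / (1 - rate)"
  have Z: "Z \<ge> 0" unfolding Z_def using Z1(1) rate by simp
  have fixed: "\<exists>us ps. fixed_pair yd f us ps \<and> energy us ps \<le> Z" if "yd \<in> B" "f \<in> B" for yd f
  proof -
    have yf: "yd \<in> H" "f \<in> H" "nrm yd \<le> R" "nrm f \<le> R"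
      using that sobolev_ballD unfolding B by blast+
    obtain u p where "fixed_pair yd f u p" "energy u p \<le> first_energy yd f / (1 - rate)"
      using fixed_point[OF yf(1,2)] unfolding fixed_pair_def by metis
    moreover have "first_energy yd f / (1 - rate) \<le> Z"
      unfolding Z_def using Z1(2)[OF yf] rate by (intro divide_right_mono) auto
    ultimately show ?thesis by (meson order_trans)
  qed
  have zero: "(\<lambda>x. 0) \<in> B" unfolding B using zero_in_Hs[OF domain_props(1) domain(2), of s] R by simp
  define c where "c = sqrt (c0 + \<tau>)"
  have c: "c > 0" using pos(1) by (simp add: c_def)
  \<comment> \<open>For \<delta> < C \<epsilon> the accumulated tracking error step_cost \<delta> /
    (1 - rate) is below c \<epsilon> / 2. The depth is taken for the constant 2 Z / c, so that the
    decayed initial error is below c \<epsilon> / 2 too; dividing the energy by c gives the bound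
    for u.\<close>
  define C where "C = c * (1 - rate) / (2 * step_cost)"
  have C: "C > 0" unfolding C_def using c rate step_cost_pos by simp
  obtain L0 :: "real \<Rightarrow> nat" where L0: "(\<lambda>\<epsilon>. real (L0 \<epsilon>)) \<in> O[at_right 0](\<lambda>\<epsilon>. ln (1 / \<epsilon>))"
    "\<And>\<epsilon> k. \<epsilon> > 0 \<Longrightarrow> L0 \<epsilon> \<le> k \<Longrightarrow> rate ^ k * (2 * Z / c) < \<epsilon>"
    by (rule logarithmic_depth[OF rate, of "2 * Z / c"]) (use Z c in auto)
  have net: "\<exists>net :: nat \<Rightarrow> ('d, 'm) iuzawa_layer.
          iuzawa_net \<Omega> L net \<and> weight_tying L net \<and>
          algorithm_tracking \<Omega> S N \<theta> QS \<sigma> \<tau> \<mu> lam (B \<times> B) \<delta> L net \<and>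
          (\<forall>yd\<in>B. \<forall>f\<in>B. \<forall>k. 1 \<le> k \<and> L0 \<epsilon> \<le> k \<and> k \<le> L \<longrightarrow>
            l2_norm \<Omega> (\<lambda>x. solution_operator \<Omega> S N \<theta> yd f x
              - fst (layer_output \<sigma> \<tau> \<mu> lam net yd f (\<lambda>x. 0) (\<lambda>x. 0) k) x) < \<epsilon>)"
    if \<epsilon>: "\<epsilon> > 0" and \<delta>: "0 < \<delta>" "\<delta> < C * \<epsilon>" for \<epsilon> \<delta> L
  proof -
    obtain lay :: "('d, 'm) iuzawa_layer" where lay: "\<And>L. iuzawa_net \<Omega> L (\<lambda>_. lay)"
      and track: "\<And>yd f u0 p0 us ps k u p u' p'. yd \<in> B \<Longrightarrow> f \<in> B \<Longrightarrow> u0 \<in> B \<Longrightarrow> p0 \<in> B \<Longrightarrow>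
        fixed_pair yd f us ps \<Longrightarrow> energy us ps \<le> Z \<Longrightarrow>
        layer_output \<sigma> \<tau> \<mu> lam (\<lambda>_. lay) yd f u0 p0 k = (u, p) \<Longrightarrow>
        layer_output \<sigma> \<tau> \<mu> lam (\<lambda>_. lay) yd f u0 p0 (Suc k) = (u', p') \<Longrightarrow>
        u \<in> H \<and> nrm (\<lambda>x. u' x - ustep u p x) \<le> \<delta> \<and> nrm (\<lambda>x. p' x - pstep yd f (ustep u p) p x) \<le> \<delta> \<and>
        energy (\<lambda>x. u x - us x) (\<lambda>x. p x - ps x)
          \<le> rate ^ k * energy (\<lambda>x. u0 x - us x) (\<lambda>x. p0 x - ps x) + step_cost * \<delta> / (1 - rate)"
      by (rule tracking_network[OF sigma(1,2) R \<delta>(1) Z, folded B]) (rule that)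
    have "algorithm_tracking \<Omega> S N \<theta> QS \<sigma> \<tau> \<mu> lam (B \<times> B) \<delta> L (\<lambda>_. lay)"
      unfolding algorithm_tracking_def
    proof (intro ballI allI impI, clarify)
      fix yd f p0 u0 k
      assume yf: "yd \<in> B" "f \<in> B" and "(p0, u0) \<in> B \<times> B \<union> {(\<lambda>x. 0, \<lambda>x. 0)}"
      then have i: "u0 \<in> B" "p0 \<in> B" using zero by auto
      obtain us ps where fp: "fixed_pair yd f us ps" "energy us ps \<le> Z" using fixed[OF yf] by blast
      obtain u p where 1: "layer_output \<sigma> \<tau> \<mu> lam (\<lambda>_. lay) yd f u0 p0 k = (u, p)" by fastforce
      obtain u' p' where 2: "layer_output \<sigma> \<tau> \<mu> lam (\<lambda>_. lay) yd f u0 p0 (Suc k) = (u', p')" by fastforce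
      show "let (u, p) = layer_output \<sigma> \<tau> \<mu> lam (\<lambda>_. lay) yd f u0 p0 k;
            (u', p') = layer_output \<sigma> \<tau> \<mu> lam (\<lambda>_. lay) yd f u0 p0 (Suc k);
            ubar = resolvent \<Omega> N \<tau> \<theta> (\<lambda>x. \<tau> * u x - l2_adjoint \<Omega> S p x);
            pbar = (\<lambda>x. p x + l2_inverse \<Omega> QS (\<lambda>z. S ubar z - p z + S f z - yd z) x)
        in l2_norm \<Omega> (\<lambda>x. u' x - ubar x) \<le> \<delta> \<and> l2_norm \<Omega> (\<lambda>x. p' x - pbar x) \<le> \<delta>"
        unfolding 1 2 Let_def prod.case
        using track[OF yf i fp 1 2] unfolding pstep_def ustep_def by blast
    qed
    moreover have "nrm (\<lambda>x. solution_operator \<Omega> S N \<theta> yd f x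
        - fst (layer_output \<sigma> \<tau> \<mu> lam (\<lambda>_. lay) yd f (\<lambda>x. 0) (\<lambda>x. 0) k) x) < \<epsilon>"
      if yf: "yd \<in> B" "f \<in> B" and k: "L0 \<epsilon> \<le> k" for yd f k
    proof -
      obtain us ps where fp: "fixed_pair yd f us ps" "energy us ps \<le> Z" using fixed[OF yf] by blast
      obtain u p where 1: "layer_output \<sigma> \<tau> \<mu> lam (\<lambda>_. lay) yd f (\<lambda>x. 0) (\<lambda>x. 0) k = (u, p)" by fastforce
      obtain u' p' where 2: "layer_output \<sigma> \<tau> \<mu> lam (\<lambda>_. lay) yd f (\<lambda>x. 0) (\<lambda>x. 0) (Suc k) = (u', p')" by fastforce
      note tr = track[OF yf zero zero fp 1 2]
      have yfL: "yd \<in> H" "f \<in> H" using yf sobolev_ballD(1) unfolding B by blast+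
      note fp' = fp(1)[unfolded fixed_pair_def]
      note sol = solution_operator_eq[OF yfL, of us ps]
      have solL: "solution_operator \<Omega> S N \<theta> yd f \<in> H" and sol_eq: "ae_eq \<Omega> (solution_operator \<Omega> S N \<theta> yd f) us"
        using sol fp' by blast+
      have "nrm (\<lambda>x. solution_operator \<Omega> S N \<theta> yd f x - u x) = nrm (\<lambda>x. u x - us x)"
        unfolding l2_norm_minus_commute[of \<Omega> u us]
      proof (rule l2_norm_cong)
        show "ae_eq \<Omega> (\<lambda>x. solution_operator \<Omega> S N \<theta> yd f x - u x) (\<lambda>x. us x - u x)"
          using sol_eq unfolding ae_eq_def by eventually_elim simp
      qed (use solL fp' tr in \<open>auto intro!: L2_measurable L2_diff\<close>)
      moreover have "c * nrm (\<lambda>x. u x - us x) < c * \<epsilon>"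
      proof -
        \<comment> \<open>From the zero initialization the initial error is the fixed pair itself,
          whose energy is at most Z uniformly over the data.\<close>
        have "energy (\<lambda>x. 0 - us x) (\<lambda>x. 0 - ps x) = energy us ps" by (intro energy_cong) simp_all
        then have "rate ^ k * energy (\<lambda>x. 0 - us x) (\<lambda>x. 0 - ps x) \<le> rate ^ k * Z"
          using fp(2) rate by (intro mult_left_mono) auto
        moreover have "rate ^ k * Z < c * \<epsilon> / 2" using L0(2)[OF \<epsilon> k] c by (simp add: field_simps)
        moreover have "step_cost * \<delta> / (1 - rate) < c * \<epsilon> / 2"
          using \<delta>(2) rate step_cost_pos by (simp add: C_def field_simps)
        ultimately show ?thesis
          using tr norms_le_energy(1)[of "\<lambda>x. u x - us x" "\<lambda>x. p x - ps x"] unfolding c_def by linarith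
      qed
      ultimately show ?thesis unfolding 1 using c by simp
    qed
    moreover have "weight_tying L (\<lambda>_. lay)" by (auto simp: weight_tying_def)
    ultimately show ?thesis using lay by blast
  qed
  show ?thesis
    by (rule exI[of _ QS], rule exI[of _ C], intro conjI QS_props C exI[of _ L0] L0(1) allI impI net) auto
qed

end
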